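(* Assume the observation scheme (O) and the condition (I) on the initial value described in the context, let $\sigma>0$ be constant, and suppose that $\sup_k\lambda_k\mathbb E[\langle\xi,e_k\rangle_\vartheta^l]<\infty$ for $l=4,8$. Then the quarticity estimator $$\tilde\sigma_{n,m}^4=\frac{\vartheta_2\pi}{3m}\sum_{j=1}^m\sum_{i=1}^n(\Delta_iX)^4(y_j)\exp(2y_j\vartheta_1/\vartheta_2)$$ satisfies $\tilde\sigma_{n,m_n}^4\stackrel{\mathbb P}{\rightarrow}\sigma^4$. In particular, as $n\to\infty$, $$(m_n\cdot n)^{1/2}\big(\pi\Gamma\tilde\sigma_{n,m_n}^4\big)^{-1/2}\big(\hat\sigma_{n,m_n}^2-\sigma^2\big)\stackrel{d}{\rightarrow}\mathcal N(0,1),$$ where $$\hat\sigma_{n,m}^2=\frac{\sqrt{\pi\vartheta_2}}{m\,n\sqrt{\Delta_n}}\sum_{j=1}^m\sum_{i=1}^n(\Delta_iX)^2(y_j)\exp(y_j\,\vartheta_1/\vartheta_2),\qquad \Gamma=\frac1\pi\sum_{r=0}^\infty\big(2\sqrt{r+1}-\sqrt{r+2}-\sqrt r\big)^2+\frac2\pi .$$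
   Context: Model. Let $\vartheta=(\vartheta_0,\vartheta_1,\vartheta_2)$ with $\vartheta_0,\vartheta_1\in\mathbb R$, $\vartheta_2>0$. For $k\ge1$ put $e_k(y)=\sqrt2\,\sin(\pi k y)\exp(-\tfrac{\vartheta_1}{2\vartheta_2}y)$, $y\in[0,1]$, and $\lambda_k=-\vartheta_0+\tfrac{\vartheta_1^2}{4\vartheta_2}+\pi^2k^2\vartheta_2$; it is assumed that $\lambda_k>0$ for all $k$. The $e_k$ form an orthonormal basis of $H_\vartheta=\{f:[0,1]\to\mathbb R:\|f\|_\vartheta<\infty\}$, $\langle f,g\rangle_\vartheta=\int_0^1e^{y\vartheta_1/\vartheta_2}f(y)g(y)\,dy$, $\|f\|_\vartheta^2=\langle f,f\rangle_\vartheta$. Let $(W^k)_{k\ge1}$ be independent standard Brownian motions and $\xi$ an $H_\vartheta$-valued random variable independent of $(W^k)_{k\ge1}$. $X$ is the (time-space continuous version of the) mild solution of $dX_t(y)=\big(\vartheta_2\partial_y^2X_t(y)+\vartheta_1\partial_yX_t(y)+\vartheta_0X_t(y)\big)dt+\sigma\,dB_t(y)$ on $[0,1]$ with $X_0=\xi$, $X_t(0)=X_t(1)=0$ and cylindrical Brownian motion $B$, that is, $$X_t(y)=\sum_{k\ge1}x_k(t)e_k(y),\qquad x_k(t)=e^{-\lambda_kt}\langle\xi,e_k\rangle_\vartheta+\int_0^te^{-\lambda_k(t-s)}\sigma\,dW^k_s.$$ (O) Observations: $X$ is observed at $(t_i,y_j)\in[0,1]^2$, $t_i=i\Delta_n$,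 $i=0,\dots,n$, $n\Delta_n=1$, $n\to\infty$, and $\delta\le y_1<\dots<y_m\le1-\delta$ for a fixed $\delta>0$; either $m$ is fixed or $m=m_n\to\infty$ with $m_n=\mathcal O(n^\rho)$ for some $\rho\in(0,1/2)$; $m\cdot\min_{2\le j\le m}|y_j-y_{j-1}|$ is bounded from below (by a positive constant), uniformly in $n$. (I) Initial value: (i) either $\mathbb E[\langle\xi,e_k\rangle_\vartheta]=0$ for all $k\ge1$ and $\sup_k\lambda_k\mathbb E[\langle\xi,e_k\rangle_\vartheta^2]<\infty$, or $\mathbb E\big[\sum_{k\ge1}\lambda_k\langle\xi,e_k\rangle_\vartheta^2\big]<\infty$ (the latter is the condition $\mathbb E[\|A_\vartheta^{1/2}\xi\|_\vartheta^2]<\infty$ for the differential operator $A_\vartheta$ with eigenvalues $-\lambda_k$); (ii) $(\langle\xi,e_k\rangle_\vartheta)_{k\ge1}$ are independent. Notation: $\Delta_iX(y)=X_{i\Delta_n}(y)-X_{(i-1)\Delta_n}(y)$, $(\Delta_iX)^p(y)=(\Delta_iX(y))^p$. *)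

theory Defs
  imports "HOL-Probability.Probability" "HOL-Library.Landau_Symbols"
begin

subsection \<open>The Hilbert space and the eigensystem\<close>

definition eigfun :: "real \<Rightarrow> real \<Rightarrow> nat \<Rightarrow> real \<Rightarrow> real" where
  "eigfun \<theta>1 \<theta>2 k y = sqrt 2 * sin (pi * real k * y) * exp (- (\<theta>1 / (2 * \<theta>2)) * y)"

definition eigval :: "real \<Rightarrow> real \<Rightarrow> real \<Rightarrow> nat \<Rightarrow> real" where
  "eigval \<theta>0 \<theta>1 \<theta>2 k = - \<theta>0 + \<theta>1\<^sup>2 / (4 * \<theta>2) + pi\<^sup>2 * (real k)\<^sup>2 * \<theta>2"

definition H_inner :: "real \<Rightarrow> real \<Rightarrow> (real \<Rightarrow> real) \<Rightarrow> (real \<Rightarrow> real) \<Rightarrow> real" where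
  "H_inner \<theta>1 \<theta>2 f g = (\<integral>y. exp (y * \<theta>1 / \<theta>2) * f y * g y \<partial>lebesgue_on {0..1})"

definition H_norm :: "real \<Rightarrow> real \<Rightarrow> (real \<Rightarrow> real) \<Rightarrow> real" where
  "H_norm \<theta>1 \<theta>2 f = sqrt (H_inner \<theta>1 \<theta>2 f f)"

text \<open>Functions on the unit interval are represented by total functions whose values outside
  of it are irrelevant. Functions that agree almost everywhere are not identified, so
  \<open>H_norm\<close> is only a seminorm on this set; every set open for the seminorm is a union of
  almost-everywhere classes, so the Borel \<open>\<sigma>\<close>-algebra below is that of the quotient.\<close>

definition H_space :: "real \<Rightarrow> real \<Rightarrow> (real \<Rightarrow> real) set" where
  "H_space \<theta>1 \<theta>2 = {f \<in> borel_measurable (lebesgue_on {0..1}).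
     integrable (lebesgue_on {0..1}) (\<lambda>y. exp (y * \<theta>1 / \<theta>2) * f y * f y)}"

definition H_borel :: "real \<Rightarrow> real \<Rightarrow> (real \<Rightarrow> real) measure" where
  "H_borel \<theta>1 \<theta>2 = sigma (H_space \<theta>1 \<theta>2)
     {U. U \<subseteq> H_space \<theta>1 \<theta>2 \<and>
         (\<forall>f\<in>U. \<exists>\<epsilon>>0. \<forall>g\<in>H_space \<theta>1 \<theta>2. H_norm \<theta>1 \<theta>2 (\<lambda>y. g y - f y) < \<epsilon> \<longrightarrow> g \<in> U)}"

subsection \<open>Brownian motion and the Wiener integral\<close>

definition standard_brownian_motion :: "'w measure \<Rightarrow> (real \<Rightarrow> 'w \<Rightarrow> real) \<Rightarrow> bool" where
  "standard_brownian_motion M W \<longleftrightarrow>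
     (\<forall>t\<ge>0. W t \<in> borel_measurable M) \<and>
     (AE \<omega> in M. W 0 \<omega> = 0) \<and>
     (\<forall>s t. 0 \<le> s \<and> s < t \<longrightarrow>
        distributed M lborel (\<lambda>\<omega>. W t \<omega> - W s \<omega>) (\<lambda>x. ennreal (normal_density 0 (sqrt (t - s)) x))) \<and>
     (\<forall>(N::nat) (\<tau>::nat \<Rightarrow> real). 0 \<le> \<tau> 0 \<and> (\<forall>i<N. \<tau> i \<le> \<tau> (Suc i)) \<longrightarrow>
        prob_space.indep_vars M (\<lambda>_. borel) (\<lambda>i \<omega>. W (\<tau> (Suc i)) \<omega> - W (\<tau> i) \<omega>) {..<N}) \<and>
     (AE \<omega> in M. continuous_on {0..} (\<lambda>t. W t \<omega>))"

text \<open>A list of triples \<open>(c, u, v)\<close> stands for the step function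
  \<open>\<Sum> c * indicator {u<..v}\<close>.\<close>

definition step_fun :: "(real \<times> real \<times> real) list \<Rightarrow> real \<Rightarrow> real" where
  "step_fun S s = (\<Sum>(c, u, v)\<leftarrow>S. c * indicator {u<..v} s)"

definition step_integral :: "(real \<Rightarrow> 'w \<Rightarrow> real) \<Rightarrow> (real \<times> real \<times> real) list \<Rightarrow> 'w \<Rightarrow> real" where
  "step_integral W S \<omega> = (\<Sum>(c, u, v)\<leftarrow>S. c * (W v \<omega> - W u \<omega>))"

text \<open>\<open>I\<close> is (a version of) the Wiener integral of the deterministic function \<open>f\<close> over
  \<open>{a..b}\<close>: the \<open>L\<^sup>2\<close>-limit of the integrals of step functions converging to \<open>f\<close> in
  \<open>L\<^sup>2\<close>. By the isometry property the limit does not depend on the approximating sequence.\<close>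

definition has_wiener_integral ::
  "'w measure \<Rightarrow> (real \<Rightarrow> 'w \<Rightarrow> real) \<Rightarrow> (real \<Rightarrow> real) \<Rightarrow> real \<Rightarrow> real \<Rightarrow> ('w \<Rightarrow> real) \<Rightarrow> bool" where
  "has_wiener_integral M W f a b I \<longleftrightarrow>
     f \<in> borel_measurable (lebesgue_on {a..b}) \<and> I \<in> borel_measurable M \<and>
     (\<exists>S. (\<forall>n. \<forall>(c, u, v)\<in>set (S n). a \<le> u \<and> u \<le> v \<and> v \<le> b) \<and>
       (\<lambda>n. \<integral>\<^sup>+s. ennreal ((f s - step_fun (S n) s)\<^sup>2) \<partial>lebesgue_on {a..b}) \<longlonglongrightarrow> 0 \<and>
       (\<lambda>n. \<integral>\<^sup>+\<omega>. ennreal ((I \<omega> - step_integral W (S n) \<omega>)\<^sup>2) \<partial>M) \<longlonglongrightarrow> 0)"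

subsection \<open>The driving noise, the initial value and the mild solution\<close>

definition indep_brownian_motions :: "'w measure \<Rightarrow> (nat \<Rightarrow> real \<Rightarrow> 'w \<Rightarrow> real) \<Rightarrow> bool" where
  "indep_brownian_motions M W \<longleftrightarrow>
     (\<forall>k\<ge>1. standard_brownian_motion M (W k)) \<and>
     prob_space.indep_vars M (\<lambda>_. PiM {0..} (\<lambda>_. borel)) (\<lambda>k \<omega>. \<lambda>t\<in>{0..}. W k t \<omega>) {1..}"

text \<open>\<open>\<xi>\<close> and \<open>W\<close> have different value spaces, hence independence is stated for the generated
  \<open>\<sigma>\<close>-algebras.\<close>

definition initial_value ::
  "'w measure \<Rightarrow> real \<Rightarrow> real \<Rightarrow> (nat \<Rightarrow> real \<Rightarrow> 'w \<Rightarrow> real) \<Rightarrow> ('w \<Rightarrow> real \<Rightarrow> real) \<Rightarrow> bool" where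
  "initial_value M \<theta>1 \<theta>2 W \<xi> \<longleftrightarrow>
     \<xi> \<in> measurable M (H_borel \<theta>1 \<theta>2) \<and>
     prob_space.indep_set M
       (sets (vimage_algebra (space M) \<xi> (H_borel \<theta>1 \<theta>2)))
       (sets (vimage_algebra (space M) (\<lambda>\<omega>. \<lambda>(k, t)\<in>{1..} \<times> {0..}. W k t \<omega>)
                (PiM ({1..} \<times> {0..}) (\<lambda>_. borel))))"

abbreviation xi_coeff :: "real \<Rightarrow> real \<Rightarrow> ('w \<Rightarrow> real \<Rightarrow> real) \<Rightarrow> nat \<Rightarrow> 'w \<Rightarrow> real" where
  "xi_coeff \<theta>1 \<theta>2 \<xi> k \<omega> \<equiv> H_inner \<theta>1 \<theta>2 (\<xi> \<omega>) (eigfun \<theta>1 \<theta>2 k)"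

text \<open>The series for \<open>X\<close> starts at \<open>k = 1\<close>. It is required to converge to \<open>X t y\<close> almost surely
  for each fixed \<open>(t, y)\<close>, that is, the random field \<open>X\<close> is a version of the series.\<close>

definition continuous_mild_solution ::
  "'w measure \<Rightarrow> real \<Rightarrow> real \<Rightarrow> real \<Rightarrow> real \<Rightarrow> (nat \<Rightarrow> real \<Rightarrow> 'w \<Rightarrow> real) \<Rightarrow>
   ('w \<Rightarrow> real \<Rightarrow> real) \<Rightarrow> (real \<Rightarrow> real \<Rightarrow> 'w \<Rightarrow> real) \<Rightarrow> bool" where
  "continuous_mild_solution M \<theta>0 \<theta>1 \<theta>2 \<sigma> W \<xi> X \<longleftrightarrow>
     (\<exists>x :: nat \<Rightarrow> real \<Rightarrow> 'w \<Rightarrow> real.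
        (\<forall>k\<ge>1. \<forall>t\<ge>0. \<exists>I.
           has_wiener_integral M (W k) (\<lambda>s. exp (- eigval \<theta>0 \<theta>1 \<theta>2 k * (t - s)) * \<sigma>) 0 t I \<and>
           (\<forall>\<omega>\<in>space M. x k t \<omega> =
              exp (- eigval \<theta>0 \<theta>1 \<theta>2 k * t) * xi_coeff \<theta>1 \<theta>2 \<xi> k \<omega> + I \<omega>)) \<and>
        (\<forall>t\<ge>0. \<forall>y\<in>{0..1}. X t y \<in> borel_measurable M \<and>
           (AE \<omega> in M. (\<lambda>k. x (Suc k) t \<omega> * eigfun \<theta>1 \<theta>2 (Suc k) y) sums X t y \<omega>))) \<and>
     (AE \<omega> in M. continuous_on ({0..} \<times> {0..1}) (\<lambda>(t, y). X t y \<omega>))"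

text \<open>Moment suprema are formed in \<open>ennreal\<close>, so that finiteness includes integrability.\<close>

definition initial_condition ::
  "'w measure \<Rightarrow> real \<Rightarrow> real \<Rightarrow> real \<Rightarrow> ('w \<Rightarrow> real \<Rightarrow> real) \<Rightarrow> bool" where
  "initial_condition M \<theta>0 \<theta>1 \<theta>2 \<xi> \<longleftrightarrow>
     (((\<forall>k\<ge>1. (\<integral>\<omega>. xi_coeff \<theta>1 \<theta>2 \<xi> k \<omega> \<partial>M) = 0) \<and>
       (SUP k\<in>{1..}. ennreal (eigval \<theta>0 \<theta>1 \<theta>2 k) *
          (\<integral>\<^sup>+\<omega>. ennreal ((xi_coeff \<theta>1 \<theta>2 \<xi> k \<omega>)\<^sup>2) \<partial>M)) < \<infinity>) \<or>
      (\<integral>\<^sup>+\<omega>. (\<Sum>k. ennreal (eigval \<theta>0 \<theta>1 \<theta>2 (Suc k) * (xi_coeff \<theta>1 \<theta>2 \<xi> (Suc k) \<omega>)\<^sup>2)) \<partial>M) < \<infinity>) \<and>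
     prob_space.indep_vars M (\<lambda>_. borel) (\<lambda>k \<omega>. xi_coeff \<theta>1 \<theta>2 \<xi> k \<omega>) {1..}"

subsection \<open>Observations and estimators\<close>

text \<open>For each \<open>n \<ge> 1\<close>, the spatial points are \<open>y n 1 < \<dots> < y n (m n)\<close>. The minimum is over
  the empty set if \<open>m n = 1\<close>, in which case the spacing condition is void.\<close>

definition observation_scheme :: "(nat \<Rightarrow> nat) \<Rightarrow> (nat \<Rightarrow> nat \<Rightarrow> real) \<Rightarrow> bool" where
  "observation_scheme m y \<longleftrightarrow>
     (\<forall>n\<ge>1. 1 \<le> m n) \<and>
     (\<exists>\<delta>>0. \<forall>n\<ge>1. \<delta> \<le> y n 1 \<and> strict_mono_on {1..m n} (y n) \<and> y n (m n) \<le> 1 - \<delta>) \<and>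
     ((\<exists>m0. \<forall>n\<ge>1. m n = m0) \<or>
      (filterlim m at_top sequentially \<and>
       (\<exists>\<rho>. 0 < \<rho> \<and> \<rho> < 1 / 2 \<and> (\<lambda>n. real (m n)) \<in> O(\<lambda>n. real n powr \<rho>)))) \<and>
     (\<exists>c>0. \<forall>n\<ge>1. 2 \<le> m n \<longrightarrow>
        c \<le> real (m n) * Min ((\<lambda>j. \<bar>y n j - y n (j - 1)\<bar>) ` {2..m n}))"

definition increment :: "(real \<Rightarrow> real \<Rightarrow> 'w \<Rightarrow> real) \<Rightarrow> nat \<Rightarrow> nat \<Rightarrow> real \<Rightarrow> 'w \<Rightarrow> real" where
  "increment X n i y \<omega> = X (real i * (1 / real n)) y \<omega> - X ((real i - 1) * (1 / real n)) y \<omega>"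

definition quarticity_estimator ::
  "real \<Rightarrow> real \<Rightarrow> (real \<Rightarrow> real \<Rightarrow> 'w \<Rightarrow> real) \<Rightarrow> (nat \<Rightarrow> nat) \<Rightarrow> (nat \<Rightarrow> nat \<Rightarrow> real) \<Rightarrow>
   nat \<Rightarrow> 'w \<Rightarrow> real" where
  "quarticity_estimator \<theta>1 \<theta>2 X m y n \<omega> =
     \<theta>2 * pi / (3 * real (m n)) *
     (\<Sum>j=1..m n. \<Sum>i=1..n. (increment X n i (y n j) \<omega>) ^ 4 * exp (2 * y n j * \<theta>1 / \<theta>2))"

definition volatility_estimator ::
  "real \<Rightarrow> real \<Rightarrow> (real \<Rightarrow> real \<Rightarrow> 'w \<Rightarrow> real) \<Rightarrow> (nat \<Rightarrow> nat) \<Rightarrow> (nat \<Rightarrow> nat \<Rightarrow> real) \<Rightarrow>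
   nat \<Rightarrow> 'w \<Rightarrow> real" where
  "volatility_estimator \<theta>1 \<theta>2 X m y n \<omega> =
     sqrt (pi * \<theta>2) / (real (m n) * real n * sqrt (1 / real n)) *
     (\<Sum>j=1..m n. \<Sum>i=1..n. (increment X n i (y n j) \<omega>)\<^sup>2 * exp (y n j * \<theta>1 / \<theta>2))"

definition Gamma_const :: real where
  "Gamma_const =
     1 / pi * (\<Sum>r. (2 * sqrt (real r + 1) - sqrt (real r + 2) - sqrt (real r))\<^sup>2) + 2 / pi"

definition converges_in_probability :: "'w measure \<Rightarrow> (nat \<Rightarrow> 'w \<Rightarrow> real) \<Rightarrow> real \<Rightarrow> bool" where
  "converges_in_probability M Z c \<longleftrightarrow>
     (\<forall>\<epsilon>>0. (\<lambda>n. measure M {\<omega> \<in> space M. \<bar>Z n \<omega> - c\<bar> > \<epsilon>}) \<longlonglongrightarrow> 0)"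

definition converges_in_distribution ::
  "'w measure \<Rightarrow> (nat \<Rightarrow> 'w \<Rightarrow> real) \<Rightarrow> real measure \<Rightarrow> bool" where
  "converges_in_distribution M Z \<mu> \<longleftrightarrow> weak_conv_m (\<lambda>n. distr M borel (Z n)) \<mu>"

end

theory Submission
  imports Defs "HOL-Real_Asymp.Real_Asymp"
begin

text \<open>Up to the contribution of the initial value, the increments, normalised to asymptotic
  variance one, form a centred Gaussian vector \<open>V\<close> with covariance matrix \<open>C\<close>. Gaussian
  integration by parts shows that the characteristic function of \<open>\<Sum> (V\<^sup>2 - 1)\<close> solves
  \<open>\<phi>' t = - 2 F t \<phi> t\<close> up to an error governed by the Frobenius norm of \<open>C\<^sup>2\<close>, where \<open>F\<close> is
  the squared Frobenius norm of \<open>C\<close>. The row sums of \<open>C\<close> are \<open>O(m)\<close> and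
  \<open>F / (m n) \<longlonglongrightarrow> \<pi> \<Gamma> / 2\<close>: the covariances are explicit series over the spectrum, the
  diagonal blocks follow from the small time asymptotics of theta functions, and two spatial
  points at distance \<open>d\<close> have covariance \<open>O(1 / (\<surd>n d))\<close> by Abel summation against the Dirichlet
  kernel. As \<open>m\<close> is of smaller order than \<open>\<surd>n\<close>, this yields the limit law for
  \<open>\<Sum> (V\<^sup>2 - 1)\<close>. A second moment bound for \<open>\<Sum> (V\<^sup>4 - 3)\<close> gives the consistency of the
  quarticity estimator, and Slutsky's argument combines the two.\<close>

section \<open>Gaussian integration by parts\<close>

text \<open>The increments are correlated in time and in space and their covariances are explicit
  only as series, so dependence is measured through C alone. A Gaussian quadratic form has variance
  twice the trace of C^2, and what exceeds this in the characteristic function is governed by the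
  trace of C^4, which Schur's test bounds by (largest absolute row sum)^2 F. With row sums O(m) and
  F of order m n, division by sqrt (m n) leaves an error of order sqrt (m / n). That m stays below
  sqrt n is used for F itself: pairs of distinct spatial points contribute up to m (1 + ln m) / sqrt
  n to F / (m n). The initial value may be non-Gaussian. It adds an independent vector A to the
  Gaussian part U; the cross term, the sum of U A, has second moment sum C p q E[A p A q], so the
  same row sums control it, and sum E[A^2] is O(m). The limit of F / (m n) stems from G h ~ c sqrt h
  for the averaged variance of an increment over lag h: the covariance at lag r + 1 tends to half
  the second difference of sqrt at r, and 1 plus twice the sum of the squares of these limits is pi
  Gamma / 2.\<close>

abbreviation l1 :: "'i set \<Rightarrow> ('i \<Rightarrow> real) \<Rightarrow> real" where "l1 I x \<equiv> (\<Sum>l\<in>I. \<bar>x l\<bar>)"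

section \<open>Stein's identity for one standard normal variable\<close>

lemma integrable_std_normal_poly:
  "integrable lborel (\<lambda>y. std_normal_density y * (1 + \<bar>y\<bar>) ^ d)"
proof -
  have "integrable lborel (\<lambda>y. \<Sum>k\<le>d. real (d choose k) * (std_normal_density y * \<bar>y\<bar> ^ k))"
    by (intro Bochner_Integration.integrable_sum integrable_mult_right integrable_std_normal_moment_abs)
  moreover have "(\<Sum>k\<le>d. real (d choose k) * (std_normal_density y * \<bar>y\<bar> ^ k)) = std_normal_density y * (1 + \<bar>y\<bar>) ^ d" for y
    by (subst add.commute) (simp add: binomial_ring sum_distrib_left mult_ac)
  ultimately show ?thesis by simp
qed

text \<open>Kills the boundary terms in \<open>std_normal_ibp\<close>.\<close>

lemma std_normal_poly_tendsto:
  "((\<lambda>y. std_normal_density y * (1 + \<bar>y\<bar>) ^ d) \<longlongrightarrow> 0) at_top"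
  "((\<lambda>y. std_normal_density y * (1 + \<bar>y\<bar>) ^ d) \<longlongrightarrow> 0) at_bot"
proof -
  have e: "((\<lambda>y::real. (1 + y) ^ d / exp y) \<longlongrightarrow> 0) at_top"
  proof -
    have "((\<lambda>y::real. (1 + y) ^ d / exp (1 + y)) \<longlongrightarrow> 0) at_top"
      by (rule filterlim_compose[OF tendsto_power_div_exp_0, of "\<lambda>y. 1 + y"]) real_asymp
    from tendsto_mult_right[OF this, of "exp 1"] show ?thesis by (simp add: exp_add)
  qed
  have *: "((\<lambda>y. std_normal_density y * (1 + y) ^ d) \<longlongrightarrow> 0) at_top"
  proof (rule Lim_null_comparison[OF _ e])
    show "\<forall>\<^sub>F y in at_top. norm (std_normal_density y * (1 + y) ^ d) \<le> (1 + y) ^ d / exp y"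
      using eventually_ge_at_top[of "2::real"]
    proof eventually_elim
      case (elim y)
      have "std_normal_density y \<le> 1 * exp (- y\<^sup>2 / 2)" unfolding std_normal_density_def
        by (intro mult_right_mono) (use pi_gt3 in \<open>auto simp: divide_simps\<close>)
      also have "\<dots> \<le> exp (- y)" using elim by (simp add: power2_eq_square)
      finally have "std_normal_density y * (1 + y) ^ d \<le> exp (- y) * (1 + y) ^ d" using elim by (intro mult_right_mono) auto
      then show ?case using elim by (simp add: exp_minus field_simps std_normal_density_def)
    qed
  qed
  show 1: "((\<lambda>y. std_normal_density y * (1 + \<bar>y\<bar>) ^ d) \<longlongrightarrow> 0) at_top"
    by (rule Lim_transform_eventually[OF *])
      (use eventually_ge_at_top[of "0::real"] in eventually_elim, simp)
  show "((\<lambda>y. std_normal_density y * (1 + \<bar>y\<bar>) ^ d) \<longlongrightarrow> 0) at_bot"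
    unfolding filterlim_at_bot_mirror using 1 by (simp add: std_normal_density_def)
qed

text \<open>Since the density n satisfies n' = - y n, the function n f has derivative n f' - n y f.
  Polynomial growth makes both terms integrable and lets n f vanish at both ends, so the derivative
  integrates to 0.\<close>

lemma std_normal_ibp:
  fixes f f' :: "real \<Rightarrow> 'a::euclidean_space"
  assumes der: "\<And>y. (f has_vector_derivative f' y) (at y)"
    and cont: "continuous_on UNIV f'"
    and bf: "\<And>y. norm (f y) \<le> B * (1 + \<bar>y\<bar>) ^ d" and bf': "\<And>y. norm (f' y) \<le> B' * (1 + \<bar>y\<bar>) ^ d'"
  shows "(\<integral>y. y *\<^sub>R f y \<partial>std_normal_distribution) = (\<integral>y. f' y \<partial>std_normal_distribution)"
proof -
  let ?n = std_normal_density
  have cf: "continuous_on UNIV f" using der by (intro continuous_at_imp_continuous_on) (auto intro: has_vector_derivative_continuous)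
  have [measurable]: "f \<in> borel_measurable borel" "f' \<in> borel_measurable borel"
    using cf cont by (auto intro: borel_measurable_continuous_onI)
  have B: "B \<ge> 0" "B' \<ge> 0" using order_trans[OF norm_ge_zero bf[of 0]] order_trans[OF norm_ge_zero bf'[of 0]] by auto
  have i1: "integrable lborel (\<lambda>y. ?n y *\<^sub>R f' y)"
    by (rule Bochner_Integration.integrable_bound[OF integrable_mult_right[OF integrable_std_normal_poly, of B' d']])
       (use mult_left_mono[OF bf', OF normal_density_nonneg] B in \<open>auto simp: abs_mult mult_ac intro!: AE_I2\<close>)
  have i2: "integrable lborel (\<lambda>y. ?n y *\<^sub>R (y *\<^sub>R f y))"
  proof (rule Bochner_Integration.integrable_bound[OF integrable_mult_right[OF integrable_std_normal_poly, of B "Suc d"]])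
    show "AE y in lborel. norm (?n y *\<^sub>R (y *\<^sub>R f y)) \<le> norm (B * (?n y * (1 + \<bar>y\<bar>) ^ Suc d))"
    proof (rule AE_I2)
      fix y :: real
      have "\<bar>y\<bar> * norm (f y) \<le> (1 + \<bar>y\<bar>) * (B * (1 + \<bar>y\<bar>) ^ d)" using bf[of y] by (intro mult_mono) auto
      then have "?n y * (\<bar>y\<bar> * norm (f y)) \<le> ?n y * ((1 + \<bar>y\<bar>) * (B * (1 + \<bar>y\<bar>) ^ d))"
        by (intro mult_left_mono) auto
      then show "norm (?n y *\<^sub>R (y *\<^sub>R f y)) \<le> norm (B * (?n y * (1 + \<bar>y\<bar>) ^ Suc d))"
        using B by (simp add: abs_mult mult_ac)
    qed
  qed simp
  have dn: "(?n has_real_derivative (- y * ?n y)) (at y)" for y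
  proof -
    have "((\<lambda>y. c * exp (- y\<^sup>2 / 2)) has_real_derivative (- y * (c * exp (- y\<^sup>2 / 2)))) (at y)" for c :: real
      by (auto intro!: derivative_eq_intros)
    then show ?thesis unfolding std_normal_density_def .
  qed
  define h where "h = (\<lambda>y. ?n y *\<^sub>R f y)"
  define h' where "h' = (\<lambda>y. ?n y *\<^sub>R f' y - ?n y *\<^sub>R (y *\<^sub>R f y))"
  have dh: "(h has_vector_derivative h' y) (at y)" for y unfolding h_def h'_def
    by (rule has_vector_derivative_eq_rhs[OF has_vector_derivative_scaleR[OF dn der]]) simp
  have cn: "continuous_on UNIV ?n" unfolding std_normal_density_def by (intro continuous_intros) auto
  have ch: "isCont h' y" for y
  proof -
    have "continuous_on UNIV h'" unfolding h'_def by (intro continuous_intros cn cf cont)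
    then show ?thesis by (simp add: continuous_on_eq_continuous_at)
  qed
  have ih: "integrable lborel h'" unfolding h'_def by (intro Bochner_Integration.integrable_diff i1 i2)
  have nh: "norm (h y) \<le> B * (?n y * (1 + \<bar>y\<bar>) ^ d)" for y
    using mult_left_mono[OF bf[of y], of "?n y"] by (simp add: h_def mult_ac)
  have lim: "(h \<longlongrightarrow> 0) at_top" "(h \<longlongrightarrow> 0) at_bot"
    by (rule Lim_null_comparison[OF always_eventually, rule_format, OF nh],
        use tendsto_mult_right[OF std_normal_poly_tendsto(1)[of d], of B] tendsto_mult_right[OF std_normal_poly_tendsto(2)[of d], of B]
        in \<open>simp add: mult_ac\<close>)+
  have "(LBINT y=-\<infinity>..\<infinity>. h' y) = 0 - 0"
  proof (rule interval_integral_FTC_integrable[where F = h])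
    show "((h \<circ> real_of_ereal) \<longlongrightarrow> 0) (at_right (-\<infinity>))" using lim(2) by (simp add: ereal_tendsto_simps)
    show "((h \<circ> real_of_ereal) \<longlongrightarrow> 0) (at_left \<infinity>)" using lim(1) by (simp add: ereal_tendsto_simps)
    show "set_integrable lborel (einterval (-\<infinity>) \<infinity>) h'" using ih by (simp add: set_integrable_def)
  qed (use dh ch in auto)
  then have "(\<integral>y. h' y \<partial>lborel) = 0" by (simp add: interval_lebesgue_integral_def set_lebesgue_integral_def)
  then have "(\<integral>y. ?n y *\<^sub>R f' y \<partial>lborel) = (\<integral>y. ?n y *\<^sub>R (y *\<^sub>R f y) \<partial>lborel)"
    unfolding h'_def by (subst (asm) Bochner_Integration.integral_diff[OF i1 i2]) simp
  then show ?thesis by (subst (1 2) integral_density) auto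
qed

section \<open>Functions of polynomial growth on the Gaussian product space\<close>

definition tame :: "'i set \<Rightarrow> (('i \<Rightarrow> real) \<Rightarrow> 'a::euclidean_space) \<Rightarrow> bool" where
  "tame I F \<longleftrightarrow> F \<in> borel_measurable (PiM I (\<lambda>_. borel)) \<and>
     (\<exists>B d. B \<ge> 0 \<and> (\<forall>x. norm (F x) \<le> B * (1 + l1 I x) ^ d))"

abbreviation gauss_space :: "'i set \<Rightarrow> ('i \<Rightarrow> real) measure" where
  "gauss_space I \<equiv> PiM I (\<lambda>_. std_normal_distribution)"

lemma prob_space_std_gauss: "prob_space std_normal_distribution"
  by (rule prob_space_normal_density) simp

lemma product_sigma_finite_std_gauss: "product_sigma_finite (\<lambda>_. std_normal_distribution)"
  using prob_space_std_gauss unfolding product_sigma_finite_def by (blast intro: prob_space_imp_sigma_finite)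

lemmas gauss_space_integral_insert =
    product_sigma_finite.product_integral_insert[OF product_sigma_finite_std_gauss]
  and gauss_space_integrable_prod =
    product_sigma_finite.product_integrable_prod[OF product_sigma_finite_std_gauss]

lemma sets_gauss_space: "sets (gauss_space I) = sets (PiM I (\<lambda>_. borel))"
  by (rule sets_PiM_cong) auto

lemma measurable_gauss_space: "measurable (gauss_space I) N = measurable (PiM I (\<lambda>_. borel)) N"
  by (rule measurable_cong_sets[OF sets_gauss_space refl])

text \<open>Dominates the growth bound of \<open>tame\<close> by a product over the coordinates,
  whose Gaussian integral factorises into one-dimensional moments.\<close>

lemma one_plus_sum_le_prod:
  fixes f :: "'i \<Rightarrow> real"
  assumes "finite I" "\<And>l. l \<in> I \<Longrightarrow> 0 \<le> f l"
  shows "1 + (\<Sum>l\<in>I. f l) \<le> (\<Prod>l\<in>I. 1 + f l)"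
  using assms
proof (induction I rule: finite_induct)
  case (insert a I)
  have "1 + (f a + (\<Sum>l\<in>I. f l)) \<le> (1 + f a) * (1 + (\<Sum>l\<in>I. f l))"
    using insert.prems by (simp add: algebra_simps sum_nonneg)
  also have "\<dots> \<le> (1 + f a) * (\<Prod>l\<in>I. 1 + f l)" using insert by (intro mult_left_mono) auto
  finally show ?case using insert by simp
qed simp

lemma tame_base: "1 \<le> 1 + (\<Sum>l\<in>I. \<bar>x l :: real\<bar>)"
  using sum_nonneg[of I "\<lambda>l. \<bar>x l\<bar>"] by simp

text \<open>Integrability on the Gaussian space is reduced to this lemma, because
  \<open>tame\<close> is stable under sums, products and coordinate maps.\<close>

lemma tame_integrable:
  assumes "finite I" "tame I F"
  shows "integrable (gauss_space I) F"
proof -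
  obtain B d where B: "B \<ge> 0" "\<And>x. norm (F x) \<le> B * (1 + l1 I x) ^ d"
    and [measurable]: "F \<in> borel_measurable (PiM I (\<lambda>_. borel))"
    using assms unfolding tame_def by auto
  have "integrable std_normal_distribution (\<lambda>y. (1 + \<bar>y\<bar>) ^ d)"
    by (subst integrable_density) (use integrable_std_normal_poly in auto)
  then have "integrable (gauss_space I) (\<lambda>x. \<Prod>l\<in>I. (1 + \<bar>x l\<bar>) ^ d)"
    by (intro gauss_space_integrable_prod assms)
  then have "integrable (gauss_space I) (\<lambda>x. B * (\<Prod>l\<in>I. (1 + \<bar>x l\<bar>) ^ d))" by (rule integrable_mult_right)
  then show ?thesis
  proof (rule Bochner_Integration.integrable_bound)
    show "F \<in> borel_measurable (gauss_space I)" by (simp add: measurable_gauss_space)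
    show "AE x in gauss_space I. norm (F x) \<le> norm (B * (\<Prod>l\<in>I. (1 + \<bar>x l\<bar>) ^ d))"
    proof (rule AE_I2)
      fix x :: "_ \<Rightarrow> real"
      have "(1 + l1 I x) ^ d \<le> (\<Prod>l\<in>I. 1 + \<bar>x l\<bar>) ^ d" using order_trans[OF zero_le_one tame_base] assms(1)
        by (intro power_mono one_plus_sum_le_prod) auto
      then have "B * (1 + l1 I x) ^ d \<le> B * (\<Prod>l\<in>I. (1 + \<bar>x l\<bar>) ^ d)"
        using B(1) by (intro mult_left_mono) (auto simp: prod_power_distrib)
      then show "norm (F x) \<le> norm (B * (\<Prod>l\<in>I. (1 + \<bar>x l\<bar>) ^ d))" using B(2)[of x] by (smt (verit) real_norm_def)
    qed
  qed
qed

lemma tameI: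
  assumes "F \<in> borel_measurable (PiM I (\<lambda>_. borel))" "\<And>x. norm (F x) \<le> B * (1 + l1 I x) ^ d"
  shows "tame I F"
proof -
  have "0 \<le> B" using assms(2)[of "\<lambda>_. 0"] order_trans[OF norm_ge_zero] by fastforce
  then show ?thesis using assms unfolding tame_def by blast
qed

lemma tame_const: "tame I (\<lambda>_. c)"
  by (rule tameI[where B = "norm c" and d = 0]) auto

lemma tame_mult:
  fixes F G :: "_ \<Rightarrow> 'a::{euclidean_space,real_normed_field}"
  assumes "tame I F" "tame I G"
  shows "tame I (\<lambda>x. F x * G x)"
proof -
  obtain B d B' d' where B: "B \<ge> 0" "\<And>x. norm (F x) \<le> B * (1 + l1 I x) ^ d"
      "B' \<ge> 0" "\<And>x. norm (G x) \<le> B' * (1 + l1 I x) ^ d'"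
    and [measurable]: "F \<in> borel_measurable (PiM I (\<lambda>_. borel))" "G \<in> borel_measurable (PiM I (\<lambda>_. borel))"
    using assms unfolding tame_def by auto
  show ?thesis
  proof (rule tameI[where B = "B * B'" and d = "d + d'"])
    fix x
    have "norm (F x) * norm (G x) \<le> (B * (1 + l1 I x) ^ d) * (B' * (1 + l1 I x) ^ d')"
      using B by (intro mult_mono) (auto intro!: mult_nonneg_nonneg zero_le_power sum_nonneg add_nonneg_nonneg)
    then show "norm (F x * G x) \<le> B * B' * (1 + l1 I x) ^ (d + d')" by (simp add: norm_mult power_add mult_ac)
  qed measurable
qed

lemma tame_add:
  assumes "tame I F" "tame I G"
  shows "tame I (\<lambda>x. F x + G x)"
proof -
  obtain B d B' d' where B: "B \<ge> 0" "\<And>x. norm (F x) \<le> B * (1 + l1 I x) ^ d"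
      "B' \<ge> 0" "\<And>x. norm (G x) \<le> B' * (1 + l1 I x) ^ d'"
    and [measurable]: "F \<in> borel_measurable (PiM I (\<lambda>_. borel))" "G \<in> borel_measurable (PiM I (\<lambda>_. borel))"
    using assms unfolding tame_def by auto
  show ?thesis
  proof (rule tameI[where B = "B + B'" and d = "d + d'"])
    fix x
    have "norm (F x + G x) \<le> B * (1 + l1 I x) ^ d + B' * (1 + l1 I x) ^ d'"
      by (rule norm_triangle_le) (use B in \<open>auto intro: add_mono\<close>)
    also have "\<dots> \<le> B * (1 + l1 I x) ^ (d + d') + B' * (1 + l1 I x) ^ (d + d')"
      using B by (intro add_mono mult_left_mono power_increasing tame_base) auto
    finally show "norm (F x + G x) \<le> (B + B') * (1 + l1 I x) ^ (d + d')" by (simp add: algebra_simps)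
  qed measurable
qed

lemma tame_sum: "(\<And>s. s \<in> S \<Longrightarrow> tame I (F s)) \<Longrightarrow> tame I (\<lambda>x. \<Sum>s\<in>S. F s x)"
  by (induction S rule: infinite_finite_induct) (auto intro: tame_const tame_add)

lemma tame_of_real: "tame I F \<Longrightarrow> tame I (\<lambda>x. of_real (F x) :: 'a::{euclidean_space,real_normed_field})"
  unfolding tame_def by (auto intro: measurable_compose[OF _ borel_measurable_of_real])

lemma tame_coord:
  assumes "finite I" "l \<in> I" shows "tame I (\<lambda>x. x l :: real)"
proof (rule tameI[where B = 1 and d = 1])
  show "norm (x l) \<le> 1 * (1 + l1 I x) ^ 1" for x :: "'a \<Rightarrow> real"
    using member_le_sum[OF assms(2), of "\<lambda>l. \<bar>x l\<bar>"] assms by simp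
qed (use assms in measurable)

text \<open>\<open>D l\<close> is the partial derivative in direction l. Differentiability is only
  asked along the lines \<open>x(l := y)\<close>, because the integration by parts moves one
  coordinate while the others are frozen.\<close>

definition smooth_with ::
  "'i set \<Rightarrow> (('i \<Rightarrow> real) \<Rightarrow> 'a::euclidean_space) \<Rightarrow> ('i \<Rightarrow> ('i \<Rightarrow> real) \<Rightarrow> 'a) \<Rightarrow> bool" where
  "smooth_with I F D \<longleftrightarrow> tame I F \<and> (\<forall>l\<in>I. tame I (D l) \<and>
     (\<forall>x. continuous_on UNIV (\<lambda>y. D l (x(l := y))) \<and>
       (\<forall>y. ((\<lambda>y. F (x(l := y))) has_vector_derivative D l (x(l := y))) (at y))))"

lemma smooth_with_continuous:
  assumes "smooth_with I F D" "l \<in> I"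
  shows "continuous_on UNIV (\<lambda>y. F (x(l := y)))"
  by (intro continuous_at_imp_continuous_on ballI has_vector_derivative_continuous)
     (use assms in \<open>auto simp: smooth_with_def\<close>)

lemma tame_section:
  assumes "finite I" "l \<in> I" "tame I F"
  obtains B d where "\<And>y. norm (F (x(l := y))) \<le> B * (1 + \<bar>y\<bar>) ^ d"
proof -
  obtain B d where B: "B \<ge> 0" "\<And>x. norm (F x) \<le> B * (1 + l1 I x) ^ d" using assms unfolding tame_def by auto
  define S where "S = 1 + (\<Sum>k\<in>I - {l}. \<bar>x k\<bar>)"
  have S: "S \<ge> 1" unfolding S_def by (rule tame_base)
  have "norm (F (x(l := y))) \<le> B * S ^ d * (1 + \<bar>y\<bar>) ^ d" for y
  proof -
    have "1 + (\<Sum>k\<in>I. \<bar>(x(l := y)) k\<bar>) = S + \<bar>y\<bar>" using assms by (subst sum.remove[of _ l]) (auto simp: S_def)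
    also have "\<dots> \<le> S * (1 + \<bar>y\<bar>)" using mult_right_mono[OF S, of "\<bar>y\<bar>"] by (simp add: algebra_simps)
    finally have "(1 + (\<Sum>k\<in>I. \<bar>(x(l := y)) k\<bar>)) ^ d \<le> (S * (1 + \<bar>y\<bar>)) ^ d"
      using order_trans[OF zero_le_one tame_base, of "x(l := y)" I] by (intro power_mono) auto
    then have "B * (1 + (\<Sum>k\<in>I. \<bar>(x(l := y)) k\<bar>)) ^ d \<le> B * (S * (1 + \<bar>y\<bar>)) ^ d"
      using B by (intro mult_left_mono)
    then show ?thesis using B(2)[of "x(l := y)"] by (simp add: power_mult_distrib mult_ac)
  qed
  then show ?thesis by (rule that)
qed

text \<open>Fubini isolates the coordinate l, and \<open>std_normal_ibp\<close> is applied to each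
  section in that coordinate.\<close>

lemma gauss_ibp:
  fixes F :: "('i \<Rightarrow> real) \<Rightarrow> 'a::{euclidean_space,real_normed_field}"
  assumes fin: "finite I" and l: "l \<in> I" and s: "smooth_with I F D"
  shows "(\<integral>x. of_real (x l) * F x \<partial>gauss_space I) = (\<integral>x. D l x \<partial>gauss_space I)"
proof -
  define J where "J = I - {l}"
  have I: "I = insert l J" "finite J" "l \<notin> J" using fin l by (auto simp: J_def)
  have t: "tame I F" "tame I (D l)" using s l by (auto simp: smooth_with_def)
  have sec: "(\<integral>y. of_real ((x(l := y)) l) * F (x(l := y)) \<partial>std_normal_distribution) = (\<integral>y. D l (x(l := y)) \<partial>std_normal_distribution)" for x
  proof -
    obtain B d where 1: "\<And>y. norm (F (x(l := y))) \<le> B * (1 + \<bar>y\<bar>) ^ d" using tame_section[OF fin l t(1)] by blast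
    obtain B' d' where 2: "\<And>y. norm (D l (x(l := y))) \<le> B' * (1 + \<bar>y\<bar>) ^ d'" using tame_section[OF fin l t(2)] by blast
    show ?thesis using std_normal_ibp[of "\<lambda>y. F (x(l := y))" "\<lambda>y. D l (x(l := y))", OF _ _ 1 2] s l
      by (simp add: smooth_with_def scaleR_conv_of_real)
  qed
  have tf: "tame I (\<lambda>x. of_real (x l) * F x)" by (intro tame_mult tame_of_real tame_coord fin l t)
  have "(\<integral>x. of_real (x l) * F x \<partial>gauss_space (insert l J)) =
      (\<integral>x. (\<integral>y. of_real ((x(l := y)) l) * F (x(l := y)) \<partial>std_normal_distribution) \<partial>gauss_space J)"
    by (rule gauss_space_integral_insert[OF I(2,3)]) (use tame_integrable[OF fin tf] I(1) in simp)
  also have "\<dots> = (\<integral>x. (\<integral>y. D l (x(l := y)) \<partial>std_normal_distribution) \<partial>gauss_space J)"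
    by (simp only: sec)
  also have "\<dots> = (\<integral>x. D l x \<partial>gauss_space (insert l J))"
    by (rule gauss_space_integral_insert[OF I(2,3), symmetric]) (use tame_integrable[OF fin t(2)] I(1) in simp)
  finally show ?thesis by (simp only: I(1)[symmetric])
qed

lemma smooth_with_of_real_sum:
  assumes fin: "finite I"
  shows "smooth_with I (\<lambda>x. of_real (\<Sum>l\<in>I. c l * x l) :: 'a::{euclidean_space,real_normed_field}) (\<lambda>l _. of_real (c l))"
  unfolding smooth_with_def
proof (intro conjI ballI allI)
  show "tame I (\<lambda>x. of_real (\<Sum>l\<in>I. c l * x l) :: 'a)" by (intro tame_of_real tame_sum tame_mult tame_const tame_coord fin)
next
  fix l x y assume l: "l \<in> I"
  have "(\<Sum>k\<in>I. c k * (x(l := z)) k) = c l * z + (\<Sum>k\<in>I - {l}. c k * x k)" for z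
    using l fin by (subst sum.remove[of _ l]) auto
  then show "((\<lambda>y. of_real (\<Sum>k\<in>I. c k * (x(l := y)) k) :: 'a) has_vector_derivative of_real (c l)) (at y)"
    by (auto intro!: derivative_eq_intros has_vector_derivative_of_real simp del: of_real_sum of_real_add of_real_mult)
qed (auto intro: tame_const)

lemma smooth_with_mult:
  fixes F G :: "_ \<Rightarrow> 'a::{euclidean_space,real_normed_field}"
  assumes F: "smooth_with I F D" and G: "smooth_with I G E"
  shows "smooth_with I (\<lambda>x. F x * G x) (\<lambda>l x. D l x * G x + F x * E l x)"
  unfolding smooth_with_def
proof (intro conjI ballI allI)
  fix l x y assume l: "l \<in> I"
  have "((\<lambda>y. F (x(l := y)) * G (x(l := y))) has_vector_derivative
      F (x(l := y)) * E l (x(l := y)) + D l (x(l := y)) * G (x(l := y))) (at y)"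
    by (rule has_vector_derivative_mult) (use F G l in \<open>auto simp: smooth_with_def\<close>)
  then show "((\<lambda>y. F (x(l := y)) * G (x(l := y))) has_vector_derivative
      D l (x(l := y)) * G (x(l := y)) + F (x(l := y)) * E l (x(l := y))) (at y)" by (simp add: add.commute)
  show "continuous_on UNIV (\<lambda>y. D l (x(l := y)) * G (x(l := y)) + F (x(l := y)) * E l (x(l := y)))"
    using l F G by (intro continuous_intros smooth_with_continuous[OF F l] smooth_with_continuous[OF G l])
      (auto simp: smooth_with_def)
qed (use F G in \<open>auto simp: smooth_with_def intro!: tame_mult tame_add\<close>)

lemma smooth_with_add:
  assumes F: "smooth_with I F D" and G: "smooth_with I G E"
  shows "smooth_with I (\<lambda>x. F x + G x) (\<lambda>l x. D l x + E l x)"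
  using assms unfolding smooth_with_def by (auto intro!: tame_add has_vector_derivative_add continuous_on_add)

lemma smooth_with_const: "smooth_with I (\<lambda>_. c) (\<lambda>_ _. 0)"
  by (auto simp: smooth_with_def intro: tame_const)

lemma smooth_with_iexp:
  fixes q :: "_ \<Rightarrow> real"
  assumes q: "smooth_with I q D"
  shows "smooth_with I (\<lambda>x. iexp (t * q x)) (\<lambda>l x. \<i> * of_real t * of_real (D l x) * iexp (t * q x))"
  unfolding smooth_with_def
proof (intro conjI ballI allI)
  have [measurable]: "q \<in> borel_measurable (PiM I (\<lambda>_. borel))" using q by (auto simp: smooth_with_def tame_def)
  show *: "tame I (\<lambda>x. iexp (t * q x))" by (rule tameI[where B = 1 and d = 0]) auto
  fix l x y assume l: "l \<in> I"
  show "tame I (\<lambda>x. \<i> * of_real t * of_real (D l x) * iexp (t * q x))"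
    by (intro tame_mult tame_const tame_of_real *) (use q l in \<open>auto simp: smooth_with_def\<close>)
  show "continuous_on UNIV (\<lambda>y. \<i> * of_real t * of_real (D l (x(l := y))) * iexp (t * q (x(l := y))))"
    using l q smooth_with_continuous[OF q l] by (intro continuous_intros) (auto simp: smooth_with_def)
  have "((\<lambda>y. q (x(l := y))) has_real_derivative D l (x(l := y))) (at y)"
    using q l by (auto simp: smooth_with_def has_real_derivative_iff_has_vector_derivative)
  then have "((\<lambda>y. complex_of_real (t * q (x(l := y)))) has_vector_derivative complex_of_real (t * D l (x(l := y)))) (at y)"
    by (intro has_vector_derivative_of_real) (auto intro!: derivative_eq_intros)
  then have "((\<lambda>y. \<i> * complex_of_real (t * q (x(l := y)))) has_vector_derivative \<i> * complex_of_real (t * D l (x(l := y)))) (at y)"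
    by (rule has_vector_derivative_mult_right)
  from field_vector_diff_chain_at[OF this DERIV_exp]
  show "((\<lambda>y. iexp (t * q (x(l := y)))) has_vector_derivative
      \<i> * of_real t * of_real (D l (x(l := y))) * iexp (t * q (x(l := y)))) (at y)" by (simp add: comp_def mult_ac)
qed

section \<open>Linear forms in independent standard normals\<close>

locale gauss_forms =
  fixes I :: "'i set" and a :: "'p \<Rightarrow> 'i \<Rightarrow> real"
  assumes fin: "finite I"
begin

definition Z :: "'p \<Rightarrow> ('i \<Rightarrow> real) \<Rightarrow> real" where "Z p x = (\<Sum>l\<in>I. a p l * x l)"
text \<open>The Gram matrix of the coefficient vectors, identified in \<open>moment2\<close> as the
  covariance matrix. It may be singular; representing the vector by linear forms avoids joint
  densities.\<close>

definition C :: "'p \<Rightarrow> 'p \<Rightarrow> real" where "C p q = (\<Sum>l\<in>I. a p l * a q l)"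

abbreviation EG :: "(('i \<Rightarrow> real) \<Rightarrow> 'b::{banach,second_countable_topology}) \<Rightarrow> 'b" where
  "EG F \<equiv> (\<integral>x. F x \<partial>gauss_space I)"

text \<open>\<open>G p\<close> is the derivative of \<open>F\<close> in the direction of the coefficient vector of \<open>Z p\<close>.\<close>

definition dirderiv :: "(('i \<Rightarrow> real) \<Rightarrow> 'a::{euclidean_space,real_normed_field}) \<Rightarrow> ('p \<Rightarrow> ('i \<Rightarrow> real) \<Rightarrow> 'a) \<Rightarrow> bool" where
  "dirderiv F G \<longleftrightarrow> (\<exists>D. smooth_with I F D \<and> (\<forall>p x. G p x = (\<Sum>l\<in>I. of_real (a p l) * D l x)))"

lemma C_sym: "C p q = C q p" by (simp add: C_def mult.commute)

lemma dirderiv_tame: assumes "dirderiv F G" shows "tame I F" "tame I (G p)"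
proof -
  obtain D where D: "smooth_with I F D" "\<And>p x. G p x = (\<Sum>l\<in>I. of_real (a p l) * D l x)"
    using assms by (auto simp: dirderiv_def)
  show "tame I F" using D by (simp add: smooth_with_def)
  have "tame I (\<lambda>x. \<Sum>l\<in>I. of_real (a p l) * D l x)"
    using D by (intro tame_sum tame_mult tame_const) (auto simp: smooth_with_def)
  then show "tame I (G p)" using D(2) by (metis (no_types, lifting) ext)
qed

lemma dirderiv_const: "dirderiv (\<lambda>_. c) (\<lambda>_ _. 0)"
  unfolding dirderiv_def by (rule exI[of _ "\<lambda>_ _. 0"]) (simp add: smooth_with_const)

lemma dirderiv_Z: "dirderiv (\<lambda>x. of_real (Z q x)) (\<lambda>p _. of_real (C p q))"
  unfolding dirderiv_def Z_def by (rule exI, rule conjI, rule smooth_with_of_real_sum[OF fin]) (simp add: C_def)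

lemma dirderiv_mult:
  assumes "dirderiv F G" "dirderiv F' G'"
  shows "dirderiv (\<lambda>x. F x * F' x) (\<lambda>p x. G p x * F' x + F x * G' p x)"
proof -
  obtain D D' where D: "smooth_with I F D" "\<And>p x. G p x = (\<Sum>l\<in>I. of_real (a p l) * D l x)"
    "smooth_with I F' D'" "\<And>p x. G' p x = (\<Sum>l\<in>I. of_real (a p l) * D' l x)" using assms by (auto simp: dirderiv_def)
  show ?thesis unfolding dirderiv_def by (rule exI, rule conjI, rule smooth_with_mult[OF D(1,3)])
       (simp add: D sum_distrib_left sum_distrib_right sum.distrib[symmetric] algebra_simps)
qed

lemma dirderiv_add:
  assumes "dirderiv F G" "dirderiv F' G'"
  shows "dirderiv (\<lambda>x. F x + F' x) (\<lambda>p x. G p x + G' p x)"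
proof -
  obtain D D' where D: "smooth_with I F D" "\<And>p x. G p x = (\<Sum>l\<in>I. of_real (a p l) * D l x)"
    "smooth_with I F' D'" "\<And>p x. G' p x = (\<Sum>l\<in>I. of_real (a p l) * D' l x)" using assms by (auto simp: dirderiv_def)
  show ?thesis unfolding dirderiv_def by (rule exI, rule conjI, rule smooth_with_add[OF D(1,3)])
       (simp add: D sum.distrib[symmetric] algebra_simps)
qed

lemma dirderiv_sum:
  assumes "\<And>s. s \<in> S \<Longrightarrow> dirderiv (F s) (G s)"
  shows "dirderiv (\<lambda>x. \<Sum>s\<in>S. F s x) (\<lambda>p x. \<Sum>s\<in>S. G s p x)"
  using assms by (induction S rule: infinite_finite_induct) (auto intro: dirderiv_const dirderiv_add)

lemma dirderiv_iexp:
  fixes F :: "_ \<Rightarrow> real"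
  assumes "dirderiv F G"
  shows "dirderiv (\<lambda>x. iexp (t * F x)) (\<lambda>p x. \<i> * of_real t * of_real (G p x) * iexp (t * F x))"
proof -
  obtain D where D: "smooth_with I F D" "\<And>p x. G p x = (\<Sum>l\<in>I. of_real (a p l) * D l x)"
    using assms by (auto simp: dirderiv_def)
  show ?thesis unfolding dirderiv_def by (rule exI, rule conjI, rule smooth_with_iexp[OF D(1), of t])
       (simp add: D sum_distrib_left sum_distrib_right mult_ac)
qed

text \<open>Stein's identity for a Gaussian vector: the coordinate identities are summed with the
  weights \<open>a p l\<close>. For a function of the forms \<open>Z q\<close>, the right side is
  the sum over q of C p q times the expected partial derivative.\<close>

lemma ibp:
  assumes "dirderiv F G"
  shows "EG (\<lambda>x. of_real (Z p x) * F x) = EG (G p)"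
proof -
  obtain D where D: "smooth_with I F D" "\<And>p x. G p x = (\<Sum>l\<in>I. of_real (a p l) * D l x)"
    using assms by (auto simp: dirderiv_def)
  have t: "tame I F" "\<And>l. l \<in> I \<Longrightarrow> tame I (D l)" using D by (auto simp: smooth_with_def)
  have "EG (\<lambda>x. of_real (Z p x) * F x) = EG (\<lambda>x. \<Sum>l\<in>I. of_real (a p l) * (of_real (x l) * F x))"
    by (simp only: Z_def of_real_sum of_real_mult sum_distrib_right mult.assoc)
  also have "\<dots> = (\<Sum>l\<in>I. EG (\<lambda>x. of_real (a p l) * (of_real (x l) * F x)))"
    by (intro Bochner_Integration.integral_sum tame_integrable fin tame_mult tame_const tame_of_real tame_coord t)
  also have "\<dots> = (\<Sum>l\<in>I. of_real (a p l) * EG (D l))" by (intro sum.cong refl) (simp add: gauss_ibp[OF fin _ D(1)])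
  also have "\<dots> = (\<Sum>l\<in>I. EG (\<lambda>x. of_real (a p l) * D l x))" by simp
  also have "\<dots> = EG (G p)" unfolding D(2)
    by (intro Bochner_Integration.integral_sum[symmetric] tame_integrable fin tame_mult tame_const t)
  finally show ?thesis .
qed

lemma dirderiv_Z_real: "dirderiv (Z q) (\<lambda>p _. C p q)"
  using dirderiv_Z[where 'a = real] by simp

lemmas ibp_real = ibp[where 'a = real, unfolded of_real_eq_id id_apply]

lemma tame_Z: "tame I (Z p)" using dirderiv_tame(1)[OF dirderiv_Z_real] .

lemma dirderiv_power: "dirderiv (\<lambda>x. Z q x ^ n) (\<lambda>p x. of_nat n * C p q * Z q x ^ (n - 1))"
proof (induction n)
  case 0 then show ?case by (simp add: dirderiv_const)
next
  case (Suc n)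
  have e: "(\<lambda>p x. C p q * Z q x ^ n + Z q x * (of_nat n * C p q * Z q x ^ (n - 1)))
      = (\<lambda>p x. of_nat (Suc n) * C p q * Z q x ^ (Suc n - 1))" by (cases n) (auto simp: fun_eq_iff algebra_simps)
  show ?case using dirderiv_mult[OF dirderiv_Z_real[of q] Suc] unfolding e by simp
qed

lemma integrable_tame: "tame I F \<Longrightarrow> integrable (gauss_space I) F"
  by (rule tame_integrable[OF fin])

lemma tame_power: "tame I (\<lambda>x. Z q x ^ n)" using dirderiv_tame(1)[OF dirderiv_power] .

lemma moment2: "EG (\<lambda>x. Z p x * Z q x) = C p q"
  using ibp_real[OF dirderiv_Z_real, of p q] by (simp add: prob_space.prob_space[OF prob_space_PiM[OF prob_space_std_gauss]])

text \<open>Isserlis' formula: integration by parts pairs \<open>Z p\<close> with each of the other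
  three factors in turn.\<close>

lemma moment4: "EG (\<lambda>x. Z p x * (Z q x * (Z r x * Z s x))) = C p q * C r s + C p r * C q s + C p s * C q r"
proof -
  note d = dirderiv_mult[OF dirderiv_Z_real[of q] dirderiv_mult[OF dirderiv_Z_real[of r] dirderiv_Z_real[of s]]]
  have "EG (\<lambda>x. Z p x * (Z q x * (Z r x * Z s x))) =
     EG (\<lambda>x. C p q * (Z r x * Z s x) + (C p r * (Z q x * Z s x) + C p s * (Z q x * Z r x)))"
    using ibp_real[OF d, of p] by (simp add: algebra_simps)
  also have "\<dots> = C p q * EG (\<lambda>x. Z r x * Z s x) + (C p r * EG (\<lambda>x. Z q x * Z s x) + C p s * EG (\<lambda>x. Z q x * Z r x))"
    by (simp add: integrable_tame tame_mult tame_Z tame_const tame_add)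
  finally show ?thesis by (simp add: moment2)
qed

text \<open>Integration by parts lowers the total degree by two. For k = 0 or n = 0 the truncated
  exponent is harmless, since the factor in front of it is 0.\<close>

lemma moment_rec:
  "EG (\<lambda>x. Z p x ^ Suc k * Z q x ^ n) =
     of_nat k * C p p * EG (\<lambda>x. Z p x ^ (k - 1) * Z q x ^ n) + of_nat n * C p q * EG (\<lambda>x. Z p x ^ k * Z q x ^ (n - 1))"
proof -
  have "EG (\<lambda>x. Z p x ^ Suc k * Z q x ^ n) =
     EG (\<lambda>x. of_nat k * C p p * (Z p x ^ (k - 1) * Z q x ^ n) + of_nat n * C p q * (Z p x ^ k * Z q x ^ (n - 1)))"
    using ibp_real[OF dirderiv_mult[OF dirderiv_power[of p k] dirderiv_power[of q n]], of p] by (simp add: algebra_simps)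
  also have "\<dots> = EG (\<lambda>x. of_nat k * C p p * (Z p x ^ (k - 1) * Z q x ^ n)) + EG (\<lambda>x. of_nat n * C p q * (Z p x ^ k * Z q x ^ (n - 1)))"
    by (intro Bochner_Integration.integral_add integrable_tame tame_mult tame_power tame_const)
  finally show ?thesis by simp
qed

lemma moment_one: "EG (\<lambda>_. 1::real) = 1"
  by (simp add: prob_space.prob_space[OF prob_space_PiM[OF prob_space_std_gauss]])

text \<open>The coefficients count the pairings of eight factors with zero, two or four mixed pairs;
  they add up to 105, the eighth moment of a standard normal.\<close>

lemma moment44: "EG (\<lambda>x. Z p x ^ 4 * Z q x ^ 4) =
    9 * (C p p)\<^sup>2 * (C q q)\<^sup>2 + 72 * C p p * C q q * (C p q)\<^sup>2 + 24 * C p q ^ 4"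
proof -
  define m where "m k n = EG (\<lambda>x. Z p x ^ k * Z q x ^ n)" for k n
  have r: "m (Suc k) n = of_nat k * C p p * m (k - 1) n + of_nat n * C p q * m k (n - 1)" for k n unfolding m_def by (rule moment_rec)
  have r': "m 0 (Suc n) = of_nat n * C q q * m 0 (n - 1)" for n using moment_rec[of q n q 0] unfolding m_def by simp
  have "m 0 0 = 1" unfolding m_def by (simp add: moment_one del: lebesgue_integral_const)
  then have "m 4 4 = 9 * (C p p)\<^sup>2 * (C q q)\<^sup>2 + 72 * C p p * C q q * (C p q)\<^sup>2 + 24 * C p q ^ 4"
    by (simp add: eval_nat_numeral r r' algebra_simps)
  then show ?thesis by (simp add: m_def)
qed

lemma moment4_single: "EG (\<lambda>x. Z p x ^ 4) = 3 * (C p p)\<^sup>2"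
  using moment4[of p p p p] by (simp add: eval_nat_numeral)

end

section \<open>Quadratic and quartic forms in Gaussian variables\<close>

text \<open>The variance of |X| is nonnegative.\<close>

lemma (in prob_space) expectation_abs_le_sqrt:
  fixes X :: "'a \<Rightarrow> real"
  assumes [measurable]: "X \<in> borel_measurable M" and i: "integrable M (\<lambda>x. (X x)\<^sup>2)"
  shows "integrable M X" "(\<integral>x. \<bar>X x\<bar> \<partial>M) \<le> sqrt (\<integral>x. (X x)\<^sup>2 \<partial>M)"
proof -
  show iX: "integrable M X" by (rule square_integrable_imp_integrable[OF _ i]) simp
  have "0 \<le> (\<integral>x. (\<bar>X x\<bar> - expectation (\<lambda>x. \<bar>X x\<bar>))\<^sup>2 \<partial>M)" by simp
  also have "\<dots> = (\<integral>x. \<bar>X x\<bar>\<^sup>2 \<partial>M) - (\<integral>x. \<bar>X x\<bar> \<partial>M)\<^sup>2"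
    by (rule variance_eq) (use iX i in auto)
  finally show "(\<integral>x. \<bar>X x\<bar> \<partial>M) \<le> sqrt (\<integral>x. (X x)\<^sup>2 \<partial>M)"
    by (intro real_le_rsqrt) simp
qed

lemma iexp_approx_quadratic: "cmod (iexp x - 1 - \<i> * of_real x) \<le> x\<^sup>2 / 2"
  using iexp_approx1[of x 1] by (simp add: power2_eq_square numeral_2_eq_2 diff_diff_eq)

text \<open>Differentiation under the integral: the second order Taylor remainder of the exponential
  is at most h^2 Q^2 / 2 pointwise, hence o(h) after integration.\<close>

lemma (in prob_space) char_has_vector_derivative:
  assumes Q[measurable]: "Q \<in> borel_measurable M" and i2: "integrable M (\<lambda>x. (Q x)\<^sup>2)"
  shows "((\<lambda>t. \<integral>x. iexp (t * Q x) \<partial>M) has_vector_derivative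
     (\<integral>x. \<i> * of_real (Q x) * iexp (t * Q x) \<partial>M)) (at t)" unfolding has_vector_derivative_def
proof (rule has_derivativeI_sandwich[where e = 1])
  have iQ: "integrable M Q" by (rule expectation_abs_le_sqrt[OF Q i2])
  have ie: "integrable M (\<lambda>x. iexp (s * Q x))" for s by (rule integrable_const_bound[where B = 1]) auto
  have iQe: "integrable M (\<lambda>x. \<i> * of_real (Q x) * iexp (t * Q x))"
    by (rule Bochner_Integration.integrable_bound[OF iQ]) (auto simp: norm_mult)
  fix s :: real assume s: "s \<noteq> t"
  define h where "h = s - t"
  have "(\<integral>x. iexp (s * Q x) \<partial>M) - (\<integral>x. iexp (t * Q x) \<partial>M) - h *\<^sub>R (\<integral>x. \<i> * of_real (Q x) * iexp (t * Q x) \<partial>M)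
     = (\<integral>x. iexp (s * Q x) - iexp (t * Q x) - h *\<^sub>R (\<i> * of_real (Q x) * iexp (t * Q x)) \<partial>M)"
    by (simp only: Bochner_Integration.integral_diff Bochner_Integration.integrable_diff
        integrable_scaleR_right integral_scaleR_right ie iQe)
  also have "norm \<dots> \<le> (\<integral>x. h\<^sup>2 / 2 * (Q x)\<^sup>2 \<partial>M)"
  proof (rule order_trans[OF integral_norm_bound], rule integral_mono)
    show "integrable M (\<lambda>x. norm (iexp (s * Q x) - iexp (t * Q x) - h *\<^sub>R (\<i> * of_real (Q x) * iexp (t * Q x))))"
      by (intro integrable_norm Bochner_Integration.integrable_diff ie integrable_scaleR_right iQe)
    show "integrable M (\<lambda>x. h\<^sup>2 / 2 * (Q x)\<^sup>2)" using i2 by simp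
    fix x
    have "iexp (s * Q x) = iexp (t * Q x) * iexp (h * Q x)" by (simp add: h_def exp_add[symmetric] algebra_simps)
    then have "iexp (s * Q x) - iexp (t * Q x) - h *\<^sub>R (\<i> * of_real (Q x) * iexp (t * Q x))
        = iexp (t * Q x) * (iexp (h * Q x) - 1 - \<i> * of_real (h * Q x))" by (simp add: scaleR_conv_of_real algebra_simps)
    then show "norm (iexp (s * Q x) - iexp (t * Q x) - h *\<^sub>R (\<i> * of_real (Q x) * iexp (t * Q x))) \<le> h\<^sup>2 / 2 * (Q x)\<^sup>2"
      using iexp_approx_quadratic[of "h * Q x"] by (simp add: norm_mult power_mult_distrib)
  qed
  finally have "norm ((\<integral>x. iexp (s * Q x) \<partial>M) - (\<integral>x. iexp (t * Q x) \<partial>M) - h *\<^sub>R (\<integral>x. \<i> * of_real (Q x) * iexp (t * Q x) \<partial>M))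
      \<le> h\<^sup>2 * ((\<integral>x. (Q x)\<^sup>2 \<partial>M) / 2)" by simp
  then have "norm ((\<integral>x. iexp (s * Q x) \<partial>M) - (\<integral>x. iexp (t * Q x) \<partial>M) - h *\<^sub>R (\<integral>x. \<i> * of_real (Q x) * iexp (t * Q x) \<partial>M)) / \<bar>h\<bar>
      \<le> h\<^sup>2 * ((\<integral>x. (Q x)\<^sup>2 \<partial>M) / 2) / \<bar>h\<bar>" by (rule divide_right_mono) simp
  also have "\<dots> = \<bar>h\<bar> * ((\<integral>x. (Q x)\<^sup>2 \<partial>M) / 2)"
  proof -
    have "h \<noteq> 0" using s by (simp add: h_def)
    then show ?thesis by (simp add: power2_eq_square abs_if)
  qed
  finally show "norm ((\<integral>x. iexp (s * Q x) \<partial>M) - (\<integral>x. iexp (t * Q x) \<partial>M) - (s - t) *\<^sub>R (\<integral>x. \<i> * of_real (Q x) * iexp (t * Q x) \<partial>M)) / norm (s - t)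
      \<le> \<bar>s - t\<bar> * ((\<integral>x. (Q x)\<^sup>2 \<partial>M) / 2)" by (simp add: h_def)
next
  show "((\<lambda>s. \<bar>s - t\<bar> * ((\<integral>x. (Q x)\<^sup>2 \<partial>M) / 2)) \<longlongrightarrow> 0) (at t)"
    by (auto intro!: tendsto_eq_intros)
qed (auto intro: bounded_linear_scaleR_left)

text \<open>exp (t^2 T) is the integrating factor of the equation without error. On the interval
  from -|t| to |t| the product moves at most by |t| times the maximal slope, and dividing by the
  factor at t removes the exponential again. The symmetric interval treats both signs of t at
  once.\<close>

lemma char_gronwall:
  fixes \<phi> \<phi>' :: "real \<Rightarrow> complex"
  assumes der: "\<And>t. (\<phi> has_vector_derivative \<phi>' t) (at t)" and "\<phi> 0 = 1"
    and bd: "\<And>t. norm (\<phi>' t + of_real (2 * t * T) * \<phi> t) \<le> 2 * \<bar>t\<bar> * \<epsilon>" and "T \<ge> 0"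
  shows "norm (\<phi> t - of_real (exp (- t\<^sup>2 * T))) \<le> 2 * t\<^sup>2 * \<epsilon>"
proof -
  have "0 \<le> 2 * \<bar>1::real\<bar> * \<epsilon>" using bd[of 1] order_trans[OF norm_ge_zero] by blast
  then have eps: "\<epsilon> \<ge> 0" by simp
  define D where "D s = exp (s\<^sup>2 * T) *\<^sub>R \<phi> s" for s
  define D' where "D' s = exp (s\<^sup>2 * T) *\<^sub>R (\<phi>' s + of_real (2 * s * T) * \<phi> s)" for s
  have dD: "(D has_vector_derivative D' s) (at s)" for s
  proof -
    have "((\<lambda>s. exp (s\<^sup>2 * T)) has_real_derivative exp (s\<^sup>2 * T) * (2 * s * T)) (at s)"
      by (auto intro!: derivative_eq_intros)
    from has_vector_derivative_scaleR[OF this der[of s]]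
    show ?thesis unfolding D_def D'_def by (rule has_vector_derivative_eq_rhs) (simp add: scaleR_conv_of_real algebra_simps)
  qed
  define S where "S = {- \<bar>t\<bar>..\<bar>t\<bar>}"
  have "norm (D t - D 0) \<le> (exp (t\<^sup>2 * T) * (2 * \<bar>t\<bar> * \<epsilon>)) * norm (t - 0)"
  proof (rule differentiable_bound[of S D "\<lambda>s h. h *\<^sub>R D' s"])
    fix s assume s: "s \<in> S"
    show "(D has_derivative (\<lambda>h. h *\<^sub>R D' s)) (at s within S)"
      using dD[of s] by (auto simp: has_vector_derivative_def intro: has_derivative_at_withinI)
    have sq: "s\<^sup>2 \<le> t\<^sup>2" using s by (auto simp: S_def abs_le_square_iff[symmetric])
    have "norm (D' s) \<le> exp (s\<^sup>2 * T) * (2 * \<bar>s\<bar> * \<epsilon>)" unfolding D'_def using bd[of s] by simp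
    also have "\<dots> \<le> exp (t\<^sup>2 * T) * (2 * \<bar>t\<bar> * \<epsilon>)"
      using s sq eps \<open>T \<ge> 0\<close> by (intro mult_mono) (auto simp: S_def intro: mult_right_mono)
    finally show "onorm (\<lambda>h. h *\<^sub>R D' s) \<le> exp (t\<^sup>2 * T) * (2 * \<bar>t\<bar> * \<epsilon>)"
      by (intro onorm_le) (simp add: mult_right_mono mult.commute[of "\<bar>_\<bar>"])
  qed (auto simp: S_def)
  then have 1: "norm (D t - 1) \<le> exp (t\<^sup>2 * T) * (2 * t\<^sup>2 * \<epsilon>)"
    using \<open>\<phi> 0 = 1\<close> by (simp add: D_def power2_eq_square mult_ac abs_mult_self_eq)
  have "\<phi> t - of_real (exp (- t\<^sup>2 * T)) = exp (- t\<^sup>2 * T) *\<^sub>R (D t - 1)"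
    by (simp add: D_def scaleR_conv_of_real algebra_simps exp_minus_inverse flip: of_real_mult exp_add)
  then have "norm (\<phi> t - of_real (exp (- t\<^sup>2 * T))) = exp (- t\<^sup>2 * T) * norm (D t - 1)" by simp
  also have "\<dots> \<le> exp (- t\<^sup>2 * T) * (exp (t\<^sup>2 * T) * (2 * t\<^sup>2 * \<epsilon>))"
    using 1 by (intro mult_left_mono) auto
  also have "\<dots> = 2 * t\<^sup>2 * \<epsilon>" by (simp flip: mult.assoc exp_add)
  finally show ?thesis .
qed

context gauss_forms
begin

lemma prob_space_gauss: "prob_space (gauss_space I)"
  by (intro prob_space_PiM prob_space_std_gauss)

lemma measure_gauss_space [simp]: "measure (gauss_space I) (space (gauss_space I)) = 1"
  by (rule prob_space.prob_space[OF prob_space_gauss])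

definition quad :: "'p set \<Rightarrow> ('i \<Rightarrow> real) \<Rightarrow> real" where
  "quad P x = (\<Sum>p\<in>P. (Z p x)\<^sup>2 - C p p)"

text \<open>By symmetry of C, \<open>frob\<close> and \<open>frob2\<close> are the traces of the
  second and fourth power of C restricted to P.\<close>

definition frob :: "'p set \<Rightarrow> real" where "frob P = (\<Sum>p\<in>P. \<Sum>q\<in>P. (C p q)\<^sup>2)"
definition frob2 :: "'p set \<Rightarrow> real" where "frob2 P = (\<Sum>p\<in>P. \<Sum>q\<in>P. (\<Sum>r\<in>P. C p r * C r q)\<^sup>2)"

lemma dirderiv_quad: "dirderiv (quad P) (\<lambda>p x. \<Sum>q\<in>P. 2 * C p q * Z q x)"
proof -
  have "dirderiv (\<lambda>x. Z q x ^ 2 + - C q q) (\<lambda>p x. 2 * C p q * Z q x + 0)" for q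
    using dirderiv_add[OF dirderiv_power[of q 2] dirderiv_const[of "- C q q"]] by simp
  from dirderiv_sum[of P "\<lambda>q x. Z q x ^ 2 + - C q q" "\<lambda>q p x. 2 * C p q * Z q x + 0", OF this]
  show ?thesis unfolding quad_def by (simp add: quad_def[abs_def])
qed

lemma tame_quad: "tame I (quad P)" by (rule dirderiv_tame(1)[OF dirderiv_quad])

text \<open>The variance of the form with matrix C in a vector with covariance C. Of the three
  pairings in \<open>moment4\<close> one yields the squared mean and each of the other two yields
  the trace of C^4.\<close>

lemma integral_bilinear_square:
  "EG (\<lambda>x. ((\<Sum>p\<in>P. \<Sum>q\<in>P. C p q * (Z p x * Z q x)) - frob P)\<^sup>2) = 2 * frob2 P"
proof -
  let ?S = "\<lambda>x. \<Sum>p\<in>P. \<Sum>q\<in>P. C p q * (Z p x * Z q x)"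
  have tS: "tame I ?S" by (intro tame_sum tame_mult tame_const tame_Z)
  have "EG ?S = (\<Sum>p\<in>P. \<Sum>q\<in>P. C p q * C p q)" by (simp add: integrable_tame tame_mult tame_Z tame_const tame_sum moment2)
  then have 1: "EG ?S = frob P" by (simp add: frob_def power2_eq_square)
  have "EG (\<lambda>x. ?S x * ?S x) = EG (\<lambda>x. \<Sum>p\<in>P. \<Sum>q\<in>P. \<Sum>r\<in>P. \<Sum>s\<in>P. C p q * C r s * (Z p x * (Z q x * (Z r x * Z s x))))"
    by (simp only: sum_distrib_right) (simp only: sum_distrib_left mult_ac)
  also have "\<dots> = (\<Sum>p\<in>P. \<Sum>q\<in>P. \<Sum>r\<in>P. \<Sum>s\<in>P. C p q * C r s * EG (\<lambda>x. Z p x * (Z q x * (Z r x * Z s x))))"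
    by (simp add: integrable_tame tame_mult tame_Z tame_const tame_sum)
  also have "\<dots> = (\<Sum>p\<in>P. \<Sum>q\<in>P. \<Sum>r\<in>P. \<Sum>s\<in>P. C p q * C r s * (C p q * C r s + C p r * C q s + C p s * C q r))"
    by (simp add: moment4)
  also have "\<dots> = (\<Sum>p\<in>P. \<Sum>q\<in>P. \<Sum>r\<in>P. \<Sum>s\<in>P. (C p q * C p q) * (C r s * C r s))
      + (\<Sum>p\<in>P. \<Sum>q\<in>P. \<Sum>r\<in>P. \<Sum>s\<in>P. C p q * C r s * C p r * C q s)
      + (\<Sum>p\<in>P. \<Sum>q\<in>P. \<Sum>r\<in>P. \<Sum>s\<in>P. C p q * C r s * C p s * C q r)"
    by (simp add: algebra_simps sum.distrib)
  also have "(\<Sum>p\<in>P. \<Sum>q\<in>P. \<Sum>r\<in>P. \<Sum>s\<in>P. (C p q * C p q) * (C r s * C r s)) = frob P * frob P"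
    unfolding frob_def power2_eq_square by (simp only: sum_distrib_right) (simp only: sum_distrib_left)
  also have "(\<Sum>p\<in>P. \<Sum>q\<in>P. \<Sum>r\<in>P. \<Sum>s\<in>P. C p q * C r s * C p s * C q r) = (\<Sum>p\<in>P. \<Sum>q\<in>P. \<Sum>r\<in>P. \<Sum>s\<in>P. C p q * C r s * C p r * C q s)"
  proof (rule sum.cong[OF refl], rule sum.cong[OF refl])
    fix p q
    show "(\<Sum>r\<in>P. \<Sum>s\<in>P. C p q * C r s * C p s * C q r) = (\<Sum>r\<in>P. \<Sum>s\<in>P. C p q * C r s * C p r * C q s)"
      by (subst sum.swap, intro sum.cong refl) (simp add: C_sym mult_ac)
  qed
  also have "(\<Sum>p\<in>P. \<Sum>q\<in>P. \<Sum>r\<in>P. \<Sum>s\<in>P. C p q * C r s * C p r * C q s) = frob2 P"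
  proof -
    have "frob2 P = (\<Sum>q\<in>P. \<Sum>r\<in>P. \<Sum>p\<in>P. \<Sum>s\<in>P. C q p * C p r * (C q s * C s r))"
      by (simp add: frob2_def power2_eq_square sum_product)
    also have "\<dots> = (\<Sum>q\<in>P. \<Sum>p\<in>P. \<Sum>r\<in>P. \<Sum>s\<in>P. C q p * C p r * (C q s * C s r))"
      by (intro sum.cong refl sum.swap)
    also have "\<dots> = (\<Sum>p\<in>P. \<Sum>q\<in>P. \<Sum>r\<in>P. \<Sum>s\<in>P. C q p * C p r * (C q s * C s r))" by (rule sum.swap)
    finally have "frob2 P = (\<Sum>p\<in>P. \<Sum>q\<in>P. \<Sum>r\<in>P. \<Sum>s\<in>P. C q p * C p r * (C q s * C s r))" .
    then show ?thesis by (elim ssubst) (intro sum.cong refl, simp add: C_sym mult_ac)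
  qed
  finally have 2: "EG (\<lambda>x. ?S x * ?S x) = frob P * frob P + 2 * frob2 P" by simp
  have "EG (\<lambda>x. (?S x - frob P)\<^sup>2) = EG (\<lambda>x. ?S x * ?S x - 2 * frob P * ?S x + frob P * frob P)"
    by (simp add: power2_eq_square algebra_simps)
  also have "\<dots> = EG (\<lambda>x. ?S x * ?S x) - 2 * frob P * EG ?S + frob P * frob P"
  proof -
    have "integrable (gauss_space I) (\<lambda>x. ?S x * ?S x)" "integrable (gauss_space I) (\<lambda>x. 2 * frob P * ?S x)"
      "integrable (gauss_space I) (\<lambda>x. frob P * frob P)" by (intro integrable_tame tame_mult tS tame_const)+
    then show ?thesis by (simp add: Bochner_Integration.integral_add Bochner_Integration.integral_diff)
  qed
  finally show ?thesis using 1 2 by simp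
qed

text \<open>By \<open>moment4\<close> the covariance of the squares of \<open>Z p\<close> and
  \<open>Z q\<close> is 2 (C p q)^2.\<close>

lemma integral_quad_square: "EG (\<lambda>x. (quad P x)\<^sup>2) = 2 * frob P"
proof -
  have e: "EG (\<lambda>x. ((Z p x)\<^sup>2 - C p p) * ((Z q x)\<^sup>2 - C q q)) = 2 * (C p q)\<^sup>2" for p q
  proof -
    have "EG (\<lambda>x. ((Z p x)\<^sup>2 - C p p) * ((Z q x)\<^sup>2 - C q q)) =
       EG (\<lambda>x. Z p x * (Z p x * (Z q x * Z q x)) + ((- C q q) * (Z p x * Z p x) + ((- C p p) * (Z q x * Z q x) + C p p * C q q)))"
      by (simp add: power2_eq_square algebra_simps)
    also have "\<dots> = EG (\<lambda>x. Z p x * (Z p x * (Z q x * Z q x))) + ((- C q q) * EG (\<lambda>x. Z p x * Z p x) + ((- C p p) * EG (\<lambda>x. Z q x * Z q x) + C p p * C q q))"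
      by (simp add: integrable_tame tame_mult tame_Z tame_const tame_add)
    finally show ?thesis by (simp add: moment2 moment4 C_sym power2_eq_square)
  qed
  have "EG (\<lambda>x. (quad P x)\<^sup>2) = EG (\<lambda>x. \<Sum>p\<in>P. \<Sum>q\<in>P. ((Z p x)\<^sup>2 - C p p) * ((Z q x)\<^sup>2 - C q q))"
    by (simp only: power2_eq_square quad_def sum_product)
  also have "\<dots> = (\<Sum>p\<in>P. \<Sum>q\<in>P. EG (\<lambda>x. ((Z p x)\<^sup>2 - C p p) * ((Z q x)\<^sup>2 - C q q)))"
  proof -
    have t: "tame I (\<lambda>x. (Z p x)\<^sup>2 - C p p)" for p using tame_add[OF tame_power[of p 2] tame_const[of I "- C p p"]] by simp
    show ?thesis by (simp add: integrable_tame tame_mult t tame_sum)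
  qed
  finally show ?thesis by (simp add: e frob_def sum_distrib_left)
qed

lemma integral_quartic_square:
  "EG (\<lambda>x. (\<Sum>p\<in>P. Z p x ^ 4 - 3 * (C p p)\<^sup>2)\<^sup>2) =
     (\<Sum>p\<in>P. \<Sum>q\<in>P. 72 * C p p * C q q * (C p q)\<^sup>2 + 24 * C p q ^ 4)"
proof -
  have e: "EG (\<lambda>x. (Z p x ^ 4 - 3 * (C p p)\<^sup>2) * (Z q x ^ 4 - 3 * (C q q)\<^sup>2)) = 72 * C p p * C q q * (C p q)\<^sup>2 + 24 * C p q ^ 4" for p q
  proof -
    have "EG (\<lambda>x. (Z p x ^ 4 - 3 * (C p p)\<^sup>2) * (Z q x ^ 4 - 3 * (C q q)\<^sup>2)) =
       EG (\<lambda>x. Z p x ^ 4 * Z q x ^ 4 + ((- 3 * (C q q)\<^sup>2) * Z p x ^ 4 + ((- 3 * (C p p)\<^sup>2) * Z q x ^ 4 + 9 * (C p p)\<^sup>2 * (C q q)\<^sup>2)))"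
      by (simp add: algebra_simps)
    also have "\<dots> = EG (\<lambda>x. Z p x ^ 4 * Z q x ^ 4) + ((- 3 * (C q q)\<^sup>2) * EG (\<lambda>x. Z p x ^ 4) + ((- 3 * (C p p)\<^sup>2) * EG (\<lambda>x. Z q x ^ 4) + 9 * (C p p)\<^sup>2 * (C q q)\<^sup>2))"
      by (simp add: integrable_tame tame_mult tame_power tame_const tame_add)
    finally show ?thesis by (simp add: moment44 moment4_single)
  qed
  have "EG (\<lambda>x. (\<Sum>p\<in>P. Z p x ^ 4 - 3 * (C p p)\<^sup>2)\<^sup>2) = EG (\<lambda>x. \<Sum>p\<in>P. \<Sum>q\<in>P. (Z p x ^ 4 - 3 * (C p p)\<^sup>2) * (Z q x ^ 4 - 3 * (C q q)\<^sup>2))"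
    by (simp only: power2_eq_square[of "sum _ _"] sum_product)
  also have "\<dots> = (\<Sum>p\<in>P. \<Sum>q\<in>P. EG (\<lambda>x. (Z p x ^ 4 - 3 * (C p p)\<^sup>2) * (Z q x ^ 4 - 3 * (C q q)\<^sup>2)))"
  proof -
    have t: "tame I (\<lambda>x. Z p x ^ 4 - 3 * (C p p)\<^sup>2)" for p
      using tame_add[OF tame_power[of p 4] tame_const[of I "- (3 * (C p p)\<^sup>2)"]] by simp
    show ?thesis by (simp add: integrable_tame tame_mult t tame_sum)
  qed
  finally show ?thesis by (simp add: e)
qed

text \<open>Let phi be the characteristic function and S the sum of C p q Z p Z q. Integration by
  parts turns the derivative of phi into -2 t E[S exp (i t Q)]. Replacing S by its mean
  \<open>frob P\<close> gives the equation of a Gaussian characteristic function; the price is the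
  standard deviation sqrt (2 \<open>frob2 P\<close>) of S, and \<open>char_gronwall\<close>
  integrates the error.\<close>

lemma char_quad_bound:
  "norm (EG (\<lambda>x. iexp (t * quad P x)) - of_real (exp (- t\<^sup>2 * frob P))) \<le> 2 * t\<^sup>2 * sqrt (2 * frob2 P)"
proof (rule char_gronwall)
  interpret G: prob_space "gauss_space I" by (rule prob_space_gauss)
  let ?e = "\<lambda>t x. iexp (t * quad P x)"
  let ?S = "\<lambda>x. \<Sum>p\<in>P. \<Sum>q\<in>P. C p q * (Z p x * Z q x)"
  let ?Ze = "\<lambda>t p q x. of_real (C p q) * (of_real (Z p x * Z q x) * ?e t x)"
  have mQ: "quad P \<in> borel_measurable (gauss_space I)" using tame_quad[of P] by (simp add: tame_def measurable_gauss_space)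
  have i2: "integrable (gauss_space I) (\<lambda>x. (quad P x)\<^sup>2)"
    unfolding power2_eq_square by (intro integrable_tame tame_mult tame_quad)
  show "((\<lambda>t. EG (?e t)) has_vector_derivative EG (\<lambda>x. \<i> * of_real (quad P x) * ?e t x)) (at t)" for t
    by (rule G.char_has_vector_derivative[OF mQ i2])
  show "EG (?e 0) = 1" by (simp add: G.prob_space)
  show "0 \<le> frob P" unfolding frob_def by (intro sum_nonneg) auto
  fix t
  note de = dirderiv_iexp[OF dirderiv_quad, of t P]
  have te: "tame I (?e t)" by (rule dirderiv_tame(1)[OF de])
  have tS: "tame I ?S" by (intro tame_sum tame_mult tame_const tame_Z)
  \<comment> \<open>Only one of the two factors \<open>Z p\<close> is integrated by parts. The
    derivative of the other one produces C p p, which cancels the centring in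
    \<open>quad\<close>.\<close>
  have one: "EG (\<lambda>x. of_real (Z p x) * (of_real (Z p x) * ?e t x)) =
      of_real (C p p) * EG (?e t) + 2 * \<i> * of_real t * (\<Sum>q\<in>P. of_real (C p q) * EG (\<lambda>x. of_real (Z p x * Z q x) * ?e t x))" for p
  proof -
    have "EG (\<lambda>x. of_real (Z p x) * (of_real (Z p x) * ?e t x)) =
      EG (\<lambda>x. of_real (C p p) * ?e t x + of_real (Z p x) * (\<i> * of_real t * of_real (\<Sum>q\<in>P. 2 * C p q * Z q x) * ?e t x))"
      by (rule ibp[OF dirderiv_mult[OF dirderiv_Z de]])
    also have "\<dots> = EG (\<lambda>x. of_real (C p p) * ?e t x + 2 * \<i> * of_real t * (\<Sum>q\<in>P. ?Ze t p q x))"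
      by (simp add: sum_distrib_left sum_distrib_right mult_ac)
    also have "\<dots> = of_real (C p p) * EG (?e t) + 2 * \<i> * of_real t * (\<Sum>q\<in>P. of_real (C p q) * EG (\<lambda>x. of_real (Z p x * Z q x) * ?e t x))"
    proof -
      have t1: "tame I (\<lambda>x. ?Ze t p q x)" for q by (intro tame_mult tame_const te tame_of_real tame_Z)
      have "EG (\<lambda>x. of_real (C p p) * ?e t x + 2 * \<i> * of_real t * (\<Sum>q\<in>P. ?Ze t p q x))
        = EG (\<lambda>x. of_real (C p p) * ?e t x) + EG (\<lambda>x. 2 * \<i> * of_real t * (\<Sum>q\<in>P. ?Ze t p q x))"
        by (intro Bochner_Integration.integral_add integrable_tame tame_mult tame_const te tame_sum tame_of_real tame_Z)
      also have "EG (\<lambda>x. 2 * \<i> * of_real t * (\<Sum>q\<in>P. ?Ze t p q x))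
         = 2 * \<i> * of_real t * EG (\<lambda>x. \<Sum>q\<in>P. ?Ze t p q x)" by (rule integral_mult_right_zero)
      also have "EG (\<lambda>x. \<Sum>q\<in>P. ?Ze t p q x) = (\<Sum>q\<in>P. EG (\<lambda>x. ?Ze t p q x))"
        by (intro Bochner_Integration.integral_sum integrable_tame t1)
      finally show ?thesis by (simp only: integral_mult_right_zero)
    qed
    finally show ?thesis .
  qed
  have "EG (\<lambda>x. \<i> * of_real (quad P x) * ?e t x) = \<i> * EG (\<lambda>x. of_real (quad P x) * ?e t x)"
    by (simp only: mult.assoc integral_mult_right_zero)
  also have "EG (\<lambda>x. of_real (quad P x) * ?e t x) =
      EG (\<lambda>x. \<Sum>p\<in>P. (of_real (Z p x) * (of_real (Z p x) * ?e t x) - of_real (C p p) * ?e t x))"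
    by (simp add: quad_def sum_distrib_right power2_eq_square algebra_simps)
  also have "\<dots> = (\<Sum>p\<in>P. EG (\<lambda>x. of_real (Z p x) * (of_real (Z p x) * ?e t x)) - of_real (C p p) * EG (?e t))"
  proof -
    have t1: "integrable (gauss_space I) (\<lambda>x. of_real (Z p x) * (of_real (Z p x) * ?e t x))" for p
      by (intro integrable_tame tame_mult tame_const te tame_of_real tame_Z)
    have t2: "integrable (gauss_space I) (\<lambda>x. of_real (C p p) * ?e t x)" for p by (intro integrable_tame tame_mult tame_const te)
    show ?thesis by (subst Bochner_Integration.integral_sum, intro Bochner_Integration.integrable_diff t1 t2)
         (simp only: Bochner_Integration.integral_diff[OF t1 t2] integral_mult_right_zero)
  qed
  also have "\<dots> = 2 * \<i> * of_real t * (\<Sum>p\<in>P. \<Sum>q\<in>P. of_real (C p q) * EG (\<lambda>x. of_real (Z p x * Z q x) * ?e t x))"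
    by (simp only: one add_diff_cancel_left' sum_distrib_left)
  also have "(\<Sum>p\<in>P. \<Sum>q\<in>P. of_real (C p q) * EG (\<lambda>x. of_real (Z p x * Z q x) * ?e t x)) = EG (\<lambda>x. of_real (?S x) * ?e t x)"
  proof -
    have t1: "tame I (\<lambda>x. ?Ze t p q x)" for p q by (intro tame_mult tame_const te tame_of_real tame_Z)
    have "EG (\<lambda>x. of_real (?S x) * ?e t x) = EG (\<lambda>x. \<Sum>p\<in>P. \<Sum>q\<in>P. ?Ze t p q x)"
      by (simp only: of_real_sum of_real_mult sum_distrib_right mult.assoc)
    also have "\<dots> = (\<Sum>p\<in>P. EG (\<lambda>x. \<Sum>q\<in>P. ?Ze t p q x))"
      by (intro Bochner_Integration.integral_sum integrable_tame t1 tame_sum)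
    also have "\<dots> = (\<Sum>p\<in>P. \<Sum>q\<in>P. EG (\<lambda>x. ?Ze t p q x))"
      by (intro sum.cong refl Bochner_Integration.integral_sum integrable_tame t1)
    finally show ?thesis by (simp only: integral_mult_right_zero)
  qed
  also have "\<i> * (2 * \<i> * of_real t * z) = - of_real (2 * t) * z" for z by (simp add: algebra_simps)
  finally have d: "EG (\<lambda>x. \<i> * of_real (quad P x) * ?e t x) = - of_real (2 * t) * EG (\<lambda>x. of_real (?S x) * ?e t x)" .
  have te': "integrable (gauss_space I) (\<lambda>x. of_real (?S x) * ?e t x)" "integrable (gauss_space I) (\<lambda>x. of_real (frob P) * ?e t x)"
    by (intro integrable_tame tame_mult tame_const te tame_of_real tS)+
  have "EG (\<lambda>x. \<i> * of_real (quad P x) * ?e t x) + of_real (2 * t * frob P) * EG (?e t)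
      = - of_real (2 * t) * (EG (\<lambda>x. of_real (?S x) * ?e t x) - EG (\<lambda>x. of_real (frob P) * ?e t x))"
  proof -
    have "- of_real (2 * t) * z + of_real (2 * t * T) * w = - of_real (2 * t) * (z - of_real T * w)" for z w :: complex and T
      by (simp add: algebra_simps)
    then show ?thesis by (simp only: d integral_mult_right_zero)
  qed
  also have "\<dots> = - of_real (2 * t) * EG (\<lambda>x. of_real (?S x - frob P) * ?e t x)"
    unfolding Bochner_Integration.integral_diff[OF te', symmetric] by (simp only: of_real_diff left_diff_distrib)
  finally have "norm (EG (\<lambda>x. \<i> * of_real (quad P x) * ?e t x) + of_real (2 * t * frob P) * EG (?e t))
      = 2 * \<bar>t\<bar> * norm (EG (\<lambda>x. of_real (?S x - frob P) * ?e t x))"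
    by (simp only: norm_mult norm_minus_cancel norm_of_real abs_mult abs_numeral)
  also have "\<dots> \<le> 2 * \<bar>t\<bar> * sqrt (2 * frob2 P)"
  proof (rule mult_left_mono)
    have tSf: "tame I (\<lambda>x. ?S x - frob P)" using tame_add[OF tS tame_const[of I "- frob P"]] by simp
    have "norm (EG (\<lambda>x. of_real (?S x - frob P) * ?e t x)) \<le> EG (\<lambda>x. norm (of_real (?S x - frob P) * ?e t x))"
      by (rule integral_norm_bound)
    also have "\<dots> = EG (\<lambda>x. \<bar>?S x - frob P\<bar>)" by (simp only: norm_mult norm_of_real norm_exp_i_times mult_1_right)
    also have "\<dots> \<le> sqrt (EG (\<lambda>x. (?S x - frob P)\<^sup>2))"
    proof (rule G.expectation_abs_le_sqrt)
      show "(\<lambda>x. ?S x - frob P) \<in> borel_measurable (gauss_space I)" using tSf by (simp add: tame_def measurable_gauss_space)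
      show "integrable (gauss_space I) (\<lambda>x. (?S x - frob P)\<^sup>2)"
        unfolding power2_eq_square by (intro integrable_tame tame_mult tSf)
    qed
    finally show "norm (EG (\<lambda>x. of_real (?S x - frob P) * ?e t x)) \<le> sqrt (2 * frob2 P)"
      by (simp only: integral_bilinear_square)
  qed simp
  finally show "norm (EG (\<lambda>x. \<i> * of_real (quad P x) * ?e t x) + of_real (2 * t * frob P) * EG (?e t)) \<le> 2 * \<bar>t\<bar> * sqrt (2 * frob2 P)" .
qed

end

section \<open>Passage from the Gaussian product space to an arbitrary probability space\<close>

definition std_gaussian_family :: "'w measure \<Rightarrow> 'i set \<Rightarrow> ('i \<Rightarrow> 'w \<Rightarrow> real) \<Rightarrow> bool" where
  "std_gaussian_family M I g \<longleftrightarrow> finite I \<and> prob_space.indep_vars M (\<lambda>_. borel) g I \<and>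
     (\<forall>l\<in>I. distributed M lborel (g l) (\<lambda>x. ennreal (std_normal_density x)))"

text \<open>The last clause of \<open>gaussian_form\<close> is all that is needed of the independence of the
  Gaussian family and \<open>A\<close>.\<close>

definition gaussian_form :: "'w measure \<Rightarrow> 'p set \<Rightarrow> ('p \<Rightarrow> 'w \<Rightarrow> real) \<Rightarrow> ('p \<Rightarrow> 'w \<Rightarrow> real) \<Rightarrow> bool" where
  "gaussian_form M P A U \<longleftrightarrow> (\<exists>(I :: (nat \<times> nat) set) g a. std_gaussian_family M I g \<and>
     (\<forall>p\<in>P. \<forall>w\<in>space M. U p w = (\<Sum>l\<in>I. a p l * g l w)) \<and>
     (\<forall>l\<in>I. \<forall>l'\<in>I. \<forall>p\<in>P. \<forall>q\<in>P. has_bochner_integral M (\<lambda>w. (g l w * g l' w) * (A p w * A q w))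
        (if l = l' then \<integral>w. A p w * A q w \<partial>M else 0)))"

context prob_space
begin

lemma std_gaussian_family_transfer:
  fixes I :: "'i set" and f :: "('i \<Rightarrow> real) \<Rightarrow> 'b::{banach,second_countable_topology}"
  assumes g: "std_gaussian_family M I g" and f[measurable]: "f \<in> borel_measurable (PiM I (\<lambda>_. borel))"
  shows "(\<integral>w. f (\<lambda>l\<in>I. g l w) \<partial>M) = (\<integral>x. f x \<partial>gauss_space I)"
    "integrable M (\<lambda>w. f (\<lambda>l\<in>I. g l w)) \<longleftrightarrow> integrable (gauss_space I) f"
proof -
  have rv: "g l \<in> borel_measurable M" and d: "distr M borel (g l) = std_normal_distribution" if "l \<in> I" for l
  proof -
    have *: "distributed M lborel (g l) (\<lambda>x. ennreal (std_normal_density x))" using g that by (auto simp: std_gaussian_family_def)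
    show "g l \<in> borel_measurable M" using distributed_measurable[OF *] by simp
    show "distr M borel (g l) = std_normal_distribution" using distributed_distr_eq_density[OF *] by (simp cong: distr_cong)
  qed
  have eq: "distr M (PiM I (\<lambda>_. borel)) (\<lambda>w. \<lambda>l\<in>I. g l w) = gauss_space I"
  proof (cases "I = {}")
    \<comment> \<open>The characterisation of independence by a product law needs a nonempty index
      set. For the empty one both measures are the point mass at the undefined function.\<close>
    case True
    show ?thesis unfolding True
    proof (rule measure_eqI)
      fix A :: "('i \<Rightarrow> real) set" assume "A \<in> sets (distr M (PiM {} (\<lambda>_. borel)) (\<lambda>w. \<lambda>l\<in>{}. g l w))"
      then have "A = {} \<or> A = {\<lambda>_. undefined}" by (auto simp: sets_PiM_empty)
      then show "emeasure (distr M (PiM {} (\<lambda>_. borel)) (\<lambda>w. \<lambda>l\<in>{}. g l w)) A = emeasure (gauss_space {}) A"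
        by (auto simp: emeasure_distr PiM_empty emeasure_space_1 restrict_def vimage_def)
    qed (simp add: sets_PiM_empty)
  next
    case False
    have "distr M (PiM I (\<lambda>_. borel)) (\<lambda>w. \<lambda>l\<in>I. g l w) = PiM I (\<lambda>l. distr M borel (g l))"
      using g indep_vars_iff_distr_eq_PiM'[OF False rv] by (simp add: std_gaussian_family_def)
    also have "\<dots> = gauss_space I" by (rule PiM_cong) (auto simp: d)
    finally show ?thesis .
  qed
  have m: "(\<lambda>w. \<lambda>l\<in>I. g l w) \<in> M \<rightarrow>\<^sub>M PiM I (\<lambda>_. borel)"
    by (rule measurable_restrict) (rule rv)
  show "(\<integral>w. f (\<lambda>l\<in>I. g l w) \<partial>M) = (\<integral>x. f x \<partial>gauss_space I)"
    unfolding eq[symmetric] by (rule integral_distr[symmetric, OF m f])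
  show "integrable M (\<lambda>w. f (\<lambda>l\<in>I. g l w)) \<longleftrightarrow> integrable (gauss_space I) f"
    unfolding eq[symmetric] by (rule integrable_distr_eq[symmetric, OF m f])
qed

text \<open>The claims on U alone are transported from the Gaussian product space. In the last one
  the square is expanded over pairs of Gaussians; the orthogonality clause of
  \<open>gaussian_form\<close> keeps the pairs l = l', which reassemble to the covariance of
  U.\<close>

lemma gaussian_form_bounds:
  fixes U A :: "'p \<Rightarrow> 'a \<Rightarrow> real"
  assumes gf: "gaussian_form M P A U" and finP: "finite P"
    and A2: "\<And>p q. p \<in> P \<Longrightarrow> q \<in> P \<Longrightarrow> integrable M (\<lambda>w. A p w * A q w)"
  defines "cov \<equiv> \<lambda>p q. \<integral>w. U p w * U q w \<partial>M"
  shows "\<And>p. p \<in> P \<Longrightarrow> U p \<in> borel_measurable M"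
    and "norm ((\<integral>w. iexp (t * (\<Sum>p\<in>P. (U p w)\<^sup>2 - cov p p)) \<partial>M) - of_real (exp (- t\<^sup>2 * (\<Sum>p\<in>P. \<Sum>q\<in>P. (cov p q)\<^sup>2))))
        \<le> 2 * t\<^sup>2 * sqrt (2 * (\<Sum>p\<in>P. \<Sum>q\<in>P. (\<Sum>r\<in>P. cov p r * cov r q)\<^sup>2))"
    and "has_bochner_integral M (\<lambda>w. (\<Sum>p\<in>P. (U p w)\<^sup>2 - cov p p)\<^sup>2) (2 * (\<Sum>p\<in>P. \<Sum>q\<in>P. (cov p q)\<^sup>2))"
    and "has_bochner_integral M (\<lambda>w. (\<Sum>p\<in>P. U p w ^ 4 - 3 * (cov p p)\<^sup>2)\<^sup>2)
        (\<Sum>p\<in>P. \<Sum>q\<in>P. 72 * cov p p * cov q q * (cov p q)\<^sup>2 + 24 * cov p q ^ 4)"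
    and "has_bochner_integral M (\<lambda>w. (\<Sum>p\<in>P. U p w * A p w)\<^sup>2)
        (\<Sum>p\<in>P. \<Sum>q\<in>P. cov p q * (\<integral>w. A p w * A q w \<partial>M))"
proof -
  obtain I :: "(nat \<times> nat) set" and g a where g: "std_gaussian_family M I g"
    and U: "\<And>p w. p \<in> P \<Longrightarrow> w \<in> space M \<Longrightarrow> U p w = (\<Sum>l\<in>I. a p l * g l w)"
    and A: "\<And>l l' p q. l \<in> I \<Longrightarrow> l' \<in> I \<Longrightarrow> p \<in> P \<Longrightarrow> q \<in> P \<Longrightarrow>
      has_bochner_integral M (\<lambda>w. (g l w * g l' w) * (A p w * A q w)) (if l = l' then \<integral>w. A p w * A q w \<partial>M else 0)"
    using gf unfolding gaussian_form_def by blast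
  interpret gauss_forms I a by unfold_locales (use g in \<open>simp add: std_gaussian_family_def\<close>)
  define G where "G w = (\<lambda>l\<in>I. g l w)" for w
  have rv: "g l \<in> borel_measurable M" if "l \<in> I" for l
    using g that distributed_measurable[of M lborel "g l"] by (auto simp: std_gaussian_family_def)
  have UZ: "U p w = gauss_forms.Z I a p (G w)" if "p \<in> P" "w \<in> space M" for p w using U[OF that] by (simp add: Z_def G_def)
  have "(\<lambda>w. \<Sum>l\<in>I. a p l * g l w) \<in> borel_measurable M" for p
    using rv by (intro borel_measurable_sum borel_measurable_times) auto
  then show mU: "U p \<in> borel_measurable M" if "p \<in> P" for p
    using U[OF that] measurable_cong[of M "U p" "\<lambda>w. \<Sum>l\<in>I. a p l * g l w"] by blast
  note tr = std_gaussian_family_transfer[OF g, folded G_def]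
  have bm: "tame I f \<Longrightarrow> f \<in> borel_measurable (PiM I (\<lambda>_. borel))" for f :: "_ \<Rightarrow> real" by (simp add: tame_def)
  have trI: "has_bochner_integral M h (EG f)" if "tame I f" "\<And>w. w \<in> space M \<Longrightarrow> h w = f (G w)" for f h :: "_ \<Rightarrow> real"
  proof -
    have "has_bochner_integral M (\<lambda>w. f (G w)) (EG f)"
      using tr[OF bm[OF that(1)]] integrable_tame[OF that(1)] by (simp add: has_bochner_integral_iff)
    then show ?thesis by (subst has_bochner_integral_cong[of M M h "\<lambda>w. f (G w)"]) (use that(2) in auto)
  qed
  have CC: "cov p q = gauss_forms.C I a p q" if "p \<in> P" "q \<in> P" for p q
  proof -
    have "has_bochner_integral M (\<lambda>w. U p w * U q w) (EG (\<lambda>x. Z p x * Z q x))"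
      by (rule trI[OF tame_mult[OF tame_Z tame_Z]]) (use that in \<open>simp add: UZ\<close>)
    then show ?thesis by (simp add: cov_def has_bochner_integral_iff moment2)
  qed
  have qU: "(\<Sum>p\<in>P. (U p w)\<^sup>2 - cov p p) = quad P (G w)" if "w \<in> space M" for w
    unfolding quad_def by (intro sum.cong refl) (simp add: CC UZ that)
  have fr: "(\<Sum>p\<in>P. \<Sum>q\<in>P. (cov p q)\<^sup>2) = frob P" unfolding frob_def by (intro sum.cong refl) (simp add: CC)
  have fr2: "(\<Sum>p\<in>P. \<Sum>q\<in>P. (\<Sum>r\<in>P. cov p r * cov r q)\<^sup>2) = frob2 P"
    unfolding frob2_def by (intro sum.cong refl arg_cong[where f = "\<lambda>x. x\<^sup>2"]) (simp add: CC)
  have "(\<integral>w. iexp (t * (\<Sum>p\<in>P. (U p w)\<^sup>2 - cov p p)) \<partial>M) = (\<integral>w. iexp (t * quad P (G w)) \<partial>M)"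
    by (intro Bochner_Integration.integral_cong refl) (simp only: qU)
  also have "\<dots> = EG (\<lambda>x. iexp (t * quad P x))"
  proof (rule tr(1))
    have [measurable]: "quad P \<in> borel_measurable (PiM I (\<lambda>_. borel))" by (rule bm[OF tame_quad])
    show "(\<lambda>x. iexp (t * quad P x)) \<in> borel_measurable (PiM I (\<lambda>_. borel))" by measurable
  qed
  finally show "norm ((\<integral>w. iexp (t * (\<Sum>p\<in>P. (U p w)\<^sup>2 - cov p p)) \<partial>M) - of_real (exp (- t\<^sup>2 * (\<Sum>p\<in>P. \<Sum>q\<in>P. (cov p q)\<^sup>2))))
        \<le> 2 * t\<^sup>2 * sqrt (2 * (\<Sum>p\<in>P. \<Sum>q\<in>P. (\<Sum>r\<in>P. cov p r * cov r q)\<^sup>2))"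
    unfolding fr fr2 using char_quad_bound[of t P] by simp
  show "has_bochner_integral M (\<lambda>w. (\<Sum>p\<in>P. (U p w)\<^sup>2 - cov p p)\<^sup>2) (2 * (\<Sum>p\<in>P. \<Sum>q\<in>P. (cov p q)\<^sup>2))"
    unfolding fr integral_quad_square[symmetric] by (rule trI) (simp add: power2_eq_square tame_mult tame_quad, simp add: qU)
  have t4: "tame I (\<lambda>x. Z p x ^ 4 - 3 * (gauss_forms.C I a p p)\<^sup>2)" for p
    using tame_add[OF tame_power[of p 4] tame_const[of I "- (3 * (gauss_forms.C I a p p)\<^sup>2)"]] by simp
  have "has_bochner_integral M (\<lambda>w. (\<Sum>p\<in>P. U p w ^ 4 - 3 * (cov p p)\<^sup>2)\<^sup>2) (EG (\<lambda>x. (\<Sum>p\<in>P. Z p x ^ 4 - 3 * (gauss_forms.C I a p p)\<^sup>2)\<^sup>2))"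
  proof (rule trI)
    show "tame I (\<lambda>x. (\<Sum>p\<in>P. Z p x ^ 4 - 3 * (gauss_forms.C I a p p)\<^sup>2)\<^sup>2)"
      unfolding power2_eq_square[of "sum _ _"] by (intro tame_mult tame_sum t4)
    show "(\<Sum>p\<in>P. U p w ^ 4 - 3 * (cov p p)\<^sup>2)\<^sup>2 = (\<Sum>p\<in>P. Z p (G w) ^ 4 - 3 * (gauss_forms.C I a p p)\<^sup>2)\<^sup>2" if "w \<in> space M" for w
      using that by (intro arg_cong[where f = "\<lambda>x. x\<^sup>2"] sum.cong refl) (simp add: CC UZ)
  qed
  then show "has_bochner_integral M (\<lambda>w. (\<Sum>p\<in>P. U p w ^ 4 - 3 * (cov p p)\<^sup>2)\<^sup>2)
        (\<Sum>p\<in>P. \<Sum>q\<in>P. 72 * cov p p * cov q q * (cov p q)\<^sup>2 + 24 * cov p q ^ 4)"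
    by (simp only: integral_quartic_square CC cong: sum.cong)
  have "has_bochner_integral M (\<lambda>w. \<Sum>p\<in>P. \<Sum>q\<in>P. \<Sum>l\<in>I. \<Sum>l'\<in>I. a p l * a q l' * ((g l w * g l' w) * (A p w * A q w)))
      (\<Sum>p\<in>P. \<Sum>q\<in>P. \<Sum>l\<in>I. \<Sum>l'\<in>I. a p l * a q l' * (if l = l' then \<integral>w. A p w * A q w \<partial>M else 0))"
    by (intro has_bochner_integral_sum has_bochner_integral_mult_right A) auto
  also have "(\<Sum>p\<in>P. \<Sum>q\<in>P. \<Sum>l\<in>I. \<Sum>l'\<in>I. a p l * a q l' * (if l = l' then \<integral>w. A p w * A q w \<partial>M else 0))
      = (\<Sum>p\<in>P. \<Sum>q\<in>P. cov p q * (\<integral>w. A p w * A q w \<partial>M))"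
    using fin by (intro sum.cong refl) (simp add: CC C_def if_distrib sum_distrib_right sum.delta cong: if_cong)
  finally show "has_bochner_integral M (\<lambda>w. (\<Sum>p\<in>P. U p w * A p w)\<^sup>2)
        (\<Sum>p\<in>P. \<Sum>q\<in>P. cov p q * (\<integral>w. A p w * A q w \<partial>M))"
  proof (rule has_bochner_integral_cong[THEN iffD1, rotated -1])
    fix w assume sp: "w \<in> space M"
    have "(\<Sum>p\<in>P. U p w * A p w)\<^sup>2 = (\<Sum>p\<in>P. \<Sum>q\<in>P. (U p w * U q w) * (A p w * A q w))"
      by (simp add: power2_eq_square sum_product mult_ac)
    also have "\<dots> = (\<Sum>p\<in>P. \<Sum>q\<in>P. (\<Sum>l\<in>I. \<Sum>l'\<in>I. (a p l * g l w) * (a q l' * g l' w)) * (A p w * A q w))"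
      by (intro sum.cong refl) (simp add: U sp sum_product)
    finally show "(\<Sum>p\<in>P. \<Sum>q\<in>P. \<Sum>l\<in>I. \<Sum>l'\<in>I. a p l * a q l' * ((g l w * g l' w) * (A p w * A q w))) = (\<Sum>p\<in>P. U p w * A p w)\<^sup>2"
      by (simp only: sum_distrib_right sum_distrib_left mult_ac)
  qed auto
qed

end

section \<open>Error bounds for a Gaussian vector with a perturbation\<close>

lemma norm_iexp_diff_le: "cmod (iexp x - iexp y) \<le> \<bar>x - y\<bar>"
proof -
  have "iexp x - iexp y = iexp y * (iexp (x - y) - 1)" by (simp add: algebra_simps flip: exp_add)
  then have "cmod (iexp x - iexp y) = cmod (iexp (x - y) - 1)" by (simp add: norm_mult)
  also have "\<dots> \<le> \<bar>x - y\<bar>" using iexp_approx1[of "x - y" 0] by simp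
  finally show ?thesis .
qed

text \<open>If |a| <= eps |u|, then (1 + eps)^4 <= 1 + 15 eps, where 15 = 4 + 6 + 4 + 1. Otherwise
  |u| <= |a| / eps and everything is bounded by a^4.\<close>

lemma pow4_perturbation:
  fixes u a \<epsilon> :: real
  assumes "0 < \<epsilon>" "\<epsilon> \<le> 1"
  shows "\<bar>(u + a) ^ 4 - u ^ 4\<bar> \<le> 15 * \<epsilon> * u ^ 4 + (1 + 1 / \<epsilon>) ^ 4 * a ^ 4"
proof -
  have tri: "\<bar>(u + a) ^ 4 - u ^ 4\<bar> \<le> (\<bar>u\<bar> + \<bar>a\<bar>) ^ 4 - \<bar>u\<bar> ^ 4"
  proof -
    have e: "(v + w) ^ 4 - v ^ 4 = 4 * (v ^ 3 * w) + 6 * (v\<^sup>2 * w\<^sup>2) + 4 * (v * w ^ 3) + w ^ 4" for v w :: real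
      by (simp add: algebra_simps eval_nat_numeral)
    have "(u + a) ^ 4 - u ^ 4 = 4 * (u ^ 3 * a) + 6 * (u\<^sup>2 * a\<^sup>2) + 4 * (u * a ^ 3) + a ^ 4" by (rule e)
    also have "\<bar>\<dots>\<bar> \<le> 4 * (\<bar>u\<bar> ^ 3 * \<bar>a\<bar>) + 6 * (\<bar>u\<bar>\<^sup>2 * \<bar>a\<bar>\<^sup>2) + 4 * (\<bar>u\<bar> * \<bar>a\<bar> ^ 3) + \<bar>a\<bar> ^ 4"
      by (rule order_trans[OF abs_triangle_ineq] add_mono)+ (auto simp: abs_mult power_abs)
    also have "\<dots> = (\<bar>u\<bar> + \<bar>a\<bar>) ^ 4 - \<bar>u\<bar> ^ 4" by (rule e[symmetric])
    finally show ?thesis .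
  qed
  show ?thesis
  proof (cases "\<bar>a\<bar> \<le> \<epsilon> * \<bar>u\<bar>")
    case True
    have "(\<bar>u\<bar> + \<bar>a\<bar>) ^ 4 \<le> ((1 + \<epsilon>) * \<bar>u\<bar>) ^ 4"
      using True by (intro power_mono) (auto simp: algebra_simps)
    also have "\<dots> = (1 + \<epsilon>) ^ 4 * u ^ 4" by (simp add: power_mult_distrib)
    also have "(1 + \<epsilon>) ^ 4 = 1 + 4 * \<epsilon> + 6 * \<epsilon> ^ 2 + 4 * \<epsilon> ^ 3 + \<epsilon> ^ 4"
      by (simp add: algebra_simps eval_nat_numeral)
    also have "\<dots> \<le> 1 + 4 * \<epsilon> + 6 * \<epsilon> + 4 * \<epsilon> + \<epsilon>"
      using assms power_decreasing[of 1 2 \<epsilon>] power_decreasing[of 1 3 \<epsilon>] power_decreasing[of 1 4 \<epsilon>] by auto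
    finally have "(\<bar>u\<bar> + \<bar>a\<bar>) ^ 4 \<le> (1 + 15 * \<epsilon>) * u ^ 4" by (simp add: mult_right_mono add.commute)
    moreover have "0 \<le> (1 + 1 / \<epsilon>) ^ 4 * a ^ 4" using assms by (intro mult_nonneg_nonneg) auto
    moreover have "(1 + 15 * \<epsilon>) * u ^ 4 = u ^ 4 + 15 * \<epsilon> * u ^ 4" "\<bar>u\<bar> ^ 4 = u ^ 4" by (auto simp: algebra_simps)
    ultimately show ?thesis using tri by linarith
  next
    case False
    then have "\<bar>u\<bar> \<le> \<bar>a\<bar> / \<epsilon>" using assms by (simp add: field_simps)
    then have "\<bar>u\<bar> + \<bar>a\<bar> \<le> (1 + 1 / \<epsilon>) * \<bar>a\<bar>" by (simp add: algebra_simps)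
    then have "(\<bar>u\<bar> + \<bar>a\<bar>) ^ 4 \<le> ((1 + 1 / \<epsilon>) * \<bar>a\<bar>) ^ 4" by (intro power_mono) auto
    also have "\<dots> = (1 + 1 / \<epsilon>) ^ 4 * a ^ 4" by (simp add: power_mult_distrib)
    finally have "(\<bar>u\<bar> + \<bar>a\<bar>) ^ 4 \<le> (1 + 1 / \<epsilon>) ^ 4 * a ^ 4" .
    moreover have "0 \<le> 15 * \<epsilon> * u ^ 4" "0 \<le> \<bar>u\<bar> ^ 4" using assms by auto
    ultimately show ?thesis using tri by linarith
  qed
qed

text \<open>Fatou's lemma with bounds that move along the sequence.\<close>

lemma nn_integral_le_of_AE_tendsto:
  fixes h :: "nat \<Rightarrow> 'a \<Rightarrow> ennreal"
  assumes [measurable]: "\<And>n. h n \<in> borel_measurable M"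
    and lim: "AE x in M. (\<lambda>n. h n x) \<longlonglongrightarrow> h' x"
    and le: "\<And>n. (\<integral>\<^sup>+x. h n x \<partial>M) \<le> ennreal (b n)" and b: "b \<longlonglongrightarrow> b'"
  shows "(\<integral>\<^sup>+x. h' x \<partial>M) \<le> ennreal b'"
proof -
  have "(\<integral>\<^sup>+x. h' x \<partial>M) = (\<integral>\<^sup>+x. liminf (\<lambda>n. h n x) \<partial>M)"
    by (rule nn_integral_cong_AE) (use lim in \<open>eventually_elim, simp add: lim_imp_Liminf\<close>)
  also have "\<dots> \<le> liminf (\<lambda>n. \<integral>\<^sup>+x. h n x \<partial>M)" by (rule nn_integral_liminf) simp
  also have "\<dots> \<le> liminf (\<lambda>n. ennreal (b n))" by (rule Liminf_mono) (simp add: le)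
  also have "\<dots> = ennreal b'" by (rule lim_imp_Liminf) (use tendsto_ennrealI[OF b] in auto)
  finally show ?thesis .
qed

text \<open>These estimates survive almost sure limits of \<open>V\<close>, which removes step functions and
  truncated series. The square root in the last one makes the initial value enter through its
  second moments only.\<close>

definition clt_bounds ::
  "'w measure \<Rightarrow> 'p set \<Rightarrow> ('p \<Rightarrow> 'w \<Rightarrow> real) \<Rightarrow> real \<Rightarrow> real \<Rightarrow> real \<Rightarrow> real \<Rightarrow> real \<Rightarrow> real \<Rightarrow> bool" where
  "clt_bounds M P V F e L E b a \<longleftrightarrow>
     (\<forall>t. norm ((\<integral>w. iexp (t * (\<Sum>p\<in>P. (V p w)\<^sup>2 - 1)) \<partial>M) - of_real (exp (- t\<^sup>2 * F)))
        \<le> 2 * t\<^sup>2 * sqrt (2 * e) + \<bar>t\<bar> * L) \<and>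
     (\<integral>\<^sup>+w. ennreal \<bar>\<Sum>p\<in>P. (V p w)\<^sup>2 - 1\<bar> \<partial>M) \<le> ennreal (sqrt (2 * F) + L) \<and>
     (\<forall>\<epsilon>. 0 < \<epsilon> \<and> \<epsilon> \<le> 1 \<longrightarrow>
        (\<integral>\<^sup>+w. ennreal (sqrt \<bar>(\<Sum>p\<in>P. V p w ^ 4) / (3 * real (card P)) - 1\<bar>) \<partial>M) \<le>
          ennreal (4 * sqrt (sqrt E / (3 * real (card P))) + 4 * sqrt b + sqrt (15 * \<epsilon>)
             + (1 + 1 / \<epsilon>)\<^sup>2 * (a / sqrt (3 * real (card P)))))"

text \<open>The characteristic functions converge by dominated convergence with bound 1, the two
  nonnegative integrals by Fatou; thus almost sure convergence of the vectors suffices.\<close>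

lemma (in prob_space) clt_bounds_tendsto:
  assumes finP: "finite P"
    and [measurable]: "\<And>n p. p \<in> P \<Longrightarrow> V n p \<in> borel_measurable M"  "\<And>p. p \<in> P \<Longrightarrow> V' p \<in> borel_measurable M"
    and lim: "\<And>p. p \<in> P \<Longrightarrow> AE w in M. (\<lambda>n. V n p w) \<longlonglongrightarrow> V' p w"
    and bd: "\<And>n. clt_bounds M P (V n) (F n) (e n) (L n) (E n) (b n) (a n)"
    and c: "F \<longlonglongrightarrow> F'" "e \<longlonglongrightarrow> e'" "L \<longlonglongrightarrow> L'" "E \<longlonglongrightarrow> E'" "b \<longlonglongrightarrow> b'" "a \<longlonglongrightarrow> a'"
  shows "clt_bounds M P V' F' e' L' E' b' a'"
  unfolding clt_bounds_def
proof (intro conjI allI impI)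
  have AEl: "AE w in M. \<forall>p\<in>P. (\<lambda>n. V n p w) \<longlonglongrightarrow> V' p w"
    using lim finP by (intro AE_finite_allI) auto
  fix t
  have 1: "(\<lambda>n. \<integral>w. iexp (t * (\<Sum>p\<in>P. (V n p w)\<^sup>2 - 1)) \<partial>M) \<longlonglongrightarrow> (\<integral>w. iexp (t * (\<Sum>p\<in>P. (V' p w)\<^sup>2 - 1)) \<partial>M)"
  proof (rule integral_dominated_convergence[where w = "\<lambda>_. 1"])
    show "AE w in M. (\<lambda>n. iexp (t * (\<Sum>p\<in>P. (V n p w)\<^sup>2 - 1))) \<longlonglongrightarrow> iexp (t * (\<Sum>p\<in>P. (V' p w)\<^sup>2 - 1))"
      using AEl by eventually_elim (auto intro!: tendsto_intros)
  qed auto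
  show "norm ((\<integral>w. iexp (t * (\<Sum>p\<in>P. (V' p w)\<^sup>2 - 1)) \<partial>M) - of_real (exp (- t\<^sup>2 * F')))
        \<le> 2 * t\<^sup>2 * sqrt (2 * e') + \<bar>t\<bar> * L'"
  proof (rule LIMSEQ_le)
    show "(\<lambda>n. norm ((\<integral>w. iexp (t * (\<Sum>p\<in>P. (V n p w)\<^sup>2 - 1)) \<partial>M) - of_real (exp (- t\<^sup>2 * F n)))) \<longlonglongrightarrow>
      norm ((\<integral>w. iexp (t * (\<Sum>p\<in>P. (V' p w)\<^sup>2 - 1)) \<partial>M) - of_real (exp (- t\<^sup>2 * F')))"
      by (intro tendsto_intros 1 c)
    show "(\<lambda>n. 2 * t\<^sup>2 * sqrt (2 * e n) + \<bar>t\<bar> * L n) \<longlonglongrightarrow> 2 * t\<^sup>2 * sqrt (2 * e') + \<bar>t\<bar> * L'"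
      by (intro tendsto_intros c)
    show "\<exists>N. \<forall>n\<ge>N. norm ((\<integral>w. iexp (t * (\<Sum>p\<in>P. (V n p w)\<^sup>2 - 1)) \<partial>M) - of_real (exp (- t\<^sup>2 * F n))) \<le> 2 * t\<^sup>2 * sqrt (2 * e n) + \<bar>t\<bar> * L n"
      using bd unfolding clt_bounds_def by blast
  qed
  show "(\<integral>\<^sup>+w. ennreal \<bar>\<Sum>p\<in>P. (V' p w)\<^sup>2 - 1\<bar> \<partial>M) \<le> ennreal (sqrt (2 * F') + L')"
  proof (rule nn_integral_le_of_AE_tendsto[where h = "\<lambda>n w. ennreal \<bar>\<Sum>p\<in>P. (V n p w)\<^sup>2 - 1\<bar>"])
    show "AE w in M. (\<lambda>n. ennreal \<bar>\<Sum>p\<in>P. (V n p w)\<^sup>2 - 1\<bar>) \<longlonglongrightarrow> ennreal \<bar>\<Sum>p\<in>P. (V' p w)\<^sup>2 - 1\<bar>"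
      using AEl by eventually_elim (auto intro!: tendsto_intros)
    show "(\<integral>\<^sup>+w. ennreal \<bar>\<Sum>p\<in>P. (V n p w)\<^sup>2 - 1\<bar> \<partial>M) \<le> ennreal (sqrt (2 * F n) + L n)" for n
      using bd unfolding clt_bounds_def by blast
    show "(\<lambda>n. sqrt (2 * F n) + L n) \<longlonglongrightarrow> sqrt (2 * F') + L'" by (intro tendsto_intros c)
  qed measurable
  fix \<epsilon> :: real assume eps: "0 < \<epsilon> \<and> \<epsilon> \<le> 1"
  let ?N = "3 * real (card P)"
  show "(\<integral>\<^sup>+w. ennreal (sqrt \<bar>(\<Sum>p\<in>P. V' p w ^ 4) / ?N - 1\<bar>) \<partial>M) \<le>
     ennreal (4 * sqrt (sqrt E' / ?N) + 4 * sqrt b' + sqrt (15 * \<epsilon>) + (1 + 1 / \<epsilon>)\<^sup>2 * (a' / sqrt ?N))"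
  proof (rule nn_integral_le_of_AE_tendsto[where h = "\<lambda>n w. ennreal (sqrt \<bar>(\<Sum>p\<in>P. V n p w ^ 4) / ?N - 1\<bar>)"])
    have "AE w in M. (\<lambda>n. sqrt \<bar>(\<Sum>p\<in>P. V n p w ^ 4) * (1 / ?N) - 1\<bar>) \<longlonglongrightarrow> sqrt \<bar>(\<Sum>p\<in>P. V' p w ^ 4) * (1 / ?N) - 1\<bar>"
      using AEl by eventually_elim (intro tendsto_intros, auto)
    then show "AE w in M. (\<lambda>n. ennreal (sqrt \<bar>(\<Sum>p\<in>P. V n p w ^ 4) / ?N - 1\<bar>)) \<longlonglongrightarrow> ennreal (sqrt \<bar>(\<Sum>p\<in>P. V' p w ^ 4) / ?N - 1\<bar>)"
      by eventually_elim (auto intro: tendsto_ennrealI)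
    show "(\<integral>\<^sup>+w. ennreal (sqrt \<bar>(\<Sum>p\<in>P. V n p w ^ 4) / ?N - 1\<bar>) \<partial>M) \<le>
     ennreal (4 * sqrt (sqrt (E n) / ?N) + 4 * sqrt (b n) + sqrt (15 * \<epsilon>) + (1 + 1 / \<epsilon>)\<^sup>2 * (a n / sqrt ?N))" for n
      using bd[of n] eps unfolding clt_bounds_def by blast
    have "(\<lambda>n. 4 * sqrt (sqrt (E n) * (1 / ?N)) + 4 * sqrt (b n) + sqrt (15 * \<epsilon>) + (1 + 1 / \<epsilon>)\<^sup>2 * (a n * (1 / sqrt ?N))) \<longlonglongrightarrow>
       4 * sqrt (sqrt E' * (1 / ?N)) + 4 * sqrt b' + sqrt (15 * \<epsilon>) + (1 + 1 / \<epsilon>)\<^sup>2 * (a' * (1 / sqrt ?N))"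
      by (intro tendsto_intros c)
    then show "(\<lambda>n. 4 * sqrt (sqrt (E n) / ?N) + 4 * sqrt (b n) + sqrt (15 * \<epsilon>) + (1 + 1 / \<epsilon>)\<^sup>2 * (a n / sqrt ?N)) \<longlonglongrightarrow>
       4 * sqrt (sqrt E' / ?N) + 4 * sqrt b' + sqrt (15 * \<epsilon>) + (1 + 1 / \<epsilon>)\<^sup>2 * (a' / sqrt ?N)" by simp
  qed measurable
qed

lemma clt_bounds_mono:
  assumes "clt_bounds M P V F e L E b a" "L \<le> L'" "e \<le> e'" "E \<le> E'" "b \<le> b'" "a \<le> a'"
  shows "clt_bounds M P V F e' L' E' b' a'"
proof -
  have 1: "2 * t\<^sup>2 * sqrt (2 * e) + \<bar>t\<bar> * L \<le> 2 * t\<^sup>2 * sqrt (2 * e') + \<bar>t\<bar> * L'" for t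
    using assms by (intro add_mono mult_left_mono) auto
  have 2: "sqrt (2 * F) + L \<le> sqrt (2 * F) + L'" using assms by simp
  have 3: "4 * sqrt (sqrt E / (3 * real (card P))) + 4 * sqrt b + sqrt (15 * \<epsilon>) + (1 + 1 / \<epsilon>)\<^sup>2 * (a / sqrt (3 * real (card P)))
    \<le> 4 * sqrt (sqrt E' / (3 * real (card P))) + 4 * sqrt b' + sqrt (15 * \<epsilon>) + (1 + 1 / \<epsilon>)\<^sup>2 * (a' / sqrt (3 * real (card P)))" for \<epsilon>
    using assms by (intro add_mono mult_left_mono divide_right_mono real_sqrt_le_mono order_refl) auto
  show ?thesis using assms(1) order_trans[OF _ 1] order_trans[OF _ ennreal_leI[OF 2]] order_trans[OF _ ennreal_leI[OF 3]]
    unfolding clt_bounds_def by blast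
qed

text \<open>The third parameter bounds the mean absolute size of what separates the statistic from a
  centred Gaussian quadratic form: the deviation of the variances from 1, the cross term of U and A,
  and the squares of A. The fourth is the second moment of the centred quartic sum, the fifth the
  bias of its centring.\<close>

abbreviation cov_clt_bounds ::
  "'w measure \<Rightarrow> 'p set \<Rightarrow> ('p \<Rightarrow> 'w \<Rightarrow> real) \<Rightarrow> ('p \<Rightarrow> 'p \<Rightarrow> real) \<Rightarrow> ('p \<Rightarrow> 'w \<Rightarrow> real) \<Rightarrow> bool" where
  "cov_clt_bounds M P V cov A \<equiv> clt_bounds M P V
     (\<Sum>p\<in>P. \<Sum>q\<in>P. (cov p q)\<^sup>2) (\<Sum>p\<in>P. \<Sum>q\<in>P. (\<Sum>r\<in>P. cov p r * cov r q)\<^sup>2)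
     ((\<Sum>p\<in>P. \<bar>cov p p - 1\<bar>) + 2 * sqrt (\<Sum>p\<in>P. \<Sum>q\<in>P. cov p q * (\<integral>w. A p w * A q w \<partial>M)) + (\<Sum>p\<in>P. \<integral>w. (A p w)\<^sup>2 \<partial>M))
     (\<Sum>p\<in>P. \<Sum>q\<in>P. 72 * cov p p * cov q q * (cov p q)\<^sup>2 + 24 * cov p q ^ 4)
     ((\<Sum>p\<in>P. \<bar>(cov p p)\<^sup>2 - 1\<bar>) / real (card P)) (\<Sum>p\<in>P. \<integral>w. (A p w)\<^sup>2 \<partial>M)"

text \<open>The statistic is the centred quadratic form in U plus a remainder that is small in mean
  absolute value; the characteristic function is Lipschitz in such a remainder.\<close>

lemma (in prob_space) clt_bounds_gaussian_form:
  fixes U A :: "'p \<Rightarrow> 'a \<Rightarrow> real"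
  assumes gf: "gaussian_form M P A U" and finP: "finite P" and ne: "P \<noteq> {}"
    and mA[measurable]: "\<And>p. p \<in> P \<Longrightarrow> A p \<in> borel_measurable M"
    and A2: "\<And>p q. p \<in> P \<Longrightarrow> q \<in> P \<Longrightarrow> integrable M (\<lambda>w. A p w * A q w)"
  defines "cov \<equiv> \<lambda>p q. \<integral>w. U p w * U q w \<partial>M"
  defines "a \<equiv> \<Sum>p\<in>P. \<integral>w. (A p w)\<^sup>2 \<partial>M"
  shows "clt_bounds M P (\<lambda>p w. U p w + A p w)
     (\<Sum>p\<in>P. \<Sum>q\<in>P. (cov p q)\<^sup>2) (\<Sum>p\<in>P. \<Sum>q\<in>P. (\<Sum>r\<in>P. cov p r * cov r q)\<^sup>2)
     ((\<Sum>p\<in>P. \<bar>cov p p - 1\<bar>) + 2 * sqrt (\<Sum>p\<in>P. \<Sum>q\<in>P. cov p q * (\<integral>w. A p w * A q w \<partial>M)) + a)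
     (\<Sum>p\<in>P. \<Sum>q\<in>P. 72 * cov p p * cov q q * (cov p q)\<^sup>2 + 24 * cov p q ^ 4)
     ((\<Sum>p\<in>P. \<bar>(cov p p)\<^sup>2 - 1\<bar>) / real (card P)) a"
    (is "clt_bounds M P ?V ?F ?e ?L ?E ?b a")
proof -
  have cov: "(\<integral>w. U p w * U q w \<partial>M) = cov p q" for p q by (simp add: cov_def)
  note B = gaussian_form_bounds[OF gf finP A2, unfolded cov]
  note mU[measurable] = B(1)
  \<comment> \<open>Everything in the sum of (U + A)^2 - 1 except the centred form in U: variance
    bias, cross term and squares of A.\<close>
  define D where "D w = (\<Sum>p\<in>P. cov p p - 1) + 2 * (\<Sum>p\<in>P. U p w * A p w) + (\<Sum>p\<in>P. (A p w)\<^sup>2)" for w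
  define Q where "Q w = (\<Sum>p\<in>P. (U p w)\<^sup>2 - cov p p)" for w
  have [measurable]: "D \<in> borel_measurable M" "Q \<in> borel_measurable M" unfolding D_def Q_def by measurable
  have split: "(\<Sum>p\<in>P. (U p w + A p w)\<^sup>2 - 1) = Q w + D w" for w
    by (simp add: Q_def D_def power2_sum sum.distrib sum_subtractf sum_distrib_left algebra_simps)
  have iA: "integrable M (\<lambda>w. (A p w)\<^sup>2)" if "p \<in> P" for p using A2[OF that that] by (simp add: power2_eq_square)
  have UA: "integrable M (\<lambda>w. \<Sum>p\<in>P. U p w * A p w)"
    "(\<integral>w. \<bar>\<Sum>p\<in>P. U p w * A p w\<bar> \<partial>M) \<le> sqrt (\<Sum>p\<in>P. \<Sum>q\<in>P. cov p q * (\<integral>w. A p w * A q w \<partial>M))"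
    using expectation_abs_le_sqrt[of "\<lambda>w. \<Sum>p\<in>P. U p w * A p w"] B(5) by (simp_all add: has_bochner_integral_iff)
  have iD: "integrable M D" unfolding D_def using UA(1) iA by auto
  have D_le: "(\<integral>w. \<bar>D w\<bar> \<partial>M) \<le> ?L"
  proof -
    have "(\<integral>w. \<bar>D w\<bar> \<partial>M) \<le> (\<integral>w. (\<Sum>p\<in>P. \<bar>cov p p - 1\<bar>) + 2 * \<bar>\<Sum>p\<in>P. U p w * A p w\<bar> + (\<Sum>p\<in>P. (A p w)\<^sup>2) \<partial>M)"
    proof (rule integral_mono)
      show "integrable M (\<lambda>w. \<bar>D w\<bar>)" using iD by simp
      show "integrable M (\<lambda>w. (\<Sum>p\<in>P. \<bar>cov p p - 1\<bar>) + 2 * \<bar>\<Sum>p\<in>P. U p w * A p w\<bar> + (\<Sum>p\<in>P. (A p w)\<^sup>2))"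
        using UA(1) iA by auto
      fix w
      have "\<bar>D w\<bar> \<le> \<bar>\<Sum>p\<in>P. cov p p - 1\<bar> + 2 * \<bar>\<Sum>p\<in>P. U p w * A p w\<bar> + \<bar>\<Sum>p\<in>P. (A p w)\<^sup>2\<bar>"
        unfolding D_def by linarith
      also have "\<bar>\<Sum>p\<in>P. cov p p - 1\<bar> \<le> (\<Sum>p\<in>P. \<bar>cov p p - 1\<bar>)" by (rule sum_abs)
      also have "\<bar>\<Sum>p\<in>P. (A p w)\<^sup>2\<bar> = (\<Sum>p\<in>P. (A p w)\<^sup>2)" by (simp add: sum_nonneg)
      finally show "\<bar>D w\<bar> \<le> (\<Sum>p\<in>P. \<bar>cov p p - 1\<bar>) + 2 * \<bar>\<Sum>p\<in>P. U p w * A p w\<bar> + (\<Sum>p\<in>P. (A p w)\<^sup>2)" by simp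
    qed
    also have "\<dots> = (\<Sum>p\<in>P. \<bar>cov p p - 1\<bar>) + 2 * (\<integral>w. \<bar>\<Sum>p\<in>P. U p w * A p w\<bar> \<partial>M) + a"
      unfolding a_def using UA(1) iA by (simp add: prob_space)
    finally show ?thesis using UA(2) by linarith
  qed
  have iQ2: "integrable M (\<lambda>w. (Q w)\<^sup>2)" "(\<integral>w. (Q w)\<^sup>2 \<partial>M) = 2 * ?F"
    using B(3) by (auto simp: has_bochner_integral_iff Q_def)
  note Q1 = expectation_abs_le_sqrt[OF _ iQ2(1), simplified, unfolded iQ2(2)]
  show ?thesis unfolding clt_bounds_def
  proof (intro conjI allI impI)
    fix t
    have "norm ((\<integral>w. iexp (t * (\<Sum>p\<in>P. (?V p w)\<^sup>2 - 1)) \<partial>M) - (\<integral>w. iexp (t * Q w) \<partial>M)) =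
       norm (\<integral>w. iexp (t * (Q w + D w)) - iexp (t * Q w) \<partial>M)"
      unfolding split by (subst Bochner_Integration.integral_diff) (auto intro!: integrable_const_bound[where B = 1])
    also have "\<dots> \<le> (\<integral>w. norm (iexp (t * (Q w + D w)) - iexp (t * Q w)) \<partial>M)" by (rule integral_norm_bound)
    also have "\<dots> \<le> (\<integral>w. \<bar>t\<bar> * \<bar>D w\<bar> \<partial>M)"
    proof (rule integral_mono')
      show "integrable M (\<lambda>w. \<bar>t\<bar> * \<bar>D w\<bar>)" using iD by simp
      show "norm (iexp (t * (Q w + D w)) - iexp (t * Q w)) \<le> \<bar>t\<bar> * \<bar>D w\<bar>" for w
        using norm_iexp_diff_le[of "t * (Q w + D w)" "t * Q w"] by (simp add: algebra_simps flip: abs_mult)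
    qed auto
    also have "\<dots> \<le> \<bar>t\<bar> * ?L" using mult_left_mono[OF D_le, of "\<bar>t\<bar>"] by simp
    finally have 1: "norm ((\<integral>w. iexp (t * (\<Sum>p\<in>P. (?V p w)\<^sup>2 - 1)) \<partial>M) - (\<integral>w. iexp (t * Q w) \<partial>M)) \<le> \<bar>t\<bar> * ?L" .
    have 2: "norm ((\<integral>w. iexp (t * Q w) \<partial>M) - of_real (exp (- t\<^sup>2 * ?F))) \<le> 2 * t\<^sup>2 * sqrt (2 * ?e)"
      using B(2) unfolding Q_def .
    show "norm ((\<integral>w. iexp (t * (\<Sum>p\<in>P. (?V p w)\<^sup>2 - 1)) \<partial>M) - of_real (exp (- t\<^sup>2 * ?F))) \<le> 2 * t\<^sup>2 * sqrt (2 * ?e) + \<bar>t\<bar> * ?L"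
      using norm_triangle_le[OF add_mono[OF 2 1]] by (simp only: add.commute[of "_ - _"] diff_add_cancel add_diff_eq) (simp add: algebra_simps)
  next
    have "(\<integral>\<^sup>+w. ennreal \<bar>\<Sum>p\<in>P. (?V p w)\<^sup>2 - 1\<bar> \<partial>M) = ennreal (\<integral>w. \<bar>Q w + D w\<bar> \<partial>M)"
      unfolding split by (rule nn_integral_eq_integral) (use Q1(1) iD in auto)
    also have "(\<integral>w. \<bar>Q w + D w\<bar> \<partial>M) \<le> (\<integral>w. \<bar>Q w\<bar> + \<bar>D w\<bar> \<partial>M)"
      by (rule integral_mono) (use Q1(1) iD in auto)
    also have "\<dots> = (\<integral>w. \<bar>Q w\<bar> \<partial>M) + (\<integral>w. \<bar>D w\<bar> \<partial>M)" using Q1(1) iD by simp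
    also have "\<dots> \<le> sqrt (2 * ?F) + ?L" using Q1(2) D_le by simp
    finally show "(\<integral>\<^sup>+w. ennreal \<bar>\<Sum>p\<in>P. (?V p w)\<^sup>2 - 1\<bar> \<partial>M) \<le> ennreal (sqrt (2 * ?F) + ?L)"
      by (simp add: ennreal_leI)
  next
    fix \<epsilon> :: real assume eps: "0 < \<epsilon> \<and> \<epsilon> \<le> 1"
    define N where "N = 3 * real (card P)"
    have N: "N > 0" using finP ne by (simp add: N_def card_gt_0_iff)
    define X where "X w = \<bar>\<Sum>p\<in>P. U p w ^ 4 - 3 * (cov p p)\<^sup>2\<bar> / N" for w
    define Y where "Y w = (\<Sum>p\<in>P. (A p w)\<^sup>2)" for w
    have [measurable]: "X \<in> borel_measurable M" "Y \<in> borel_measurable M" unfolding X_def Y_def by measurable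
    have b0: "?b \<ge> 0" by (intro divide_nonneg_nonneg sum_nonneg) auto
    have iX2: "integrable M (\<lambda>w. (X w)\<^sup>2)" "(\<integral>w. (X w)\<^sup>2 \<partial>M) = ?E / N\<^sup>2"
      using B(4) by (simp_all add: has_bochner_integral_iff X_def power_divide)
    note X1 = expectation_abs_le_sqrt[OF _ iX2(1), simplified, unfolded iX2(2)]
    have X0: "X w \<ge> 0" for w using N by (simp add: X_def)
    have Y0: "Y w \<ge> 0" for w by (simp add: Y_def sum_nonneg)
    have sX: "integrable M (\<lambda>w. sqrt (X w))" "(\<integral>w. sqrt (X w) \<partial>M) \<le> sqrt (sqrt ?E / N)"
    proof -
      have i: "integrable M (\<lambda>w. (sqrt (X w))\<^sup>2)" using X1(1) X0 by simp
      note s = expectation_abs_le_sqrt[OF _ i, simplified]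
      show "integrable M (\<lambda>w. sqrt (X w))" by (rule s)
      have "(\<integral>w. sqrt (X w) \<partial>M) \<le> sqrt (\<integral>w. \<bar>X w\<bar> \<partial>M)" using s(2) X0 by simp
      also have "\<dots> \<le> sqrt (sqrt (?E / N\<^sup>2))" using X1(2) by simp
      also have "sqrt (?E / N\<^sup>2) = sqrt ?E / N" using N by (simp add: real_sqrt_divide)
      finally show "(\<integral>w. sqrt (X w) \<partial>M) \<le> sqrt (sqrt ?E / N)" .
    qed
    have iY: "integrable M Y" "(\<integral>w. Y w \<partial>M) = a" unfolding Y_def a_def using iA by auto
    \<comment> \<open>The four terms are the fluctuation of the fourth powers of U, the bias of
      their mean, the relative loss 15 eps of \<open>pow4_perturbation\<close>, and the initial
      value. The factor 4 is the root of 16 >= 1 + 15 eps.\<close>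
    have pt: "sqrt \<bar>(\<Sum>p\<in>P. ?V p w ^ 4) / N - 1\<bar> \<le>
        4 * sqrt (X w) + 4 * sqrt ?b + sqrt (15 * \<epsilon>) + (1 + 1 / \<epsilon>)\<^sup>2 / sqrt N * Y w" for w
    proof -
      define u where "u = (\<Sum>p\<in>P. U p w ^ 4) / N"
      have c1: "\<bar>u - 1\<bar> \<le> X w + ?b"
      proof -
        have "(\<Sum>p\<in>P. U p w ^ 4 - 3 * (cov p p)\<^sup>2) + (\<Sum>p\<in>P. 3 * ((cov p p)\<^sup>2 - 1)) = (\<Sum>p\<in>P. U p w ^ 4) - N"
          unfolding sum.distrib[symmetric] by (simp add: sum_subtractf N_def algebra_simps)
        then have "u - 1 = ((\<Sum>p\<in>P. U p w ^ 4 - 3 * (cov p p)\<^sup>2) + (\<Sum>p\<in>P. 3 * ((cov p p)\<^sup>2 - 1))) / N"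
          using N by (simp add: u_def diff_divide_distrib)
        also have "\<bar>\<dots>\<bar> \<le> (\<bar>\<Sum>p\<in>P. U p w ^ 4 - 3 * (cov p p)\<^sup>2\<bar> + \<bar>\<Sum>p\<in>P. 3 * ((cov p p)\<^sup>2 - 1)\<bar>) / N"
          using N by (simp add: divide_right_mono)
        also have "\<bar>\<Sum>p\<in>P. 3 * ((cov p p)\<^sup>2 - 1)\<bar> \<le> (\<Sum>p\<in>P. 3 * \<bar>(cov p p)\<^sup>2 - 1\<bar>)"
          by (rule order_trans[OF sum_abs]) (simp only: abs_mult abs_numeral order_refl)
        finally show ?thesis using N by (simp add: X_def N_def add_divide_distrib divide_right_mono flip: sum_distrib_left)
      qed
      have "\<bar>(\<Sum>p\<in>P. ?V p w ^ 4) - (\<Sum>p\<in>P. U p w ^ 4)\<bar> \<le> (\<Sum>p\<in>P. 15 * \<epsilon> * U p w ^ 4 + (1 + 1 / \<epsilon>) ^ 4 * A p w ^ 4)"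
        unfolding sum_subtractf[symmetric] by (rule order_trans[OF sum_abs]) (intro sum_mono pow4_perturbation, use eps in auto)
      also have "\<dots> = 15 * \<epsilon> * (N * u) + (1 + 1 / \<epsilon>) ^ 4 * (\<Sum>p\<in>P. A p w ^ 4)"
      proof -
        have "N * u = (\<Sum>p\<in>P. U p w ^ 4)" using N by (simp add: u_def)
        then show ?thesis by (simp add: sum.distrib sum_distrib_left)
      qed
      \<comment> \<open>A sum of fourth powers is at most the square of the sum of squares, so after
        the square root the initial value enters linearly through Y, whose mean needs second moments
        only.\<close>
      also have "(\<Sum>p\<in>P. A p w ^ 4) \<le> (Y w)\<^sup>2"
      proof -
        have "(\<Sum>p\<in>P. A p w ^ 4) = (\<Sum>p\<in>P. (A p w)\<^sup>2 * (A p w)\<^sup>2)" by (simp flip: power_add)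
        also have "\<dots> \<le> (\<Sum>p\<in>P. (A p w)\<^sup>2 * Y w)"
          unfolding Y_def using finP by (intro sum_mono mult_left_mono member_le_sum) auto
        finally show ?thesis by (simp add: Y_def power2_eq_square sum_distrib_right)
      qed
      finally have "\<bar>(\<Sum>p\<in>P. ?V p w ^ 4) - (\<Sum>p\<in>P. U p w ^ 4)\<bar> / N \<le> (15 * \<epsilon> * (N * u) + (1 + 1 / \<epsilon>) ^ 4 * (Y w)\<^sup>2) / N"
        using N eps by (simp add: divide_right_mono mult_left_mono)
      also have "\<dots> = 15 * \<epsilon> * u + (1 + 1 / \<epsilon>) ^ 4 * (Y w)\<^sup>2 / N" using N by (simp add: add_divide_distrib)
      finally have c2: "\<bar>(\<Sum>p\<in>P. ?V p w ^ 4) / N - u\<bar> \<le> 15 * \<epsilon> * u + (1 + 1 / \<epsilon>) ^ 4 * (Y w)\<^sup>2 / N"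
        using N by (simp add: u_def flip: diff_divide_distrib)
      have "\<bar>(\<Sum>p\<in>P. ?V p w ^ 4) / N - 1\<bar> \<le> (X w + ?b) + (15 * \<epsilon> * (1 + (X w + ?b)) + (1 + 1 / \<epsilon>) ^ 4 * (Y w)\<^sup>2 / N)"
      proof -
        have "15 * \<epsilon> * u \<le> 15 * \<epsilon> * (1 + (X w + ?b))" using c1 eps by (intro mult_left_mono) auto
        then show ?thesis using c1 c2 by linarith
      qed
      also have "\<dots> = (1 + 15 * \<epsilon>) * X w + (1 + 15 * \<epsilon>) * ?b + 15 * \<epsilon> + (1 + 1 / \<epsilon>) ^ 4 * (Y w)\<^sup>2 / N"
        by (simp add: algebra_simps add_divide_distrib)
      also have "\<dots> \<le> 16 * X w + 16 * ?b + 15 * \<epsilon> + (1 + 1 / \<epsilon>) ^ 4 * (Y w)\<^sup>2 / N"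
        using eps X0 b0 by (intro add_mono mult_right_mono order_refl) auto
      finally have "sqrt \<bar>(\<Sum>p\<in>P. ?V p w ^ 4) / N - 1\<bar> \<le> sqrt (16 * X w + 16 * ?b + 15 * \<epsilon> + (1 + 1 / \<epsilon>) ^ 4 * (Y w)\<^sup>2 / N)"
        by simp
      also have "\<dots> \<le> sqrt (16 * X w) + sqrt (16 * ?b) + sqrt (15 * \<epsilon>) + sqrt ((1 + 1 / \<epsilon>) ^ 4 * (Y w)\<^sup>2 / N)"
        using X0[of w] b0 eps N
        by (intro order_trans[OF sqrt_add_le_add_sqrt] add_mono order_refl) (auto intro!: add_nonneg_nonneg mult_nonneg_nonneg divide_nonneg_nonneg)
      also have "sqrt ((1 + 1 / \<epsilon>) ^ 4 * (Y w)\<^sup>2 / N) = (1 + 1 / \<epsilon>)\<^sup>2 / sqrt N * Y w"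
      proof -
        have "(1 + 1 / \<epsilon>) ^ 4 * (Y w)\<^sup>2 = ((1 + 1 / \<epsilon>)\<^sup>2 * Y w)\<^sup>2" by (simp add: power_mult_distrib)
        then show ?thesis using Y0[of w] eps by (simp add: real_sqrt_divide)
      qed
      finally have "sqrt \<bar>(\<Sum>p\<in>P. ?V p w ^ 4) / N - 1\<bar> \<le>
        sqrt (16 * X w) + sqrt (16 * ?b) + sqrt (15 * \<epsilon>) + (1 + 1 / \<epsilon>)\<^sup>2 / sqrt N * Y w" .
      moreover have "sqrt (16 * x) = 4 * sqrt x" for x by (simp add: real_sqrt_mult)
      ultimately show ?thesis by (simp only:)
    qed
    have "(\<integral>\<^sup>+w. ennreal (sqrt \<bar>(\<Sum>p\<in>P. ?V p w ^ 4) / N - 1\<bar>) \<partial>M) \<le>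
      (\<integral>\<^sup>+w. ennreal (4 * sqrt (X w) + 4 * sqrt ?b + sqrt (15 * \<epsilon>) + (1 + 1 / \<epsilon>)\<^sup>2 / sqrt N * Y w) \<partial>M)"
      by (intro nn_integral_mono ennreal_leI pt)
    also have "\<dots> = ennreal (\<integral>w. 4 * sqrt (X w) + 4 * sqrt ?b + sqrt (15 * \<epsilon>) + (1 + 1 / \<epsilon>)\<^sup>2 / sqrt N * Y w \<partial>M)"
      by (rule nn_integral_eq_integral) (use sX(1) iY(1) X0 Y0 b0 eps N in \<open>auto intro!: AE_I2 add_nonneg_nonneg mult_nonneg_nonneg\<close>)
    also have "(\<integral>w. 4 * sqrt (X w) + 4 * sqrt ?b + sqrt (15 * \<epsilon>) + (1 + 1 / \<epsilon>)\<^sup>2 / sqrt N * Y w \<partial>M)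
      = 4 * (\<integral>w. sqrt (X w) \<partial>M) + 4 * sqrt ?b + sqrt (15 * \<epsilon>) + (1 + 1 / \<epsilon>)\<^sup>2 / sqrt N * a"
      using sX(1) iY by (simp add: prob_space)
    also have "\<dots> \<le> 4 * sqrt (sqrt ?E / N) + 4 * sqrt ?b + sqrt (15 * \<epsilon>) + (1 + 1 / \<epsilon>)\<^sup>2 / sqrt N * a"
      using sX(2) by simp
    finally show "(\<integral>\<^sup>+w. ennreal (sqrt \<bar>(\<Sum>p\<in>P. ?V p w ^ 4) / (3 * real (card P)) - 1\<bar>) \<partial>M) \<le>
      ennreal (4 * sqrt (sqrt ?E / (3 * real (card P))) + 4 * sqrt ?b + sqrt (15 * \<epsilon>) + (1 + 1 / \<epsilon>)\<^sup>2 * (a / sqrt (3 * real (card P))))"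
      by (simp add: N_def ennreal_leI)
  qed
qed

section \<open>Wiener integrals as Gaussian forms\<close>

lemma bm_increment_std_normal:
  assumes "prob_space M" "standard_brownian_motion M W" "0 \<le> u" "u < v"
  shows "distributed M lborel (\<lambda>w. (W v w - W u w) / sqrt (v - u)) (\<lambda>x. ennreal (std_normal_density x))"
proof -
  interpret prob_space M by fact
  have "distributed M lborel (\<lambda>w. W v w - W u w) (\<lambda>x. ennreal (normal_density 0 (sqrt (v - u)) x))"
    using assms unfolding standard_brownian_motion_def by blast
  from normal_density_affine[OF this, of "1 / sqrt (v - u)" 0] show ?thesis using assms by simp
qed

lemma bm_measurable: "standard_brownian_motion M W \<Longrightarrow> 0 \<le> t \<Longrightarrow> W t \<in> borel_measurable M"
  by (auto simp: standard_brownian_motion_def)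

lemma bm_increment_square:
  assumes "prob_space M" "standard_brownian_motion M W" "0 \<le> u" "0 \<le> v"
  shows "has_bochner_integral M (\<lambda>w. (W v w - W u w)\<^sup>2) \<bar>v - u\<bar>"
proof -
  interpret prob_space M by fact
  have *: "has_bochner_integral M (\<lambda>w. (W v w - W u w)\<^sup>2) (v - u)" if uv: "0 \<le> u" "u < v" for u v
  proof -
    define X where "X w = (W v w - W u w) / sqrt (v - u)" for w
    have d: "distributed M lborel X (\<lambda>x. ennreal (std_normal_density x))"
      using bm_increment_std_normal[OF assms(1,2) uv] by (simp add: X_def[abs_def])
    have i: "integrable M (\<lambda>w. (X w)\<^sup>2)"
      by (subst distributed_integrable[OF d, symmetric]) (use integrable_std_normal_moment[of 2] in auto)
    have "(\<integral>w. (X w)\<^sup>2 \<partial>M) = 1"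
      using standard_normal_distributed_variance[OF d] standard_normal_distributed_expectation[OF d] by simp
    with i have "has_bochner_integral M (\<lambda>w. (X w)\<^sup>2) 1" by (simp add: has_bochner_integral_iff)
    from has_bochner_integral_mult_right[OF this, of "v - u"]
    show ?thesis using uv by (simp add: X_def power_divide)
  qed
  consider "u < v" | "v < u" | "u = v" by linarith
  then show ?thesis using *[of u v] *[of v u] assms by cases (auto simp: power2_commute[of "W u _"] intro: has_bochner_integral_zero)
qed

text \<open>Polarisation: the product of two increments is half a signed sum of four squared
  increments. This covers all relative positions of the two intervals without a case
  distinction.\<close>

lemma bm_increment_product:
  assumes "prob_space M" "standard_brownian_motion M W" "0 \<le> u" "0 \<le> v" "0 \<le> u'" "0 \<le> v'"
  shows "has_bochner_integral M (\<lambda>w. (W v w - W u w) * (W v' w - W u' w))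
    ((\<bar>v - u'\<bar> + \<bar>u - v'\<bar> - \<bar>v - v'\<bar> - \<bar>u - u'\<bar>) / 2)"
proof -
  note s = bm_increment_square[OF assms(1,2)]
  have "has_bochner_integral M (\<lambda>w. ((W v w - W u' w)\<^sup>2 + (W u w - W v' w)\<^sup>2 - (W v w - W v' w)\<^sup>2 - (W u w - W u' w)\<^sup>2) / 2)
     ((\<bar>v - u'\<bar> + \<bar>u - v'\<bar> - \<bar>v - v'\<bar> - \<bar>u - u'\<bar>) / 2)"
    by (intro has_bochner_integral_divide_zero has_bochner_integral_diff has_bochner_integral_add s assms)
  moreover have "((W v w - W u' w)\<^sup>2 + (W u w - W v' w)\<^sup>2 - (W v w - W v' w)\<^sup>2 - (W u w - W u' w)\<^sup>2) / 2
     = (W v w - W u w) * (W v' w - W u' w)" for w by (simp add: power2_eq_square field_simps)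
  ultimately show ?thesis by simp
qed

section \<open>Step integrals as linear forms in independent increments\<close>

definition bm_path :: "(real \<Rightarrow> 'w \<Rightarrow> real) \<Rightarrow> 'w \<Rightarrow> real \<Rightarrow> real" where
  "bm_path W w = (\<lambda>t\<in>{0..}. W t w)"

lemma indep_bm_paths:
  "indep_brownian_motions M W \<Longrightarrow> prob_space.indep_vars M (\<lambda>_. PiM {0..} (\<lambda>_. borel)) (\<lambda>k. bm_path (W k)) {1..}"
  by (simp add: indep_brownian_motions_def bm_path_def[abs_def])

text \<open>Independence over the pairs (k, l) is assembled from two layers: the paths are
  independent over k, and within one path the increments are independent over l. The product formula
  is verified on rectangles.\<close>

lemma std_gaussian_family_grid:
  fixes \<tau> :: "nat \<Rightarrow> real"
  assumes "prob_space M" and bm: "indep_brownian_motions M W"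
    and K: "1 \<le> K" and L: "1 \<le> L" and \<tau>0: "0 \<le> \<tau> 0" and \<tau>: "\<And>i. i < L \<Longrightarrow> \<tau> i < \<tau> (Suc i)"
  shows "std_gaussian_family M ({1..K} \<times> {..<L})
     (\<lambda>(k, l) w. (W k (\<tau> (Suc l)) w - W k (\<tau> l) w) / sqrt (\<tau> (Suc l) - \<tau> l))"
proof -
  interpret prob_space M by fact
  let ?g = "\<lambda>k l w. (W k (\<tau> (Suc l)) w - W k (\<tau> l) w) / sqrt (\<tau> (Suc l) - \<tau> l)"
  let ?I = "{1..K} \<times> {..<L}"
  have \<tau>nn: "0 \<le> \<tau> l" if "l \<le> L" for l using that
  proof (induction l)
    case (Suc l) then show ?case using \<tau>[of l] by force
  qed (use \<tau>0 in auto)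
  have sbm: "standard_brownian_motion M (W k)" if "k \<ge> 1" for k using bm that by (auto simp: indep_brownian_motions_def)
  have Wm: "W k (\<tau> l) \<in> borel_measurable M" if "k \<ge> 1" "l \<le> L" for k l
    using bm_measurable[OF sbm[OF that(1)] \<tau>nn[OF that(2)]] .
  have gm: "?g k l \<in> borel_measurable M" if "k \<ge> 1" "l < L" for k l
    using Wm[of k l] Wm[of k "Suc l"] that by (intro borel_measurable_divide borel_measurable_diff borel_measurable_const) auto
  have inner: "indep_vars (\<lambda>_. borel) (?g k) {..<L}" if "k \<ge> 1" for k
  proof -
    have "indep_vars (\<lambda>_. borel) (\<lambda>i w. W k (\<tau> (Suc i)) w - W k (\<tau> i) w) {..<L}"
      using sbm[OF that] \<tau>0 \<tau> unfolding standard_brownian_motion_def by (meson less_imp_le)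
    then show ?thesis by (rule indep_vars_compose2[where Y = "\<lambda>i x. x / sqrt (\<tau> (Suc i) - \<tau> i)"]) auto
  qed
  have "indep_vars (\<lambda>_. borel) (\<lambda>(k, l). ?g k l) ?I"
  proof (subst indep_vars_finite[where E = "\<lambda>_. sets borel"])
    have "(1, 0) \<in> ?I" using K L by auto
    then show "?I \<noteq> {}" "finite ?I" by blast+
    show "sets borel = sigma_sets (space borel) (sets borel)" by (rule sets.sigma_sets_eq[symmetric])
    show "Int_stable (sets borel)" by (rule sets.Int_stable)
    show "(case i of (k, l) \<Rightarrow> ?g k l) \<in> borel_measurable M" if "i \<in> ?I" for i using that gm by auto
    show "\<forall>A\<in>?I \<rightarrow> sets borel. prob (\<Inter>j\<in>?I. (case j of (k, l) \<Rightarrow> ?g k l) -` A j \<inter> space M) =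
      (\<Prod>j\<in>?I. prob ((case j of (k, l) \<Rightarrow> ?g k l) -` A j \<inter> space M))"
    proof
      fix A :: "nat \<times> nat \<Rightarrow> real set" assume A: "A \<in> ?I \<rightarrow> sets borel"
      define P where "P = PiM {0::real..} (\<lambda>_. borel :: real measure)"
      \<comment> \<open>The cylinder set of paths whose normalised increments all lie in the
        prescribed sets; it turns the condition on the row k into one condition on the k-th
        path.\<close>
      define B where "B k = {f \<in> space P. \<forall>l\<in>{..<L}. (f (\<tau> (Suc l)) - f (\<tau> l)) / sqrt (\<tau> (Suc l) - \<tau> l) \<in> A (k, l)}" for k
      have B: "B k \<in> sets P" if "k \<in> {1..K}" for k unfolding B_def
      proof (intro sets.sets_Collect_finite_All)
        fix l assume l: "l \<in> {..<L}"
        have "(\<lambda>f. (f (\<tau> (Suc l)) - f (\<tau> l)) / sqrt (\<tau> (Suc l) - \<tau> l)) \<in> borel_measurable P"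
          unfolding P_def using \<tau>nn[of l] \<tau>nn[of "Suc l"] l
          by (intro borel_measurable_divide borel_measurable_diff borel_measurable_const measurable_component_singleton) auto
        moreover have "A (k, l) \<in> sets borel" using A l that by auto
        ultimately show "{f \<in> space P. (f (\<tau> (Suc l)) - f (\<tau> l)) / sqrt (\<tau> (Suc l) - \<tau> l) \<in> A (k, l)} \<in> sets P"
          by measurable
      qed simp
      have pre: "bm_path (W k) -` B k \<inter> space M = (\<Inter>l\<in>{..<L}. ?g k l -` A (k, l) \<inter> space M)" if "k \<in> {1..K}" for k
      proof -
        have "bm_path (W k) w \<in> space P" for w by (auto simp: P_def space_PiM bm_path_def)
        moreover have "bm_path (W k) w (\<tau> l) = W k (\<tau> l) w" if "l \<le> L" for l w using \<tau>nn[OF that] by (simp add: bm_path_def)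
        ultimately show ?thesis using L by (auto simp: B_def lessThan_iff Suc_le_eq)
      qed
      have "prob (\<Inter>j\<in>?I. (case j of (k, l) \<Rightarrow> ?g k l) -` A j \<inter> space M)
          = prob (\<Inter>k\<in>{1..K}. bm_path (W k) -` B k \<inter> space M)" by (rule arg_cong[where f = prob]) (use pre in auto)
      also have "\<dots> = (\<Prod>k\<in>{1..K}. prob (bm_path (W k) -` B k \<inter> space M))"
        by (rule indep_varsD[OF indep_bm_paths[OF bm]]) (use K B in \<open>auto simp: P_def\<close>)
      also have "\<dots> = (\<Prod>k\<in>{1..K}. \<Prod>l\<in>{..<L}. prob (?g k l -` A (k, l) \<inter> space M))"
      proof (intro prod.cong refl)
        fix k assume k: "k \<in> {1..K}"
        have "prob (\<Inter>l\<in>{..<L}. ?g k l -` A (k, l) \<inter> space M) = (\<Prod>l\<in>{..<L}. prob (?g k l -` A (k, l) \<inter> space M))"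
          by (rule indep_varsD[OF inner]) (use k L A in \<open>auto simp: lessThan_empty_iff\<close>)
        then show "prob (bm_path (W k) -` B k \<inter> space M) = (\<Prod>l\<in>{..<L}. prob (?g k l -` A (k, l) \<inter> space M))"
          by (simp only: pre[OF k])
      qed
      also have "\<dots> = (\<Prod>j\<in>?I. prob ((case j of (k, l) \<Rightarrow> ?g k l) -` A j \<inter> space M))"
        by (subst prod.cartesian_product) (intro prod.cong refl, auto)
      finally show "prob (\<Inter>j\<in>?I. (case j of (k, l) \<Rightarrow> ?g k l) -` A j \<inter> space M) =
        (\<Prod>j\<in>?I. prob ((case j of (k, l) \<Rightarrow> ?g k l) -` A j \<inter> space M))" .
    qed
  qed auto
  moreover have "distributed M lborel (?g k l) (\<lambda>x. ennreal (std_normal_density x))" if "k \<ge> 1" "l < L" for k l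
    by (rule bm_increment_std_normal[OF assms(1) sbm]) (use that \<tau> \<tau>nn[of l] in auto)
  ultimately show ?thesis by (auto simp: std_gaussian_family_def case_prod_beta)
qed

text \<open>Linear combinations without named coefficients, so that step integrals and their sums
  can be recognised as linear forms by closure rules.\<close>

definition span_of :: "'w measure \<Rightarrow> 'i set \<Rightarrow> ('i \<Rightarrow> 'w \<Rightarrow> real) \<Rightarrow> ('w \<Rightarrow> real) set" where
  "span_of M I g = {Y. \<exists>a. \<forall>w\<in>space M. Y w = (\<Sum>l\<in>I. a l * g l w)}"

lemma span_of_zero: "(\<lambda>_. 0) \<in> span_of M I g"
  unfolding span_of_def by (auto intro!: exI[of _ "\<lambda>_. 0"])

lemma span_of_add: "Y \<in> span_of M I g \<Longrightarrow> Y' \<in> span_of M I g \<Longrightarrow> (\<lambda>w. Y w + Y' w) \<in> span_of M I g"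
proof -
  assume "Y \<in> span_of M I g" "Y' \<in> span_of M I g"
  then obtain a b where "\<forall>w\<in>space M. Y w = (\<Sum>l\<in>I. a l * g l w)" "\<forall>w\<in>space M. Y' w = (\<Sum>l\<in>I. b l * g l w)"
    by (auto simp: span_of_def)
  then show ?thesis unfolding span_of_def by (auto intro!: exI[of _ "\<lambda>l. a l + b l"] simp: algebra_simps sum.distrib)
qed

lemma span_of_scale: "Y \<in> span_of M I g \<Longrightarrow> (\<lambda>w. c * Y w) \<in> span_of M I g"
proof -
  assume "Y \<in> span_of M I g"
  then obtain a where "\<forall>w\<in>space M. Y w = (\<Sum>l\<in>I. a l * g l w)" by (auto simp: span_of_def)
  then show ?thesis unfolding span_of_def by (auto intro!: exI[of _ "\<lambda>l. c * a l"] simp: sum_distrib_left mult_ac)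
qed

lemma span_of_sum: "(\<And>s. s \<in> S \<Longrightarrow> Y s \<in> span_of M I g) \<Longrightarrow> (\<lambda>w. \<Sum>s\<in>S. Y s w) \<in> span_of M I g"
  by (induction S rule: infinite_finite_induct) (auto intro: span_of_zero span_of_add)

lemma span_of_generator: "finite I \<Longrightarrow> l \<in> I \<Longrightarrow> g l \<in> span_of M I g"
  unfolding span_of_def
  by (auto intro!: exI[of _ "\<lambda>k. if k = l then 1 else 0"] simp: if_distrib[of "\<lambda>c. c * _"] sum.delta cong: if_cong)

lemma step_integral_in_span:
  assumes "\<And>u v. u \<in> T \<Longrightarrow> v \<in> T \<Longrightarrow> u \<le> v \<Longrightarrow> (\<lambda>w. W v w - W u w) \<in> span_of M I g"
    and "\<And>c u v. (c, u, v) \<in> set S \<Longrightarrow> u \<in> T \<and> v \<in> T \<and> u \<le> v"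
  shows "step_integral W S \<in> span_of M I g"
  using assms(2)
proof (induction S)
  case Nil
  show ?case using span_of_zero by (simp add: step_integral_def[abs_def])
next
  case (Cons x S)
  obtain c u v where x: "x = (c, u, v)" by (cases x)
  have "(\<lambda>w. c * (W v w - W u w)) \<in> span_of M I g" using Cons.prems[of c u v] by (intro span_of_scale assms(1)) (auto simp: x)
  moreover have "step_integral W S \<in> span_of M I g" by (rule Cons.IH) (use Cons.prems in auto)
  moreover have "step_integral W (x # S) = (\<lambda>w. c * (W v w - W u w) + step_integral W S w)"
    by (simp add: step_integral_def[abs_def] x)
  ultimately show ?case using span_of_add by simp
qed

text \<open>All break points are merged into one increasing grid. An increment between two of them
  telescopes over the grid cells and is therefore a combination of the independent
  generators.\<close>

lemma grid_family:
  assumes "prob_space M" and bm: "indep_brownian_motions M W" and K: "1 \<le> K"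
    and T: "finite T" "T \<subseteq> {0..}"
  obtains I :: "(nat \<times> nat) set" and g where "std_gaussian_family M I g"
    and "\<And>l. l \<in> I \<Longrightarrow> \<exists>k\<ge>1. \<exists>u\<ge>0. \<exists>v\<ge>0. \<exists>c. g l = (\<lambda>w. (W k v w - W k u w) / c)"
    and "\<And>k u v. k \<in> {1..K} \<Longrightarrow> u \<in> T \<Longrightarrow> v \<in> T \<Longrightarrow> u \<le> v \<Longrightarrow> (\<lambda>w. W k v w - W k u w) \<in> span_of M I g"
proof -
  \<comment> \<open>Adding 0 and 1 guarantees at least one grid cell even if T is empty.\<close>
  define T' where "T' = insert 0 (insert 1 T)"
  have T': "finite T'" "T' \<subseteq> {0..}" "0 \<in> T'" "1 \<in> T'" using T by (auto simp: T'_def)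
  define ts where "ts = sorted_list_of_set T'"
  have ts: "set ts = T'" "sorted ts" "distinct ts" using T' by (auto simp: ts_def)
  have card2: "2 \<le> card T'"
  proof -
    have "card {0, 1::real} \<le> card T'" by (rule card_mono) (use T' in auto)
    then show ?thesis by simp
  qed
  have len: "length ts = card T'" by (simp add: ts_def)
  define L where "L = length ts - 1"
  have L: "1 \<le> L" "Suc L = length ts" using card2 len by (auto simp: L_def)
  define \<tau> where "\<tau> i = ts ! i" for i
  have nn: "0 \<le> ts ! i" if "i < length ts" for i
  proof -
    have "ts ! i \<in> T'" using nth_mem[OF that] ts(1) by simp
    then show ?thesis using T'(2) by auto
  qed
  have \<tau>0: "0 \<le> \<tau> 0" unfolding \<tau>_def by (rule nn) (use L in linarith)
  have smono: "ts ! i < ts ! j" if "i < j" "j < length ts" for i j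
    using sorted_nth_mono[OF ts(2), of i j] nth_eq_iff_index_eq[OF ts(3), of i j] that by simp
  have \<tau>: "\<tau> i < \<tau> (Suc i)" if "i < L" for i unfolding \<tau>_def by (rule smono) (use that L in linarith)+
  define I where "I = {1..K} \<times> {..<L}"
  define g where "g = (\<lambda>(k, l) w. (W k (\<tau> (Suc l)) w - W k (\<tau> l) w) / sqrt (\<tau> (Suc l) - \<tau> l))"
  have fin: "finite I" by (simp add: I_def)
  have \<tau>nn: "0 \<le> \<tau> l" if "l \<le> L" for l unfolding \<tau>_def by (rule nn) (use that L in linarith)
  show thesis
  proof (rule that)
    show "std_gaussian_family M I g" unfolding I_def g_def by (rule std_gaussian_family_grid[OF assms(1) bm K L(1) \<tau>0 \<tau>])
    show "\<exists>k\<ge>1. \<exists>u\<ge>0. \<exists>v\<ge>0. \<exists>c. g l = (\<lambda>w. (W k v w - W k u w) / c)" if l_in: "l \<in> I" for l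
    proof -
      obtain k i where l: "l = (k, i)" "1 \<le> k" "i < L" using l_in by (auto simp: I_def)
      then show ?thesis using \<tau>nn[of i] \<tau>nn[of "Suc i"] by (auto simp: g_def)
    qed
    fix k u v assume k: "k \<in> {1..K}" and u: "u \<in> T" and v: "v \<in> T" and uv: "u \<le> v"
    have "u \<in> set ts" using u by (simp add: ts(1) T'_def)
    then obtain a where a: "a < length ts" "\<tau> a = u" unfolding in_set_conv_nth \<tau>_def by blast
    have "v \<in> set ts" using v by (simp add: ts(1) T'_def)
    then obtain b where b: "b < length ts" "\<tau> b = v" unfolding in_set_conv_nth \<tau>_def by blast
    have "a \<le> b"
    proof (rule ccontr)
      assume "\<not> a \<le> b"
      then have "b < a" by simp
      then have "\<tau> b < \<tau> a" unfolding \<tau>_def by (rule smono) (rule a)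
      then show False using a b uv by simp
    qed
    then have tel: "W k v w - W k u w = (\<Sum>i=a..<b. W k (\<tau> (Suc i)) w - W k (\<tau> i) w)" for w
      using sum_Suc_diff'[of a b "\<lambda>i. W k (\<tau> i) w"] a b by simp
    have "(\<lambda>w. \<Sum>i=a..<b. W k (\<tau> (Suc i)) w - W k (\<tau> i) w) \<in> span_of M I g"
    proof (rule span_of_sum)
      fix i assume "i \<in> {a..<b}"
      then have i: "i < L" using b L by auto
      have "(k, i) \<in> I" using i k by (simp add: I_def)
      have gki: "g (k, i) = (\<lambda>w. (W k (\<tau> (Suc i)) w - W k (\<tau> i) w) / sqrt (\<tau> (Suc i) - \<tau> i))"
        by (simp add: g_def)
      have "(\<lambda>w. sqrt (\<tau> (Suc i) - \<tau> i) * g (k, i) w) \<in> span_of M I g"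
        by (rule span_of_scale, rule span_of_generator) fact+
      then show "(\<lambda>w. W k (\<tau> (Suc i)) w - W k (\<tau> i) w) \<in> span_of M I g" using \<tau>[OF i] unfolding gki by simp
    qed
    then show "(\<lambda>w. W k v w - W k u w) \<in> span_of M I g" by (simp only: tel)
  qed
qed

text \<open>With the unit vectors as coefficients, \<open>Z p\<close> is the coordinate p and
  \<open>moment2\<close> gives the Kronecker delta.\<close>

lemma (in prob_space) std_gaussian_family_orthonormal:
  fixes g :: "'i \<Rightarrow> 'a \<Rightarrow> real"
  assumes g: "std_gaussian_family M I g" and l: "l \<in> I" "l' \<in> I"
  shows "has_bochner_integral M (\<lambda>w. g l w * g l' w) (if l = l' then 1 else 0)"
proof -
  have fin: "finite I" using g by (simp add: std_gaussian_family_def)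
  interpret gauss_forms I "\<lambda>p l. if p = l then 1 else 0 :: real" by unfold_locales fact
  have Z: "Z p x = x p" if "p \<in> I" for p x
    using fin that by (simp add: Z_def if_distrib[of "\<lambda>c. c * _"] sum.delta cong: if_cong)
  have C: "C l l' = (if l = l' then 1 else 0)" using fin l by (simp add: C_def if_distrib[of "\<lambda>c. c * _"] sum.delta cong: if_cong)
  have t: "tame I (\<lambda>x. x l * x l' :: real)" by (intro tame_mult tame_coord fin l)
  then have m: "(\<lambda>x. x l * x l' :: real) \<in> borel_measurable (PiM I (\<lambda>_. borel))" by (simp add: tame_def)
  note tr = std_gaussian_family_transfer[OF g m]
  have "(\<integral>x. x l * x l' \<partial>gauss_space I) = (if l = l' then 1 else 0)" using moment2[of l l'] l by (simp add: Z C)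
  then show ?thesis using tr integrable_tame[OF t] l by (simp add: has_bochner_integral_iff)
qed

section \<open>Measurability of the coefficients of the initial value and its independence of the
  noise\<close>

lemma unit_mult_le_abs:
  fixes y c :: real
  assumes "0 \<le> y" "y \<le> 1"
  shows "y * c \<le> \<bar>c\<bar>"
proof -
  have "y * c \<le> y * \<bar>c\<bar>" using assms by (intro mult_left_mono) auto
  also have "\<dots> \<le> 1 * \<bar>c\<bar>" using assms by (intro mult_right_mono) auto
  finally show ?thesis by simp
qed

text \<open>Young's inequality with a free weight; a suitable choice of it takes the place of the
  Cauchy-Schwarz inequality for integrals.\<close>

lemma mult_le_weighted_squares:
  fixes a b \<eta> :: real
  assumes "\<eta> > 0"
  shows "\<bar>a * b\<bar> \<le> (a\<^sup>2 / \<eta> + \<eta> * b\<^sup>2) / 2"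
proof -
  have "0 \<le> (\<bar>a\<bar> - \<eta> * \<bar>b\<bar>)\<^sup>2" by simp
  then have "2 * \<eta> * \<bar>a * b\<bar> \<le> a\<^sup>2 + \<eta> * \<eta> * b\<^sup>2" by (simp add: power2_eq_square algebra_simps abs_mult)
  then show ?thesis using assms by (simp add: field_simps power2_eq_square)
qed

text \<open>The functional is continuous for the seminorm, so preimages of open sets belong to the
  generator of \<open>H_borel\<close>. For two functions at distance below r, Young's inequality
  with weight r bounds the difference by r (1 + E) / 2, where E is the squared norm of e; r = eps /
  (1 + E) makes this eps / 2.\<close>

lemma H_inner_measurable:
  assumes [measurable]: "e \<in> borel_measurable (lebesgue_on {0..1})" and eB: "\<And>y. y \<in> {0..1} \<Longrightarrow> \<bar>e y\<bar> \<le> B"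
  shows "(\<lambda>f. H_inner \<theta>1 \<theta>2 f e) \<in> borel_measurable (H_borel \<theta>1 \<theta>2)"
proof -
  let ?\<mu> = "lebesgue_on {0..1::real}"
  let ?w = "\<lambda>y. exp (y * \<theta>1 / \<theta>2)"
  let ?H = "H_space \<theta>1 \<theta>2"
  have [measurable]: "?w \<in> borel_measurable ?\<mu>" by (intro measurable_restrict_space1 measurable_completion) measurable
  have w0: "?w y > 0" for y by simp
  have iw: "integrable ?\<mu> (\<lambda>y. ?w y * e y * e y)"
  proof (rule integrableI_bounded_set[where A = "{0..1}" and B = "exp \<bar>\<theta>1 / \<theta>2\<bar> * (B * B)"])
    show "AE y in ?\<mu>. y \<in> {0..1} \<longrightarrow> norm (?w y * e y * e y) \<le> exp \<bar>\<theta>1 / \<theta>2\<bar> * (B * B)"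
    proof (intro AE_I2 impI)
      fix y :: real assume y: "y \<in> {0..1}"
      have "y * \<theta>1 / \<theta>2 \<le> \<bar>\<theta>1 / \<theta>2\<bar>" using y unit_mult_le_abs[of y "\<theta>1 / \<theta>2"] by simp
      moreover have "\<bar>e y\<bar> * \<bar>e y\<bar> \<le> B * B" using eB[OF y] by (intro mult_mono) auto
      ultimately show "norm (?w y * e y * e y) \<le> exp \<bar>\<theta>1 / \<theta>2\<bar> * (B * B)"
        by (simp add: abs_mult mult.assoc mult_mono)
    qed
  qed (auto simp: emeasure_restrict_space)
  define E where "E = (\<integral>y. ?w y * e y * e y \<partial>?\<mu>)"
  have E0: "E \<ge> 0" unfolding E_def by (intro Bochner_Integration.integral_nonneg) (simp add: mult.assoc)
  have mH: "f \<in> borel_measurable ?\<mu>" and iH: "integrable ?\<mu> (\<lambda>y. ?w y * f y * f y)" if "f \<in> ?H" for f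
    using that by (auto simp: H_space_def)
  have ife: "integrable ?\<mu> (\<lambda>y. ?w y * f y * e y)" if f: "f \<in> ?H" for f
  proof (rule Bochner_Integration.integrable_bound[OF Bochner_Integration.integrable_add[OF iH[OF f] iw]])
    show "(\<lambda>y. ?w y * f y * e y) \<in> borel_measurable ?\<mu>" using mH[OF f] by measurable
    have "\<bar>f y * e y\<bar> \<le> f y * f y + e y * e y" for y
      using sum_squares_bound[of "\<bar>f y\<bar>" "\<bar>e y\<bar>"] mult_nonneg_nonneg[OF abs_ge_zero abs_ge_zero, of "f y" "e y"]
      unfolding abs_mult power2_eq_square abs_mult_self_eq by linarith
    then have 1: "?w y * \<bar>f y * e y\<bar> \<le> ?w y * (f y * f y + e y * e y)" for y by (intro mult_left_mono) auto
    have "0 \<le> ?w y * (f y * f y + e y * e y)" for y by (rule mult_nonneg_nonneg[OF _ add_nonneg_nonneg]) auto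
    with 1 show "AE y in ?\<mu>. norm (?w y * f y * e y) \<le> norm (?w y * f y * f y + ?w y * e y * e y)"
      by (intro AE_I2) (simp add: abs_mult mult.assoc flip: distrib_left)
  qed
  have cont: "\<bar>H_inner \<theta>1 \<theta>2 g e - H_inner \<theta>1 \<theta>2 f e\<bar> \<le> r * (1 + E) / 2"
    if f: "f \<in> ?H" and g: "g \<in> ?H" and r: "r > 0" and d: "H_norm \<theta>1 \<theta>2 (\<lambda>y. g y - f y) < r" for f g r
  proof -
    have [measurable]: "f \<in> borel_measurable ?\<mu>" "g \<in> borel_measurable ?\<mu>" using mH f g by auto
    let ?d = "\<lambda>y. g y - f y"
    have id: "integrable ?\<mu> (\<lambda>y. ?w y * ?d y * ?d y)"
    proof (rule Bochner_Integration.integrable_bound)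
      show "integrable ?\<mu> (\<lambda>y. 2 * (?w y * g y * g y) + 2 * (?w y * f y * f y))" using iH[OF f] iH[OF g] by simp
      have "?d y * ?d y \<le> 2 * (g y * g y) + 2 * (f y * f y)" for y using zero_le_square[of "g y + f y"] by (simp add: algebra_simps)
      then have 1: "?w y * (?d y * ?d y) \<le> ?w y * (2 * (g y * g y) + 2 * (f y * f y))" for y by (intro mult_left_mono) auto
      have 0: "0 \<le> ?w y * (?d y * ?d y)" for y by (rule mult_nonneg_nonneg) auto
      show "AE y in ?\<mu>. norm (?w y * ?d y * ?d y) \<le> norm (2 * (?w y * g y * g y) + 2 * (?w y * f y * f y))"
      proof (rule AE_I2)
        fix y
        have e: "?w y * ?d y * ?d y = ?w y * (?d y * ?d y)" "2 * (?w y * g y * g y) + 2 * (?w y * f y * f y) = ?w y * (2 * (g y * g y) + 2 * (f y * f y))"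
          by (simp_all add: algebra_simps)
        show "norm (?w y * ?d y * ?d y) \<le> norm (2 * (?w y * g y * g y) + 2 * (?w y * f y * f y))"
          unfolding e real_norm_def using 1[of y] 0[of y] by linarith
      qed
    qed measurable
    have nn: "0 \<le> H_inner \<theta>1 \<theta>2 ?d ?d" unfolding H_inner_def by (intro Bochner_Integration.integral_nonneg) (simp add: mult.assoc)
    have "(H_norm \<theta>1 \<theta>2 ?d)\<^sup>2 = H_inner \<theta>1 \<theta>2 ?d ?d" using nn by (simp add: H_norm_def)
    moreover have "(H_norm \<theta>1 \<theta>2 ?d)\<^sup>2 \<le> r\<^sup>2" using d nn by (intro power_mono) (auto simp: H_norm_def)
    ultimately have dd: "(\<integral>y. ?w y * ?d y * ?d y \<partial>?\<mu>) \<le> r * r" by (simp add: H_inner_def power2_eq_square)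
    have ide: "integrable ?\<mu> (\<lambda>y. ?w y * ?d y * e y)"
      using Bochner_Integration.integrable_diff[OF ife[OF g] ife[OF f]] by (simp add: algebra_simps)
    have "H_inner \<theta>1 \<theta>2 g e - H_inner \<theta>1 \<theta>2 f e = (\<integral>y. ?w y * ?d y * e y \<partial>?\<mu>)"
      unfolding H_inner_def by (subst Bochner_Integration.integral_diff[symmetric, OF ife[OF g] ife[OF f]]) (simp add: algebra_simps)
    also have "\<bar>\<dots>\<bar> \<le> (\<integral>y. \<bar>?w y * ?d y * e y\<bar> \<partial>?\<mu>)" by (rule integral_abs_bound)
    also have "\<dots> \<le> (\<integral>y. (?w y * ?d y * ?d y) / (2 * r) + r / 2 * (?w y * e y * e y) \<partial>?\<mu>)"
    proof (rule integral_mono)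
      show "integrable ?\<mu> (\<lambda>y. \<bar>?w y * ?d y * e y\<bar>)" using ide by simp
      show "integrable ?\<mu> (\<lambda>y. (?w y * ?d y * ?d y) / (2 * r) + r / 2 * (?w y * e y * e y))" using id iw by simp
      fix y
      have "(A / r + r * B) / 2 = A / (2 * r) + r / 2 * B" for A B using r by (simp add: field_simps)
      then have "\<bar>?d y * e y\<bar> \<le> (?d y * ?d y) / (2 * r) + r / 2 * (e y * e y)"
        using mult_le_weighted_squares[OF r, of "?d y" "e y"] by (simp only: power2_eq_square)
      from mult_left_mono[OF this, of "?w y"]
      have "?w y * \<bar>?d y * e y\<bar> \<le> ?w y * ((?d y * ?d y) / (2 * r) + r / 2 * (e y * e y))" by simp
      moreover have "?w y * \<bar>?d y * e y\<bar> = \<bar>?w y * ?d y * e y\<bar>" by (simp only: abs_mult abs_exp_cancel mult.assoc)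
      moreover have "?w y * (A / (2 * r) + r / 2 * B) = (?w y * A) / (2 * r) + r / 2 * (?w y * B)" for A B by (simp add: algebra_simps)
      ultimately show "\<bar>?w y * ?d y * e y\<bar> \<le> (?w y * ?d y * ?d y) / (2 * r) + r / 2 * (?w y * e y * e y)"
        by (simp only: mult.assoc)
    qed
    also have "\<dots> = (\<integral>y. ?w y * ?d y * ?d y \<partial>?\<mu>) / (2 * r) + r / 2 * E" unfolding E_def using id iw by simp
    also have "\<dots> \<le> r * r / (2 * r) + r / 2 * E" using dd r by (intro add_right_mono divide_right_mono) auto
    also have "\<dots> = r * (1 + E) / 2" using r by (simp add: field_simps)
    finally show ?thesis .
  qed
  have sub: "{U. U \<subseteq> ?H \<and> (\<forall>f\<in>U. \<exists>\<epsilon>>0. \<forall>g\<in>?H. H_norm \<theta>1 \<theta>2 (\<lambda>y. g y - f y) < \<epsilon> \<longrightarrow> g \<in> U)} \<subseteq> Pow ?H" by auto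
  have sp: "space (H_borel \<theta>1 \<theta>2) = ?H" unfolding H_borel_def by (rule space_measure_of[OF sub])
  show ?thesis
  proof (rule borel_measurableI)
    fix S :: "real set" assume S: "open S"
    have "{f \<in> ?H. H_inner \<theta>1 \<theta>2 f e \<in> S} \<in> sets (H_borel \<theta>1 \<theta>2)"
      unfolding H_borel_def sets_measure_of[OF sub]
    proof (intro sigma_sets.Basic CollectI conjI ballI)
      fix f assume f: "f \<in> {f \<in> ?H. H_inner \<theta>1 \<theta>2 f e \<in> S}"
      then have "H_inner \<theta>1 \<theta>2 f e \<in> S" by simp
      then obtain \<epsilon> where eps: "\<epsilon> > 0" "\<And>x. \<bar>x - H_inner \<theta>1 \<theta>2 f e\<bar> < \<epsilon> \<Longrightarrow> x \<in> S"
        using S[unfolded open_dist dist_real_def] by blast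
      define r where "r = \<epsilon> / (1 + E)"
      have "1 + E > 0" using E0 by simp
      then have r: "r > 0" "r * (1 + E) / 2 < \<epsilon>" using eps(1) by (auto simp: r_def)
      show "\<exists>\<epsilon>>0. \<forall>g\<in>?H. H_norm \<theta>1 \<theta>2 (\<lambda>y. g y - f y) < \<epsilon> \<longrightarrow> g \<in> {f \<in> ?H. H_inner \<theta>1 \<theta>2 f e \<in> S}"
      proof (intro exI[of _ r] conjI ballI impI r CollectI)
        fix g assume g: "g \<in> ?H" "H_norm \<theta>1 \<theta>2 (\<lambda>y. g y - f y) < r"
        show "H_inner \<theta>1 \<theta>2 g e \<in> S" using cont[of f g r] f g r by (intro eps(2)) auto
      qed
    qed auto
    then show "(\<lambda>f. H_inner \<theta>1 \<theta>2 f e) -` S \<inter> space (H_borel \<theta>1 \<theta>2) \<in> sets (H_borel \<theta>1 \<theta>2)"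
      by (simp add: sp Int_def vimage_def conj_commute)
  qed
qed

lemma xi_coeff_functional_measurable:
  "(\<lambda>f. H_inner \<theta>1 \<theta>2 f (eigfun \<theta>1 \<theta>2 k)) \<in> borel_measurable (H_borel \<theta>1 \<theta>2)"
proof (rule H_inner_measurable)
  show "eigfun \<theta>1 \<theta>2 k \<in> borel_measurable (lebesgue_on {0..1})"
    unfolding eigfun_def[abs_def] by (intro measurable_restrict_space1 measurable_completion) measurable
  fix y :: real assume y: "y \<in> {0..1}"
  have "- (\<theta>1 / (2 * \<theta>2)) * y \<le> \<bar>\<theta>1 / (2 * \<theta>2)\<bar>"
    using y unit_mult_le_abs[of y "- (\<theta>1 / (2 * \<theta>2))"] by (simp add: mult.commute)
  then have "exp (- (\<theta>1 / (2 * \<theta>2)) * y) \<le> exp \<bar>\<theta>1 / (2 * \<theta>2)\<bar>" by simp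
  moreover have "\<bar>sqrt 2 * sin (pi * real k * y)\<bar> \<le> sqrt 2 * 1" unfolding abs_mult by (intro mult_mono) auto
  ultimately have "\<bar>sqrt 2 * sin (pi * real k * y)\<bar> * exp (- (\<theta>1 / (2 * \<theta>2)) * y) \<le> (sqrt 2 * 1) * exp \<bar>\<theta>1 / (2 * \<theta>2)\<bar>"
    by (intro mult_mono) auto
  then show "\<bar>eigfun \<theta>1 \<theta>2 k y\<bar> \<le> (sqrt 2 * 1) * exp \<bar>\<theta>1 / (2 * \<theta>2)\<bar>" by (simp add: eigfun_def abs_mult)
qed

text \<open>Preimages under functions of the initial value and of the noise lie in the two generated
  sigma-algebras, whose independence is assumed.\<close>

lemma indep_initial_noise:
  assumes "prob_space M" and iv: "initial_value M \<theta>1 \<theta>2 W \<xi>"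
    and h: "h \<in> borel_measurable (H_borel \<theta>1 \<theta>2)"
    and G: "G \<in> borel_measurable (PiM ({1..} \<times> {0..}) (\<lambda>_. borel))"
    and W: "\<And>k t. k \<ge> 1 \<Longrightarrow> t \<ge> 0 \<Longrightarrow> W k t \<in> borel_measurable M"
  shows "prob_space.indep_var M borel (\<lambda>w. h (\<xi> w) :: real) borel (\<lambda>w. G (\<lambda>(k, t)\<in>{1..} \<times> {0..}. W k t w) :: real)"
proof -
  interpret prob_space M by fact
  let ?W = "\<lambda>w. \<lambda>(k, t)\<in>{1..} \<times> {0..}. W k t w"
  let ?P = "PiM ({1..} \<times> {0..}) (\<lambda>_. borel) :: (nat \<times> real \<Rightarrow> real) measure"
  have xim: "\<xi> \<in> measurable M (H_borel \<theta>1 \<theta>2)" using iv by (simp add: initial_value_def)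
  have Wm: "?W \<in> measurable M ?P" by (rule measurable_restrict) (use W in auto)
  have ind: "indep_set (sets (vimage_algebra (space M) \<xi> (H_borel \<theta>1 \<theta>2))) (sets (vimage_algebra (space M) ?W ?P))"
    using iv by (simp add: initial_value_def)
  have s1: "sigma_sets (space M) {(\<lambda>w. h (\<xi> w)) -` A \<inter> space M |A. A \<in> sets borel} \<subseteq> sets (vimage_algebra (space M) \<xi> (H_borel \<theta>1 \<theta>2))"
  proof -
    have f: "\<xi> \<in> space M \<rightarrow> space (H_borel \<theta>1 \<theta>2)" using measurable_space[OF xim] by auto
    have "(\<lambda>w. h (\<xi> w)) \<in> borel_measurable (vimage_algebra (space M) \<xi> (H_borel \<theta>1 \<theta>2))"
      using measurable_comp[OF measurable_vimage_algebra1[OF f] h] by (simp add: comp_def)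
    from measurable_sets[OF this] show ?thesis
      by (intro sets.sigma_sets_subset[of _ "vimage_algebra (space M) \<xi> (H_borel \<theta>1 \<theta>2)", unfolded space_vimage_algebra]) auto
  qed
  have s2: "sigma_sets (space M) {(\<lambda>w. G (?W w)) -` A \<inter> space M |A. A \<in> sets borel} \<subseteq> sets (vimage_algebra (space M) ?W ?P)"
  proof -
    have f: "?W \<in> space M \<rightarrow> space ?P" using measurable_space[OF Wm] by auto
    have "(\<lambda>w. G (?W w)) \<in> borel_measurable (vimage_algebra (space M) ?W ?P)"
      using measurable_comp[OF measurable_vimage_algebra1[OF f] G] by (simp add: comp_def)
    from measurable_sets[OF this] show ?thesis
      by (intro sets.sigma_sets_subset[of _ "vimage_algebra (space M) ?W ?P", unfolded space_vimage_algebra]) auto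
  qed
  have "indep_set (sigma_sets (space M) {(\<lambda>w. h (\<xi> w)) -` A \<inter> space M |A. A \<in> sets borel})
     (sigma_sets (space M) {(\<lambda>w. G (?W w)) -` A \<inter> space M |A. A \<in> sets borel})" unfolding indep_set_def
    by (rule indep_sets_mono_sets[OF ind[unfolded indep_set_def]]) (use s1 s2 in \<open>auto split: bool.split\<close>)
  then show ?thesis unfolding indep_var_eq using measurable_comp[OF Wm G] measurable_comp[OF xim h] by (simp add: comp_def)
qed

section \<open>Products of square integrable functions and their limits\<close>

lemma square_integrable_mult:
  fixes f g :: "'a \<Rightarrow> real"
  assumes [measurable]: "f \<in> borel_measurable M" "g \<in> borel_measurable M"
    and i: "integrable M (\<lambda>x. (f x)\<^sup>2)" "integrable M (\<lambda>x. (g x)\<^sup>2)"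
  shows "integrable M (\<lambda>x. f x * g x)"
proof (rule Bochner_Integration.integrable_bound[OF Bochner_Integration.integrable_add[OF i]])
  show "AE x in M. norm (f x * g x) \<le> norm ((f x)\<^sup>2 + (g x)\<^sup>2)"
  proof (rule AE_I2)
    fix x
    have "\<bar>f x * g x\<bar> \<le> (f x)\<^sup>2 + (g x)\<^sup>2" using mult_le_weighted_squares[of 1 "f x" "g x"] by simp
    then show "norm (f x * g x) \<le> norm ((f x)\<^sup>2 + (g x)\<^sup>2)" by simp
  qed
qed simp

lemma square_integrable_add:
  fixes f g :: "'a \<Rightarrow> real"
  assumes [measurable]: "f \<in> borel_measurable M" "g \<in> borel_measurable M"
    and i: "integrable M (\<lambda>x. (f x)\<^sup>2)" "integrable M (\<lambda>x. (g x)\<^sup>2)"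
  shows "integrable M (\<lambda>x. (f x + g x)\<^sup>2)"
  using square_integrable_mult[OF assms] i by (simp add: power2_sum mult.assoc)

lemma L2_mult_tendsto_0:
  fixes a :: "nat \<Rightarrow> 'a \<Rightarrow> real"
  assumes [measurable]: "\<And>n. a n \<in> borel_measurable M" "b \<in> borel_measurable M"
    and ia: "\<And>n. integrable M (\<lambda>x. (a n x)\<^sup>2)" and ib: "integrable M (\<lambda>x. (b x)\<^sup>2)"
    and lim: "(\<lambda>n. \<integral>x. (a n x)\<^sup>2 \<partial>M) \<longlonglongrightarrow> 0"
  shows "(\<lambda>n. \<integral>x. a n x * b x \<partial>M) \<longlonglongrightarrow> 0"
proof (rule Lim_null_comparison)
  define A where "A n = (\<integral>x. (a n x)\<^sup>2 \<partial>M)" for n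
  define B where "B = (\<integral>x. (b x)\<^sup>2 \<partial>M)"
  \<comment> \<open>The optimal weight in Young's inequality is of the size sqrt (A n); the summand
    1 / (n + 1) keeps it positive when A n = 0.\<close>
  define \<eta> where "\<eta> n = sqrt (A n + 1 / real (Suc n))" for n
  have A0: "A n \<ge> 0" for n by (simp add: A_def)
  have eta: "\<eta> n > 0" for n using A0[of n] by (simp add: \<eta>_def add_nonneg_pos)
  have eta2: "A n \<le> \<eta> n * \<eta> n" for n using A0[of n] by (simp add: \<eta>_def)
  show "\<forall>\<^sub>F n in sequentially. norm (\<integral>x. a n x * b x \<partial>M) \<le> (\<eta> n + \<eta> n * B) / 2"
  proof (rule always_eventually, rule allI)
    fix n
    have "norm (\<integral>x. a n x * b x \<partial>M) \<le> (\<integral>x. ((a n x)\<^sup>2 / \<eta> n + \<eta> n * (b x)\<^sup>2) / 2 \<partial>M)"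
      by (rule order_trans[OF integral_norm_bound], rule integral_mono)
         (use ia ib square_integrable_mult[OF _ _ ia[of n] ib] mult_le_weighted_squares[OF eta] in auto)
    also have "\<dots> = (A n / \<eta> n + \<eta> n * B) / 2" unfolding A_def B_def using ia ib by simp
    also have "A n / \<eta> n \<le> \<eta> n" using eta[of n] eta2[of n] by (simp add: field_simps)
    finally show "norm (\<integral>x. a n x * b x \<partial>M) \<le> (\<eta> n + \<eta> n * B) / 2" by simp
  qed
  have "\<eta> \<longlonglongrightarrow> sqrt (0 + 0)" unfolding \<eta>_def[abs_def]
    by (intro tendsto_real_sqrt tendsto_add lim[folded A_def] LIMSEQ_Suc[OF lim_1_over_n])
  then have "(\<lambda>n. (\<eta> n + \<eta> n * B) / 2) \<longlonglongrightarrow> (sqrt (0 + 0) + sqrt (0 + 0) * B) / 2" by (intro tendsto_intros) auto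
  then show "(\<lambda>n. (\<eta> n + \<eta> n * B) / 2) \<longlonglongrightarrow> 0" by simp
qed

lemma L2_limit:
  fixes f :: "'a \<Rightarrow> real"
  assumes [measurable]: "\<And>n. fn n \<in> borel_measurable M" "f \<in> borel_measurable M"
    and i: "\<And>n. integrable M (\<lambda>x. (fn n x)\<^sup>2)"
    and lim: "(\<lambda>n. \<integral>\<^sup>+x. ennreal ((f x - fn n x)\<^sup>2) \<partial>M) \<longlonglongrightarrow> 0"
  shows "integrable M (\<lambda>x. (f x)\<^sup>2)" "integrable M (\<lambda>x. (f x - fn n x)\<^sup>2)"
    "(\<lambda>n. \<integral>x. (f x - fn n x)\<^sup>2 \<partial>M) \<longlonglongrightarrow> 0"
proof -
  \<comment> \<open>One member at finite distance suffices to transfer square integrability to the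
    limit f.\<close>
  obtain n0 where n0: "(\<integral>\<^sup>+x. ennreal ((f x - fn n0 x)\<^sup>2) \<partial>M) < 1"
    using order_tendstoD(2)[OF lim, of 1] by (auto simp: eventually_sequentially)
  have "integrable M (\<lambda>x. (f x - fn n0 x)\<^sup>2)" by (rule integrableI_nonneg) (use n0 in \<open>auto intro: less_trans\<close>)
  from square_integrable_add[OF _ _ this i[of n0]] show if2: "integrable M (\<lambda>x. (f x)\<^sup>2)" by simp
  have i2: "integrable M (\<lambda>x. (f x - fn n x)\<^sup>2)" for n
    using square_integrable_add[of f M "\<lambda>x. - fn n x"] if2 i by simp
  show "integrable M (\<lambda>x. (f x - fn n x)\<^sup>2)" by (rule i2)
  have "(\<lambda>n. ennreal (\<integral>x. (f x - fn n x)\<^sup>2 \<partial>M)) \<longlonglongrightarrow> ennreal 0"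
    using lim by (simp add: nn_integral_eq_integral[OF i2])
  then show "(\<lambda>n. \<integral>x. (f x - fn n x)\<^sup>2 \<partial>M) \<longlonglongrightarrow> 0"
    by (subst (asm) tendsto_ennreal_iff) auto
qed

text \<open>Writes fn gn as f g minus two mixed terms plus the product of the errors. The mixed
  terms vanish by \<open>L2_mult_tendsto_0\<close>, the last one by Young's inequality.\<close>

lemma L2_product_limit:
  fixes f g :: "'a \<Rightarrow> real"
  assumes [measurable]: "\<And>n. fn n \<in> borel_measurable M" "f \<in> borel_measurable M" "\<And>n. gn n \<in> borel_measurable M" "g \<in> borel_measurable M"
    and i: "\<And>n. integrable M (\<lambda>x. (fn n x)\<^sup>2)" "\<And>n. integrable M (\<lambda>x. (gn n x)\<^sup>2)"
    and lim: "(\<lambda>n. \<integral>\<^sup>+x. ennreal ((f x - fn n x)\<^sup>2) \<partial>M) \<longlonglongrightarrow> 0" "(\<lambda>n. \<integral>\<^sup>+x. ennreal ((g x - gn n x)\<^sup>2) \<partial>M) \<longlonglongrightarrow> 0"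
  shows "(\<lambda>n. \<integral>x. fn n x * gn n x \<partial>M) \<longlonglongrightarrow> (\<integral>x. f x * g x \<partial>M)"
proof -
  note F = L2_limit[OF assms(1,2) i(1) lim(1)] and G = L2_limit[OF assms(3,4) i(2) lim(2)]
  have 1: "(\<lambda>n. \<integral>x. (f x - fn n x) * g x \<partial>M) \<longlonglongrightarrow> 0"
    by (rule L2_mult_tendsto_0) (use F G in auto)
  have 2: "(\<lambda>n. \<integral>x. (g x - gn n x) * f x \<partial>M) \<longlonglongrightarrow> 0"
    by (rule L2_mult_tendsto_0) (use F G in auto)
  have 3: "(\<lambda>n. \<integral>x. (f x - fn n x) * (g x - gn n x) \<partial>M) \<longlonglongrightarrow> 0"
  proof (rule Lim_null_comparison)
    have "norm (\<integral>x. (f x - fn n x) * (g x - gn n x) \<partial>M) \<le> (\<integral>x. ((f x - fn n x)\<^sup>2 + (g x - gn n x)\<^sup>2) / 2 \<partial>M)" for n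
      by (rule order_trans[OF integral_norm_bound], rule integral_mono)
         (use F(2)[of n] G(2)[of n] square_integrable_mult[OF _ _ F(2) G(2)] mult_le_weighted_squares[of 1] in auto)
    then show "\<forall>\<^sub>F n in sequentially. norm (\<integral>x. (f x - fn n x) * (g x - gn n x) \<partial>M) \<le> ((\<integral>x. (f x - fn n x)\<^sup>2 \<partial>M) + (\<integral>x. (g x - gn n x)\<^sup>2 \<partial>M)) / 2"
      using F(2) G(2) by (intro always_eventually allI) simp
    have "(\<lambda>n. ((\<integral>x. (f x - fn n x)\<^sup>2 \<partial>M) + (\<integral>x. (g x - gn n x)\<^sup>2 \<partial>M)) / 2) \<longlonglongrightarrow> (0 + 0) / 2"
      by (intro tendsto_intros F(3) G(3)) auto
    then show "(\<lambda>n. ((\<integral>x. (f x - fn n x)\<^sup>2 \<partial>M) + (\<integral>x. (g x - gn n x)\<^sup>2 \<partial>M)) / 2) \<longlonglongrightarrow> 0" by simp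
  qed
  have "(\<integral>x. fn n x * gn n x \<partial>M) = (\<integral>x. f x * g x \<partial>M) - (\<integral>x. (f x - fn n x) * g x \<partial>M) - (\<integral>x. (g x - gn n x) * f x \<partial>M)
      + (\<integral>x. (f x - fn n x) * (g x - gn n x) \<partial>M)" for n
  proof -
    have a: "integrable M (\<lambda>x. f x * g x)" "integrable M (\<lambda>x. (f x - fn n x) * g x)" "integrable M (\<lambda>x. (g x - gn n x) * f x)"
      "integrable M (\<lambda>x. (f x - fn n x) * (g x - gn n x))" by (intro square_integrable_mult F G; measurable)+
    have "(\<integral>x. fn n x * gn n x \<partial>M) = (\<integral>x. f x * g x - (f x - fn n x) * g x - (g x - gn n x) * f x + (f x - fn n x) * (g x - gn n x) \<partial>M)"
      by (intro Bochner_Integration.integral_cong refl) (simp add: algebra_simps)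
    then show ?thesis using a by (simp only: Bochner_Integration.integral_add Bochner_Integration.integral_diff Bochner_Integration.integrable_diff)
  qed
  then show ?thesis
    using tendsto_add[OF tendsto_diff[OF tendsto_diff[OF tendsto_const 1] 2] 3, of "\<integral>x. f x * g x \<partial>M"] by simp
qed

section \<open>The isometry for Wiener integrals and the covariances of the modes\<close>

definition admissible_steps :: "real \<Rightarrow> real \<Rightarrow> (real \<times> real \<times> real) list \<Rightarrow> bool" where
  "admissible_steps a b S \<longleftrightarrow> (\<forall>(c, u, v)\<in>set S. a \<le> u \<and> u \<le> v \<and> v \<le> b)"

lemma step_fun_Cons: "step_fun ((c, u, v) # S) s = c * indicator {u<..v} s + step_fun S s"
  by (simp add: step_fun_def)

lemma step_integral_Cons: "step_integral W ((c, u, v) # S) w = c * (W v w - W u w) + step_integral W S w"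
  by (simp add: step_integral_def)

lemma step_fun_Nil [simp]: "step_fun [] s = 0" by (simp add: step_fun_def)
lemma step_integral_Nil [simp]: "step_integral W [] w = 0" by (simp add: step_integral_def)

lemma step_fun_measurable [measurable]: "step_fun S \<in> borel_measurable borel"
proof (induction S)
  case Nil then show ?case by (simp add: step_fun_def[abs_def])
next
  case (Cons x S)
  obtain c u v where x: "x = (c, u, v)" by (cases x)
  show ?case unfolding x step_fun_Cons[abs_def] using Cons by measurable
qed

lemma step_fun_outside: "admissible_steps a b S \<Longrightarrow> s \<notin> {a..b} \<Longrightarrow> step_fun S s = 0"
proof (induction S)
  case (Cons x S)
  obtain c u v where x: "x = (c, u, v)" by (cases x)
  show ?case using Cons unfolding x step_fun_Cons by (auto simp: admissible_steps_def indicator_def)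
qed simp

text \<open>The Ito isometry for two step functions. It is stated as the existence of a common value
  r, which makes a double induction over the lists of steps possible without a closed
  formula.\<close>

lemma step_product_isometry:
  assumes "prob_space M" and bm: "standard_brownian_motion M W"
    and S: "admissible_steps 0 b S" and S': "admissible_steps 0 b' S'"
  shows "\<exists>r. has_bochner_integral lebesgue (\<lambda>s. step_fun S s * step_fun S' s) r \<and>
     has_bochner_integral M (\<lambda>w. step_integral W S w * step_integral W S' w) r"
proof -
  have single: "\<exists>r. has_bochner_integral lebesgue (\<lambda>s. (c * indicator {u<..v} s) * (c' * indicator {u'<..v'} s)) r \<and>
     has_bochner_integral M (\<lambda>w. (c * (W v w - W u w)) * (c' * (W v' w - W u' w))) r"
    if uv: "0 \<le> u" "u \<le> v" "0 \<le> u'" "u' \<le> v'" for c c' u v u' v'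
  proof -
    define r where "r = (\<bar>v - u'\<bar> + \<bar>u - v'\<bar> - \<bar>v - v'\<bar> - \<bar>u - u'\<bar>) / 2"
    have em: "emeasure lborel {x<..y::real} < \<infinity>" for x y by (cases "x \<le> y") auto
    have "has_bochner_integral lebesgue (indicator ({u<..v} \<inter> {u'<..v'})) (measure lebesgue ({u<..v} \<inter> {u'<..v'}))"
      by (rule has_bochner_integral_real_indicator) (use em in \<open>auto simp: Int_greaterThanAtMost\<close>)
    \<comment> \<open>The length of the overlap of two intervals agrees with the expression from
      \<open>bm_increment_product\<close>.\<close>
    also have "measure lebesgue ({u<..v} \<inter> {u'<..v'}) = r"
      using uv by (auto simp: Int_greaterThanAtMost r_def max_def min_def abs_if field_simps)
    finally have "has_bochner_integral lebesgue (\<lambda>s. (c * c') * indicator ({u<..v} \<inter> {u'<..v'}) s) ((c * c') * r)"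
      by (rule has_bochner_integral_mult_right)
    then have 1: "has_bochner_integral lebesgue (\<lambda>s. (c * indicator {u<..v} s) * (c' * indicator {u'<..v'} s)) ((c * c') * r)"
      by (simp only: indicator_inter_arith mult_ac)
    have "has_bochner_integral M (\<lambda>w. (c * c') * ((W v w - W u w) * (W v' w - W u' w))) ((c * c') * r)"
      unfolding r_def using uv by (intro has_bochner_integral_mult_right bm_increment_product[OF assms(1) bm]) auto
    with 1 show ?thesis by (auto simp: mult_ac)
  qed
  have row: "\<exists>r. has_bochner_integral lebesgue (\<lambda>s. (c * indicator {u<..v} s) * step_fun S' s) r \<and>
     has_bochner_integral M (\<lambda>w. (c * (W v w - W u w)) * step_integral W S' w) r"
    if uv: "0 \<le> u" "u \<le> v" for c u v using S'
  proof (induction S')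
    case Nil
    show ?case by (auto intro!: exI[of _ 0] has_bochner_integral_zero)
  next
    case (Cons x S')
    obtain c' u' v' where x: "x = (c', u', v')" by (cases x)
    have uv': "0 \<le> u'" "u' \<le> v'" using Cons.prems by (auto simp: admissible_steps_def x)
    obtain r1 where r1: "has_bochner_integral lebesgue (\<lambda>s. (c * indicator {u<..v} s) * (c' * indicator {u'<..v'} s)) r1"
       "has_bochner_integral M (\<lambda>w. (c * (W v w - W u w)) * (c' * (W v' w - W u' w))) r1" using single[OF uv uv'] by blast
    have "admissible_steps 0 b' S'" using Cons.prems by (simp add: admissible_steps_def)
    then obtain r2 where r2: "has_bochner_integral lebesgue (\<lambda>s. (c * indicator {u<..v} s) * step_fun S' s) r2"
       "has_bochner_integral M (\<lambda>w. (c * (W v w - W u w)) * step_integral W S' w) r2" using Cons.IH by blast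
    show ?case unfolding x step_fun_Cons step_integral_Cons distrib_left
      using has_bochner_integral_add[OF r1(1) r2(1)] has_bochner_integral_add[OF r1(2) r2(2)] by blast
  qed
  show ?thesis using S
  proof (induction S)
    case Nil
    show ?case by (auto intro!: exI[of _ 0] has_bochner_integral_zero)
  next
    case (Cons x S)
    obtain c u v where x: "x = (c, u, v)" by (cases x)
    have uv: "0 \<le> u" "u \<le> v" using Cons.prems by (auto simp: admissible_steps_def x)
    obtain r1 where r1: "has_bochner_integral lebesgue (\<lambda>s. (c * indicator {u<..v} s) * step_fun S' s) r1"
       "has_bochner_integral M (\<lambda>w. (c * (W v w - W u w)) * step_integral W S' w) r1" using row[OF uv] by blast
    have "admissible_steps 0 b S" using Cons.prems by (simp add: admissible_steps_def)
    then obtain r2 where r2: "has_bochner_integral lebesgue (\<lambda>s. step_fun S s * step_fun S' s) r2"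
       "has_bochner_integral M (\<lambda>w. step_integral W S w * step_integral W S' w) r2" using Cons.IH by blast
    show ?case unfolding x step_fun_Cons step_integral_Cons distrib_right
      using has_bochner_integral_add[OF r1(1) r2(1)] has_bochner_integral_add[OF r1(2) r2(2)] by blast
  qed
qed

lemma step_integral_measurable:
  assumes bm: "standard_brownian_motion M W" and S: "admissible_steps 0 b S"
  shows "step_integral W S \<in> borel_measurable M"
  using S
proof (induction S)
  case Nil then show ?case by (simp add: step_integral_def[abs_def])
next
  case (Cons x S)
  obtain c u v where x: "x = (c, u, v)" by (cases x)
  have uv: "0 \<le> u" "0 \<le> v" using Cons.prems by (auto simp: admissible_steps_def x)
  have "step_integral W S \<in> borel_measurable M" using Cons by (simp add: admissible_steps_def)
  then show ?case unfolding x step_integral_Cons[abs_def] using bm_measurable[OF bm uv(1)] bm_measurable[OF bm uv(2)] by measurable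
qed

lemma step_integral_square_integrable:
  assumes "prob_space M" "standard_brownian_motion M W" "admissible_steps 0 b S"
  shows "integrable M (\<lambda>w. (step_integral W S w)\<^sup>2)" "integrable lebesgue (\<lambda>s. (step_fun S s)\<^sup>2)"
  using step_product_isometry[OF assms assms(3)] by (auto simp: has_bochner_integral_iff power2_eq_square)

text \<open>The integrand is extended by 0 outside \<open>{0..t}\<close>, so that integrals with
  different horizons are compared on the same measure space.\<close>

lemma wiener_integralE:
  assumes "has_wiener_integral M W f 0 t I"
  obtains S where "\<And>n. admissible_steps 0 t (S n)" "I \<in> borel_measurable M"
    "(\<lambda>s. indicator {0..t} s * f s) \<in> borel_measurable lebesgue"
    "(\<lambda>n. \<integral>\<^sup>+s. ennreal ((indicator {0..t} s * f s - step_fun (S n) s)\<^sup>2) \<partial>lebesgue) \<longlonglongrightarrow> 0"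
    "(\<lambda>n. \<integral>\<^sup>+w. ennreal ((I w - step_integral W (S n) w)\<^sup>2) \<partial>M) \<longlonglongrightarrow> 0"
proof -
  obtain S where S: "\<And>n. admissible_steps 0 t (S n)"
    and l: "(\<lambda>n. \<integral>\<^sup>+s. ennreal ((f s - step_fun (S n) s)\<^sup>2) \<partial>lebesgue_on {0..t}) \<longlonglongrightarrow> 0"
    "(\<lambda>n. \<integral>\<^sup>+w. ennreal ((I w - step_integral W (S n) w)\<^sup>2) \<partial>M) \<longlonglongrightarrow> 0"
    and m: "I \<in> borel_measurable M" "f \<in> borel_measurable (lebesgue_on {0..t})"
    using assms unfolding has_wiener_integral_def admissible_steps_def by blast
  have "(\<integral>\<^sup>+s. ennreal ((f s - step_fun (S n) s)\<^sup>2) \<partial>lebesgue_on {0..t}) =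
     (\<integral>\<^sup>+s. ennreal ((indicator {0..t} s * f s - step_fun (S n) s)\<^sup>2) \<partial>lebesgue)" for n
  proof (subst nn_integral_restrict_space)
    show "(\<integral>\<^sup>+s. ennreal ((f s - step_fun (S n) s)\<^sup>2) * indicator {0..t} s \<partial>lebesgue) =
      (\<integral>\<^sup>+s. ennreal ((indicator {0..t} s * f s - step_fun (S n) s)\<^sup>2) \<partial>lebesgue)"
      by (intro nn_integral_cong) (use step_fun_outside[OF S] in \<open>auto simp: indicator_def\<close>)
  qed auto
  with l(1) have l1: "(\<lambda>n. \<integral>\<^sup>+s. ennreal ((indicator {0..t} s * f s - step_fun (S n) s)\<^sup>2) \<partial>lebesgue) \<longlonglongrightarrow> 0" by simp
  have "(\<lambda>s. indicator {0..t} s *\<^sub>R f s) \<in> borel_measurable lebesgue"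
    using m(2) by (subst (asm) borel_measurable_restrict_space_iff) auto
  then show thesis using that[OF S m(1) _ l1 l(2)] by simp
qed

text \<open>Both sides of the isometry for step functions are products of sequences converging in
  mean square, hence the isometry passes to the limit.\<close>

lemma wiener_integral_product:
  assumes "prob_space M" and bm: "standard_brownian_motion M W"
    and I: "has_wiener_integral M W f 0 t I" and I': "has_wiener_integral M W f' 0 t' I'"
  shows "integrable M (\<lambda>w. (I w)\<^sup>2)"
    and "(\<integral>w. I w * I' w \<partial>M) = (\<integral>s. (indicator {0..t} s * f s) * (indicator {0..t'} s * f' s) \<partial>lebesgue)"
proof -
  interpret prob_space M by fact
  obtain S where S: "\<And>n. admissible_steps 0 t (S n)" and mI[measurable]: "I \<in> borel_measurable M"
    and mf[measurable]: "(\<lambda>s. indicator {0..t} s * f s) \<in> borel_measurable lebesgue"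
    and lf: "(\<lambda>n. \<integral>\<^sup>+s. ennreal ((indicator {0..t} s * f s - step_fun (S n) s)\<^sup>2) \<partial>lebesgue) \<longlonglongrightarrow> 0"
    and lI: "(\<lambda>n. \<integral>\<^sup>+w. ennreal ((I w - step_integral W (S n) w)\<^sup>2) \<partial>M) \<longlonglongrightarrow> 0"
    using wiener_integralE[OF I] by blast
  obtain S' where S': "\<And>n. admissible_steps 0 t' (S' n)" and mI'[measurable]: "I' \<in> borel_measurable M"
    and mf'[measurable]: "(\<lambda>s. indicator {0..t'} s * f' s) \<in> borel_measurable lebesgue"
    and lf': "(\<lambda>n. \<integral>\<^sup>+s. ennreal ((indicator {0..t'} s * f' s - step_fun (S' n) s)\<^sup>2) \<partial>lebesgue) \<longlonglongrightarrow> 0"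
    and lI': "(\<lambda>n. \<integral>\<^sup>+w. ennreal ((I' w - step_integral W (S' n) w)\<^sup>2) \<partial>M) \<longlonglongrightarrow> 0"
    using wiener_integralE[OF I'] by blast
  note sq = step_integral_square_integrable[OF assms(1) bm]
  note ms = step_integral_measurable[OF bm]
  have msf: "step_fun T \<in> borel_measurable lebesgue" for T by (intro measurable_completion) simp
  show "integrable M (\<lambda>w. (I w)\<^sup>2)" by (rule L2_limit(1)[OF ms[OF S] mI sq(1)[OF S] lI])
  have 1: "(\<lambda>n. \<integral>w. step_integral W (S n) w * step_integral W (S' n) w \<partial>M) \<longlonglongrightarrow> (\<integral>w. I w * I' w \<partial>M)"
    by (rule L2_product_limit[OF ms[OF S] mI ms[OF S'] mI' sq(1)[OF S] sq(1)[OF S'] lI lI'])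
  have 2: "(\<lambda>n. \<integral>s. step_fun (S n) s * step_fun (S' n) s \<partial>lebesgue) \<longlonglongrightarrow> (\<integral>s. (indicator {0..t} s * f s) * (indicator {0..t'} s * f' s) \<partial>lebesgue)"
    by (rule L2_product_limit[OF msf mf msf mf' sq(2)[OF S] sq(2)[OF S'] lf lf'])
  have "(\<integral>w. step_integral W (S n) w * step_integral W (S' n) w \<partial>M) = (\<integral>s. step_fun (S n) s * step_fun (S' n) s \<partial>lebesgue)" for n
    using step_product_isometry[OF assms(1) bm S[of n] S'[of n]] by (auto simp: has_bochner_integral_iff)
  then show "(\<integral>w. I w * I' w \<partial>M) = (\<integral>s. (indicator {0..t} s * f s) * (indicator {0..t'} s * f' s) \<partial>lebesgue)"
    using LIMSEQ_unique[OF 1] 2 by simp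
qed

text \<open>The product of the kernels is supported on [0, min t t'], and t + t' - 2 min t t' = |t -
  t'|.\<close>

lemma exp_kernel_integral:
  fixes \<mu> \<sigma> t t' :: real
  assumes "\<mu> \<noteq> 0" "0 \<le> t" "0 \<le> t'"
  shows "(\<integral>s. (indicator {0..t} s * (exp (- \<mu> * (t - s)) * \<sigma>)) * (indicator {0..t'} s * (exp (- \<mu> * (t' - s)) * \<sigma>)) \<partial>lebesgue)
     = \<sigma>\<^sup>2 * (exp (- \<mu> * \<bar>t - t'\<bar>) - exp (- \<mu> * (t + t'))) / (2 * \<mu>)"
proof -
  define r where "r = min t t'"
  have r: "0 \<le> r" using assms by (simp add: r_def)
  define F where "F s = \<sigma>\<^sup>2 * exp (- \<mu> * (t + t' - 2 * s)) / (2 * \<mu>)" for s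
  have "(\<integral>s. (indicator {0..t} s * (exp (- \<mu> * (t - s)) * \<sigma>)) * (indicator {0..t'} s * (exp (- \<mu> * (t' - s)) * \<sigma>)) \<partial>lebesgue)
     = (\<integral>s. (indicator {0..t} s * (exp (- \<mu> * (t - s)) * \<sigma>)) * (indicator {0..t'} s * (exp (- \<mu> * (t' - s)) * \<sigma>)) \<partial>lborel)"
    by (rule integral_completion) measurable
  also have "\<dots> = (\<integral>s. indicator {0..r} s *\<^sub>R (\<sigma>\<^sup>2 * exp (- \<mu> * (t + t' - 2 * s))) \<partial>lborel)"
    by (intro Bochner_Integration.integral_cong refl)
       (auto simp: indicator_def r_def power2_eq_square algebra_simps simp flip: exp_add)
  also have "\<dots> = F r - F 0"
  proof (rule integral_FTC_Icc[OF r])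
    fix s
    have "(F has_real_derivative \<sigma>\<^sup>2 * exp (- \<mu> * (t + t' - 2 * s))) (at s)"
      unfolding F_def using assms by (auto intro!: derivative_eq_intros)
    then show "(F has_vector_derivative \<sigma>\<^sup>2 * exp (- \<mu> * (t + t' - 2 * s))) (at s within {0..r})"
      by (simp add: has_real_derivative_iff_has_vector_derivative has_vector_derivative_at_within)
  qed (intro continuous_intros)
  also have "t + t' - 2 * r = \<bar>t - t'\<bar>" by (auto simp: r_def min_def abs_if)
  then have "F r - F 0 = \<sigma>\<^sup>2 * (exp (- \<mu> * \<bar>t - t'\<bar>) - exp (- \<mu> * (t + t'))) / (2 * \<mu>)"
    by (simp add: F_def diff_divide_distrib right_diff_distrib)
  finally show ?thesis .
qed

lemma bm_independent_product:
  assumes "prob_space M" and bm: "indep_brownian_motions M W"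
    and k: "1 \<le> k" "1 \<le> k'" "k \<noteq> k'" and uv: "0 \<le> u" "u \<le> v" "0 \<le> u'" "u' \<le> v'"
  shows "has_bochner_integral M (\<lambda>w. (W k v w - W k u w) * (W k' v' w - W k' u' w)) 0"
proof -
  define T where "T = {u, v, u', v'}"
  have T: "finite T" "T \<subseteq> {0..}" using uv by (auto simp: T_def)
  interpret prob_space M by fact
  have s: "standard_brownian_motion M (W k)" "standard_brownian_motion M (W k')" using bm k by (auto simp: indep_brownian_motions_def)
  let ?X = "\<lambda>w. W k v w - W k u w" and ?Y = "\<lambda>w. W k' v' w - W k' u' w"
  have mX: "?X \<in> borel_measurable M" "?Y \<in> borel_measurable M"
    using bm_measurable[OF s(1)] bm_measurable[OF s(2)] uv by (auto intro!: borel_measurable_diff)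
  have sq: "integrable M (\<lambda>w. (?X w)\<^sup>2)" "integrable M (\<lambda>w. (?Y w)\<^sup>2)"
    using bm_increment_square[OF assms(1) s(1), of u v] bm_increment_square[OF assms(1) s(2), of u' v'] uv
    by (auto simp: has_bochner_integral_iff)
  have i: "integrable M ?X" "integrable M ?Y" using expectation_abs_le_sqrt(1)[OF mX(1) sq(1)] expectation_abs_le_sqrt(1)[OF mX(2) sq(2)] .
  have mean: "(\<integral>w. W k v w - W k u w \<partial>M) = 0" if uv: "0 \<le> u" "u \<le> v" and k: "k \<ge> 1" for k u v
  proof (cases "u = v")
    case False
    have "standard_brownian_motion M (W k)" using bm k by (auto simp: indep_brownian_motions_def)
    then have "distributed M lborel (\<lambda>w. W k v w - W k u w) (\<lambda>x. ennreal (normal_density 0 (sqrt (v - u)) x))"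
      using uv False unfolding standard_brownian_motion_def by auto
    from normal_distributed_expectation[OF _ this] show ?thesis using uv False by simp
  qed simp
  have "indep_var borel ?X borel ?Y"
  proof -
    have "indep_var (PiM {k} (\<lambda>_. PiM {0..} (\<lambda>_. borel))) (\<lambda>w. \<lambda>i\<in>{k}. bm_path (W i) w)
        (PiM {k'} (\<lambda>_. PiM {0..} (\<lambda>_. borel))) (\<lambda>w. \<lambda>i\<in>{k'}. bm_path (W i) w)"
      by (rule indep_var_restrict[OF indep_bm_paths[OF bm]]) (use k in auto)
    note iv = this
    have m: "(\<lambda>f. f k t :: real) \<in> borel_measurable (PiM {k} (\<lambda>_. PiM {0..} (\<lambda>_. borel)))" if "0 \<le> t" for k :: nat and t :: real
      by (rule measurable_compose[OF measurable_component_singleton[of k] measurable_component_singleton[of t]]) (use that in auto)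
    have m1: "(\<lambda>f. f k v - f k u :: real) \<in> borel_measurable (PiM {k} (\<lambda>_. PiM {0..} (\<lambda>_. borel)))"
      using uv by (intro borel_measurable_diff m) auto
    have m2: "(\<lambda>f. f k' v' - f k' u' :: real) \<in> borel_measurable (PiM {k'} (\<lambda>_. PiM {0..} (\<lambda>_. borel)))"
      using uv by (intro borel_measurable_diff m) auto
    from indep_var_compose[OF iv m1 m2]
    show ?thesis using uv by (simp add: comp_def bm_path_def)
  qed
  from indep_var_lebesgue_integral[OF this i] indep_var_integrable[OF this i] mean[OF uv(1,2) k(1)] mean[OF uv(3,4) k(2)]
  show ?thesis by (simp add: has_bochner_integral_iff)
qed

lemma step_product_independent:
  assumes "prob_space M" and bm: "indep_brownian_motions M W"
    and k: "1 \<le> k" "1 \<le> k'" "k \<noteq> k'"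
    and S: "admissible_steps 0 b S" and S': "admissible_steps 0 b' S'"
  shows "has_bochner_integral M (\<lambda>w. step_integral (W k) S w * step_integral (W k') S' w) 0"
proof -
  have row: "has_bochner_integral M (\<lambda>w. (c * (W k v w - W k u w)) * step_integral (W k') S' w) 0"
    if uv: "0 \<le> u" "u \<le> v" for c u v using S'
  proof (induction S')
    case Nil
    show ?case by (simp add: has_bochner_integral_zero)
  next
    case (Cons x S')
    obtain c' u' v' where x: "x = (c', u', v')" by (cases x)
    have uv': "0 \<le> u'" "u' \<le> v'" using Cons.prems by (auto simp: admissible_steps_def x)
    have "has_bochner_integral M (\<lambda>w. (c * c') * ((W k v w - W k u w) * (W k' v' w - W k' u' w))) ((c * c') * 0)"
      by (intro has_bochner_integral_mult_right bm_independent_product[OF assms(1) bm k uv uv'])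
    then have r1: "has_bochner_integral M (\<lambda>w. (c * (W k v w - W k u w)) * (c' * (W k' v' w - W k' u' w))) 0" by (simp add: mult_ac)
    have "admissible_steps 0 b' S'" using Cons.prems by (simp add: admissible_steps_def)
    from has_bochner_integral_add[OF r1 Cons.IH[OF this]]
    show ?case unfolding x step_integral_Cons distrib_left by simp
  qed
  show ?thesis using S
  proof (induction S)
    case Nil
    show ?case by (simp add: has_bochner_integral_zero)
  next
    case (Cons x S)
    obtain c u v where x: "x = (c, u, v)" by (cases x)
    have uv: "0 \<le> u" "u \<le> v" using Cons.prems by (auto simp: admissible_steps_def x)
    have "admissible_steps 0 b S" using Cons.prems by (simp add: admissible_steps_def)
    from has_bochner_integral_add[OF row[OF uv] Cons.IH[OF this]]
    show ?case unfolding x step_integral_Cons distrib_right by simp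
  qed
qed

lemma wiener_integral_exp_cov:
  assumes "prob_space M" and bm: "indep_brownian_motions M W"
    and k: "1 \<le> k" "1 \<le> k'" and \<mu>: "\<And>k. k \<ge> 1 \<Longrightarrow> \<mu> k \<noteq> 0" and t: "0 \<le> t" "0 \<le> t'"
    and I: "has_wiener_integral M (W k) (\<lambda>s. exp (- \<mu> k * (t - s)) * \<sigma>) 0 t I"
    and I': "has_wiener_integral M (W k') (\<lambda>s. exp (- \<mu> k' * (t' - s)) * \<sigma>) 0 t' I'"
  shows "has_bochner_integral M (\<lambda>w. I w * I' w)
     (if k = k' then \<sigma>\<^sup>2 * (exp (- \<mu> k * \<bar>t - t'\<bar>) - exp (- \<mu> k * (t + t'))) / (2 * \<mu> k) else 0)"
proof -
  have sbm: "standard_brownian_motion M (W k)" "standard_brownian_motion M (W k')" using bm k by (auto simp: indep_brownian_motions_def)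
  have m: "I \<in> borel_measurable M" "I' \<in> borel_measurable M" using I I' by (auto simp: has_wiener_integral_def)
  have i: "integrable M (\<lambda>w. I w * I' w)"
    by (rule square_integrable_mult[OF m wiener_integral_product(1)[OF assms(1) sbm(1) I I] wiener_integral_product(1)[OF assms(1) sbm(2) I' I']])
  show ?thesis
  proof (cases "k = k'")
    case True
    have "(\<integral>w. I w * I' w \<partial>M) = \<sigma>\<^sup>2 * (exp (- \<mu> k * \<bar>t - t'\<bar>) - exp (- \<mu> k * (t + t'))) / (2 * \<mu> k)"
      using wiener_integral_product(2)[OF assms(1) sbm(1) I] I' exp_kernel_integral[OF \<mu>[OF k(1)] t] True by simp
    then show ?thesis using i True by (simp add: has_bochner_integral_iff)
  next
    case False
    obtain S where S: "\<And>n. admissible_steps 0 t (S n)"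
      and lI: "(\<lambda>n. \<integral>\<^sup>+w. ennreal ((I w - step_integral (W k) (S n) w)\<^sup>2) \<partial>M) \<longlonglongrightarrow> 0"
      using wiener_integralE[OF I] by blast
    obtain S' where S': "\<And>n. admissible_steps 0 t' (S' n)"
      and lI': "(\<lambda>n. \<integral>\<^sup>+w. ennreal ((I' w - step_integral (W k') (S' n) w)\<^sup>2) \<partial>M) \<longlonglongrightarrow> 0"
      using wiener_integralE[OF I'] by blast
    have "(\<lambda>n. \<integral>w. step_integral (W k) (S n) w * step_integral (W k') (S' n) w \<partial>M) \<longlonglongrightarrow> (\<integral>w. I w * I' w \<partial>M)"
      by (rule L2_product_limit[OF step_integral_measurable[OF sbm(1) S] m(1) step_integral_measurable[OF sbm(2) S'] m(2)
          step_integral_square_integrable(1)[OF assms(1) sbm(1) S] step_integral_square_integrable(1)[OF assms(1) sbm(2) S'] lI lI'])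
    moreover have "(\<integral>w. step_integral (W k) (S n) w * step_integral (W k') (S' n) w \<partial>M) = 0" for n
      using step_product_independent[OF assms(1) bm k False S S'] by (auto simp: has_bochner_integral_iff)
    ultimately have "(\<integral>w. I w * I' w \<partial>M) = 0" using LIMSEQ_unique[OF _ tendsto_const] by auto
    then show ?thesis using i False by (simp add: has_bochner_integral_iff)
  qed
qed

text \<open>Schur's test: Cauchy-Schwarz with the weights |C p r| bounds an entry of C^2 by the root
  of a row sum times a weighted column norm, and summation over p uses the row sums once more
  through symmetry.\<close>

lemma frob_rows_le:
  fixes C :: "'p \<Rightarrow> 'p \<Rightarrow> real"
  assumes fin: "finite P" and R: "\<And>p. p \<in> P \<Longrightarrow> (\<Sum>q\<in>P. \<bar>C p q\<bar>) \<le> R" and sym: "\<And>p q. p \<in> P \<Longrightarrow> q \<in> P \<Longrightarrow> C p q = C q p" and R0: "0 \<le> R"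
  shows "(\<Sum>p\<in>P. \<Sum>q\<in>P. (\<Sum>r\<in>P. C p r * C r q)\<^sup>2) \<le> R\<^sup>2 * (\<Sum>p\<in>P. \<Sum>q\<in>P. (C p q)\<^sup>2)"
proof -
  have cs: "(\<Sum>r\<in>P. C p r * C r q)\<^sup>2 \<le> R * (\<Sum>r\<in>P. \<bar>C p r\<bar> * (C r q)\<^sup>2)" if p: "p \<in> P" for p q
  proof -
    have "\<bar>\<Sum>r\<in>P. C p r * C r q\<bar> \<le> (\<Sum>r\<in>P. sqrt \<bar>C p r\<bar> * (sqrt \<bar>C p r\<bar> * \<bar>C r q\<bar>))"
      by (rule order_trans[OF sum_abs]) (simp add: abs_mult flip: mult.assoc)
    then have "(\<Sum>r\<in>P. C p r * C r q)\<^sup>2 \<le> (\<Sum>r\<in>P. sqrt \<bar>C p r\<bar> * (sqrt \<bar>C p r\<bar> * \<bar>C r q\<bar>))\<^sup>2"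
      by (rule power2_le_iff_abs_le[THEN iffD2, rotated]) (auto intro!: sum_nonneg)
    also have "\<dots> \<le> (\<Sum>r\<in>P. (sqrt \<bar>C p r\<bar>)\<^sup>2) * (\<Sum>r\<in>P. (sqrt \<bar>C p r\<bar> * \<bar>C r q\<bar>)\<^sup>2)"
      by (rule Cauchy_Schwarz_ineq_sum)
    also have "\<dots> = (\<Sum>r\<in>P. \<bar>C p r\<bar>) * (\<Sum>r\<in>P. \<bar>C p r\<bar> * (C r q)\<^sup>2)" by (simp add: power_mult_distrib)
    also have "\<dots> \<le> R * (\<Sum>r\<in>P. \<bar>C p r\<bar> * (C r q)\<^sup>2)" using R[OF p] by (intro mult_right_mono sum_nonneg) auto
    finally show ?thesis .
  qed
  have "(\<Sum>p\<in>P. \<Sum>q\<in>P. (\<Sum>r\<in>P. C p r * C r q)\<^sup>2) \<le> (\<Sum>p\<in>P. \<Sum>q\<in>P. R * (\<Sum>r\<in>P. \<bar>C p r\<bar> * (C r q)\<^sup>2))"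
    by (intro sum_mono cs)
  also have "\<dots> = R * (\<Sum>p\<in>P. \<Sum>q\<in>P. \<Sum>r\<in>P. \<bar>C p r\<bar> * (C r q)\<^sup>2)" by (simp only: sum_distrib_left)
  finally have 1: "(\<Sum>p\<in>P. \<Sum>q\<in>P. (\<Sum>r\<in>P. C p r * C r q)\<^sup>2) \<le> R * (\<Sum>p\<in>P. \<Sum>q\<in>P. \<Sum>r\<in>P. \<bar>C p r\<bar> * (C r q)\<^sup>2)" .
  have "(\<Sum>p\<in>P. \<Sum>q\<in>P. \<Sum>r\<in>P. \<bar>C p r\<bar> * (C r q)\<^sup>2) = (\<Sum>r\<in>P. (\<Sum>q\<in>P. (C r q)\<^sup>2) * (\<Sum>p\<in>P. \<bar>C r p\<bar>))"
  proof -
    have "(\<Sum>p\<in>P. \<Sum>q\<in>P. \<Sum>r\<in>P. \<bar>C p r\<bar> * (C r q)\<^sup>2) = (\<Sum>p\<in>P. \<Sum>r\<in>P. \<Sum>q\<in>P. \<bar>C p r\<bar> * (C r q)\<^sup>2)"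
      by (rule sum.cong[OF refl]) (rule sum.swap)
    also have "\<dots> = (\<Sum>r\<in>P. \<Sum>p\<in>P. \<Sum>q\<in>P. \<bar>C p r\<bar> * (C r q)\<^sup>2)" by (rule sum.swap)
    also have "\<dots> = (\<Sum>r\<in>P. (\<Sum>p\<in>P. \<bar>C p r\<bar>) * (\<Sum>q\<in>P. (C r q)\<^sup>2))"
      by (rule sum.cong[OF refl]) (simp only: sum_product)
    also have "\<dots> = (\<Sum>r\<in>P. (\<Sum>q\<in>P. (C r q)\<^sup>2) * (\<Sum>p\<in>P. \<bar>C r p\<bar>))"
      by (intro sum.cong refl) (simp add: sym mult.commute cong: sum.cong)
    finally show ?thesis .
  qed
  also have "\<dots> \<le> (\<Sum>r\<in>P. (\<Sum>q\<in>P. (C r q)\<^sup>2) * R)" by (intro sum_mono mult_left_mono R sum_nonneg) auto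
  also have "\<dots> = (\<Sum>p\<in>P. \<Sum>q\<in>P. (C p q)\<^sup>2) * R" by (simp only: sum_distrib_right)
  finally have "R * (\<Sum>p\<in>P. \<Sum>q\<in>P. \<Sum>r\<in>P. \<bar>C p r\<bar> * (C r q)\<^sup>2) \<le> R * ((\<Sum>p\<in>P. \<Sum>q\<in>P. (C p q)\<^sup>2) * R)"
    using R0 by (rule mult_left_mono)
  with 1 show ?thesis by (simp add: power2_eq_square mult_ac)
qed

text \<open>For B p q = E[A p A q] this bounds the second moment of the cross term. Each B p q is
  split into halves of the diagonal entries, and symmetry assigns the half with B q q to the row
  q.\<close>

lemma bilinear_rows_le:
  fixes C B :: "'p \<Rightarrow> 'p \<Rightarrow> real"
  assumes fin: "finite P" and R: "\<And>p. p \<in> P \<Longrightarrow> (\<Sum>q\<in>P. \<bar>C p q\<bar>) \<le> R" and sym: "\<And>p q. p \<in> P \<Longrightarrow> q \<in> P \<Longrightarrow> C p q = C q p"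
    and B: "\<And>p q. p \<in> P \<Longrightarrow> q \<in> P \<Longrightarrow> \<bar>B p q\<bar> \<le> (B p p + B q q) / 2" and B0: "\<And>p. p \<in> P \<Longrightarrow> 0 \<le> B p p"
  shows "(\<Sum>p\<in>P. \<Sum>q\<in>P. C p q * B p q) \<le> R * (\<Sum>p\<in>P. B p p)"
proof -
  have "(\<Sum>p\<in>P. \<Sum>q\<in>P. C p q * B p q) \<le> (\<Sum>p\<in>P. \<Sum>q\<in>P. \<bar>C p q\<bar> * (B p p / 2) + \<bar>C q p\<bar> * (B q q / 2))"
  proof (intro sum_mono)
    fix p q assume p: "p \<in> P" "q \<in> P"
    have "C p q * B p q \<le> \<bar>C p q\<bar> * \<bar>B p q\<bar>" by (metis abs_ge_self abs_mult)
    also have "\<dots> \<le> \<bar>C p q\<bar> * ((B p p + B q q) / 2)" by (intro mult_left_mono B p) auto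
    finally show "C p q * B p q \<le> \<bar>C p q\<bar> * (B p p / 2) + \<bar>C q p\<bar> * (B q q / 2)"
      using sym[OF p] by (simp add: algebra_simps add_divide_distrib)
  qed
  also have "\<dots> = (\<Sum>p\<in>P. \<Sum>q\<in>P. \<bar>C p q\<bar> * (B p p / 2)) + (\<Sum>q\<in>P. \<Sum>p\<in>P. \<bar>C q p\<bar> * (B q q / 2))"
    unfolding sum.distrib by (subst (3) sum.swap) simp
  also have "\<dots> = (\<Sum>p\<in>P. (\<Sum>q\<in>P. \<bar>C p q\<bar>) * B p p)"
    by (simp add: sum_distrib_right[symmetric] flip: sum_divide_distrib sum_distrib_left)
  also have "\<dots> \<le> (\<Sum>p\<in>P. R * B p p)" by (intro sum_mono mult_right_mono R B0)
  finally show ?thesis by (simp add: sum_distrib_left)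
qed

text \<open>Two approximations are combined here: the Wiener integrals are \<open>L\<^sup>2\<close>-limits of step
  integrals, which are jointly linear forms in independent standard normal increments.\<close>

lemma noise_clt_bounds:
  fixes P :: "'p set" and b :: "'p \<Rightarrow> nat \<Rightarrow> nat \<Rightarrow> real"
  assumes "prob_space M" and bm: "indep_brownian_motions M W" and iv: "initial_value M \<theta>1 \<theta>2 W \<xi>"
    and finP: "finite P" and ne: "P \<noteq> {}" and finJ: "finite J" and K: "1 \<le> K"
    and t: "\<And>i. i \<in> J \<Longrightarrow> 0 \<le> t i"
    and I: "\<And>k i. k \<in> {1..K} \<Longrightarrow> i \<in> J \<Longrightarrow> has_wiener_integral M (W k) (f k i) 0 (t i) (I k i)"
    and h: "\<And>p. p \<in> P \<Longrightarrow> h p \<in> borel_measurable (H_borel \<theta>1 \<theta>2)"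
    and h2: "\<And>p. p \<in> P \<Longrightarrow> integrable M (\<lambda>w. (h p (\<xi> w))\<^sup>2)"
  defines "U \<equiv> \<lambda>p w. \<Sum>k=1..K. \<Sum>i\<in>J. b p k i * I k i w"
  defines "A \<equiv> \<lambda>p w. h p (\<xi> w)"
  defines "cov \<equiv> \<lambda>p q. \<integral>w. U p w * U q w \<partial>M"
  shows "cov_clt_bounds M P (\<lambda>p w. U p w + A p w) cov A"
proof -
  interpret prob_space M by fact
  have sbm: "standard_brownian_motion M (W k)" if "k \<in> {1..K}" for k using bm that by (auto simp: indep_brownian_motions_def)
  define Q where "Q k i S \<longleftrightarrow> (\<forall>N. admissible_steps 0 (t i) (S N)) \<and> I k i \<in> borel_measurable M \<and>
     (\<lambda>N. \<integral>\<^sup>+w. ennreal ((I k i w - step_integral (W k) (S N) w)\<^sup>2) \<partial>M) \<longlonglongrightarrow> 0" for k i S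
  have "\<exists>S. Q k i S" if "k \<in> {1..K}" "i \<in> J" for k i unfolding Q_def by (rule wiener_integralE[OF I[OF that]]) blast
  then have QS: "Q k i (SOME S. Q k i S)" if "k \<in> {1..K}" "i \<in> J" for k i using that by (intro someI_ex[of "Q k i"]) blast
  define S where "S k i = (SOME S. Q k i S)" for k i
  have S: "\<And>k i N. k \<in> {1..K} \<Longrightarrow> i \<in> J \<Longrightarrow> admissible_steps 0 (t i) (S k i N)"
    and mI: "\<And>k i. k \<in> {1..K} \<Longrightarrow> i \<in> J \<Longrightarrow> I k i \<in> borel_measurable M"
    and lim: "\<And>k i. k \<in> {1..K} \<Longrightarrow> i \<in> J \<Longrightarrow> (\<lambda>N. \<integral>\<^sup>+w. ennreal ((I k i w - step_integral (W k) (S k i N) w)\<^sup>2) \<partial>M) \<longlonglongrightarrow> 0"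
    using QS[folded S_def] unfolding Q_def by blast+
  define X where "X N k i = step_integral (W k) (S k i N)" for N k i
  have mX: "X N k i \<in> borel_measurable M" and iX: "integrable M (\<lambda>w. (X N k i w)\<^sup>2)" if "k \<in> {1..K}" "i \<in> J" for N k i
    unfolding X_def by (rule step_integral_measurable[OF sbm S], use that in auto)
      (rule step_integral_square_integrable(1)[OF assms(1) sbm S], use that in auto)
  note L2 = L2_limit[OF mX mI iX lim[folded X_def]]
  define V where "V N p w = (\<Sum>k=1..K. \<Sum>i\<in>J. b p k i * X N k i w)" for N p w
  have mV: "V N p \<in> borel_measurable M" for N p unfolding V_def using mX by (intro borel_measurable_sum borel_measurable_times) auto
  have mU: "U p \<in> borel_measurable M" for p unfolding U_def using mI by (intro borel_measurable_sum borel_measurable_times) auto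
  have xim: "\<xi> \<in> measurable M (H_borel \<theta>1 \<theta>2)" using iv by (simp add: initial_value_def)
  have mA: "A p \<in> borel_measurable M" if "p \<in> P" for p
    unfolding A_def using measurable_comp[OF xim h[OF that]] by (simp add: comp_def)
  have iA2: "integrable M (\<lambda>w. (A p w)\<^sup>2)" if "p \<in> P" for p using h2[OF that] by (simp add: A_def)
  have iA: "integrable M (\<lambda>w. A p w * A q w)" if "p \<in> P" "q \<in> P" for p q
    by (rule square_integrable_mult[OF mA mA iA2 iA2]) (use that in auto)
  have gf: "gaussian_form M P A (V N)" for N
  proof -
    \<comment> \<open>All break points of the N-th approximations of all integrals, so that they
      become linear forms in one common family of increments.\<close>
    define T where "T = (\<Union>k\<in>{1..K}. \<Union>i\<in>J. \<Union>(c, u, v)\<in>set (S k i N). {u, v})"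
    have "finite T" unfolding T_def using finJ by (intro finite_UN_I) auto
    have "0 \<le> u \<and> 0 \<le> v" if "k \<in> {1..K}" "i \<in> J" "(c, u, v) \<in> set (S k i N)" for k i c u v
      using S[OF that(1,2), of N] that(3) unfolding admissible_steps_def by fastforce
    then have "T \<subseteq> {0..}" unfolding T_def by fast
    note T = \<open>finite T\<close> this
    obtain G :: "(nat \<times> nat) set" and g where g: "std_gaussian_family M G g"
      and gl: "\<And>l. l \<in> G \<Longrightarrow> \<exists>k\<ge>1. \<exists>u\<ge>0. \<exists>v\<ge>0. \<exists>c. g l = (\<lambda>w. (W k v w - W k u w) / c)"
      and gs: "\<And>k u v. k \<in> {1..K} \<Longrightarrow> u \<in> T \<Longrightarrow> v \<in> T \<Longrightarrow> u \<le> v \<Longrightarrow> (\<lambda>w. W k v w - W k u w) \<in> span_of M G g"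
      using grid_family[OF assms(1) bm K T] by blast
    have "X N k i \<in> span_of M G g" if k: "k \<in> {1..K}" "i \<in> J" for k i unfolding X_def
    proof (rule step_integral_in_span[where T = T])
      fix c u v assume *: "(c, u, v) \<in> set (S k i N)"
      then have "u \<in> T" "v \<in> T" unfolding T_def using k by blast+
      moreover have "u \<le> v" using S[OF k, of N] * by (auto simp: admissible_steps_def)
      ultimately show "u \<in> T \<and> v \<in> T \<and> u \<le> v" by simp
    qed (use gs k in auto)
    then have "V N p \<in> span_of M G g" for p unfolding V_def by (intro span_of_sum span_of_scale) auto
    then have "\<forall>p. \<exists>a. \<forall>w\<in>space M. V N p w = (\<Sum>l\<in>G. a l * g l w)" by (auto simp: span_of_def)
    then obtain a where a: "\<And>p w. w \<in> space M \<Longrightarrow> V N p w = (\<Sum>l\<in>G. a p l * g l w)" by metis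
    have bi: "has_bochner_integral M (\<lambda>w. (g l w * g l' w) * (A p w * A q w)) (if l = l' then \<integral>w. A p w * A q w \<partial>M else 0)"
      if l: "l \<in> G" "l' \<in> G" and p: "p \<in> P" "q \<in> P" for l l' p q
    proof -
      obtain k u v c where 1: "k \<ge> 1" "u \<ge> 0" "v \<ge> 0" "g l = (\<lambda>w. (W k v w - W k u w) / c)" using gl[OF l(1)] by blast
      obtain k' u' v' c' where 2: "k' \<ge> 1" "u' \<ge> 0" "v' \<ge> 0" "g l' = (\<lambda>w. (W k' v' w - W k' u' w) / c')" using gl[OF l(2)] by blast
      let ?W = "\<lambda>w. \<lambda>(k, t)\<in>{1..} \<times> {0..}. W k t w"
      define H where "H z = ((z (k, v) - z (k, u)) / c) * ((z (k', v') - z (k', u')) / c')" for z :: "nat \<times> real \<Rightarrow> real"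
      have mc: "(\<lambda>z. z (k, u)) \<in> borel_measurable (PiM ({1..} \<times> {0..}) (\<lambda>_. borel))" if "k \<ge> 1" "u \<ge> 0" for k :: nat and u :: real
        by (rule measurable_component_singleton) (use that in auto)
      have Hm: "H \<in> borel_measurable (PiM ({1..} \<times> {0..}) (\<lambda>_. borel))"
        unfolding H_def[abs_def] using 1 2 by (intro borel_measurable_times borel_measurable_divide borel_measurable_diff mc borel_measurable_const) auto
      have Wm: "W k t \<in> borel_measurable M" if "k \<ge> 1" "t \<ge> 0" for k t
        using bm that by (auto simp: indep_brownian_motions_def standard_brownian_motion_def)
      have "indep_var borel (\<lambda>w. (h p (\<xi> w) * h q (\<xi> w))) borel (\<lambda>w. H (?W w))"
        by (rule indep_initial_noise[OF assms(1) iv _ Hm Wm, where h = "\<lambda>x. h p x * h q x"]) (use h[OF p(1)] h[OF p(2)] in auto)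
      moreover have "H (?W w) = g l w * g l' w" for w using 1 2 by (simp add: H_def)
      ultimately have ind: "indep_var borel (\<lambda>w. A p w * A q w) borel (\<lambda>w. g l w * g l' w)" by (simp add: A_def)
      have o: "has_bochner_integral M (\<lambda>w. g l w * g l' w) (if l = l' then 1 else 0)"
        by (rule std_gaussian_family_orthonormal[OF g l])
      then have io: "integrable M (\<lambda>w. g l w * g l' w)" by (simp add: has_bochner_integral_iff)
      have "integrable M (\<lambda>w. (A p w * A q w) * (g l w * g l' w))" by (rule indep_var_integrable[OF ind iA[OF p] io])
      moreover have "(\<integral>w. (A p w * A q w) * (g l w * g l' w) \<partial>M) = (\<integral>w. A p w * A q w \<partial>M) * (\<integral>w. g l w * g l' w \<partial>M)"
        by (rule indep_var_lebesgue_integral[OF ind iA[OF p] io])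
      ultimately show ?thesis using o by (simp add: has_bochner_integral_iff mult.commute)
    qed
    show ?thesis unfolding gaussian_form_def by (intro exI[of _ G] exI[of _ g] exI[of _ a] conjI g ballI) (use a bi in auto)
  qed
  define covN where "covN N p q = (\<integral>w. V N p w * V N q w \<partial>M)" for N p q
  have covN: "(\<lambda>N. covN N p q) \<longlonglongrightarrow> cov p q" for p q
  proof -
    have e: "has_bochner_integral M (\<lambda>w. (\<Sum>k=1..K. \<Sum>i\<in>J. b p k i * Y k i w) * (\<Sum>k=1..K. \<Sum>i\<in>J. b q k i * Y k i w))
      (\<Sum>k=1..K. \<Sum>i\<in>J. \<Sum>k'=1..K. \<Sum>i'\<in>J. b p k i * b q k' i' * (\<integral>w. Y k i w * Y k' i' w \<partial>M))"
      if Y: "\<And>k i. k \<in> {1..K} \<Longrightarrow> i \<in> J \<Longrightarrow> Y k i \<in> borel_measurable M" "\<And>k i. k \<in> {1..K} \<Longrightarrow> i \<in> J \<Longrightarrow> integrable M (\<lambda>w. (Y k i w)\<^sup>2)" for Y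
    proof -
      have "has_bochner_integral M (\<lambda>w. \<Sum>k=1..K. \<Sum>i\<in>J. \<Sum>k'=1..K. \<Sum>i'\<in>J. b p k i * b q k' i' * (Y k i w * Y k' i' w))
        (\<Sum>k=1..K. \<Sum>i\<in>J. \<Sum>k'=1..K. \<Sum>i'\<in>J. b p k i * b q k' i' * (\<integral>w. Y k i w * Y k' i' w \<partial>M))"
        by (intro has_bochner_integral_sum has_bochner_integral_mult_right has_bochner_integral_integrable square_integrable_mult Y)
      moreover have "(\<Sum>k=1..K. \<Sum>i\<in>J. b p k i * Y k i w) * (\<Sum>k=1..K. \<Sum>i\<in>J. b q k i * Y k i w)
         = (\<Sum>k=1..K. \<Sum>i\<in>J. \<Sum>k'=1..K. \<Sum>i'\<in>J. b p k i * b q k' i' * (Y k i w * Y k' i' w))" for w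
        by (simp only: sum_distrib_right) (simp only: sum_distrib_left mult_ac)
      ultimately show ?thesis by simp
    qed
    have 1: "covN N p q = (\<Sum>k=1..K. \<Sum>i\<in>J. \<Sum>k'=1..K. \<Sum>i'\<in>J. b p k i * b q k' i' * (\<integral>w. X N k i w * X N k' i' w \<partial>M))" for N
      unfolding covN_def V_def using e[of "X N", OF mX iX] by (simp add: has_bochner_integral_iff)
    have 2: "cov p q = (\<Sum>k=1..K. \<Sum>i\<in>J. \<Sum>k'=1..K. \<Sum>i'\<in>J. b p k i * b q k' i' * (\<integral>w. I k i w * I k' i' w \<partial>M))"
      unfolding cov_def U_def using e[of I, OF mI L2(1)] by (simp add: has_bochner_integral_iff)
    show ?thesis unfolding 1 2
      by (intro tendsto_sum tendsto_mult tendsto_const L2_product_limit[OF mX mI mX mI iX iX lim[folded X_def] lim[folded X_def]])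
  qed
  have bnd: "cov_clt_bounds M P (\<lambda>p w. V N p w + A p w) (covN N) A" for N
    unfolding covN_def by (rule clt_bounds_gaussian_form[OF gf finP ne mA iA])
  \<comment> \<open>D dominates every squared error, hence one subsequence along which it vanishes
    serves all modes and times simultaneously.\<close>
  define D where "D N w = (\<Sum>k=1..K. \<Sum>i\<in>J. (I k i w - X N k i w)\<^sup>2)" for N w
  have iD: "integrable M (D N)" for N unfolding D_def by (intro Bochner_Integration.integrable_sum L2(2))
  have D0: "0 \<le> D N w" for N w unfolding D_def by (intro sum_nonneg) auto
  have "(\<lambda>N. \<integral>w. norm (D N w) \<partial>M) = (\<lambda>N. \<Sum>k=1..K. \<Sum>i\<in>J. \<integral>w. (I k i w - X N k i w)\<^sup>2 \<partial>M)"
  proof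
    fix N
    have "(\<integral>w. norm (D N w) \<partial>M) = (\<integral>w. D N w \<partial>M)" using D0 by simp
    also have "\<dots> = (\<Sum>k=1..K. \<integral>w. (\<Sum>i\<in>J. (I k i w - X N k i w)\<^sup>2) \<partial>M)"
      unfolding D_def by (intro Bochner_Integration.integral_sum Bochner_Integration.integrable_sum L2(2))
    also have "\<dots> = (\<Sum>k=1..K. \<Sum>i\<in>J. \<integral>w. (I k i w - X N k i w)\<^sup>2 \<partial>M)"
      by (intro sum.cong refl Bochner_Integration.integral_sum L2(2))
    finally show "(\<integral>w. norm (D N w) \<partial>M) = (\<Sum>k=1..K. \<Sum>i\<in>J. \<integral>w. (I k i w - X N k i w)\<^sup>2 \<partial>M)" .
  qed
  moreover have "(\<lambda>N. \<Sum>k=1..K. \<Sum>i\<in>J. \<integral>w. (I k i w - X N k i w)\<^sup>2 \<partial>M) \<longlonglongrightarrow> 0"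
    by (intro tendsto_null_sum L2(3))
  ultimately have "(\<lambda>N. \<integral>w. norm (D N w) \<partial>M) \<longlonglongrightarrow> 0" by simp
  from tendsto_L1_AE_subseq[OF iD this] obtain r where r: "strict_mono r" "AE w in M. (\<lambda>N. D (r N) w) \<longlonglongrightarrow> 0" by blast
  have VU: "AE w in M. (\<lambda>N. V (r N) p w + A p w) \<longlonglongrightarrow> U p w + A p w" for p using r(2)
  proof eventually_elim
    case (elim w)
    have "(\<lambda>N. X (r N) k i w) \<longlonglongrightarrow> I k i w" if k: "k \<in> {1..K}" "i \<in> J" for k i
    proof -
      have "(I k i w - X N k i w)\<^sup>2 \<le> D N w" for N
      proof -
        have "(I k i w - X N k i w)\<^sup>2 \<le> (\<Sum>i\<in>J. (I k i w - X N k i w)\<^sup>2)" using k finJ by (intro member_le_sum) auto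
        also have "\<dots> \<le> D N w" unfolding D_def
          using k by (intro member_le_sum[of k "{1..K}" "\<lambda>k. \<Sum>i\<in>J. (I k i w - X N k i w)\<^sup>2"] sum_nonneg) auto
        finally show ?thesis .
      qed
      then have "(\<lambda>N. (I k i w - X (r N) k i w)\<^sup>2) \<longlonglongrightarrow> 0"
        by (intro tendsto_sandwich[OF _ _ tendsto_const elim]) auto
      then have "(\<lambda>N. sqrt ((I k i w - X (r N) k i w)\<^sup>2)) \<longlonglongrightarrow> sqrt 0" by (rule tendsto_real_sqrt)
      then have "(\<lambda>N. I k i w - X (r N) k i w) \<longlonglongrightarrow> 0" by (simp add: tendsto_rabs_zero_iff)
      from tendsto_diff[OF tendsto_const[of "I k i w"] this] show ?thesis by simp
    qed
    then show ?case unfolding V_def U_def by (intro tendsto_intros) auto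
  qed
  have cr: "(\<lambda>N. covN (r N) p q) \<longlonglongrightarrow> cov p q" for p q
    using LIMSEQ_subseq_LIMSEQ[OF covN r(1)] by (simp add: comp_def)
  show ?thesis
  proof (rule clt_bounds_tendsto[where V = "\<lambda>N p w. V (r N) p w + A p w", OF finP _ _ VU bnd])
    show "(\<lambda>w. V (r n) p w + A p w) \<in> borel_measurable M" if "p \<in> P" for n p using mV mA[OF that] by measurable
    show "(\<lambda>w. U p w + A p w) \<in> borel_measurable M" if "p \<in> P" for p using mU mA[OF that] by measurable
  qed (unfold divide_inverse, (rule tendsto_add tendsto_sum tendsto_rabs tendsto_diff tendsto_power tendsto_mult tendsto_real_sqrt
      tendsto_const cr)+)
qed

section \<open>Theta functions and the spectrum\<close>

abbreviation cos2pi :: "nat \<Rightarrow> real \<Rightarrow> real" where "cos2pi k y \<equiv> cos (2 * pi * real (Suc k) * y)"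

section \<open>Second differences and trapezoid sums of a Gaussian function\<close>

lemma gaussian_second_deriv_bound:
  fixes r z k :: real
  assumes "r > 0" "0 \<le> k" "k \<le> z"
  shows "\<bar>(4 * r\<^sup>2 * z\<^sup>2 - 2 * r) * exp (- r * z\<^sup>2)\<bar> \<le> 8 * r * exp (- r * k\<^sup>2 / 2)"
proof -
  define w where "w = r * z\<^sup>2"
  have w: "0 \<le> w" using assms by (simp add: w_def)
  have "\<bar>(4 * r\<^sup>2 * z\<^sup>2 - 2 * r) * exp (- r * z\<^sup>2)\<bar> = 2 * r * \<bar>2 * w - 1\<bar> * exp (- w)"
  proof -
    have "(4 * r\<^sup>2 * z\<^sup>2 - 2 * r) = 2 * r * (2 * w - 1)" by (simp add: w_def power2_eq_square algebra_simps)
    then show ?thesis using assms by (simp add: abs_mult w_def)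
  qed
  \<comment> \<open>The polynomial factor is absorbed by half of the exponential decay.\<close>
  also have "\<bar>2 * w - 1\<bar> \<le> 4 * (1 + w / 2)" using w by (auto simp: abs_if)
  also have "1 + w / 2 \<le> exp (w / 2)" by (rule exp_ge_add_one_self)
  finally have "\<bar>(4 * r\<^sup>2 * z\<^sup>2 - 2 * r) * exp (- r * z\<^sup>2)\<bar> \<le> 2 * r * (4 * exp (w / 2)) * exp (- w)"
    using assms by (simp add: mult_left_mono mult_right_mono)
  also have "\<dots> = 8 * r * exp (- w / 2)" by (simp flip: exp_add)
  also have "\<dots> \<le> 8 * r * exp (- r * k\<^sup>2 / 2)"
  proof -
    have "k\<^sup>2 \<le> z\<^sup>2" using assms by (intro power_mono) auto
    then have "r * k\<^sup>2 \<le> w" unfolding w_def using assms by (intro mult_left_mono) auto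
    then show ?thesis using assms by (intro mult_left_mono) auto
  qed
  finally show ?thesis .
qed

lemma gaussian_deriv_lipschitz:
  fixes r x y k :: real
  assumes "r > 0" "0 \<le> k" "k \<le> x" "k \<le> y"
  shows "\<bar>(- 2 * r * x * exp (- r * x\<^sup>2)) - (- 2 * r * y * exp (- r * y\<^sup>2))\<bar> \<le> 8 * r * exp (- r * k\<^sup>2 / 2) * \<bar>x - y\<bar>"
proof -
  have "norm ((- 2 * r * x * exp (- r * x\<^sup>2)) - (- 2 * r * y * exp (- r * y\<^sup>2))) \<le> 8 * r * exp (- r * k\<^sup>2 / 2) * norm (x - y)"
  proof (rule field_differentiable_bound[of "{k..}"])
    fix z assume "z \<in> {k..}"
    then have z: "k \<le> z" by simp
    show "((\<lambda>x. - 2 * r * x * exp (- r * x\<^sup>2)) has_field_derivative (4 * r\<^sup>2 * z\<^sup>2 - 2 * r) * exp (- r * z\<^sup>2)) (at z within {k..})"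
      by (auto intro!: derivative_eq_intros simp: power2_eq_square algebra_simps)
    show "norm ((4 * r\<^sup>2 * z\<^sup>2 - 2 * r) * exp (- r * z\<^sup>2)) \<le> 8 * r * exp (- r * k\<^sup>2 / 2)"
      using gaussian_second_deriv_bound[OF assms(1,2) z] by simp
  qed (use assms in auto)
  then show ?thesis by simp
qed

lemma gaussian_DERIV: "((\<lambda>x. exp (- r * x\<^sup>2)) has_real_derivative - 2 * r * x * exp (- r * x\<^sup>2)) (at x within S)"
  by (auto intro!: derivative_eq_intros simp: power2_eq_square algebra_simps)

lemma gaussian_mvt:
  fixes r x y :: real
  assumes "x < y"
  obtains z where "x < z" "z < y" "exp (- r * y\<^sup>2) - exp (- r * x\<^sup>2) = (y - x) * (- 2 * r * z * exp (- r * z\<^sup>2))"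
  using MVT2[OF assms, of "\<lambda>x. exp (- r * x\<^sup>2)" "\<lambda>z. - 2 * r * z * exp (- r * z\<^sup>2)"] gaussian_DERIV[of r _ UNIV] by blast

text \<open>The mean value theorem turns the two first differences into derivatives at points less
  than 2 apart, and the derivative is Lipschitz.\<close>

lemma gaussian_second_difference:
  fixes r k :: real
  assumes "r > 0" "0 \<le> k"
  shows "\<bar>exp (- r * (k + 2)\<^sup>2) - 2 * exp (- r * (k + 1)\<^sup>2) + exp (- r * k\<^sup>2)\<bar> \<le> 16 * r * exp (- r * k\<^sup>2 / 2)"
proof -
  obtain z1 where z1: "k < z1" "z1 < k + 1" "exp (- r * (k + 1)\<^sup>2) - exp (- r * k\<^sup>2) = - 2 * r * z1 * exp (- r * z1\<^sup>2)"
    by (rule gaussian_mvt[of k "k + 1" r]) auto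
  obtain z2 where z2: "k + 1 < z2" "z2 < k + 2" "exp (- r * (k + 2)\<^sup>2) - exp (- r * (k + 1)\<^sup>2) = - 2 * r * z2 * exp (- r * z2\<^sup>2)"
    by (rule gaussian_mvt[of "k + 1" "k + 2" r]) auto
  have "\<bar>exp (- r * (k + 2)\<^sup>2) - 2 * exp (- r * (k + 1)\<^sup>2) + exp (- r * k\<^sup>2)\<bar> =
     \<bar>(- 2 * r * z2 * exp (- r * z2\<^sup>2)) - (- 2 * r * z1 * exp (- r * z1\<^sup>2))\<bar>" using z1(3) z2(3) by linarith
  also have "\<dots> \<le> 8 * r * exp (- r * k\<^sup>2 / 2) * \<bar>z2 - z1\<bar>"
    by (rule gaussian_deriv_lipschitz) (use assms z1 z2 in auto)
  also have "\<dots> \<le> 8 * r * exp (- r * k\<^sup>2 / 2) * 2" using assms z1 z2 by (intro mult_left_mono) auto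
  finally show ?thesis by simp
qed

text \<open>The trapezoid error over [k, t] is differentiated in t. The mean value theorem writes
  its derivative as (t - k) / 2 times a difference of two values of u', which is small because u' is
  Lipschitz.\<close>

lemma gaussian_trapezoid:
  fixes r k :: real
  assumes "r > 0" "0 \<le> k"
  shows "\<bar>integral {k..k + 1} (\<lambda>x. exp (- r * x\<^sup>2)) - (exp (- r * k\<^sup>2) + exp (- r * (k + 1)\<^sup>2)) / 2\<bar> \<le> 4 * r * exp (- r * k\<^sup>2 / 2)"
proof -
  define u where "u x = exp (- r * x\<^sup>2)" for x
  define u' where "u' x = - 2 * r * x * exp (- r * x\<^sup>2)" for x
  define \<phi> where "\<phi> t = integral {k..t} u - (t - k) * (u k + u t) / 2" for t
  define \<phi>' where "\<phi>' t = (u t - u k - (t - k) * u' t) / 2" for t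
  have cu: "continuous_on S u" for S unfolding u_def by (intro continuous_intros)
  have du: "(u has_real_derivative u' t) (at t within S)" for t S unfolding u_def[abs_def] u'_def by (rule gaussian_DERIV)
  have "norm (\<phi> (k + 1) - \<phi> k) \<le> 4 * r * exp (- r * k\<^sup>2 / 2) * norm (k + 1 - k)"
  proof (rule field_differentiable_bound[of "{k..k + 1}"])
    fix t assume t: "t \<in> {k..k + 1}"
    have "((\<lambda>t. integral {k..t} u) has_real_derivative u t) (at t within {k..k + 1})"
      by (rule integral_has_real_derivative[OF cu t])
    then show "(\<phi> has_field_derivative \<phi>' t) (at t within {k..k + 1})" unfolding \<phi>_def[abs_def] \<phi>'_def
      by (auto intro!: derivative_eq_intros du simp: field_simps)
    show "norm (\<phi>' t) \<le> 4 * r * exp (- r * k\<^sup>2 / 2)"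
    proof (cases "t = k")
      case True then show ?thesis using assms by (simp add: \<phi>'_def)
    next
      case False
      then have kt: "k < t" using t by auto
      obtain z where z: "k < z" "z < t" "u t - u k = (t - k) * u' z" using gaussian_mvt[OF kt, of r] unfolding u_def u'_def by blast
      have "\<phi>' t = (t - k) * (u' z - u' t) / 2" unfolding \<phi>'_def z(3) by (simp add: algebra_simps)
      also have "\<bar>\<dots>\<bar> = (t - k) * \<bar>u' z - u' t\<bar> / 2" using kt by (simp add: abs_mult)
      also have "\<dots> \<le> 1 * (8 * r * exp (- r * k\<^sup>2 / 2) * \<bar>z - t\<bar>) / 2"
        using kt t z unfolding u'_def by (intro divide_right_mono mult_mono gaussian_deriv_lipschitz assms) auto
      also have "\<dots> \<le> 1 * (8 * r * exp (- r * k\<^sup>2 / 2) * 1) / 2"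
        using z t assms by (intro divide_right_mono mult_left_mono) auto
      finally show ?thesis by simp
    qed
  qed auto
  then show ?thesis by (simp add: \<phi>_def u_def[abs_def])
qed

lemma gaussian_half_line:
  assumes "r > 0"
  shows "has_bochner_integral lborel (\<lambda>x. indicator {0..} x * exp (- r * x\<^sup>2)) (sqrt (pi / r) / 2)"
proof -
  have s: "sqrt r > 0" using assms by simp
  have "has_bochner_integral lborel (\<lambda>x. indicator {0..} (0 + sqrt r * x) *\<^sub>R exp (- (0 + sqrt r * x)\<^sup>2)) ((sqrt pi / 2) /\<^sub>R \<bar>sqrt r\<bar>)"
    using gaussian_moment_0 s by (subst (asm) lborel_has_bochner_integral_real_affine_iff[of "sqrt r" _ _ 0]) auto
  moreover have "indicator {0..} (0 + sqrt r * x) *\<^sub>R exp (- (0 + sqrt r * x)\<^sup>2) = indicator {0..} x * exp (- r * x\<^sup>2)" for x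
    using assms by (auto simp: indicator_def power_mult_distrib zero_le_mult_iff)
  moreover have "(sqrt pi / 2) /\<^sub>R \<bar>sqrt r\<bar> = sqrt (pi / r) / 2" using s by (simp add: real_sqrt_divide field_simps)
  ultimately show ?thesis by simp
qed

lemma gaussian_integral_tendsto:
  assumes "r > 0"
  shows "(\<lambda>n. integral {0..real n} (\<lambda>x. exp (- r * x\<^sup>2))) \<longlonglongrightarrow> sqrt (pi / r) / 2"
proof -
  let ?f = "\<lambda>x. indicator {0..} x * exp (- r * x\<^sup>2)"
  note h = gaussian_half_line[OF assms]
  have "((\<lambda>y. \<integral>x. indicator {..y} x *\<^sub>R ?f x \<partial>lborel) \<longlongrightarrow> (\<integral>x. ?f x \<partial>lborel)) at_top"
    by (rule tendsto_integral_at_top) (use h in \<open>auto simp: has_bochner_integral_iff\<close>)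
  from filterlim_compose[OF this filterlim_real_sequentially]
  have "(\<lambda>n. \<integral>x. indicator {..real n} x *\<^sub>R ?f x \<partial>lborel) \<longlonglongrightarrow> sqrt (pi / r) / 2"
    using has_bochner_integral_integral_eq[OF h] by (simp only:)
  moreover have "(\<integral>x. indicator {..real n} x *\<^sub>R ?f x \<partial>lborel) = integral {0..real n} (\<lambda>x. exp (- r * x\<^sup>2))" for n
  proof -
    have c: "continuous_on {0..real n} (\<lambda>x. exp (- r * x\<^sup>2))" by (intro continuous_intros)
    have "(\<integral>x. indicator {..real n} x *\<^sub>R ?f x \<partial>lborel) = (\<integral>x. indicator {0..real n} x *\<^sub>R exp (- r * x\<^sup>2) \<partial>lborel)"
      by (intro Bochner_Integration.integral_cong refl) (auto simp: indicator_def)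
    also have "\<dots> = integral {0..real n} (\<lambda>x. exp (- r * x\<^sup>2))"
      using set_borel_integral_eq_integral(2)[OF borel_integrable_atLeastAtMost'[OF c]] by (simp add: set_lebesgue_integral_def)
    finally show ?thesis .
  qed
  ultimately show ?thesis by simp
qed

lemma gaussian_sum_bound:
  assumes "r > 0"
  shows "summable (\<lambda>k. exp (- r * (real k)\<^sup>2))" "(\<Sum>k. exp (- r * (real k)\<^sup>2)) \<le> 1 + sqrt (pi / r) / 2"
proof -
  let ?u = "\<lambda>x. exp (- r * x\<^sup>2)"
  have part: "(\<Sum>k<n. ?u (real k)) \<le> 1 + integral {0..real n} ?u" for n
  proof (induction n)
    case (Suc n)
    have io: "?u integrable_on {a..b}" for a b by (intro integrable_continuous_interval continuous_intros)
    show ?case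
    proof (cases "n = 0")
      case True
      have "0 \<le> integral {0..1} ?u" by (intro integral_nonneg io) auto
      then show ?thesis using True by simp
    next
      case False
      have "(\<Sum>k<Suc n. ?u (real k)) = 1 + (\<Sum>k=1..<Suc n. ?u (real k))" by (simp add: lessThan_atLeast0 sum.atLeast_Suc_lessThan)
      also have "(\<Sum>k=1..<Suc n. ?u (real k)) \<le> integral {0..real n} ?u"
      proof (induction n)
        case (Suc n)
        have "?u (real (Suc n)) = integral {real n..real (Suc n)} (\<lambda>_. ?u (real (Suc n)))" by simp
        also have "\<dots> \<le> integral {real n..real (Suc n)} ?u"
        proof (intro integral_le io)
          fix x assume x: "x \<in> {real n..real (Suc n)}"
          then have "x\<^sup>2 \<le> (real (Suc n))\<^sup>2" by (intro power_mono) auto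
          then show "?u (real (Suc n)) \<le> ?u x" using assms by simp
        qed auto
        finally have "(\<Sum>k=1..<Suc (Suc n). ?u (real k)) \<le> integral {0..real n} ?u + integral {real n..real (Suc n)} ?u"
          using Suc by simp
        also have "\<dots> = integral {0..real (Suc n)} ?u" by (rule Henstock_Kurzweil_Integration.integral_combine[OF _ _ io]) auto
        finally show ?case .
      qed simp
      also have "integral {0..real n} ?u \<le> integral {0..real (Suc n)} ?u"
        by (rule integral_subset_le) (auto intro!: integrable_continuous_interval continuous_intros)
      finally show ?thesis by simp
    qed
  qed simp
  have mono: "integral {0..real n} ?u \<le> sqrt (pi / r) / 2" for n
  proof (rule incseq_le[OF _ gaussian_integral_tendsto[OF assms]])
    show "incseq (\<lambda>n. integral {0..real n} ?u)"
      by (intro incseq_SucI integral_subset_le) (auto intro!: integrable_continuous_interval continuous_intros)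
  qed
  show s: "summable (\<lambda>k. exp (- r * (real k)\<^sup>2))" by (rule bounded_imp_summable[of _ "1 + sqrt (pi / r) / 2"])
       (simp, subst lessThan_Suc_atMost[symmetric], use order_trans[OF part add_left_mono[OF mono], of "Suc _"] in simp)
  show "(\<Sum>k. exp (- r * (real k)\<^sup>2)) \<le> 1 + sqrt (pi / r) / 2"
    by (rule suminf_le_const[OF s]) (rule order_trans[OF part add_left_mono[OF mono]])
qed

text \<open>The common bound for the trapezoid error and the total second difference of
  \<open>z \<mapsto> exp (- r z\<^sup>2)\<close>.\<close>

definition gauss_err :: "real \<Rightarrow> real" where "gauss_err r = 16 * r * (1 + sqrt (2 * pi / r) / 2)"

lemma gauss_err_sum:
  assumes "r > 0"
  shows "summable (\<lambda>k. 16 * r * exp (- r * (real k)\<^sup>2 / 2))" "(\<Sum>k. 16 * r * exp (- r * (real k)\<^sup>2 / 2)) \<le> gauss_err r"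
proof -
  have e: "exp (- r * (real k)\<^sup>2 / 2) = exp (- (r / 2) * (real k)\<^sup>2)" for k by simp
  note g = gaussian_sum_bound[of "r / 2"]
  show "summable (\<lambda>k. 16 * r * exp (- r * (real k)\<^sup>2 / 2))" unfolding e by (rule summable_mult) (use g assms in simp)
  have "(\<Sum>k. 16 * r * exp (- r * (real k)\<^sup>2 / 2)) = 16 * r * (\<Sum>k. exp (- (r / 2) * (real k)\<^sup>2))"
    unfolding e by (rule suminf_mult) (use g assms in simp)
  also have "\<dots> \<le> gauss_err r" unfolding gauss_err_def using g(2) assms by (intro mult_left_mono) (auto simp: mult.commute)
  finally show "(\<Sum>k. 16 * r * exp (- r * (real k)\<^sup>2 / 2)) \<le> gauss_err r" .
qed

text \<open>Small r behaviour of the theta function at 0. The left sum is the trapezoid sum of the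
  Gaussian on the half line, with the end weight 1 / 2 at the origin, and \<open>gauss_err\<close>
  is O(sqrt r).\<close>

lemma theta_zero:
  assumes r: "r > 0"
  shows "\<bar>1 / 2 + (\<Sum>k. exp (- r * (real (Suc k))\<^sup>2)) - sqrt (pi / r) / 2\<bar> \<le> gauss_err r"
proof -
  let ?u = "\<lambda>x. exp (- r * x\<^sup>2)"
  define d where "d k = (?u (real k) + ?u (real k + 1)) / 2 - integral {real k..real k + 1} ?u" for k
  have d: "norm (d k) \<le> 16 * r * exp (- r * (real k)\<^sup>2 / 2)" for k
  proof -
    have "norm (d k) \<le> 4 * r * exp (- r * (real k)\<^sup>2 / 2)"
      unfolding d_def real_norm_def by (subst abs_minus_commute) (rule gaussian_trapezoid[OF r], simp)
    also have "\<dots> \<le> 16 * r * exp (- r * (real k)\<^sup>2 / 2)" using r by (intro mult_right_mono) auto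
    finally show ?thesis .
  qed
  have sd: "summable (\<lambda>k. norm (d k))" by (rule summable_comparison_test[OF _ gauss_err_sum(1)[OF r]]) (use d in auto)
  have "\<bar>\<Sum>k. d k\<bar> \<le> (\<Sum>k. norm (d k))" using summable_norm[OF sd] by simp
  also have "\<dots> \<le> (\<Sum>k. 16 * r * exp (- r * (real k)\<^sup>2 / 2))" by (rule suminf_le[OF d sd gauss_err_sum(1)[OF r]])
  also have "\<dots> \<le> gauss_err r" by (rule gauss_err_sum(2)[OF r])
  finally have b: "\<bar>\<Sum>k. d k\<bar> \<le> gauss_err r" .
  have su: "summable (\<lambda>k. ?u (real k))" by (rule gaussian_sum_bound(1)[OF r])
  have part: "(\<Sum>k<n. d k) = 1 / 2 + (\<Sum>k<n. ?u (real (Suc k))) - ?u (real n) / 2 - integral {0..real n} ?u" for n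
  proof (induction n)
    case (Suc n)
    have io: "?u integrable_on {a..b}" for a b by (intro integrable_continuous_interval continuous_intros)
    have "integral {0..real n} ?u + integral {real n..real n + 1} ?u = integral {0..real n + 1} ?u"
      by (rule Henstock_Kurzweil_Integration.integral_combine[OF _ _ io]) auto
    then show ?case using Suc by (simp add: d_def field_simps)
  qed simp
  have "(\<lambda>n. \<Sum>k<n. d k) \<longlonglongrightarrow> 1 / 2 + (\<Sum>k. ?u (real (Suc k))) - 0 / 2 - sqrt (pi / r) / 2"
    unfolding part by (intro tendsto_intros gaussian_integral_tendsto[OF r] summable_LIMSEQ summable_LIMSEQ_zero[OF su]
        summable_Suc_iff[of "\<lambda>k. ?u (real k)", THEN iffD2] su) auto
  with summable_LIMSEQ[OF summable_norm_cancel[OF sd]]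
  have "(\<Sum>k. d k) = 1 / 2 + (\<Sum>k. ?u (real (Suc k))) - 0 / 2 - sqrt (pi / r) / 2" by (rule LIMSEQ_unique)
  then show ?thesis using b by simp
qed

text \<open>Multiplication by 2 - 2 cos (2 pi y) = 4 sin^2 (pi y) turns the cosines into second
  differences, and summation by parts moves these onto the Gaussian factors. The boundary term 1 -
  exp (- r) accounts for the extra r.\<close>

lemma theta_cos:
  assumes r: "r > 0"
  shows "4 * (sin (pi * y))\<^sup>2 * \<bar>1 / 2 + (\<Sum>k. exp (- r * (real (Suc k))\<^sup>2) * cos2pi k y)\<bar> \<le> gauss_err r + r"
proof -
  define u where "u k = exp (- r * (real k)\<^sup>2)" for k
  define c where "c k = cos (2 * pi * real k * y)" for k
  define d where "d k = (2 * u (Suc k) - u k - u (Suc (Suc k))) * c (Suc k)" for k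
  have d: "norm (d k) \<le> 16 * r * exp (- r * (real k)\<^sup>2 / 2)" for k
  proof -
    have "norm (d k) \<le> \<bar>2 * u (Suc k) - u k - u (Suc (Suc k))\<bar> * 1"
      unfolding d_def real_norm_def abs_mult c_def by (intro mult_left_mono) auto
    also have "\<dots> = \<bar>exp (- r * (real k + 2)\<^sup>2) - 2 * exp (- r * (real k + 1)\<^sup>2) + exp (- r * (real k)\<^sup>2)\<bar>"
      unfolding u_def by (simp add: add.commute)
    also have "\<dots> \<le> 16 * r * exp (- r * (real k)\<^sup>2 / 2)" by (rule gaussian_second_difference[OF r]) simp
    finally show ?thesis .
  qed
  have sd: "summable (\<lambda>k. norm (d k))" by (rule summable_comparison_test[OF _ gauss_err_sum(1)[OF r]]) (use d in auto)
  have "\<bar>\<Sum>k. d k\<bar> \<le> (\<Sum>k. norm (d k))" using summable_norm[OF sd] by simp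
  also have "\<dots> \<le> (\<Sum>k. 16 * r * exp (- r * (real k)\<^sup>2 / 2))" by (rule suminf_le[OF d sd gauss_err_sum(1)[OF r]])
  also have "\<dots> \<le> gauss_err r" by (rule gauss_err_sum(2)[OF r])
  finally have b: "\<bar>\<Sum>k. d k\<bar> \<le> gauss_err r" .
  have su: "summable u" unfolding u_def[abs_def] by (rule gaussian_sum_bound(1)[OF r])
  have c2: "2 * cos (2 * pi * y) * c (Suc k) = c (Suc (Suc k)) + c k" for k
  proof -
    have "2 * pi * real (Suc (Suc k)) * y = 2 * pi * real (Suc k) * y + 2 * pi * y"
      "2 * pi * real k * y = 2 * pi * real (Suc k) * y - 2 * pi * y" by (simp_all add: algebra_simps)
    then show ?thesis unfolding c_def by (simp only: cos_add cos_diff) simp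
  qed
  have c0: "c 0 = 1" "c (Suc 0) = cos (2 * pi * y)" "u 0 = 1" by (simp_all add: c_def u_def)
  have part: "(\<Sum>k<n. d k) + 1 - u (Suc 0) = (2 - 2 * cos (2 * pi * y)) * (1 / 2 + (\<Sum>k<n. u (Suc k) * c (Suc k)))
      + u n * c (Suc n) - u (Suc n) * c n" for n
  proof (induction n)
    case 0 then show ?case using c0 by (simp add: algebra_simps)
  next
    case (Suc n)
    have "(\<Sum>k<Suc n. d k) + 1 - u (Suc 0) = (2 - 2 * cos (2 * pi * y)) * (1 / 2 + (\<Sum>k<n. u (Suc k) * c (Suc k)))
      + u n * c (Suc n) - u (Suc n) * c n + d n" using Suc by simp
    also have "\<dots> = (2 - 2 * cos (2 * pi * y)) * (1 / 2 + (\<Sum>k<n. u (Suc k) * c (Suc k)))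
       + (2 * u (Suc n) * c (Suc n) - u (Suc n) * c n) - u (Suc (Suc n)) * c (Suc n)" by (simp add: d_def algebra_simps)
    also have "2 * u (Suc n) * c (Suc n) - u (Suc n) * c n = (2 - 2 * cos (2 * pi * y)) * (u (Suc n) * c (Suc n)) + u (Suc n) * c (Suc (Suc n))"
    proof -
      have "u (Suc n) * (2 * cos (2 * pi * y) * c (Suc n)) = u (Suc n) * (c (Suc (Suc n)) + c n)" by (simp only: c2)
      then show ?thesis by (simp add: algebra_simps)
    qed
    finally show ?case by (simp add: algebra_simps)
  qed
  have sc: "summable (\<lambda>k. u (Suc k) * c (Suc k))"
  proof (rule summable_comparison_test)
    show "\<exists>N. \<forall>n\<ge>N. norm (u (Suc n) * c (Suc n)) \<le> u (Suc n)"
      unfolding norm_mult by (intro exI[of _ 0] allI impI) (auto simp: u_def c_def intro: mult_left_le)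
    show "summable (\<lambda>k. u (Suc k))" using su by (simp add: summable_Suc_iff)
  qed
  have z: "(\<lambda>n. u n * c (Suc n)) \<longlonglongrightarrow> 0" "(\<lambda>n. u (Suc n) * c n) \<longlonglongrightarrow> 0"
  proof -
    show "(\<lambda>n. u n * c (Suc n)) \<longlonglongrightarrow> 0" by (rule Lim_null_comparison[OF _ summable_LIMSEQ_zero[OF su]])
         (auto simp: abs_mult u_def c_def intro!: always_eventually mult_left_le)
    show "(\<lambda>n. u (Suc n) * c n) \<longlonglongrightarrow> 0"
      by (rule Lim_null_comparison[OF _ LIMSEQ_Suc[OF summable_LIMSEQ_zero[OF su]]])
         (auto simp: abs_mult u_def c_def intro!: always_eventually mult_left_le)
  qed
  have "(\<lambda>n. (\<Sum>k<n. d k) + 1 - u (Suc 0)) \<longlonglongrightarrow> (2 - 2 * cos (2 * pi * y)) * (1 / 2 + (\<Sum>k. u (Suc k) * c (Suc k))) + 0 - 0"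
    unfolding part by (intro tendsto_intros z summable_LIMSEQ sc)
  moreover have "(\<lambda>n. (\<Sum>k<n. d k) + 1 - u (Suc 0)) \<longlonglongrightarrow> (\<Sum>k. d k) + 1 - u (Suc 0)"
    by (intro tendsto_intros summable_LIMSEQ summable_norm_cancel[OF sd])
  ultimately have eq: "(\<Sum>k. d k) + 1 - u (Suc 0) = (2 - 2 * cos (2 * pi * y)) * (1 / 2 + (\<Sum>k. u (Suc k) * c (Suc k)))"
    using LIMSEQ_unique by fastforce
  have "2 - 2 * cos (2 * pi * y) = 4 * (sin (pi * y))\<^sup>2" using cos_double_sin[of "pi * y"] by (simp add: mult.assoc)
  with eq have "(\<Sum>k. d k) + (1 - u (Suc 0)) = 4 * (sin (pi * y))\<^sup>2 * (1 / 2 + (\<Sum>k. u (Suc k) * c (Suc k)))"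
    by (simp only: add_diff_eq)
  then have "4 * (sin (pi * y))\<^sup>2 * \<bar>1 / 2 + (\<Sum>k. u (Suc k) * c (Suc k))\<bar> = \<bar>(\<Sum>k. d k) + (1 - u (Suc 0))\<bar>"
    by (simp only: abs_mult abs_power2 abs_numeral)
  also have "\<dots> \<le> gauss_err r + r"
  proof -
    have "1 - r \<le> u (Suc 0)" "u (Suc 0) \<le> 1" using exp_ge_add_one_self[of "- r"] r by (auto simp: u_def)
    then show ?thesis using b by linarith
  qed
  finally show ?thesis by (simp add: u_def c_def)
qed

section \<open>Small time behaviour of heat sums over the eigenvalues\<close>

locale heat_spectrum =
  fixes b \<kappa> :: real
  assumes b_pos: "b > 0" and first_pos: "b + \<kappa> > 0"
begin

definition lam :: "nat \<Rightarrow> real" where "lam k = \<kappa> + b * (real k)\<^sup>2"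

text \<open>If kappa is negative, then kappa >= kappa k^2, so the first eigenvalue b + kappa
  controls all others.\<close>

lemma lam_lower: "1 \<le> k \<Longrightarrow> min b (b + \<kappa>) * (real k)\<^sup>2 \<le> lam k"
proof -
  assume k: "1 \<le> k"
  then have k2: "1 \<le> (real k)\<^sup>2" by simp
  show ?thesis
  proof (cases "\<kappa> \<ge> 0")
    case True then show ?thesis by (simp add: lam_def min_def)
  next
    case False
    then have "\<kappa> * (real k)\<^sup>2 \<le> \<kappa> * 1" using k2 by (intro mult_left_mono_neg) auto
    then show ?thesis using False by (simp add: lam_def min_def algebra_simps)
  qed
qed

lemma lam_pos: "1 \<le> k \<Longrightarrow> 0 < lam k"
proof -
  assume k: "1 \<le> k"
  have "0 < min b (b + \<kappa>) * (real k)\<^sup>2" using b_pos first_pos k by (intro mult_pos_pos) auto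
  then show ?thesis using lam_lower[OF k] by linarith
qed

lemma lam_Suc_pos [simp]: "0 < lam (Suc k)" by (rule lam_pos) simp

lemma lam_mono: "j \<le> k \<Longrightarrow> lam j \<le> lam k"
  unfolding lam_def using b_pos by (intro add_left_mono mult_left_mono power_mono) auto

lemma summable_inverse_lam: "summable (\<lambda>k. 1 / lam (Suc k))"
proof (rule summable_comparison_test)
  define m where "m = min b (b + \<kappa>)"
  have m: "m > 0" using b_pos first_pos by (simp add: m_def)
  have "summable (\<lambda>n. inverse (real n ^ 2))" by (rule inverse_power_summable) simp
  then have "summable (\<lambda>n. inverse (real (Suc n) ^ 2))" by (rule summable_Suc_iff[of "\<lambda>n. inverse ((real n)\<^sup>2)", THEN iffD2])
  then show "summable (\<lambda>n. 1 / m * inverse (real (Suc n) ^ 2))" by (rule summable_mult)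
  show "\<exists>N. \<forall>n\<ge>N. norm (1 / lam (Suc n)) \<le> 1 / m * inverse (real (Suc n) ^ 2)"
  proof (intro exI[of _ 0] allI impI)
    fix n
    have "0 < m * (real (Suc n))\<^sup>2" using m by (intro mult_pos_pos) auto
    then have "1 / lam (Suc n) \<le> 1 / (m * (real (Suc n))\<^sup>2)"
      using lam_lower[of "Suc n"] by (intro divide_left_mono) (auto simp: m_def intro!: mult_pos_pos)
    then show "norm (1 / lam (Suc n)) \<le> 1 / m * inverse (real (Suc n) ^ 2)"
      using abs_of_pos[OF lam_Suc_pos[of n]] by (simp add: divide_inverse del: of_nat_Suc)
  qed
qed

lemma one_minus_exp_bounds:
  fixes x :: real assumes "0 \<le> x" shows "0 \<le> 1 - exp (- x)" "1 - exp (- x) \<le> 1" "1 - exp (- x) \<le> x"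
  using assms exp_ge_add_one_self[of "- x"] by auto

text \<open>Differentiation in h turns the series into a theta-like sum, which is close to the
  derivative of c sqrt h up to E'. The derived series may diverge at h = 0, so the bound is obtained
  from two monotone functions, E minus and E plus the difference, which are differentiable inside
  and continuous up to the end points.\<close>

lemma heat_integral_bound:
  fixes a :: "nat \<Rightarrow> real" and c :: real and E E' :: "real \<Rightarrow> real"
  assumes a: "\<And>k. 0 \<le> a k" "\<And>k. a k \<le> 2"
    and \<phi>: "\<And>s. 0 < s \<Longrightarrow> s < 1 \<Longrightarrow> \<bar>(\<Sum>k. a k * exp (- lam (Suc k) * s)) - c / (2 * sqrt s)\<bar> \<le> E' s"
    and E: "\<And>s. 0 < s \<Longrightarrow> s < 1 \<Longrightarrow> (E has_real_derivative E' s) (at s)" "continuous_on {0..1} E" "E 0 = 0"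
    and h: "0 \<le> h" "h \<le> 1"
  shows "\<bar>(\<Sum>k. a k * ((1 - exp (- lam (Suc k) * h)) / lam (Suc k))) - c * sqrt h\<bar> \<le> E h"
proof (cases "h = 0")
  case True then show ?thesis using E(3) by simp
next
  case False
  then have h0: "0 < h" using h by simp
  define f where "f k s = a k * ((1 - exp (- lam (Suc k) * s)) / lam (Suc k))" for k s
  define f' where "f' k s = a k * exp (- lam (Suc k) * s)" for k s
  define F where "F s = (\<Sum>k. f k s)" for s
  have fb: "norm (f k s) \<le> 2 * (1 / lam (Suc k))" if "0 \<le> s" for k s
  proof -
    have x: "0 \<le> lam (Suc k) * s" using that less_imp_le[OF lam_Suc_pos[of k]] by simp
    have "(1 - exp (- lam (Suc k) * s)) / lam (Suc k) \<le> 1 / lam (Suc k)"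
      using one_minus_exp_bounds(2)[OF x] less_imp_le[OF lam_Suc_pos[of k]] by (intro divide_right_mono) auto
    moreover have "0 \<le> (1 - exp (- lam (Suc k) * s)) / lam (Suc k)"
      using one_minus_exp_bounds(1)[OF x] less_imp_le[OF lam_Suc_pos[of k]] by (intro divide_nonneg_nonneg) auto
    ultimately show ?thesis using a unfolding f_def norm_mult by (intro mult_mono) auto
  qed
  have s2: "summable (\<lambda>k. 2 * (1 / lam (Suc k)))" by (rule summable_mult[OF summable_inverse_lam])
  have "uniform_limit {0..h} (\<lambda>n s. \<Sum>k<n. f k s) F sequentially" unfolding F_def by (rule Weierstrass_m_test[OF fb s2]) auto
  then have cF: "continuous_on {0..h} F"
    by (rule uniform_limit_theorem[rotated]) (auto simp: f_def intro!: always_eventually continuous_intros simp: less_imp_neq[OF lam_Suc_pos, symmetric])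
  have dF: "(F has_real_derivative (\<Sum>k. f' k s)) (at s)" if s: "0 < s" for s unfolding F_def
  proof (rule has_field_derivative_series'(2)[where S = "{s / 2<..}" and x0 = s])
    show "(f k has_field_derivative f' k x) (at x within {s / 2<..})" for k x
      unfolding f_def f'_def by (auto intro!: derivative_eq_intros simp: less_imp_neq[OF lam_Suc_pos, symmetric])
    show "uniformly_convergent_on {s / 2<..} (\<lambda>n x. \<Sum>k<n. f' k x)"
    \<comment> \<open>Away from 0 the derived series is dominated uniformly, since exp (- y) <= 1 /
      y.\<close>
    proof (rule Weierstrass_m_test'[where M = "\<lambda>k. (4 / s) * (1 / lam (Suc k))"])
      fix k x assume x: "x \<in> {s / 2<..}"
      define y where "y = lam (Suc k) * x"
      have y: "0 < y" using x s by (simp add: y_def)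
      have "y \<le> exp y" using exp_ge_add_one_self[of y] by linarith
      then have "exp (- y) \<le> 1 / y" using y by (simp add: exp_minus field_simps)
      also have "\<dots> \<le> 1 / (lam (Suc k) * (s / 2))"
        unfolding y_def using x s by (intro divide_left_mono mult_left_mono mult_pos_pos) (auto simp: less_imp_le)
      finally have "exp (- lam (Suc k) * x) \<le> 2 / (lam (Suc k) * s)" by (simp add: y_def)
      then have "a k * exp (- lam (Suc k) * x) \<le> 2 * (2 / (lam (Suc k) * s))" using a by (intro mult_mono) auto
      then show "norm (f' k x) \<le> (4 / s) * (1 / lam (Suc k))" using a by (simp add: f'_def mult.commute)
    qed (rule summable_mult[OF summable_inverse_lam])
    show "summable (\<lambda>k. f k s)" by (rule summable_comparison_test[OF _ s2]) (use fb[of s] s in auto)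
    show "s \<in> interior {s / 2<..}" using s by (simp add: interior_open)
  qed (use s in auto)
  have dsq: "((\<lambda>s. c * sqrt s) has_real_derivative c / (2 * sqrt s)) (at s)" if "0 < s" for s
    using that by (auto intro!: derivative_eq_intros simp: field_simps)
  have cs: "continuous_on {0..h} (\<lambda>s. c * sqrt s)" by (intro continuous_intros)
  have cE: "continuous_on {0..h} E" by (rule continuous_on_subset[OF E(2)]) (use h in auto)
  have "E 0 - (F 0 - c * sqrt 0) \<le> E h - (F h - c * sqrt h)"
  proof (rule DERIV_nonneg_imp_increasing_open[OF h(1), of "\<lambda>s. E s - (F s - c * sqrt s)"])
    fix s assume s: "0 < s" "s < h"
    then show "\<exists>y. ((\<lambda>s. E s - (F s - c * sqrt s)) has_real_derivative y) (at s) \<and> 0 \<le> y"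
      using \<phi>[of s] h dF[of s] dsq[of s] E(1)[of s]
      by (intro exI[of _ "E' s - ((\<Sum>k. f' k s) - c / (2 * sqrt s))"] conjI DERIV_diff) (auto simp: f'_def)
  qed (intro continuous_intros cF cs cE)
  moreover have "E 0 + (F 0 - c * sqrt 0) \<le> E h + (F h - c * sqrt h)"
  proof (rule DERIV_nonneg_imp_increasing_open[OF h(1), of "\<lambda>s. E s + (F s - c * sqrt s)"])
    fix s assume s: "0 < s" "s < h"
    then show "\<exists>y. ((\<lambda>s. E s + (F s - c * sqrt s)) has_real_derivative y) (at s) \<and> 0 \<le> y"
      using \<phi>[of s] h dF[of s] dsq[of s] E(1)[of s]
      by (intro exI[of _ "E' s + ((\<Sum>k. f' k s) - c / (2 * sqrt s))"] conjI DERIV_add DERIV_diff) (auto simp: f'_def)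
  qed (intro continuous_intros cF cs cE)
  moreover have "F 0 = 0" by (simp add: F_def f_def)
  ultimately show ?thesis using E(3) by (simp add: F_def f_def)
qed

lemma exp_minus_one_bound:
  fixes s :: real assumes "0 \<le> s" "s \<le> 1"
  shows "\<bar>exp (- \<kappa> * s) - 1\<bar> \<le> \<bar>\<kappa>\<bar> * exp \<bar>\<kappa>\<bar> * s" "exp (- \<kappa> * s) \<le> exp \<bar>\<kappa>\<bar>"
proof -
  have ks: "\<bar>\<kappa> * s\<bar> \<le> \<bar>\<kappa>\<bar>" using assms by (simp add: abs_mult mult_left_le)
  then show "exp (- \<kappa> * s) \<le> exp \<bar>\<kappa>\<bar>" by simp
  have e: "\<bar>exp x - 1\<bar> \<le> \<bar>x\<bar> * exp \<bar>x\<bar>" for x :: real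
  proof (cases "x \<ge> 0")
    case True
    have "1 - x \<le> exp (- x)" using exp_ge_add_one_self[of "- x"] by simp
    then have "(1 - x) * exp x \<le> exp (- x) * exp x" by (intro mult_right_mono) auto
    then have "exp x - 1 \<le> x * exp x" by (simp add: algebra_simps flip: exp_add)
    then show ?thesis using True by simp
  next
    case False
    have "1 - exp x \<le> - x" using exp_ge_add_one_self[of x] by linarith
    also have "\<dots> \<le> - x * exp (- x)" using False by (simp add: mult_le_cancel_left1)
    finally show ?thesis using False by simp
  qed
  have "\<bar>exp (- \<kappa> * s) - 1\<bar> \<le> \<bar>- \<kappa> * s\<bar> * exp \<bar>- \<kappa> * s\<bar>" by (rule e)
  also have "\<dots> \<le> (\<bar>\<kappa>\<bar> * s) * exp \<bar>\<kappa>\<bar>" using ks assms by (intro mult_mono) (auto simp: abs_mult)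
  finally show "\<bar>exp (- \<kappa> * s) - 1\<bar> \<le> \<bar>\<kappa>\<bar> * exp \<bar>\<kappa>\<bar> * s" by (simp add: mult_ac)
qed

lemma gauss_err_le:
  assumes "0 < s" "s \<le> 1"
  shows "gauss_err (b * s) \<le> (16 * b + 8 * sqrt (2 * pi * b)) * sqrt s" "b * s \<le> b * sqrt s"
proof -
  have ss: "s \<le> sqrt s" using assms by (intro real_le_rsqrt) (simp add: power2_eq_square mult_left_le)
  then show "b * s \<le> b * sqrt s" using b_pos by simp
  have "sqrt (2 * pi / (b * s)) * (b * s) = sqrt (2 * pi * b) * sqrt s"
  proof -
    have "sqrt (2 * pi / (b * s)) * (b * s) = sqrt (2 * pi / (b * s)) * sqrt ((b * s)\<^sup>2)" using assms b_pos by simp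
    also have "\<dots> = sqrt (2 * pi * b * s)" unfolding real_sqrt_mult[symmetric] using assms b_pos by (simp add: power2_eq_square)
    finally show ?thesis by (simp add: real_sqrt_mult)
  qed
  then have "gauss_err (b * s) = 16 * b * s + 8 * (sqrt (2 * pi * b) * sqrt s)" by (simp add: gauss_err_def algebra_simps)
  also have "\<dots> \<le> 16 * b * sqrt s + 8 * (sqrt (2 * pi * b) * sqrt s)" using ss b_pos by simp
  finally show "gauss_err (b * s) \<le> (16 * b + 8 * sqrt (2 * pi * b)) * sqrt s" by (simp add: algebra_simps)
qed

text \<open>The factor of sqrt h in the leading term of \<open>G h\<close>.\<close>

definition heat_c :: real where "heat_c = sqrt (pi / b)"

lemma heat_c_pos: "heat_c > 0" using b_pos by (simp add: heat_c_def)

text \<open>The shift kappa of the spectrum contributes the factor exp (- kappa s) = 1 + O(s);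
  against the leading term of order 1 / sqrt s this costs O(sqrt s).\<close>

lemma heat_shift_bound:
  assumes s: "0 < s" "s \<le> 1" and X: "\<bar>X - heat_c / (2 * sqrt s)\<bar> \<le> D"
  shows "\<bar>exp (- \<kappa> * s) * X - heat_c / (2 * sqrt s)\<bar> \<le> exp \<bar>\<kappa>\<bar> * D + \<bar>\<kappa>\<bar> * exp \<bar>\<kappa>\<bar> * heat_c / 2 * sqrt s"
proof -
  define Y where "Y = heat_c / (2 * sqrt s)"
  have Y: "0 \<le> Y" using heat_c_pos s by (simp add: Y_def)
  have D: "0 \<le> D" using X by linarith
  have "exp (- \<kappa> * s) * X - Y = exp (- \<kappa> * s) * (X - Y) + (exp (- \<kappa> * s) - 1) * Y" by (simp add: algebra_simps)
  also have "\<bar>\<dots>\<bar> \<le> exp (- \<kappa> * s) * \<bar>X - Y\<bar> + \<bar>exp (- \<kappa> * s) - 1\<bar> * Y"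
    by (rule order_trans[OF abs_triangle_ineq]) (use Y in \<open>simp add: abs_mult\<close>)
  also have "\<dots> \<le> exp \<bar>\<kappa>\<bar> * D + (\<bar>\<kappa>\<bar> * exp \<bar>\<kappa>\<bar> * s) * Y"
    using exp_minus_one_bound[of s] s X Y D unfolding Y_def[symmetric] by (intro add_mono mult_mono) auto
  also have "s * Y = heat_c / 2 * sqrt s"
  proof -
    have "s = sqrt s * sqrt s" using s by simp
    then show ?thesis unfolding Y_def using s by (simp add: field_simps)
  qed
  then have "(\<bar>\<kappa>\<bar> * exp \<bar>\<kappa>\<bar> * s) * Y = \<bar>\<kappa>\<bar> * exp \<bar>\<kappa>\<bar> * heat_c / 2 * sqrt s" by (simp add: mult.assoc)
  finally show ?thesis by (simp add: Y_def)
qed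

lemma theta_asym: "s > 0 \<Longrightarrow> sqrt (pi / (b * s)) / 2 = heat_c / (2 * sqrt s)"
  by (simp add: heat_c_def real_sqrt_divide real_sqrt_mult)

lemma lam_exp: "exp (- lam k * s) = exp (- \<kappa> * s) * exp (- (b * s) * (real k)\<^sup>2)"
  by (simp add: lam_def algebra_simps flip: exp_add)

lemma theta_summable: "s > 0 \<Longrightarrow> summable (\<lambda>k. exp (- (b * s) * (real (Suc k))\<^sup>2))"
  using gaussian_sum_bound(1)[of "b * s"] b_pos summable_Suc_iff[of "\<lambda>k. exp (- (b * s) * (real k)\<^sup>2)"] by simp

text \<open>Sum over all modes of the variance of a stationary Ornstein-Uhlenbeck increment over lag
  h, with unit noise.\<close>

definition G :: "real \<Rightarrow> real" where "G h = (\<Sum>k. (1 - exp (- lam (Suc k) * h)) / lam (Suc k))"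

text \<open>The constant 1 / 2 in \<open>theta_zero\<close> leaves a bounded error of the
  derivative, so the error of G is linear in h.\<close>

lemma G_asym: "\<exists>C\<ge>0. \<forall>h. 0 \<le> h \<and> h \<le> 1 \<longrightarrow> \<bar>G h - heat_c * sqrt h\<bar> \<le> C * h"
proof -
  define A where "A = 16 * b + 8 * sqrt (2 * pi * b)"
  define D where "D = 1 / 2 + A"
  define C where "C = exp \<bar>\<kappa>\<bar> * D + \<bar>\<kappa>\<bar> * exp \<bar>\<kappa>\<bar> * heat_c / 2"
  have A0: "A \<ge> 0" using b_pos by (simp add: A_def)
  then have D0: "D \<ge> 0" by (simp add: D_def)
  have C0: "C \<ge> 0" using D0 heat_c_pos by (simp add: C_def)
  have "\<bar>(\<Sum>k. 1 * ((1 - exp (- lam (Suc k) * h)) / lam (Suc k))) - heat_c * sqrt h\<bar> \<le> C * h" if h: "0 \<le> h" "h \<le> 1" for h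
  proof (rule heat_integral_bound[where E' = "\<lambda>_. C"])
    fix s :: real assume s: "0 < s" "s < 1"
    define X where "X = (\<Sum>k. exp (- (b * s) * (real (Suc k))\<^sup>2))"
    have e: "(\<Sum>k. 1 * exp (- lam (Suc k) * s)) = exp (- \<kappa> * s) * X"
      unfolding X_def lam_exp using suminf_mult[OF theta_summable[OF s(1)]] by simp
    have "\<bar>1 / 2 + X - heat_c / (2 * sqrt s)\<bar> \<le> gauss_err (b * s)"
      unfolding X_def theta_asym[OF s(1), symmetric] by (rule theta_zero) (use b_pos s in simp)
    also have "\<dots> \<le> A * sqrt s" unfolding A_def using s by (intro gauss_err_le) auto
    also have "\<dots> \<le> A * 1" using s A0 by (intro mult_left_mono) auto
    finally have X: "\<bar>1 / 2 + X - heat_c / (2 * sqrt s)\<bar> \<le> A" by simp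
    have "\<bar>X - heat_c / (2 * sqrt s)\<bar> \<le> D"
      unfolding D_def by (rule abs_leI) (use abs_le_D1[OF X] abs_le_D2[OF X] in linarith)+
    from heat_shift_bound[OF _ _ this] s
    have "\<bar>exp (- \<kappa> * s) * X - heat_c / (2 * sqrt s)\<bar> \<le> exp \<bar>\<kappa>\<bar> * D + \<bar>\<kappa>\<bar> * exp \<bar>\<kappa>\<bar> * heat_c / 2 * sqrt s" by simp
    also have "\<dots> \<le> exp \<bar>\<kappa>\<bar> * D + \<bar>\<kappa>\<bar> * exp \<bar>\<kappa>\<bar> * heat_c / 2 * 1"
      using s heat_c_pos by (intro add_left_mono mult_left_mono) auto
    finally show "\<bar>(\<Sum>k. 1 * exp (- lam (Suc k) * s)) - heat_c / (2 * sqrt s)\<bar> \<le> C" unfolding e C_def by simp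
  qed (use h in \<open>auto intro!: derivative_eq_intros continuous_intros\<close>)
  then show ?thesis using C0 by (auto simp: G_def intro!: exI[of _ C])
qed

text \<open>With the weight 1 - cos the constants 1 / 2 of \<open>theta_zero\<close> and
  \<open>theta_cos\<close> cancel. The derivative then has error O(sqrt s) and the integral error
  O(h^(3/2)). After normalisation by sqrt n this is O(1 / n) at h = 1 / n, hence summable over n
  time steps.\<close>

lemma heat_cos_asym:
  assumes "\<sigma>0 > 0"
  shows "\<exists>C\<ge>0. \<forall>y h. \<sigma>0 \<le> 4 * (sin (pi * y))\<^sup>2 \<and> 0 \<le> h \<and> h \<le> 1 \<longrightarrow>
     \<bar>(\<Sum>k. (1 - cos2pi k y) * ((1 - exp (- lam (Suc k) * h)) / lam (Suc k))) - heat_c * sqrt h\<bar> \<le> C * (h * sqrt h)"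
proof -
  define A where "A = 16 * b + 8 * sqrt (2 * pi * b)"
  define D where "D = A + (A + b) / \<sigma>0"
  define C where "C = exp \<bar>\<kappa>\<bar> * D + \<bar>\<kappa>\<bar> * exp \<bar>\<kappa>\<bar> * heat_c / 2"
  have A0: "A \<ge> 0" using b_pos by (simp add: A_def)
  have D0: "D \<ge> 0" using A0 b_pos assms by (simp add: D_def)
  have C0: "C \<ge> 0" using D0 heat_c_pos by (simp add: C_def)
  have "\<bar>(\<Sum>k. (1 - cos2pi k y) * ((1 - exp (- lam (Suc k) * h)) / lam (Suc k))) - heat_c * sqrt h\<bar> \<le> 2 / 3 * C * (h * sqrt h)"
    if y: "\<sigma>0 \<le> 4 * (sin (pi * y))\<^sup>2" and h: "0 \<le> h" "h \<le> 1" for y h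
  proof (rule heat_integral_bound[where E' = "\<lambda>s. C * sqrt s" and E = "\<lambda>h. 2 / 3 * C * (h * sqrt h)"])
    fix s :: real assume s: "0 < s" "s < 1"
    define X where "X = (\<Sum>k. exp (- (b * s) * (real (Suc k))\<^sup>2))"
    define Y where "Y = (\<Sum>k. exp (- (b * s) * (real (Suc k))\<^sup>2) * cos2pi k y)"
    note st = theta_summable[OF s(1)]
    have sc: "summable (\<lambda>k. exp (- (b * s) * (real (Suc k))\<^sup>2) * cos2pi k y)"
      by (rule summable_comparison_test[OF _ st]) (auto simp: abs_mult intro!: exI[of _ 0] mult_left_le)
    have e: "(\<Sum>k. (1 - cos2pi k y) * exp (- lam (Suc k) * s)) = exp (- \<kappa> * s) * (X - Y)"
    proof -
      have "exp (- \<kappa> * s) * (X - Y) = (\<Sum>k. exp (- \<kappa> * s) * (exp (- (b * s) * (real (Suc k))\<^sup>2) - exp (- (b * s) * (real (Suc k))\<^sup>2) * cos2pi k y))"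
        unfolding X_def Y_def suminf_diff[OF st sc] by (rule suminf_mult[symmetric, OF summable_diff[OF st sc]])
      then show ?thesis unfolding lam_exp by (simp add: algebra_simps)
    qed
    have "\<bar>1 / 2 + X - heat_c / (2 * sqrt s)\<bar> \<le> gauss_err (b * s)"
      unfolding X_def theta_asym[OF s(1), symmetric] by (rule theta_zero) (use b_pos s in simp)
    also have ge: "gauss_err (b * s) \<le> A * sqrt s" unfolding A_def using s by (intro gauss_err_le) auto
    finally have 1: "\<bar>1 / 2 + X - heat_c / (2 * sqrt s)\<bar> \<le> A * sqrt s" .
    have "\<sigma>0 * \<bar>1 / 2 + Y\<bar> \<le> 4 * (sin (pi * y))\<^sup>2 * \<bar>1 / 2 + Y\<bar>" using y by (intro mult_right_mono) auto
    also have "\<dots> \<le> gauss_err (b * s) + b * s" unfolding Y_def by (rule theta_cos) (use b_pos s in simp)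
    also have "\<dots> \<le> A * sqrt s + b * sqrt s" using ge gauss_err_le(2)[of s] s by linarith
    finally have 2: "\<bar>1 / 2 + Y\<bar> \<le> (A + b) / \<sigma>0 * sqrt s" using assms by (simp add: field_simps)
    have "\<bar>(X - Y) - heat_c / (2 * sqrt s)\<bar> \<le> D * sqrt s" unfolding D_def distrib_right
      by (rule abs_leI) (use abs_le_D1[OF 1] abs_le_D2[OF 1] abs_le_D1[OF 2] abs_le_D2[OF 2] in linarith)+
    from heat_shift_bound[OF _ _ this] s
    show "\<bar>(\<Sum>k. (1 - cos2pi k y) * exp (- lam (Suc k) * s)) - heat_c / (2 * sqrt s)\<bar> \<le> C * sqrt s"
      unfolding e C_def by (simp add: algebra_simps)
    have "((\<lambda>h. 2 / 3 * C * (h * sqrt h)) has_real_derivative 2 / 3 * C * (1 * sqrt s + s * (inverse (sqrt s) / 2))) (at s)"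
      using s by (auto intro!: derivative_eq_intros)
    moreover have "s * (inverse (sqrt s) / 2) = sqrt s / 2" using s real_sqrt_mult_self[of s] by (simp add: field_simps)
    ultimately show "((\<lambda>h. 2 / 3 * C * (h * sqrt h)) has_real_derivative C * sqrt s) (at s)" by simp
  qed (use h in \<open>auto intro!: continuous_intros simp: cos_ge_minus_one[THEN order_trans[rotated]]\<close>)
  moreover have "2 / 3 * C * (h * sqrt h) \<le> C * (h * sqrt h)" if "0 \<le> h" for h using C0 that by (intro mult_right_mono) auto
  ultimately show ?thesis using C0 by (intro exI[of _ C]) (meson order_trans)
qed

end

section \<open>Covariances of the increments\<close>

definition ndist :: "nat \<Rightarrow> nat \<Rightarrow> nat" where "ndist a b = (if a \<le> b then b - a else a - b)"

lemma sum_ndist: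
  fixes f :: "nat \<Rightarrow> real"
  assumes "a < n"
  shows "(\<Sum>a'<n. f (ndist a a')) = f 0 + (\<Sum>r<a. f (Suc r)) + (\<Sum>r<n - Suc a. f (Suc r))"
proof -
  have "{..<n} = {..<a} \<union> {a} \<union> {Suc a..<n}" using assms by auto
  then have "(\<Sum>a'<n. f (ndist a a')) = (\<Sum>a'\<in>({..<a} \<union> {a}) \<union> {Suc a..<n}. f (ndist a a'))" by (rule arg_cong)
  also have "\<dots> = (\<Sum>a'\<in>{..<a} \<union> {a}. f (ndist a a')) + (\<Sum>a'\<in>{Suc a..<n}. f (ndist a a'))"
    by (rule sum.union_disjoint) auto
  also have "(\<Sum>a'\<in>{..<a} \<union> {a}. f (ndist a a')) = (\<Sum>a'<a. f (a - a')) + f 0"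
    by (subst sum.union_disjoint) (auto simp: ndist_def intro!: sum.cong)
  also have "(\<Sum>a'<a. f (a - a')) = (\<Sum>r<a. f (Suc r))"
    by (rule sum.reindex_bij_witness[of _ "\<lambda>r. a - Suc r" "\<lambda>a'. a - Suc a'"]) (auto simp: Suc_diff_Suc)
  also have "(\<Sum>a'\<in>{Suc a..<n}. f (ndist a a')) = (\<Sum>r<n - Suc a. f (Suc r))"
    by (rule sum.reindex_bij_witness[of _ "\<lambda>r. a + Suc r" "\<lambda>a'. a' - Suc a"]) (auto simp: ndist_def Suc_diff_Suc)
  finally show ?thesis by simp
qed

lemma sum_ndist_le:
  fixes f :: "nat \<Rightarrow> real"
  assumes "a < n" "\<And>r. 0 \<le> f r"
  shows "(\<Sum>a'<n. f (ndist a a')) \<le> f 0 + 2 * (\<Sum>r<n. f (Suc r))"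
proof -
  have "(\<Sum>r<a. f (Suc r)) \<le> (\<Sum>r<n. f (Suc r))" "(\<Sum>r<n - Suc a. f (Suc r)) \<le> (\<Sum>r<n. f (Suc r))"
    using assms by (auto intro!: sum_mono2)
  then show ?thesis unfolding sum_ndist[OF assms(1)] by linarith
qed

text \<open>In an n by n Toeplitz matrix the lag r + 1 occurs 2 (n - r - 1) times.\<close>

lemma sum_sum_ndist:
  fixes f :: "nat \<Rightarrow> real"
  shows "(\<Sum>a<n. \<Sum>a'<n. f (ndist a a')) = real n * f 0 + 2 * (\<Sum>r<n. real (n - Suc r) * f (Suc r))"
proof -
  have 1: "(\<Sum>a<n. \<Sum>r<a. f (Suc r)) = (\<Sum>r<n. real (n - Suc r) * f (Suc r))" for n
  proof (induction n)
    case (Suc n)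
    have "(\<Sum>r<Suc n. real (Suc n - Suc r) * f (Suc r)) = (\<Sum>r<n. real (n - Suc r) * f (Suc r) + f (Suc r))"
    proof -
      have "real (Suc n - Suc r) = real (n - Suc r) + 1" if "r < n" for r using that by (simp add: of_nat_diff)
      then show ?thesis by (simp add: algebra_simps)
    qed
    then show ?case using Suc by (simp add: sum.distrib)
  qed simp
  have 2: "(\<Sum>a<n. \<Sum>r<n - Suc a. f (Suc r)) = (\<Sum>a<n. \<Sum>r<a. f (Suc r))" by (rule sum.nat_diff_reindex)
  have "(\<Sum>a<n. \<Sum>a'<n. f (ndist a a')) = (\<Sum>a<n. f 0 + (\<Sum>r<a. f (Suc r)) + (\<Sum>r<n - Suc a. f (Suc r)))"
    by (intro sum.cong refl sum_ndist) simp
  also have "\<dots> = real n * f 0 + 2 * (\<Sum>r<n. real (n - Suc r) * f (Suc r))" using 1[of n] 2 by (simp add: sum.distrib)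
  finally show ?thesis .
qed

definition tvar :: "nat \<Rightarrow> (nat \<Rightarrow> real) \<Rightarrow> real" where "tvar K f = (\<Sum>k<K. \<bar>f (Suc k) - f k\<bar>)"

text \<open>Summation by parts: the boundary term contributes B and the variation of f at most V
  B.\<close>

lemma abel_bound:
  fixes f c :: "nat \<Rightarrow> real"
  assumes f: "\<And>k. \<bar>f k\<bar> \<le> 1" and tv: "\<And>K. tvar K f \<le> V" and c: "\<And>K. \<bar>\<Sum>k<K. c k\<bar> \<le> B"
  shows "\<bar>\<Sum>k<K. f k * c k\<bar> \<le> (1 + V) * B"
proof -
  define S where "S K = (\<Sum>k<K. c k)" for K
  have B: "B \<ge> 0" using c[of 0] by simp
  have e: "(\<Sum>k<K. f k * c k) = f K * S K - (\<Sum>k<K. (f (Suc k) - f k) * S (Suc k))" for K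
    by (induction K) (auto simp: S_def algebra_simps)
  have "\<bar>\<Sum>k<K. f k * c k\<bar> \<le> \<bar>f K * S K\<bar> + \<bar>\<Sum>k<K. (f (Suc k) - f k) * S (Suc k)\<bar>"
    unfolding e by (rule abs_triangle_ineq4)
  also have "\<bar>f K * S K\<bar> \<le> 1 * B" unfolding abs_mult S_def by (intro mult_mono f c) auto
  also have "\<bar>\<Sum>k<K. (f (Suc k) - f k) * S (Suc k)\<bar> \<le> (\<Sum>k<K. \<bar>f (Suc k) - f k\<bar> * B)"
    by (rule order_trans[OF sum_abs]) (intro sum_mono, simp add: abs_mult S_def mult_left_mono c del: sum.lessThan_Suc)
  also have "\<dots> = tvar K f * B" by (simp add: tvar_def sum_distrib_right)
  also have "\<dots> \<le> V * B" using tv[of K] B by (rule mult_right_mono)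
  finally show ?thesis by (simp add: algebra_simps)
qed

lemma tvar_mult:
  assumes "\<And>k. \<bar>f k\<bar> \<le> 1" "\<And>k. \<bar>g k\<bar> \<le> 1"
  shows "tvar K (\<lambda>k. f k * g k) \<le> tvar K f + tvar K g"
  unfolding tvar_def sum.distrib[symmetric]
proof (rule sum_mono)
  fix k
  have "f (Suc k) * g (Suc k) - f k * g k = (f (Suc k) - f k) * g (Suc k) + f k * (g (Suc k) - g k)" by (simp add: algebra_simps)
  also have "\<bar>\<dots>\<bar> \<le> \<bar>f (Suc k) - f k\<bar> * \<bar>g (Suc k)\<bar> + \<bar>f k\<bar> * \<bar>g (Suc k) - g k\<bar>"
    by (rule order_trans[OF abs_triangle_ineq]) (simp add: abs_mult)
  also have "\<dots> \<le> \<bar>f (Suc k) - f k\<bar> * 1 + 1 * \<bar>g (Suc k) - g k\<bar>"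
    by (intro add_mono mult_left_mono mult_right_mono assms) auto
  finally show "\<bar>f (Suc k) * g (Suc k) - f k * g k\<bar> \<le> \<bar>f (Suc k) - f k\<bar> + \<bar>g (Suc k) - g k\<bar>" by simp
qed

lemma tvar_incseq: "incseq f \<Longrightarrow> (\<And>k. 0 \<le> f k) \<Longrightarrow> (\<And>k. f k \<le> 1) \<Longrightarrow> tvar K f \<le> 1"
proof -
  assume m: "incseq f" and b: "\<And>k. 0 \<le> f k" "\<And>k. f k \<le> 1"
  have "tvar K f = (\<Sum>k<K. f (Suc k) - f k)" unfolding tvar_def using incseq_SucD[OF m] by (intro sum.cong) auto
  also have "\<dots> = f K - f 0" by (rule sum_lessThan_telescope)
  finally show ?thesis using b[of 0] b[of K] by linarith
qed

lemma tvar_decseq: "decseq f \<Longrightarrow> (\<And>k. 0 \<le> f k) \<Longrightarrow> (\<And>k. f k \<le> 1) \<Longrightarrow> tvar K f \<le> 1"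
proof -
  assume m: "decseq f" and b: "\<And>k. 0 \<le> f k" "\<And>k. f k \<le> 1"
  have "tvar K f = (\<Sum>k<K. f k - f (Suc k))" unfolding tvar_def using decseq_SucD[OF m] by (intro sum.cong) auto
  also have "\<dots> = f 0 - f K" by (rule sum_lessThan_telescope')
  finally show ?thesis using b[of 0] b[of K] by linarith
qed

text \<open>Multiplied by 2 sin (theta / 2) the sum telescopes to a difference of two sines.\<close>

lemma dirichlet_kernel_bound:
  assumes "sin (\<theta> / 2) \<noteq> 0"
  shows "\<bar>\<Sum>k<K. cos (real (Suc k) * \<theta>)\<bar> \<le> 1 / \<bar>sin (\<theta> / 2)\<bar>"
proof -
  have "2 * sin (\<theta> / 2) * (\<Sum>k<K. cos (real (Suc k) * \<theta>)) = sin ((real K + 1 / 2) * \<theta>) - sin (\<theta> / 2)"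
  proof (induction K)
    case (Suc K)
    have "2 * sin (\<theta> / 2) * cos (real (Suc K) * \<theta>) = sin (real (Suc K) * \<theta> + \<theta> / 2) - sin (real (Suc K) * \<theta> - \<theta> / 2)"
      by (simp add: sin_add sin_diff)
    moreover have "real (Suc K) * \<theta> + \<theta> / 2 = (real (Suc K) + 1 / 2) * \<theta>" "real (Suc K) * \<theta> - \<theta> / 2 = (real K + 1 / 2) * \<theta>"
      by (simp_all add: field_simps)
    ultimately show ?case using Suc by (simp add: distrib_left del: of_nat_Suc)
  qed simp
  then have "2 * \<bar>sin (\<theta> / 2)\<bar> * \<bar>\<Sum>k<K. cos (real (Suc k) * \<theta>)\<bar> = \<bar>sin ((real K + 1 / 2) * \<theta>) - sin (\<theta> / 2)\<bar>"
    by (metis abs_mult abs_numeral)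
  also have "\<dots> \<le> 2" using abs_sin_le_one[of "(real K + 1 / 2) * \<theta>"] abs_sin_le_one[of "\<theta> / 2"] by linarith
  finally show ?thesis using assms by (simp add: field_simps)
qed

lemma sin_lower:
  fixes x :: real assumes "0 \<le> x" "x \<le> pi / 2"
  shows "x / 2 \<le> sin x"
proof -
  have "\<bar>sin x - (\<Sum>m<3. sin_coeff m * x ^ m)\<bar> \<le> inverse (fact 3) * \<bar>x\<bar> ^ 3" by (rule Maclaurin_sin_bound)
  also have "(\<Sum>m<3. sin_coeff m * x ^ m) = x" by (simp add: eval_nat_numeral sin_coeff_def)
  finally have 0: "\<bar>sin x - x\<bar> \<le> inverse (fact 3) * \<bar>x\<bar> ^ 3" .
  have "inverse (fact 3) * \<bar>x\<bar> ^ 3 = x ^ 3 / 6" using assms by (simp add: fact_numeral)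
  then have 1: "x - x ^ 3 / 6 \<le> sin x" using abs_le_D2[OF 0] by linarith
  \<comment> \<open>On [0, pi / 2] this gives x^2 <= 1.7^2 < 3, so the cubic term x^3 / 6 is at most
    x / 2.\<close>
  have "pi \<le> 17 / 5" by (rule order_trans[OF pi_approx(2)]) simp
  then have "x \<le> 17 / 10" using assms by linarith
  then have "x * x \<le> 17 / 10 * (17 / 10)" using assms by (intro mult_mono) auto
  then have "x * (x * x) \<le> x * 3" using assms by (intro mult_left_mono) auto
  then have "x ^ 3 \<le> 3 * x" by (simp add: power3_eq_cube mult_ac)
  then show ?thesis using 1 by linarith
qed

lemma abs_sin_half_pi_lower: "\<bar>u\<bar> \<le> 1 \<Longrightarrow> \<bar>u\<bar> / 2 \<le> \<bar>sin (pi * u / 2)\<bar>"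
proof -
  assume u: "\<bar>u\<bar> \<le> 1"
  have p: "2 \<le> pi" using pi_ge_two by simp
  have "\<bar>u\<bar> / 2 \<le> (pi * \<bar>u\<bar> / 2) / 2" using p mult_right_mono[OF p, of "\<bar>u\<bar>"] by simp
  also have "\<dots> \<le> sin (pi * \<bar>u\<bar> / 2)" using u by (intro sin_lower) auto
  also have "\<dots> \<le> \<bar>sin (pi * u / 2)\<bar>" by (cases "u \<ge> 0") auto
  finally show ?thesis .
qed

lemma sin_pi_lower:
  assumes "0 < \<delta>" "\<delta> \<le> z" "z \<le> 1 - \<delta>"
  shows "\<delta> \<le> sin (pi * z)"
proof -
  have *: "\<delta> \<le> sin (pi * z)" if "\<delta> \<le> z" "z \<le> 1 / 2" for z
  proof -
    have p: "2 \<le> pi" using pi_ge_two by simp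
    have "2 * z \<le> pi * z" using mult_right_mono[OF p, of z] that assms by simp
    moreover have "pi * z / 2 \<le> sin (pi * z)" using that assms mult_left_mono[of z "1/2" pi] by (intro sin_lower) auto
    ultimately show ?thesis using that by linarith
  qed
  show ?thesis
  proof (cases "z \<le> 1 / 2")
    case False
    have "sin (pi * z) = sin (pi * (1 - z))" by (simp add: right_diff_distrib)
    then show ?thesis using *[of "1 - z"] False assms by simp
  qed (use * assms in auto)
qed

section \<open>Covariance coefficients of the modes and bounded row sums\<close>

context heat_spectrum
begin

text \<open>Time steps are counted from \<open>0\<close>. Up to the factor \<open>\<sigma>\<^sup>2\<close>, \<open>gam n k a a'\<close> is the covariance of the
  increments of the \<open>k\<close>-th stochastic convolution over the steps \<open>a\<close> and \<open>a'\<close>; \<open>al\<close> is its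
  stationary part and \<open>be\<close> the correction for the start in \<open>0\<close>. \<open>CC\<close> is the covariance of the
  normalised increments, \<open>CK\<close> its truncation and \<open>AA\<close> its stationary, spatially averaged part.\<close>

definition q :: "nat \<Rightarrow> nat \<Rightarrow> real" where "q n k = exp (- (lam k / real n))"
definition al :: "nat \<Rightarrow> nat \<Rightarrow> nat \<Rightarrow> real" where
  "al n k r = (if r = 0 then (1 - q n k) / lam k else - ((1 - q n k)\<^sup>2 * q n k ^ (r - 1) / (2 * lam k)))"
definition be :: "nat \<Rightarrow> nat \<Rightarrow> nat \<Rightarrow> real" where "be n k s = (1 - q n k)\<^sup>2 * q n k ^ s / (2 * lam k)"
definition gam :: "nat \<Rightarrow> nat \<Rightarrow> nat \<Rightarrow> nat \<Rightarrow> real" where "gam n k a a' = al n k (ndist a a') - be n k (a + a')"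
definition Nn :: "nat \<Rightarrow> real" where "Nn n = sqrt (real n) / heat_c"
definition wt :: "nat \<Rightarrow> real \<Rightarrow> real \<Rightarrow> real" where "wt k y y' = 2 * (sin (pi * real k * y) * sin (pi * real k * y'))"
definition CK :: "nat \<Rightarrow> nat \<Rightarrow> nat \<Rightarrow> nat \<Rightarrow> real \<Rightarrow> real \<Rightarrow> real" where
  "CK K n a a' y y' = Nn n * (\<Sum>k<K. gam n (Suc k) a a' * wt (Suc k) y y')"
definition CC :: "nat \<Rightarrow> nat \<Rightarrow> nat \<Rightarrow> real \<Rightarrow> real \<Rightarrow> real" where
  "CC n a a' y y' = Nn n * (\<Sum>k. gam n (Suc k) a a' * wt (Suc k) y y')"
definition AA :: "nat \<Rightarrow> nat \<Rightarrow> real" where "AA n r = Nn n * (\<Sum>k. al n (Suc k) r)"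

text \<open>The common majorant of the coefficients \<open>al\<close> and \<open>be\<close> in k.
  Its sum is \<open>G (1 / real n)\<close>, which \<open>Nn n\<close> scales to a bounded
  quantity.\<close>

abbreviation ratio :: "nat \<Rightarrow> nat \<Rightarrow> real" where "ratio n k \<equiv> (1 - q n (Suc k)) / lam (Suc k)"

lemma lam_nz [simp]: "lam (Suc k) \<noteq> 0" using lam_Suc_pos[of k] by linarith
lemma lam_ge0 [simp]: "0 \<le> lam (Suc k)" using lam_Suc_pos[of k] by linarith

lemma q_bounds:
  assumes "n \<ge> 1" shows "0 < q n (Suc k)" "q n (Suc k) < 1" "0 \<le> q n (Suc k)" "q n (Suc k) \<le> 1"
  using assms by (auto simp: q_def)

lemma wt_le: "\<bar>wt k y y'\<bar> \<le> 2"
proof -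
  have "\<bar>sin (pi * real k * y) * sin (pi * real k * y')\<bar> \<le> 1 * 1" unfolding abs_mult by (intro mult_mono) auto
  then show ?thesis by (simp add: wt_def abs_mult)
qed

lemma wt_cos: "wt k y y' = cos (pi * real k * (y - y')) - cos (pi * real k * (y + y'))"
  by (simp add: wt_def cos_add cos_diff algebra_simps)

lemma be_nonneg: "n \<ge> 1 \<Longrightarrow> 0 \<le> be n (Suc k) s"
  unfolding be_def using q_bounds(3)[of n k] by (intro divide_nonneg_nonneg mult_nonneg_nonneg) auto

lemma be_le: "n \<ge> 1 \<Longrightarrow> be n (Suc k) s \<le> ratio n k"
proof -
  assume n: "n \<ge> 1"
  note q = q_bounds[OF n, of k]
  have "(1 - q n (Suc k))\<^sup>2 * q n (Suc k) ^ s \<le> (1 - q n (Suc k)) * 1"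
    unfolding power2_eq_square mult.assoc using q by (intro mult_left_mono mult_le_one power_le_one) auto
  then have "be n (Suc k) s \<le> (1 - q n (Suc k)) / (2 * lam (Suc k))" unfolding be_def by (intro divide_right_mono) auto
  also have "\<dots> \<le> ratio n k" using q by (intro divide_left_mono) auto
  finally show ?thesis .
qed

lemma al_Suc: "al n k (Suc r) = - be n k r" by (simp add: al_def be_def)

lemma abs_al_Suc: "n \<ge> 1 \<Longrightarrow> \<bar>al n (Suc k) (Suc r)\<bar> = be n (Suc k) r"
  by (simp add: al_Suc be_nonneg)

lemma abs_al_le: "n \<ge> 1 \<Longrightarrow> \<bar>al n (Suc k) r\<bar> \<le> ratio n k"
proof (cases r)
  case 0
  assume "n \<ge> 1" then show ?thesis using 0 q_bounds(4)[of n k] by (simp add: al_def)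
next
  case (Suc s)
  assume "n \<ge> 1" then show ?thesis using Suc be_le[of n k s] by (simp add: abs_al_Suc)
qed

lemma G_summable: "0 \<le> h \<Longrightarrow> summable (\<lambda>k. (1 - exp (- lam (Suc k) * h)) / lam (Suc k))"
proof (rule summable_comparison_test[OF _ summable_inverse_lam])
  assume h: "0 \<le> h"
  show "\<exists>N. \<forall>n\<ge>N. norm ((1 - exp (- lam (Suc n) * h)) / lam (Suc n)) \<le> 1 / lam (Suc n)"
  proof (intro exI[of _ 0] allI impI)
    fix n
    have x: "0 \<le> lam (Suc n) * h" using h by simp
    show "norm ((1 - exp (- lam (Suc n) * h)) / lam (Suc n)) \<le> 1 / lam (Suc n)"
      using one_minus_exp_bounds(1,2)[OF x] by (simp add: divide_right_mono)
  qed
qed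

lemma q_exp: "q n k ^ j = exp (- lam k * (real j / real n))"
  by (simp add: q_def exp_of_nat_mult[symmetric])

lemma G_q: "G (1 / real n) = (\<Sum>k. ratio n k)"
  by (simp add: G_def q_def)

lemma q_summable: "summable (\<lambda>k. ratio n k)"
  using G_summable[of "1 / real n"] by (simp add: q_def)

lemma be_summable: "n \<ge> 1 \<Longrightarrow> summable (\<lambda>k. be n (Suc k) s)"
  by (rule summable_comparison_test[OF _ q_summable[of n]]) (use be_le be_nonneg in auto)

lemma al_summable: "n \<ge> 1 \<Longrightarrow> summable (\<lambda>k. al n (Suc k) r)"
  by (rule summable_comparison_test[OF _ q_summable[of n]]) (use abs_al_le in auto)

lemma NnG_bound: "\<exists>C\<ge>0. \<forall>n\<ge>1. Nn n * G (1 / real n) \<le> C"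
proof -
  obtain C where C: "C \<ge> 0" "\<And>h. 0 \<le> h \<Longrightarrow> h \<le> 1 \<Longrightarrow> \<bar>G h - heat_c * sqrt h\<bar> \<le> C * h" using G_asym by blast
  have "Nn n * G (1 / real n) \<le> 1 + C / heat_c" if n: "n \<ge> 1" for n
  proof -
    have h: "0 \<le> 1 / real n" "1 / real n \<le> 1" using n by auto
    have s: "sqrt (real n) > 0" using n by simp
    have sq: "1 / real n \<le> sqrt (1 / real n)"
      using mult_left_le[OF h(2,1)] unfolding power2_eq_square by (intro real_le_rsqrt) (simp only: power2_eq_square)
    have "G (1 / real n) \<le> heat_c * sqrt (1 / real n) + C * sqrt (1 / real n)"
      using C(2)[OF h] mult_left_mono[OF sq C(1)] by (simp add: abs_le_iff)
    then have "Nn n * G (1 / real n) \<le> Nn n * (heat_c * sqrt (1 / real n) + C * sqrt (1 / real n))"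
      unfolding Nn_def using heat_c_pos by (intro mult_left_mono) auto
    also have "\<dots> = 1 + C / heat_c" using heat_c_pos s unfolding Nn_def by (simp add: real_sqrt_divide field_simps)
    finally show ?thesis .
  qed
  then show ?thesis using C(1) heat_c_pos by (intro exI[of _ "1 + C / heat_c"]) auto
qed

text \<open>One factor 1 - q is consumed by the geometric series over s, the other one
  remains.\<close>

lemma sum_be_le: "n \<ge> 1 \<Longrightarrow> (\<Sum>s<N. be n (Suc k) s) \<le> (1 - q n (Suc k)) / (2 * lam (Suc k))"
proof -
  assume n: "n \<ge> 1"
  note q = q_bounds[OF n, of k]
  have "(\<Sum>s<N. be n (Suc k) s) = (1 - q n (Suc k)) / (2 * lam (Suc k)) * ((1 - q n (Suc k)) * (\<Sum>s<N. q n (Suc k) ^ s))"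
    by (simp add: be_def sum_distrib_left power2_eq_square mult_ac)
  also have "(1 - q n (Suc k)) * (\<Sum>s<N. q n (Suc k) ^ s) = 1 - q n (Suc k) ^ N" by (rule one_diff_power_eq[symmetric])
  also have "(1 - q n (Suc k)) / (2 * lam (Suc k)) * (1 - q n (Suc k) ^ N) \<le> (1 - q n (Suc k)) / (2 * lam (Suc k)) * 1"
    using q by (intro mult_left_mono) auto
  finally show ?thesis by simp
qed

lemma sum_be_shift_le: "n \<ge> 1 \<Longrightarrow> (\<Sum>a'<N. be n (Suc k) (a + a')) \<le> (1 - q n (Suc k)) / (2 * lam (Suc k))"
proof -
  assume n: "n \<ge> 1"
  note q = q_bounds[OF n, of k]
  have "be n (Suc k) (a + a') \<le> be n (Suc k) a'" for a'
    unfolding be_def using q by (intro divide_right_mono mult_left_mono power_decreasing) auto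
  then have "(\<Sum>a'<N. be n (Suc k) (a + a')) \<le> (\<Sum>a'<N. be n (Suc k) a')" by (rule sum_mono)
  then show ?thesis using sum_be_le[OF n, of k N] by linarith
qed

lemma sum_abs_al_le: "n \<ge> 1 \<Longrightarrow> a < N \<Longrightarrow> (\<Sum>a'<N. \<bar>al n (Suc k) (ndist a a')\<bar>) \<le> 2 * (ratio n k)"
proof -
  assume n: "n \<ge> 1" and a: "a < N"
  have "(\<Sum>a'<N. \<bar>al n (Suc k) (ndist a a')\<bar>) \<le> \<bar>al n (Suc k) 0\<bar> + 2 * (\<Sum>r<N. \<bar>al n (Suc k) (Suc r)\<bar>)"
    by (rule sum_ndist_le[OF a]) simp
  also have "\<dots> = \<bar>al n (Suc k) 0\<bar> + 2 * (\<Sum>r<N. be n (Suc k) r)" using n by (simp add: abs_al_Suc)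
  also have "\<dots> \<le> ratio n k + 2 * ((1 - q n (Suc k)) / (2 * lam (Suc k)))"
    by (intro add_mono mult_left_mono abs_al_le sum_be_le n) auto
  also have "x / l + 2 * (x / (2 * l)) = 2 * (x / l)" for x l :: real by simp
  finally show ?thesis .
qed

lemma sum_abs_gam_le:
  assumes n: "n \<ge> 1" and a: "a < N"
  shows "(\<Sum>a'<N. \<bar>gam n (Suc k) a a'\<bar>) \<le> 3 * (ratio n k)"
proof -
  have "(\<Sum>a'<N. \<bar>gam n (Suc k) a a'\<bar>) \<le> (\<Sum>a'<N. \<bar>al n (Suc k) (ndist a a')\<bar> + be n (Suc k) (a + a'))"
    unfolding gam_def using be_nonneg[OF n] by (intro sum_mono order_trans[OF abs_triangle_ineq4]) simp
  also have "\<dots> \<le> 2 * (ratio n k) + (1 - q n (Suc k)) / (2 * lam (Suc k))"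
    unfolding sum.distrib by (intro add_mono sum_abs_al_le sum_be_shift_le n a)
  also have "\<dots> \<le> 3 * (ratio n k)"
  proof -
    have "0 \<le> ratio n k" using q_bounds(4)[OF n] by simp
    moreover have "(1 - q n (Suc k)) / (2 * lam (Suc k)) = ratio n k / 2" by simp
    ultimately show ?thesis by linarith
  qed
  finally show ?thesis .
qed

lemma Nn_nonneg: "0 \<le> Nn n" using heat_c_pos by (simp add: Nn_def)

lemma CK_tendsto: "n \<ge> 1 \<Longrightarrow> (\<lambda>K. CK K n a a' y y') \<longlonglongrightarrow> CC n a a' y y'"
  and gam_wt_summable: "n \<ge> 1 \<Longrightarrow> summable (\<lambda>k. gam n (Suc k) a a' * wt (Suc k) y y')"
proof -
  assume n: "n \<ge> 1"
  show s: "summable (\<lambda>k. gam n (Suc k) a a' * wt (Suc k) y y')"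
  proof (rule summable_comparison_test)
    show "summable (\<lambda>k. 4 * (ratio n k))" by (rule summable_mult[OF q_summable])
    show "\<exists>N. \<forall>k\<ge>N. norm (gam n (Suc k) a a' * wt (Suc k) y y') \<le> 4 * (ratio n k)"
    proof (intro exI[of _ 0] allI impI)
      fix k
      have "\<bar>gam n (Suc k) a a'\<bar> \<le> \<bar>al n (Suc k) (ndist a a')\<bar> + be n (Suc k) (a + a')"
        unfolding gam_def using be_nonneg[OF n] by (intro order_trans[OF abs_triangle_ineq4]) simp
      also have "\<dots> \<le> 2 * (ratio n k)" using add_mono[OF abs_al_le[OF n] be_le[OF n]] by (simp only: mult_2)
      finally have "\<bar>gam n (Suc k) a a'\<bar> * \<bar>wt (Suc k) y y'\<bar> \<le> (2 * (ratio n k)) * 2"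
        using wt_le by (intro mult_mono) auto
      then show "norm (gam n (Suc k) a a' * wt (Suc k) y y') \<le> 4 * (ratio n k)" by (simp add: abs_mult)
    qed
  qed
  show "(\<lambda>K. CK K n a a' y y') \<longlonglongrightarrow> CC n a a' y y'"
    unfolding CK_def CC_def by (intro tendsto_intros summable_LIMSEQ s)
qed

text \<open>The sum over time is taken first, mode by mode, where geometric series leave at most 3
  \<open>ratio\<close>; only then are the modes summed. The weights are merely bounded by 2, so the
  spatial point may vary with a'.\<close>

lemma CK_row_sum: "\<exists>C\<ge>0. \<forall>n\<ge>1. \<forall>K a y y'. a < n \<longrightarrow> (\<Sum>a'<n. \<bar>CK K n a a' y (y' a')\<bar>) \<le> C"
proof -
  obtain C where C: "C \<ge> 0" "\<And>n. n \<ge> 1 \<Longrightarrow> Nn n * G (1 / real n) \<le> C" using NnG_bound by blast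
  have "(\<Sum>a'<n. \<bar>CK K n a a' y (y' a')\<bar>) \<le> 6 * C" if n: "n \<ge> 1" and a: "a < n" for n K a y y'
  proof -
    have "(\<Sum>a'<n. \<bar>CK K n a a' y (y' a')\<bar>) \<le> (\<Sum>a'<n. Nn n * (\<Sum>k<K. \<bar>gam n (Suc k) a a'\<bar> * 2))"
    proof (rule sum_mono)
      fix a'
      have "\<bar>\<Sum>k<K. gam n (Suc k) a a' * wt (Suc k) y (y' a')\<bar> \<le> (\<Sum>k<K. \<bar>gam n (Suc k) a a'\<bar> * 2)"
        by (rule order_trans[OF sum_abs]) (intro sum_mono, simp add: abs_mult mult_left_mono wt_le)
      then show "\<bar>CK K n a a' y (y' a')\<bar> \<le> Nn n * (\<Sum>k<K. \<bar>gam n (Suc k) a a'\<bar> * 2)"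
        unfolding CK_def abs_mult using Nn_nonneg[of n] by (simp add: mult_left_mono)
    qed
    also have "\<dots> = Nn n * (\<Sum>k<K. 2 * (\<Sum>a'<n. \<bar>gam n (Suc k) a a'\<bar>))"
      unfolding sum_distrib_left[symmetric] by (subst sum.swap) (simp add: sum_distrib_left mult.commute)
    also have "\<dots> \<le> Nn n * (\<Sum>k<K. 2 * (3 * (ratio n k)))" by (intro mult_left_mono sum_mono sum_abs_gam_le n a Nn_nonneg) auto
    also have "\<dots> = 6 * (Nn n * (\<Sum>k<K. ratio n k))" by (simp add: sum_distrib_left mult_ac)
    also have "(\<Sum>k<K. ratio n k) \<le> G (1 / real n)"
      unfolding G_q by (rule sum_le_suminf[OF q_summable]) (use q_bounds(4)[OF n] in auto)
    then have "6 * (Nn n * (\<Sum>k<K. ratio n k)) \<le> 6 * (Nn n * G (1 / real n))" using Nn_nonneg by (intro mult_left_mono) auto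
    also have "\<dots> \<le> 6 * C" using C(2)[OF n] by simp
    finally show ?thesis .
  qed
  then show ?thesis using C(1) by (intro exI[of _ "6 * C"]) auto
qed

lemma CC_row_sum: "\<exists>C\<ge>0. \<forall>n\<ge>1. \<forall>a y y'. a < n \<longrightarrow> (\<Sum>a'<n. \<bar>CC n a a' y (y' a')\<bar>) \<le> C"
proof -
  obtain C where C: "C \<ge> 0" "\<And>n K a y y'. n \<ge> 1 \<Longrightarrow> a < n \<Longrightarrow> (\<Sum>a'<n. \<bar>CK K n a a' y (y' a')\<bar>) \<le> C" using CK_row_sum by metis
  have "(\<Sum>a'<n. \<bar>CC n a a' y (y' a')\<bar>) \<le> C" if n: "n \<ge> 1" and a: "a < n" for n a y y'
    by (rule LIMSEQ_le_const2[of "\<lambda>K. \<Sum>a'<n. \<bar>CK K n a a' y (y' a')\<bar>"])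
       (use C(2)[OF n a] in \<open>auto intro!: tendsto_intros CK_tendsto n\<close>)
  then show ?thesis using C(1) by blast
qed

section \<open>Decorrelation of distinct spatial points\<close>

lemma q_antimono: "n \<ge> 1 \<Longrightarrow> j \<le> k \<Longrightarrow> q n k \<le> q n j"
  using lam_mono[of j k] by (simp add: q_def divide_right_mono)

lemma tvar_q_power: "n \<ge> 1 \<Longrightarrow> tvar K (\<lambda>k. q n (Suc k) ^ s) \<le> 1"
proof (rule tvar_decseq)
  assume n: "n \<ge> 1"
  show "decseq (\<lambda>k. q n (Suc k) ^ s)" by (rule decseq_SucI) (intro power_mono q_antimono n q_bounds(3), simp)
  show "0 \<le> q n (Suc k) ^ s" "q n (Suc k) ^ s \<le> 1" for k using q_bounds[OF n, of k] by (auto intro: power_le_one)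
qed

lemma tvar_one_minus_q: "n \<ge> 1 \<Longrightarrow> tvar K (\<lambda>k. 1 - q n (Suc k)) \<le> 1"
proof (rule tvar_incseq)
  assume n: "n \<ge> 1"
  show "incseq (\<lambda>k. 1 - q n (Suc k))" by (rule incseq_SucI) (intro diff_left_mono q_antimono n, simp)
  show "0 \<le> 1 - q n (Suc k)" "1 - q n (Suc k) \<le> 1" for k using q_bounds[OF n, of k] by auto
qed

lemma exp_quotient_antimono:
  fixes x y :: real
  assumes "0 < x" "x \<le> y"
  shows "(1 - exp (- y)) / y \<le> (1 - exp (- x)) / x"
proof (rule DERIV_nonpos_imp_nonincreasing[OF assms(2)])
  fix t assume t: "x \<le> t" "t \<le> y"
  then have t0: "t > 0" using assms by simp
  have "((\<lambda>t. (1 - exp (- t)) / t) has_real_derivative (exp (- t) * t - (1 - exp (- t))) / (t * t)) (at t)"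
    using t0 by (auto intro!: derivative_eq_intros)
  moreover have "(exp (- t) * t - (1 - exp (- t))) / (t * t) \<le> 0"
  proof -
    have "exp (- t) * (1 + t) \<le> exp (- t) * exp t" by (intro mult_left_mono exp_ge_add_one_self) auto
    then have "exp (- t) * t - (1 - exp (- t)) \<le> 0" by (simp add: algebra_simps flip: exp_add)
    then show ?thesis using t0 by (simp add: divide_le_0_iff)
  qed
  ultimately show "\<exists>z. ((\<lambda>t. (1 - exp (- t)) / t) has_real_derivative z) (at t) \<and> z \<le> 0" by blast
qed

text \<open>With this factor \<open>be\<close> and \<open>al\<close> become 1 / n times products of
  sequences that are monotone in k with values in [0, 1]. Their total variation is thus bounded
  uniformly in n and in the lag.\<close>

definition e1 :: "nat \<Rightarrow> nat \<Rightarrow> real" where "e1 n k = (1 - q n k) / (lam k / real n)"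

lemma e1_bounds: "n \<ge> 1 \<Longrightarrow> 0 \<le> e1 n (Suc k)" "n \<ge> 1 \<Longrightarrow> e1 n (Suc k) \<le> 1"
proof -
  assume n: "n \<ge> 1"
  have x: "0 < lam (Suc k) / real n" using n by simp
  show "0 \<le> e1 n (Suc k)" unfolding e1_def using q_bounds(4)[OF n, of k] x by (intro divide_nonneg_nonneg) auto
  show "e1 n (Suc k) \<le> 1" unfolding e1_def q_def
    using one_minus_exp_bounds(3)[of "lam (Suc k) / real n"] x by (simp only: divide_le_eq_1_pos)
qed

lemma tvar_e1: "n \<ge> 1 \<Longrightarrow> tvar K (\<lambda>k. e1 n (Suc k)) \<le> 1"
proof (rule tvar_decseq)
  assume n: "n \<ge> 1"
  show "decseq (\<lambda>k. e1 n (Suc k))"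
  proof (rule decseq_SucI)
    fix k
    show "e1 n (Suc (Suc k)) \<le> e1 n (Suc k)" unfolding e1_def q_def
      by (rule exp_quotient_antimono) (use n lam_mono[of "Suc k" "Suc (Suc k)"] in \<open>auto intro: divide_right_mono\<close>)
  qed
  show "0 \<le> e1 n (Suc k)" "e1 n (Suc k) \<le> 1" for k using e1_bounds[OF n] by auto
qed

lemma be_e1: "n \<ge> 1 \<Longrightarrow> be n k s = 1 / (2 * real n) * (e1 n k * ((1 - q n k) * q n k ^ s))"
  by (simp add: be_def e1_def power2_eq_square)

lemma al0_e1: "n \<ge> 1 \<Longrightarrow> al n k 0 = 1 / real n * e1 n k"
  by (simp add: al_def e1_def)

text \<open>Three monotone factors have total variation at most 3, so Abel summation against the
  Dirichlet kernel costs 1 + 3, and the prefactor 1 / (2 n) leaves 2 / n.\<close>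

lemma be_cos_bound:
  assumes n: "n \<ge> 1" and u: "sin (pi * u / 2) \<noteq> 0"
  shows "\<bar>\<Sum>k<K. be n (Suc k) s * cos (pi * real (Suc k) * u)\<bar> \<le> 2 / (real n * \<bar>sin (pi * u / 2)\<bar>)"
proof -
  have D: "\<bar>\<Sum>k<K. cos (pi * real (Suc k) * u)\<bar> \<le> 1 / \<bar>sin (pi * u / 2)\<bar>" for K
    using dirichlet_kernel_bound[OF u, of K] by (simp add: mult_ac)
  note qb = q_bounds[OF n] and eb = e1_bounds[OF n]
  have q1: "\<bar>1 - q n (Suc k)\<bar> \<le> 1" "\<bar>q n (Suc k) ^ s\<bar> \<le> 1" "\<bar>e1 n (Suc k)\<bar> \<le> 1" for k
    using qb[of k] eb[of k] by (auto simp: power_abs intro: power_le_one)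
  have q2: "\<bar>(1 - q n (Suc k)) * q n (Suc k) ^ s\<bar> \<le> 1" for k unfolding abs_mult using q1[of k] by (intro mult_le_one) auto
  have q3: "\<bar>e1 n (Suc k) * ((1 - q n (Suc k)) * q n (Suc k) ^ s)\<bar> \<le> 1" for k
    unfolding abs_mult[of "e1 n (Suc k)"] using q1[of k] q2[of k] by (intro mult_le_one) auto
  have tv: "tvar K (\<lambda>k. e1 n (Suc k) * ((1 - q n (Suc k)) * q n (Suc k) ^ s)) \<le> 3" for K
    using tvar_mult[where f = "\<lambda>k. e1 n (Suc k)" and g = "\<lambda>k. (1 - q n (Suc k)) * q n (Suc k) ^ s" and K = K, OF q1(3) q2]
      tvar_mult[where f = "\<lambda>k. 1 - q n (Suc k)" and g = "\<lambda>k. q n (Suc k) ^ s" and K = K, OF q1(1,2)] tvar_e1[OF n, of K] tvar_one_minus_q[OF n, of K] tvar_q_power[OF n, of K s]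
    by linarith
  have "\<bar>\<Sum>k<K. (e1 n (Suc k) * ((1 - q n (Suc k)) * q n (Suc k) ^ s)) * cos (pi * real (Suc k) * u)\<bar> \<le> (1 + 3) * (1 / \<bar>sin (pi * u / 2)\<bar>)"
    by (rule abel_bound[OF q3 tv D])
  then have "1 / (2 * real n) * \<bar>\<Sum>k<K. (e1 n (Suc k) * ((1 - q n (Suc k)) * q n (Suc k) ^ s)) * cos (pi * real (Suc k) * u)\<bar> \<le> 1 / (2 * real n) * ((1 + 3) * (1 / \<bar>sin (pi * u / 2)\<bar>))"
    by (rule mult_left_mono) simp
  also have "1 / (2 * real n) * \<bar>\<Sum>k<K. (e1 n (Suc k) * ((1 - q n (Suc k)) * q n (Suc k) ^ s)) * cos (pi * real (Suc k) * u)\<bar> =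
     \<bar>\<Sum>k<K. be n (Suc k) s * cos (pi * real (Suc k) * u)\<bar>"
    unfolding be_e1[OF n] by (simp add: abs_mult sum_distrib_left[symmetric] mult.assoc sum_divide_distrib[symmetric])
  finally show ?thesis by (simp add: mult.commute)
qed

lemma al_cos_bound:
  assumes n: "n \<ge> 1" and u: "sin (pi * u / 2) \<noteq> 0"
  shows "\<bar>\<Sum>k<K. al n (Suc k) r * cos (pi * real (Suc k) * u)\<bar> \<le> 2 / (real n * \<bar>sin (pi * u / 2)\<bar>)"
proof (cases r)
  case (Suc s)
  then show ?thesis using be_cos_bound[OF n u, of s K] by (simp add: al_Suc sum_negf)
next
  case 0
  have D: "\<bar>\<Sum>k<K. cos (pi * real (Suc k) * u)\<bar> \<le> 1 / \<bar>sin (pi * u / 2)\<bar>" for K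
    using dirichlet_kernel_bound[OF u, of K] by (simp add: mult_ac)
  have q1: "\<bar>e1 n (Suc k)\<bar> \<le> 1" for k using e1_bounds[OF n, of k] by auto
  have "\<bar>\<Sum>k<K. e1 n (Suc k) * cos (pi * real (Suc k) * u)\<bar> \<le> (1 + 1) * (1 / \<bar>sin (pi * u / 2)\<bar>)"
    by (rule abel_bound[OF q1 tvar_e1[OF n] D])
  then have "1 / real n * \<bar>\<Sum>k<K. e1 n (Suc k) * cos (pi * real (Suc k) * u)\<bar> \<le> 1 / real n * ((1 + 1) * (1 / \<bar>sin (pi * u / 2)\<bar>))"
    by (rule mult_left_mono) simp
  also have "1 / real n * \<bar>\<Sum>k<K. e1 n (Suc k) * cos (pi * real (Suc k) * u)\<bar> = \<bar>\<Sum>k<K. al n (Suc k) r * cos (pi * real (Suc k) * u)\<bar>"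
    unfolding 0 al0_e1[OF n] by (simp add: abs_mult sum_distrib_left[symmetric] mult.assoc sum_divide_distrib[symmetric])
  finally show ?thesis by (simp add: mult.commute)
qed

lemma gam_cos_bound:
  assumes n: "n \<ge> 1" and u: "sin (pi * u / 2) \<noteq> 0"
  shows "\<bar>\<Sum>k<K. gam n (Suc k) a a' * cos (pi * real (Suc k) * u)\<bar> \<le> 4 / (real n * \<bar>sin (pi * u / 2)\<bar>)"
proof -
  have "(\<Sum>k<K. gam n (Suc k) a a' * cos (pi * real (Suc k) * u)) =
     (\<Sum>k<K. al n (Suc k) (ndist a a') * cos (pi * real (Suc k) * u)) - (\<Sum>k<K. be n (Suc k) (a + a') * cos (pi * real (Suc k) * u))"
    by (simp add: gam_def left_diff_distrib sum_subtractf)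
  also have "\<bar>\<dots>\<bar> \<le> 2 / (real n * \<bar>sin (pi * u / 2)\<bar>) + 2 / (real n * \<bar>sin (pi * u / 2)\<bar>)"
    by (intro order_trans[OF abs_triangle_ineq4] add_mono al_cos_bound be_cos_bound n u)
  finally show ?thesis by simp
qed

lemma Nn_div: "n \<ge> 1 \<Longrightarrow> Nn n / real n = 1 / (heat_c * sqrt (real n))"
  unfolding Nn_def using heat_c_pos by (simp add: field_simps)

text \<open>The weight is a difference of cosines with frequencies y - y' and y + y'. The sine of pi
  (y - y') / 2 is at least |y - y'| / 2 in modulus, while the sine of pi (y + y') / 2 stays above
  delta because both points keep that distance from the boundary. The factor \<open>Nn n\<close> / n
  is of order 1 / sqrt n.\<close>

lemma CC_offdiag:
  assumes \<delta>: "\<delta> > 0"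
  shows "\<exists>C\<ge>0. \<forall>n\<ge>1. \<forall>a a' y y'. \<delta> \<le> y \<and> y \<le> 1 - \<delta> \<and> \<delta> \<le> y' \<and> y' \<le> 1 - \<delta> \<and> y \<noteq> y' \<longrightarrow>
    \<bar>CC n a a' y y'\<bar> \<le> C / (sqrt (real n) * \<bar>y - y'\<bar>)"
proof -
  define C where "C = (8 + 4 / \<delta>) / heat_c"
  have C0: "C \<ge> 0" using \<delta> heat_c_pos by (simp add: C_def)
  have "\<bar>CC n a a' y y'\<bar> \<le> C / (sqrt (real n) * \<bar>y - y'\<bar>)"
    if n: "n \<ge> 1" and y: "\<delta> \<le> y" "y \<le> 1 - \<delta>" "\<delta> \<le> y'" "y' \<le> 1 - \<delta>" "y \<noteq> y'" for n a a' y y'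
  proof (rule LIMSEQ_le_const2)
    define d where "d = \<bar>y - y'\<bar>"
    have d: "0 < d" "d \<le> 1" using y \<delta> by (auto simp: d_def)
    have s1: "d / 2 \<le> \<bar>sin (pi * (y - y') / 2)\<bar>" unfolding d_def by (rule abs_sin_half_pi_lower) (use d in \<open>simp add: d_def\<close>)
    have s2: "\<delta> \<le> sin (pi * (y + y') / 2)" using sin_pi_lower[of \<delta> "(y + y') / 2"] \<delta> y by simp
    show "(\<lambda>K. \<bar>CK K n a a' y y'\<bar>) \<longlonglongrightarrow> \<bar>CC n a a' y y'\<bar>" by (intro tendsto_intros CK_tendsto n)
    have "\<bar>CK K n a a' y y'\<bar> \<le> C / (sqrt (real n) * d)" for K
    proof -
      have "(\<Sum>k<K. gam n (Suc k) a a' * wt (Suc k) y y') = (\<Sum>k<K. gam n (Suc k) a a' * cos (pi * real (Suc k) * (y - y')))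
         - (\<Sum>k<K. gam n (Suc k) a a' * cos (pi * real (Suc k) * (y + y')))" by (simp add: wt_cos right_diff_distrib sum_subtractf)
      also have "\<bar>\<dots>\<bar> \<le> 4 / (real n * \<bar>sin (pi * (y - y') / 2)\<bar>) + 4 / (real n * \<bar>sin (pi * (y + y') / 2)\<bar>)"
        by (intro order_trans[OF abs_triangle_ineq4] add_mono gam_cos_bound n) (use s1 s2 d \<delta> in auto)
      also have "\<dots> \<le> 4 / (real n * (d / 2)) + 4 / (real n * \<delta>)"
        using s1 s2 d \<delta> n by (intro add_mono divide_left_mono mult_left_mono mult_pos_pos) auto
      also have "\<dots> \<le> 4 / (real n * (d / 2)) + (4 / \<delta>) / (real n * d)"
      proof (rule add_left_mono)
        have "4 / (real n * \<delta>) = (4 / \<delta>) / (real n * 1)" by simp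
        also have "\<dots> \<le> (4 / \<delta>) / (real n * d)" using d n \<delta> by (intro divide_left_mono mult_left_mono mult_pos_pos) auto
        finally show "4 / (real n * \<delta>) \<le> (4 / \<delta>) / (real n * d)" .
      qed
      also have "4 / (real n * (d / 2)) + (4 / \<delta>) / (real n * d) = (8 + 4 / \<delta>) / d / real n"
        using d n by (simp add: field_simps)
      finally have A: "\<bar>\<Sum>k<K. gam n (Suc k) a a' * wt (Suc k) y y'\<bar> \<le> (8 + 4 / \<delta>) / d / real n" .
      have "\<bar>CK K n a a' y y'\<bar> = Nn n * \<bar>\<Sum>k<K. gam n (Suc k) a a' * wt (Suc k) y y'\<bar>"
        unfolding CK_def abs_mult using Nn_nonneg[of n] by simp
      also have "\<dots> \<le> Nn n * ((8 + 4 / \<delta>) / d / real n)" by (intro mult_left_mono A Nn_nonneg)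
      also have "\<dots> = (8 + 4 / \<delta>) / d * (Nn n / real n)" by simp
      also have "\<dots> = C / (sqrt (real n) * d)" unfolding Nn_div[OF n] C_def by simp
      finally show ?thesis .
    qed
    then show "\<exists>N. \<forall>K\<ge>N. \<bar>CK K n a a' y y'\<bar> \<le> C / (sqrt (real n) * \<bar>y - y'\<bar>)" by (auto simp: d_def)
  qed
  then show ?thesis using C0 by blast
qed

section \<open>The correction for the start in 0 at a single spatial point\<close>

lemma wt_same: "wt k y y = 1 - cos (2 * pi * real k * y)"
proof -
  have "pi * real k * (y + y) = 2 * pi * real k * y" by simp
  then show ?thesis unfolding wt_cos by (simp only: diff_self mult_zero_right cos_zero)
qed

lemma wt_same_nonneg: "0 \<le> wt k y y" by (simp add: wt_same)

definition beN :: "nat \<Rightarrow> nat \<Rightarrow> real \<Rightarrow> real" where "beN n s y = Nn n * (\<Sum>k. be n (Suc k) s * wt (Suc k) y y)"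

lemma be_wt_summable: "n \<ge> 1 \<Longrightarrow> summable (\<lambda>k. be n (Suc k) s * wt (Suc k) y y)"
proof (rule summable_comparison_test[OF _ summable_mult[OF be_summable, of n 2 s]])
  assume n: "n \<ge> 1"
  show "\<exists>N. \<forall>k\<ge>N. norm (be n (Suc k) s * wt (Suc k) y y) \<le> 2 * be n (Suc k) s"
  proof (intro exI[of _ 0] allI impI)
    fix k
    have "be n (Suc k) s * \<bar>wt (Suc k) y y\<bar> \<le> be n (Suc k) s * 2" using be_nonneg[OF n] by (intro mult_left_mono wt_le) auto
    then show "norm (be n (Suc k) s * wt (Suc k) y y) \<le> 2 * be n (Suc k) s" using be_nonneg[OF n, of k s] by (simp add: abs_mult)
  qed
qed

lemma beN_nonneg: "n \<ge> 1 \<Longrightarrow> 0 \<le> beN n s y"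
  unfolding beN_def by (intro mult_nonneg_nonneg Nn_nonneg suminf_nonneg be_wt_summable be_nonneg wt_same_nonneg)

lemma sum_beN_le:
  assumes n: "n \<ge> 1" and S: "finite S" and b: "\<And>k. (\<Sum>s\<in>S. be n (Suc k) s) \<le> B k" and sB: "summable B"
  shows "(\<Sum>s\<in>S. beN n s y) \<le> 2 * Nn n * (\<Sum>k. B k)"
proof -
  have "(\<Sum>s\<in>S. beN n s y) = Nn n * (\<Sum>k. \<Sum>s\<in>S. be n (Suc k) s * wt (Suc k) y y)"
    unfolding beN_def sum_distrib_left[symmetric] by (subst suminf_sum) (rule be_wt_summable[OF n], simp)
  also have "\<dots> \<le> Nn n * (\<Sum>k. 2 * B k)"
  proof (intro mult_left_mono suminf_le Nn_nonneg)
    fix k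
    have "(\<Sum>s\<in>S. be n (Suc k) s * wt (Suc k) y y) = (\<Sum>s\<in>S. be n (Suc k) s) * wt (Suc k) y y" by (simp add: sum_distrib_right)
    also have "\<dots> \<le> (\<Sum>s\<in>S. be n (Suc k) s) * 2"
      using wt_le[of "Suc k" y y] be_nonneg[OF n] by (intro mult_left_mono sum_nonneg) auto
    also have "\<dots> \<le> B k * 2" using b by (intro mult_right_mono) auto
    finally show "(\<Sum>s\<in>S. be n (Suc k) s * wt (Suc k) y y) \<le> 2 * B k" by simp
  next
    show "summable (\<lambda>k. \<Sum>s\<in>S. be n (Suc k) s * wt (Suc k) y y)" by (intro summable_sum be_wt_summable n)
    show "summable (\<lambda>k. 2 * B k)" by (rule summable_mult[OF sB])
  qed
  also have "\<dots> = 2 * Nn n * (\<Sum>k. B k)" by (simp add: suminf_mult[OF sB])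
  finally show ?thesis .
qed

text \<open>The indices a + a are distinct even numbers, so a single geometric series up to 2 n
  bounds the sum.\<close>

lemma sum_beN_diag: "\<exists>C\<ge>0. \<forall>n\<ge>1. \<forall>y. (\<Sum>a<n. beN n (a + a) y) \<le> C"
proof -
  obtain C where C: "C \<ge> 0" "\<And>n. n \<ge> 1 \<Longrightarrow> Nn n * G (1 / real n) \<le> C" using NnG_bound by blast
  have "(\<Sum>a<n. beN n (a + a) y) \<le> 2 * C" if n: "n \<ge> 1" for n y
  proof -
    have "(\<Sum>a<n. beN n (a + a) y) = (\<Sum>s\<in>(\<lambda>a. a + a) ` {..<n}. beN n s y)"
      by (subst sum.reindex) (auto simp: inj_on_def)
    also have "\<dots> \<le> 2 * Nn n * (\<Sum>k. ratio n k)"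
    proof (rule sum_beN_le[OF n])
      fix k
      have "(\<Sum>s\<in>(\<lambda>a. a + a) ` {..<n}. be n (Suc k) s) \<le> (\<Sum>s<2 * n. be n (Suc k) s)"
        by (rule sum_mono2) (auto simp: be_nonneg[OF n])
      also have "\<dots> \<le> (1 - q n (Suc k)) / (2 * lam (Suc k))" by (rule sum_be_le[OF n])
      also have "\<dots> \<le> ratio n k" using q_bounds(4)[OF n, of k] by (intro divide_left_mono) auto
      finally show "(\<Sum>s\<in>(\<lambda>a. a + a) ` {..<n}. be n (Suc k) s) \<le> ratio n k" .
    qed (auto intro: q_summable)
    also have "\<dots> = 2 * (Nn n * G (1 / real n))" by (simp add: G_q)
    also have "\<dots> \<le> 2 * C" using C(2)[OF n] by simp
    finally show ?thesis .
  qed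
  then show ?thesis using C(1) by (intro exI[of _ "2 * C"]) auto
qed

text \<open>Both factors 1 - q are consumed by the two geometric series, which leaves the summable 1
  / lam; what grows is the normalisation \<open>Nn n\<close>. The start in 0 thus costs sqrt n,
  against a Frobenius norm of order n.\<close>

lemma sum_sum_beN: "\<exists>C\<ge>0. \<forall>n\<ge>1. \<forall>y. (\<Sum>a<n. \<Sum>a'<n. beN n (a + a') y) \<le> C * sqrt (real n)"
proof -
  define L where "L = (\<Sum>k. 1 / lam (Suc k))"
  have L0: "L \<ge> 0" unfolding L_def by (intro suminf_nonneg summable_inverse_lam) simp
  have "(\<Sum>a<n. \<Sum>a'<n. beN n (a + a') y) \<le> 2 * L / heat_c * sqrt (real n)" if n: "n \<ge> 1" for n y
  proof -
    have b: "(\<Sum>a<n. \<Sum>a'<n. be n (Suc k) (a + a')) \<le> 1 / lam (Suc k)" for k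
    proof -
      note qb = q_bounds[OF n, of k]
      have "(\<Sum>a<n. \<Sum>a'<n. be n (Suc k) (a + a')) = 1 / (2 * lam (Suc k)) * (((1 - q n (Suc k)) * (\<Sum>a<n. q n (Suc k) ^ a)) * ((1 - q n (Suc k)) * (\<Sum>a<n. q n (Suc k) ^ a)))"
      proof -
        have "(\<Sum>a<n. \<Sum>a'<n. be n (Suc k) (a + a')) = (\<Sum>a<n. \<Sum>a'<n. (1 - q n (Suc k))\<^sup>2 / (2 * lam (Suc k)) * (q n (Suc k) ^ a * q n (Suc k) ^ a'))"
          by (simp add: be_def power_add)
        also have "\<dots> = (1 - q n (Suc k))\<^sup>2 / (2 * lam (Suc k)) * ((\<Sum>a<n. q n (Suc k) ^ a) * (\<Sum>a<n. q n (Suc k) ^ a))"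
          by (simp only: sum_product) (simp only: sum_distrib_left)
        finally show ?thesis by (simp add: power2_eq_square mult_ac)
      qed
      also have "(1 - q n (Suc k)) * (\<Sum>a<n. q n (Suc k) ^ a) = 1 - q n (Suc k) ^ n" by (rule one_diff_power_eq[symmetric])
      also have "1 / (2 * lam (Suc k)) * ((1 - q n (Suc k) ^ n) * (1 - q n (Suc k) ^ n)) \<le> 1 / (2 * lam (Suc k)) * (1 * 1)"
        using qb by (intro mult_left_mono mult_mono) (auto intro: power_le_one)
      also have "\<dots> \<le> 1 / lam (Suc k)" by (simp add: field_simps)
      finally show ?thesis .
    qed
    have "(\<Sum>a<n. \<Sum>a'<n. beN n (a + a') y) = Nn n * (\<Sum>k. \<Sum>a<n. \<Sum>a'<n. be n (Suc k) (a + a') * wt (Suc k) y y)"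
    proof -
      have "(\<Sum>k. \<Sum>a<n. \<Sum>a'<n. be n (Suc k) (a + a') * wt (Suc k) y y) = (\<Sum>a<n. \<Sum>k. \<Sum>a'<n. be n (Suc k) (a + a') * wt (Suc k) y y)"
        by (rule suminf_sum) (intro summable_sum be_wt_summable n)
      also have "\<dots> = (\<Sum>a<n. \<Sum>a'<n. \<Sum>k. be n (Suc k) (a + a') * wt (Suc k) y y)"
        by (intro sum.cong refl suminf_sum be_wt_summable n)
      finally show ?thesis by (simp add: beN_def sum_distrib_left)
    qed
    also have "\<dots> \<le> Nn n * (\<Sum>k. 2 * (1 / lam (Suc k)))"
    proof (intro mult_left_mono suminf_le Nn_nonneg)
      fix k
      have "(\<Sum>a<n. \<Sum>a'<n. be n (Suc k) (a + a') * wt (Suc k) y y) = (\<Sum>a<n. \<Sum>a'<n. be n (Suc k) (a + a')) * wt (Suc k) y y"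
        by (simp only: sum_distrib_right)
      also have "\<dots> \<le> (\<Sum>a<n. \<Sum>a'<n. be n (Suc k) (a + a')) * 2"
        using wt_le[of "Suc k" y y] be_nonneg[OF n] by (intro mult_left_mono sum_nonneg) auto
      also have "\<dots> \<le> 1 / lam (Suc k) * 2" using b by (intro mult_right_mono) auto
      finally show "(\<Sum>a<n. \<Sum>a'<n. be n (Suc k) (a + a') * wt (Suc k) y y) \<le> 2 * (1 / lam (Suc k))" by simp
    next
      show "summable (\<lambda>k. \<Sum>a<n. \<Sum>a'<n. be n (Suc k) (a + a') * wt (Suc k) y y)" by (intro summable_sum be_wt_summable n)
      show "summable (\<lambda>k. 2 * (1 / lam (Suc k)))" by (rule summable_mult[OF summable_inverse_lam])
    qed
    also have "(\<Sum>k. 2 * (1 / lam (Suc k))) = 2 * L" unfolding L_def by (rule suminf_mult[OF summable_inverse_lam])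
    finally show ?thesis by (simp add: Nn_def mult_ac)
  qed
  then show ?thesis using L0 heat_c_pos by (intro exI[of _ "2 * L / heat_c"]) auto
qed

end

section \<open>Frobenius norm of a diagonal block and its limit\<close>

context heat_spectrum
begin

abbreviation AA_frob :: "nat \<Rightarrow> real" where "AA_frob n \<equiv> (\<Sum>a<n. \<Sum>a'<n. (AA n (ndist a a'))\<^sup>2)"

lemma AA_row_sum: "\<exists>C\<ge>0. \<forall>n\<ge>1. \<forall>a<n. (\<Sum>a'<n. \<bar>AA n (ndist a a')\<bar>) \<le> C"
proof -
  obtain C where C: "C \<ge> 0" "\<And>n. n \<ge> 1 \<Longrightarrow> Nn n * G (1 / real n) \<le> C" using NnG_bound by blast
  have "(\<Sum>a'<n. \<bar>AA n (ndist a a')\<bar>) \<le> 2 * C" if n: "n \<ge> 1" and a: "a < n" for n a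
  proof -
    have sa: "summable (\<lambda>k. \<bar>al n (Suc k) r\<bar>)" for r
      by (rule summable_comparison_test[OF _ q_summable[of n]]) (use abs_al_le[OF n] in auto)
    have "(\<Sum>a'<n. \<bar>AA n (ndist a a')\<bar>) \<le> (\<Sum>a'<n. Nn n * (\<Sum>k. \<bar>al n (Suc k) (ndist a a')\<bar>))"
      unfolding AA_def abs_mult using Nn_nonneg[of n] by (intro sum_mono) (auto intro!: mult_left_mono summable_rabs sa)
    also have "\<dots> = Nn n * (\<Sum>k. \<Sum>a'<n. \<bar>al n (Suc k) (ndist a a')\<bar>)"
      unfolding sum_distrib_left[symmetric] by (subst suminf_sum) (rule sa, simp)
    also have "\<dots> \<le> Nn n * (\<Sum>k. 2 * (ratio n k))"
      by (intro mult_left_mono suminf_le Nn_nonneg sum_abs_al_le n a summable_sum sa summable_mult q_summable)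
    also have "\<dots> = 2 * (Nn n * G (1 / real n))" unfolding G_q by (subst suminf_mult[OF q_summable]) simp
    also have "\<dots> \<le> 2 * C" using C(2)[OF n] by simp
    finally show ?thesis .
  qed
  then show ?thesis using C(1) by (intro exI[of _ "2 * C"]) auto
qed

text \<open>The oscillating part of the stationary covariance, left over when \<open>wt_same\<close>
  splits off the spatial average \<open>AA\<close>.\<close>

definition alcos :: "nat \<Rightarrow> nat \<Rightarrow> real \<Rightarrow> real" where
  "alcos n r y = Nn n * (\<Sum>k. al n (Suc k) r * cos2pi k y)"

lemma alcos_summable: "n \<ge> 1 \<Longrightarrow> summable (\<lambda>k. al n (Suc k) r * cos2pi k y)"
proof (rule summable_comparison_test[OF _ q_summable[of n]])
  assume n: "n \<ge> 1"
  show "\<exists>N. \<forall>k\<ge>N. norm (al n (Suc k) r * cos2pi k y) \<le> ratio n k"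
  proof (intro exI[of _ 0] allI impI)
    fix k
    have "\<bar>al n (Suc k) r\<bar> * \<bar>cos2pi k y\<bar> \<le> \<bar>al n (Suc k) r\<bar> * 1" by (intro mult_left_mono) auto
    then show "norm (al n (Suc k) r * cos2pi k y) \<le> ratio n k" using abs_al_le[OF n, of k r] by (simp add: abs_mult)
  qed
qed

lemma CC_same: "n \<ge> 1 \<Longrightarrow> CC n a a' y y = AA n (ndist a a') - alcos n (ndist a a') y - beN n (a + a') y"
proof -
  assume n: "n \<ge> 1"
  have "(\<Sum>k. gam n (Suc k) a a' * wt (Suc k) y y) =
    (\<Sum>k. al n (Suc k) (ndist a a') - al n (Suc k) (ndist a a') * cos2pi k y - be n (Suc k) (a + a') * wt (Suc k) y y)"
    by (simp add: gam_def wt_same algebra_simps)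
  also have "\<dots> = (\<Sum>k. al n (Suc k) (ndist a a')) - (\<Sum>k. al n (Suc k) (ndist a a') * cos2pi k y) - (\<Sum>k. be n (Suc k) (a + a') * wt (Suc k) y y)"
    using al_summable[OF n] alcos_summable[OF n] be_wt_summable[OF n] by (simp add: suminf_diff[symmetric] summable_diff)
  finally show ?thesis by (simp add: CC_def AA_def alcos_def beN_def right_diff_distrib)
qed

text \<open>Abel summation as for distinct points, with y - y' replaced by 2 y, whose sine is
  bounded below by delta.\<close>

lemma alcos_le:
  assumes n: "n \<ge> 1" and \<delta>: "0 < \<delta>" "\<delta> \<le> y" "y \<le> 1 - \<delta>"
  shows "\<bar>alcos n r y\<bar> \<le> 2 / (heat_c * \<delta>) / sqrt (real n)"
proof (rule LIMSEQ_le_const2)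
  show "(\<lambda>K. \<bar>Nn n * (\<Sum>k<K. al n (Suc k) r * cos2pi k y)\<bar>) \<longlonglongrightarrow> \<bar>alcos n r y\<bar>"
    unfolding alcos_def by (intro tendsto_intros summable_LIMSEQ alcos_summable n)
  have s: "\<delta> \<le> sin (pi * y)" using sin_pi_lower[OF \<delta>] .
  have "\<bar>Nn n * (\<Sum>k<K. al n (Suc k) r * cos2pi k y)\<bar> \<le> 2 / (heat_c * \<delta>) / sqrt (real n)" for K
  proof -
    have e: "pi * (2 * y) / 2 = pi * y" by simp
    have c: "pi * real (Suc k) * (2 * y) = 2 * pi * real (Suc k) * y" for k by simp
    have "\<bar>\<Sum>k<K. al n (Suc k) r * cos2pi k y\<bar> \<le> 2 / (real n * \<bar>sin (pi * y)\<bar>)"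
    proof -
      have "sin (pi * (2 * y) / 2) \<noteq> 0" unfolding e using s \<delta> by linarith
      from al_cos_bound[OF n this, of r K] show ?thesis unfolding e c .
    qed
    also have "\<dots> \<le> 2 / (real n * \<delta>)" using s \<delta> n by (intro divide_left_mono mult_left_mono mult_pos_pos) auto
    finally have A: "\<bar>\<Sum>k<K. al n (Suc k) r * cos2pi k y\<bar> \<le> 2 / (real n * \<delta>)" .
    have "\<bar>Nn n * (\<Sum>k<K. al n (Suc k) r * cos2pi k y)\<bar> = Nn n * \<bar>\<Sum>k<K. al n (Suc k) r * cos2pi k y\<bar>"
      unfolding abs_mult using Nn_nonneg[of n] by simp
    also have "\<dots> \<le> Nn n * (2 / (real n * \<delta>))" by (intro mult_left_mono A Nn_nonneg)
    also have "\<dots> = 2 / \<delta> * (Nn n / real n)" by (simp add: mult.commute)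
    also have "\<dots> = 2 / (heat_c * \<delta>) / sqrt (real n)" unfolding Nn_div[OF n] by simp
    finally show ?thesis .
  qed
  then show "\<exists>N. \<forall>K\<ge>N. \<bar>Nn n * (\<Sum>k<K. al n (Suc k) r * cos2pi k y)\<bar> \<le> 2 / (heat_c * \<delta>) / sqrt (real n)" by blast
qed

text \<open>By the cancellation in \<open>heat_cos_asym\<close> each of the n stationary variances
  is 1 + O(1 / n). The corrections for the start in 0 have a bounded sum.\<close>

lemma CC_diag:
  assumes \<delta>: "\<delta> > 0"
  shows "\<exists>C\<ge>0. \<forall>n\<ge>1. \<forall>y. \<delta> \<le> y \<and> y \<le> 1 - \<delta> \<longrightarrow> (\<Sum>a<n. \<bar>CC n a a y y - 1\<bar>) \<le> C"
proof -
  obtain C1 where C1: "C1 \<ge> 0" "\<And>n y. n \<ge> 1 \<Longrightarrow> (\<Sum>a<n. beN n (a + a) y) \<le> C1" using sum_beN_diag by blast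
  have "0 < 4 * \<delta>\<^sup>2" using \<delta> by simp
  from heat_cos_asym[OF this] obtain C2 where C2: "C2 \<ge> 0"
    "\<And>y h. 4 * \<delta>\<^sup>2 \<le> 4 * (sin (pi * y))\<^sup>2 \<Longrightarrow> 0 \<le> h \<Longrightarrow> h \<le> 1 \<Longrightarrow>
      \<bar>(\<Sum>k. (1 - cos2pi k y) * ((1 - exp (- lam (Suc k) * h)) / lam (Suc k))) - heat_c * sqrt h\<bar> \<le> C2 * (h * sqrt h)"
    by blast
  have "(\<Sum>a<n. \<bar>CC n a a y y - 1\<bar>) \<le> C2 / heat_c + C1" if n: "n \<ge> 1" and y: "\<delta> \<le> y" "y \<le> 1 - \<delta>" for n y
  proof -
    define F where "F = (\<Sum>k. (1 - cos2pi k y) * (ratio n k))"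
    have "\<delta> \<le> sin (pi * y)" using sin_pi_lower[OF \<delta> y] .
    then have "\<delta>\<^sup>2 \<le> (sin (pi * y))\<^sup>2" using \<delta> by (intro power_mono) auto
    then have s4: "4 * \<delta>\<^sup>2 \<le> 4 * (sin (pi * y))\<^sup>2" by simp
    have Fb: "\<bar>F - heat_c * sqrt (1 / real n)\<bar> \<le> C2 * (1 / real n * sqrt (1 / real n))"
      using C2(2)[OF s4, of "1 / real n"] n by (simp add: F_def q_def)
    have sn: "sqrt (real n) > 0" using n by simp
    have "Nn n * F - 1 = Nn n * (F - heat_c * sqrt (1 / real n))"
      using sn heat_c_pos by (simp add: Nn_def right_diff_distrib real_sqrt_divide)
    also have "\<bar>\<dots>\<bar> = Nn n * \<bar>F - heat_c * sqrt (1 / real n)\<bar>" unfolding abs_mult using Nn_nonneg[of n] by simp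
    also have "\<dots> \<le> Nn n * (C2 * (1 / real n * sqrt (1 / real n)))" by (intro mult_left_mono Fb Nn_nonneg)
    also have "\<dots> = C2 / heat_c / real n" using sn heat_c_pos by (simp add: Nn_def real_sqrt_divide)
    finally have NF: "\<bar>Nn n * F - 1\<bar> \<le> C2 / heat_c / real n" .
    have CCa: "CC n a a y y = Nn n * F - beN n (a + a) y" for a
    proof -
      have "F = (\<Sum>k. al n (Suc k) 0 - al n (Suc k) 0 * cos2pi k y)" by (simp add: F_def al_def algebra_simps)
      also have "\<dots> = (\<Sum>k. al n (Suc k) 0) - (\<Sum>k. al n (Suc k) 0 * cos2pi k y)"
        by (rule suminf_diff[symmetric, OF al_summable[OF n] alcos_summable[OF n]])
      finally show ?thesis unfolding CC_same[OF n] AA_def alcos_def by (simp add: ndist_def right_diff_distrib)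
    qed
    have "(\<Sum>a<n. \<bar>CC n a a y y - 1\<bar>) \<le> (\<Sum>a<n. C2 / heat_c / real n + beN n (a + a) y)"
    proof (rule sum_mono)
      fix a
      show "\<bar>CC n a a y y - 1\<bar> \<le> C2 / heat_c / real n + beN n (a + a) y"
        unfolding CCa using NF beN_nonneg[OF n, of "a + a" y] by linarith
    qed
    also have "\<dots> = C2 / heat_c + (\<Sum>a<n. beN n (a + a) y)" using n by (simp add: sum.distrib)
    also have "\<dots> \<le> C2 / heat_c + C1" using C1(2)[OF n] by simp
    finally show ?thesis .
  qed
  then show ?thesis using C1(1) C2(1) heat_c_pos by (intro exI[of _ "C2 / heat_c + C1"]) auto
qed

lemma member_le_row:
  fixes f :: "nat \<Rightarrow> real" shows "a < n \<Longrightarrow> \<bar>f a\<bar> \<le> (\<Sum>a<n. \<bar>f a\<bar>)"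
  by (rule member_le_sum) auto

text \<open>A difference of squares is the difference of the entries times their sum. The difference
  is O(1 / sqrt n) plus \<open>beN\<close>. In the first part the row sums of the second factor add
  up to O(n), in the second part that factor is bounded and \<open>sum_sum_beN\<close> applies; both
  give O(sqrt n).\<close>

lemma CC_frobenius:
  assumes \<delta>: "\<delta> > 0"
  shows "\<exists>C\<ge>0. \<forall>n\<ge>1. \<forall>y. \<delta> \<le> y \<and> y \<le> 1 - \<delta> \<longrightarrow>
     \<bar>(\<Sum>a<n. \<Sum>a'<n. (CC n a a' y y)\<^sup>2) - AA_frob n\<bar> \<le> C * sqrt (real n)"
proof -
  obtain C1 where C1: "C1 \<ge> 0" "\<And>n a. n \<ge> 1 \<Longrightarrow> a < n \<Longrightarrow> (\<Sum>a'<n. \<bar>AA n (ndist a a')\<bar>) \<le> C1" using AA_row_sum by blast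
  obtain C2 where C2: "C2 \<ge> 0" "\<And>n a y y'. n \<ge> 1 \<Longrightarrow> a < n \<Longrightarrow> (\<Sum>a'<n. \<bar>CC n a a' y (y' a')\<bar>) \<le> C2" using CC_row_sum by metis
  obtain C3 where C3: "C3 \<ge> 0" "\<And>n y. n \<ge> 1 \<Longrightarrow> (\<Sum>a<n. \<Sum>a'<n. beN n (a + a') y) \<le> C3 * sqrt (real n)" using sum_sum_beN by blast
  define D where "D = 2 / (heat_c * \<delta>)"
  have D0: "D \<ge> 0" using heat_c_pos \<delta> by (simp add: D_def)
  define B where "B = C1 + C2"
  have B0: "B \<ge> 0" using C1 C2 by (simp add: B_def)
  have "\<bar>(\<Sum>a<n. \<Sum>a'<n. (CC n a a' y y)\<^sup>2) - AA_frob n\<bar> \<le> (D * B + B * C3) * sqrt (real n)"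
    if n: "n \<ge> 1" and y: "\<delta> \<le> y" "y \<le> 1 - \<delta>" for n y
  proof -
    define s where "s a a' = \<bar>CC n a a' y y\<bar> + \<bar>AA n (ndist a a')\<bar>" for a a'
    have s0: "0 \<le> s a a'" for a a' by (simp add: s_def)
    have srow: "(\<Sum>a'<n. s a a') \<le> B" if "a < n" for a
      using C1(2)[OF n that] C2(2)[OF n that, of y "\<lambda>_. y"] by (simp add: s_def sum.distrib B_def)
    have sle: "s a a' \<le> B" if "a < n" "a' < n" for a a'
      using order_trans[OF member_le_sum[of a' "{..<n}" "s a"] srow[OF that(1)]] that s0 by auto
    have pt: "\<bar>(CC n a a' y y)\<^sup>2 - (AA n (ndist a a'))\<^sup>2\<bar> \<le> D / sqrt (real n) * s a a' + B * beN n (a + a') y" if a: "a < n" "a' < n" for a a'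
    proof -
      have "(CC n a a' y y)\<^sup>2 - (AA n (ndist a a'))\<^sup>2 = (CC n a a' y y - AA n (ndist a a')) * (CC n a a' y y + AA n (ndist a a'))"
        by (simp add: power2_eq_square algebra_simps)
      also have "\<bar>\<dots>\<bar> \<le> (D / sqrt (real n) + beN n (a + a') y) * s a a'" unfolding abs_mult
      proof (rule mult_mono)
        show "\<bar>CC n a a' y y - AA n (ndist a a')\<bar> \<le> D / sqrt (real n) + beN n (a + a') y"
          unfolding CC_same[OF n] D_def using alcos_le[OF n \<delta> y, of "ndist a a'"] beN_nonneg[OF n, of "a + a'" y] by linarith
        show "\<bar>CC n a a' y y + AA n (ndist a a')\<bar> \<le> s a a'" unfolding s_def by (rule abs_triangle_ineq)
      qed (use D0 beN_nonneg[OF n, of "a + a'" y] in auto)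
      also have "\<dots> = D / sqrt (real n) * s a a' + s a a' * beN n (a + a') y" by (simp add: algebra_simps)
      also have "\<dots> \<le> D / sqrt (real n) * s a a' + B * beN n (a + a') y"
        using sle[OF a] beN_nonneg[OF n, of "a + a'" y] by (intro add_left_mono mult_right_mono) auto
      finally show ?thesis .
    qed
    have "\<bar>(\<Sum>a<n. \<Sum>a'<n. (CC n a a' y y)\<^sup>2) - AA_frob n\<bar> =
        \<bar>\<Sum>a<n. \<Sum>a'<n. (CC n a a' y y)\<^sup>2 - (AA n (ndist a a'))\<^sup>2\<bar>" by (simp add: sum_subtractf)
    also have "\<dots> \<le> (\<Sum>a<n. \<Sum>a'<n. \<bar>(CC n a a' y y)\<^sup>2 - (AA n (ndist a a'))\<^sup>2\<bar>)"
      by (intro order_trans[OF sum_abs] sum_mono sum_abs)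
    also have "\<dots> \<le> (\<Sum>a<n. \<Sum>a'<n. D / sqrt (real n) * s a a' + B * beN n (a + a') y)" by (intro sum_mono pt) auto
    also have "\<dots> = D / sqrt (real n) * (\<Sum>a<n. \<Sum>a'<n. s a a') + B * (\<Sum>a<n. \<Sum>a'<n. beN n (a + a') y)"
      by (simp add: sum.distrib sum_distrib_left)
    also have "\<dots> \<le> D / sqrt (real n) * (\<Sum>a<n. B) + B * (C3 * sqrt (real n))"
      using D0 B0 by (intro add_mono mult_left_mono sum_mono srow C3(2) n) auto
    also have "D / sqrt (real n) * (\<Sum>a<n. B) = D * B * sqrt (real n)"
    proof -
      have "real n / sqrt (real n) = sqrt (real n)" using n by (simp add: real_div_sqrt)
      moreover have "D / sqrt (real n) * (\<Sum>a<n. B) = D * B * (real n / sqrt (real n))" by simp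
      ultimately show ?thesis by (simp only:)
    qed
    finally show ?thesis by (simp add: algebra_simps)
  qed
  then show ?thesis using D0 B0 C3(1) by (intro exI[of _ "D * B + B * C3"]) auto
qed

definition bn :: "nat \<Rightarrow> nat \<Rightarrow> real" where "bn n r = Nn n * (\<Sum>k. be n (Suc k) r)"

lemma AA_Suc: "n \<ge> 1 \<Longrightarrow> AA n (Suc r) = - bn n r"
  by (simp add: AA_def bn_def al_Suc suminf_minus be_summable)

lemma AA_0: "AA n 0 = Nn n * G (1 / real n)" by (simp add: AA_def al_def G_q)

lemma bn_nonneg: "n \<ge> 1 \<Longrightarrow> 0 \<le> bn n r"
  unfolding bn_def by (intro mult_nonneg_nonneg Nn_nonneg suminf_nonneg be_summable be_nonneg)

text \<open>A decreasing sequence with bounded partial sums decays like 1 / (r + 1). The squares are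
  then dominated uniformly in n by a summable sequence.\<close>

lemma bn_le: "\<exists>C\<ge>0. \<forall>n\<ge>1. \<forall>r. bn n r \<le> C / real (Suc r)"
proof -
  obtain C where C: "C \<ge> 0" "\<And>n. n \<ge> 1 \<Longrightarrow> Nn n * G (1 / real n) \<le> C" using NnG_bound by blast
  have "bn n r \<le> C / real (Suc r)" if n: "n \<ge> 1" for n r
  proof -
    have dec: "bn n r \<le> bn n s" if "s \<le> r" for s unfolding bn_def
    proof (intro mult_left_mono suminf_le be_summable n Nn_nonneg)
      fix k
      show "be n (Suc k) r \<le> be n (Suc k) s" unfolding be_def
        using q_bounds[OF n, of k] that by (intro divide_right_mono mult_left_mono power_decreasing) auto
    qed
    have "real (Suc r) * bn n r = (\<Sum>s<Suc r. bn n r)" by simp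
    also have "\<dots> \<le> (\<Sum>s<Suc r. bn n s)" by (intro sum_mono dec) auto
    also have "\<dots> = Nn n * (\<Sum>k. \<Sum>s<Suc r. be n (Suc k) s)"
      unfolding bn_def sum_distrib_left[symmetric] by (subst suminf_sum) (rule be_summable[OF n], simp)
    also have "\<dots> \<le> Nn n * (\<Sum>k. ratio n k)"
    proof (intro mult_left_mono suminf_le Nn_nonneg summable_sum be_summable n q_summable)
      fix k
      have "(\<Sum>s<Suc r. be n (Suc k) s) \<le> (1 - q n (Suc k)) / (2 * lam (Suc k))" by (rule sum_be_le[OF n])
      also have "\<dots> \<le> ratio n k" using q_bounds(4)[OF n, of k] by (intro divide_left_mono) auto
      finally show "(\<Sum>s<Suc r. be n (Suc k) s) \<le> ratio n k" .
    qed
    also have "\<dots> \<le> C" using C(2)[OF n] by (simp add: G_q)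
    finally show ?thesis by (simp add: field_simps)
  qed
  then show ?thesis using C(1) by blast
qed

lemma NnG_tendsto: "(\<lambda>n. Nn n * G (real r / real n)) \<longlonglongrightarrow> sqrt (real r)"
proof -
  obtain C where C: "C \<ge> 0" "\<And>h. 0 \<le> h \<Longrightarrow> h \<le> 1 \<Longrightarrow> \<bar>G h - heat_c * sqrt h\<bar> \<le> C * h" using G_asym by blast
  have "(\<lambda>n. Nn n * G (real r / real n) - sqrt (real r)) \<longlonglongrightarrow> 0"
  proof (rule Lim_null_comparison)
    show "\<forall>\<^sub>F n in sequentially. norm (Nn n * G (real r / real n) - sqrt (real r)) \<le> C * real r / heat_c * (1 / sqrt (real n))"
      using eventually_ge_at_top[of "max 1 r"]
    proof eventually_elim
      case (elim n)
      then have n: "n \<ge> 1" "r \<le> n" by auto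
      have sn: "sqrt (real n) > 0" using n by simp
      have "Nn n * G (real r / real n) - sqrt (real r) = Nn n * (G (real r / real n) - heat_c * sqrt (real r / real n))"
        using sn heat_c_pos by (simp add: Nn_def right_diff_distrib real_sqrt_divide)
      also have "norm \<dots> = Nn n * \<bar>G (real r / real n) - heat_c * sqrt (real r / real n)\<bar>"
        using Nn_nonneg[of n] by (simp add: abs_mult)
      also have "\<dots> \<le> Nn n * (C * (real r / real n))" using n by (intro mult_left_mono C Nn_nonneg) auto
      also have "\<dots> = C * real r * (Nn n / real n)" by simp
      also have "\<dots> = C * real r / heat_c * (1 / sqrt (real n))" unfolding Nn_div[OF n(1)] by simp
      finally show ?case .
    qed
    have "(\<lambda>n. 1 / sqrt (real n)) \<longlonglongrightarrow> 0" by real_asymp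
    from tendsto_mult_left[OF this, of "C * real r / heat_c"]
    show "(\<lambda>n. C * real r / heat_c * (1 / sqrt (real n))) \<longlonglongrightarrow> 0" by (simp only: mult_zero_right)
  qed
  then show ?thesis by (rule LIM_zero_cancel)
qed

text \<open>(1 - q)^2 q^r is the second difference of the powers of q at r, so summation over k
  yields a second difference of G.\<close>

lemma be_second_difference:
  "n \<ge> 1 \<Longrightarrow> (\<Sum>k. be n (Suc k) r) = (2 * G (real (Suc r) / real n) - G (real r / real n) - G (real (Suc (Suc r)) / real n)) / 2"
proof -
  assume n: "n \<ge> 1"
  define g where "g j k = (1 - q n (Suc k) ^ j) / lam (Suc k)" for j k
  have G: "G (real j / real n) = (\<Sum>k. g j k)" for j unfolding G_def g_def q_exp ..
  have sg: "summable (g j)" for j using G_summable[of "real j / real n"] unfolding g_def q_exp by simp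
  have "be n (Suc k) r = (2 * g (Suc r) k - g r k - g (Suc (Suc r)) k) / 2" for k by (simp add: be_def g_def power2_eq_square field_simps)
  then have "(\<Sum>k. be n (Suc k) r) = (\<Sum>k. (2 * g (Suc r) k - g r k - g (Suc (Suc r)) k) / 2)" by (rule suminf_cong)
  also have "\<dots> = (\<Sum>k. 2 * g (Suc r) k - g r k - g (Suc (Suc r)) k) / 2" by (intro suminf_divide summable_diff summable_mult sg)
  also have "(\<Sum>k. 2 * g (Suc r) k - g r k - g (Suc (Suc r)) k) = 2 * (\<Sum>k. g (Suc r) k) - (\<Sum>k. g r k) - (\<Sum>k. g (Suc (Suc r)) k)"
    by (simp add: suminf_diff[symmetric] suminf_mult[symmetric] sg summable_diff summable_mult)
  finally show ?thesis by (simp only: G)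
qed

lemma bn_tendsto: "(\<lambda>n. bn n r) \<longlonglongrightarrow> (2 * sqrt (real (Suc r)) - sqrt (real r) - sqrt (real (Suc (Suc r)))) / 2"
proof (rule Lim_transform_eventually)
  have "(\<lambda>n. (2 * (Nn n * G (real (Suc r) / real n)) - Nn n * G (real r / real n) - Nn n * G (real (Suc (Suc r)) / real n)) / 2)
     \<longlonglongrightarrow> (2 * sqrt (real (Suc r)) - sqrt (real r) - sqrt (real (Suc (Suc r)))) / 2"
    by (intro tendsto_intros NnG_tendsto) auto
  then show "(\<lambda>n. (2 * (Nn n * G (real (Suc r) / real n)) - Nn n * G (real r / real n) - Nn n * G (real (Suc (Suc r)) / real n)) / 2)
     \<longlonglongrightarrow> (2 * sqrt (real (Suc r)) - sqrt (real r) - sqrt (real (Suc (Suc r)))) / 2" .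
  show "\<forall>\<^sub>F n in sequentially. (2 * (Nn n * G (real (Suc r) / real n)) - Nn n * G (real r / real n) - Nn n * G (real (Suc (Suc r)) / real n)) / 2 = bn n r"
    using eventually_ge_at_top[of 1] by eventually_elim (simp add: bn_def be_second_difference algebra_simps)
qed

text \<open>The Toeplitz structure reduces the norm to a sum over lags with weights 1 - (r + 1) / n.
  Tannery's theorem with the majorant from \<open>bn_le\<close> passes to the limit termwise, which
  gives 1 + 2 sum rho^2.\<close>

lemma AA_frobenius_tendsto:
  "(\<lambda>n. AA_frob n / real n) \<longlonglongrightarrow> pi * Gamma_const / 2"
proof -
  obtain C where C: "C \<ge> 0" "\<And>n r. n \<ge> 1 \<Longrightarrow> bn n r \<le> C / real (Suc r)" using bn_le by blast
  define \<rho> where "\<rho> r = (2 * sqrt (real (Suc r)) - sqrt (real r) - sqrt (real (Suc (Suc r)))) / 2" for r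
  define f where "f r n = (if r < n then real (n - Suc r) / real n * (bn n r)\<^sup>2 else 0)" for r n
  have sM: "summable (\<lambda>r. C\<^sup>2 * inverse (real (Suc r) ^ 2))"
  proof (rule summable_mult)
    have "summable (\<lambda>n. inverse (real n ^ 2))" by (rule inverse_power_summable) simp
    then show "summable (\<lambda>n. inverse (real (Suc n) ^ 2))"
      by (rule summable_Suc_iff[of "\<lambda>n. inverse ((real n)\<^sup>2)", THEN iffD2])
  qed
  have fl: "(\<lambda>n. f r n) \<longlonglongrightarrow> (\<rho> r)\<^sup>2" for r
  proof (rule Lim_transform_eventually)
    have "(\<lambda>n. (1 - real (Suc r) / real n) * (bn n r)\<^sup>2) \<longlonglongrightarrow> (1 - 0) * (\<rho> r)\<^sup>2"
      unfolding \<rho>_def by (intro tendsto_intros bn_tendsto lim_const_over_n)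
    then show "(\<lambda>n. (1 - real (Suc r) / real n) * (bn n r)\<^sup>2) \<longlonglongrightarrow> (\<rho> r)\<^sup>2" by simp
    show "\<forall>\<^sub>F n in sequentially. (1 - real (Suc r) / real n) * (bn n r)\<^sup>2 = f r n" using eventually_gt_at_top[of r]
      by eventually_elim (simp add: f_def of_nat_diff Suc_le_eq field_simps)
  qed
  have fb: "norm (f r n) \<le> C\<^sup>2 * inverse (real (Suc r) ^ 2)" if n: "n \<ge> 1" for r n
  proof (cases "r < n")
    case True
    have "(bn n r)\<^sup>2 \<le> (C / real (Suc r))\<^sup>2" using C(2)[OF n] bn_nonneg[OF n] by (intro power_mono) auto
    moreover have "real (n - Suc r) / real n \<le> 1" using n by simp
    ultimately have "real (n - Suc r) / real n * (bn n r)\<^sup>2 \<le> 1 * (C / real (Suc r))\<^sup>2" by (intro mult_mono) auto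
    then show ?thesis using True by (simp add: f_def power_mult_distrib power_inverse divide_inverse del: of_nat_Suc)
  qed (auto simp: f_def)
  have "(\<lambda>n. \<Sum>r. f r n) \<longlonglongrightarrow> (\<Sum>r. (\<rho> r)\<^sup>2)"
  proof (rule tannerys_theorem[THEN conjunct2, THEN conjunct2])
    show "\<And>k. (f k \<longlongrightarrow> (\<rho> k)\<^sup>2) sequentially" by (rule fl)
    show "\<forall>\<^sub>F (k, n) in sequentially \<times>\<^sub>F sequentially. norm (f k n) \<le> C\<^sup>2 * inverse (real (Suc k) ^ 2)"
      unfolding eventually_prod_sequentially prod.case by (intro exI[of _ 1] allI impI fb)
  qed (rule sM, simp)
  moreover have "(\<Sum>r. f r n) = (\<Sum>r<n. real (n - Suc r) / real n * (bn n r)\<^sup>2)" for n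
    by (subst suminf_finite[of "{..<n}"]) (auto simp: f_def)
  ultimately have 1: "(\<lambda>n. \<Sum>r<n. real (n - Suc r) / real n * (bn n r)\<^sup>2) \<longlonglongrightarrow> (\<Sum>r. (\<rho> r)\<^sup>2)" by simp
  have 2: "(\<lambda>n. AA n 0) \<longlonglongrightarrow> 1" using NnG_tendsto[of 1] by (simp add: AA_0)
  have "(\<lambda>n. (AA n 0)\<^sup>2 + 2 * (\<Sum>r<n. real (n - Suc r) / real n * (bn n r)\<^sup>2)) \<longlonglongrightarrow> 1\<^sup>2 + 2 * (\<Sum>r. (\<rho> r)\<^sup>2)"
    by (intro tendsto_intros 1 2)
  moreover have "\<forall>\<^sub>F n in sequentially. (AA n 0)\<^sup>2 + 2 * (\<Sum>r<n. real (n - Suc r) / real n * (bn n r)\<^sup>2) = AA_frob n / real n"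
    using eventually_ge_at_top[of 1]
  proof eventually_elim
    case (elim n)
    have "AA_frob n = real n * (AA n 0)\<^sup>2 + 2 * (\<Sum>r<n. real (n - Suc r) * (AA n (Suc r))\<^sup>2)" by (rule sum_sum_ndist)
    then show ?case using elim by (simp add: AA_Suc add_divide_distrib flip: sum_divide_distrib)
  qed
  ultimately have L: "(\<lambda>n. AA_frob n / real n) \<longlonglongrightarrow> 1\<^sup>2 + 2 * (\<Sum>r. (\<rho> r)\<^sup>2)"
    by (rule Lim_transform_eventually)
  have s\<rho>: "summable (\<lambda>r. (\<rho> r)\<^sup>2)"
  proof (rule summable_comparison_test[OF _ sM])
    have "(\<rho> r)\<^sup>2 \<le> C\<^sup>2 * inverse (real (Suc r) ^ 2)" for r
    proof (rule LIMSEQ_le_const2[OF fl])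
      show "\<exists>N. \<forall>n\<ge>N. f r n \<le> C\<^sup>2 * inverse (real (Suc r) ^ 2)"
      proof (intro exI[of _ 1] allI impI)
        fix n :: nat assume "1 \<le> n"
        from fb[OF this, of r] show "f r n \<le> C\<^sup>2 * inverse (real (Suc r) ^ 2)" unfolding real_norm_def by (rule abs_le_D1)
      qed
    qed
    then show "\<exists>N. \<forall>r\<ge>N. norm ((\<rho> r)\<^sup>2) \<le> C\<^sup>2 * inverse (real (Suc r) ^ 2)" by auto
  qed
  \<comment> \<open>The summand in \<open>Gamma_const\<close> is the square of 2 rho; the diagonal
    accounts for the summand 2 / pi.\<close>
  have "(2 * sqrt (real r + 1) - sqrt (real r + 2) - sqrt (real r))\<^sup>2 = 4 * (\<rho> r)\<^sup>2" for r
    by (simp add: \<rho>_def power_divide add.commute diff_diff_eq)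
  then have "pi * Gamma_const = (\<Sum>r. 4 * (\<rho> r)\<^sup>2) + 2" by (simp add: Gamma_const_def distrib_left)
  also have "(\<Sum>r. 4 * (\<rho> r)\<^sup>2) = 4 * (\<Sum>r. (\<rho> r)\<^sup>2)" by (rule suminf_mult[OF s\<rho>])
  finally have "1\<^sup>2 + 2 * (\<Sum>r. (\<rho> r)\<^sup>2) = pi * Gamma_const / 2" by simp
  with L show ?thesis by (simp only:)
qed

end

section \<open>The observed increments and the estimators\<close>

lemma finite_SUP_ennrealD:
  fixes f :: "'i \<Rightarrow> ennreal"
  assumes "(SUP k\<in>S. f k) < \<infinity>"
  obtains C where "C \<ge> 0" "\<And>k. k \<in> S \<Longrightarrow> f k \<le> ennreal C"
proof -
  obtain C where "C \<ge> 0" "(SUP k\<in>S. f k) = ennreal C" using assms by (cases "SUP k\<in>S. f k") auto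
  then show ?thesis using that[of C] SUP_upper[of _ S f] by metis
qed

lemma finite_nn_integral_square:
  fixes f :: "'a \<Rightarrow> real"
  assumes [measurable]: "f \<in> borel_measurable M" and l: "l > 0"
    and le: "ennreal l * (\<integral>\<^sup>+x. ennreal ((f x)\<^sup>2) \<partial>M) \<le> ennreal C" and C: "C \<ge> 0"
  shows "integrable M (\<lambda>x. (f x)\<^sup>2)" "(\<integral>x. (f x)\<^sup>2 \<partial>M) \<le> C / l"
proof -
  have e: "(\<integral>\<^sup>+x. ennreal ((f x)\<^sup>2) \<partial>M) \<le> ennreal (C / l)"
  proof -
    have "ennreal l * ennreal (C / l) = ennreal C" using l C by (simp flip: ennreal_mult)
    with le have "ennreal l * (\<integral>\<^sup>+x. ennreal ((f x)\<^sup>2) \<partial>M) \<le> ennreal l * ennreal (C / l)" by simp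
    then show ?thesis using l by (subst (asm) ennreal_mult_le_mult_iff) auto
  qed
  then have "(\<integral>\<^sup>+x. ennreal (norm ((f x)\<^sup>2)) \<partial>M) < \<infinity>" using order_le_less_trans by fastforce
  then show i: "integrable M (\<lambda>x. (f x)\<^sup>2)" by (intro integrableI_bounded) auto
  show "(\<integral>x. (f x)\<^sup>2 \<partial>M) \<le> C / l" using e C l nn_integral_eq_integral[OF i] by simp
qed

lemma uncorrelated_sum_square:
  fixes z :: "nat \<Rightarrow> 'a \<Rightarrow> real"
  assumes z: "\<And>k. k \<in> S \<Longrightarrow> z k \<in> borel_measurable M" "\<And>k. k \<in> S \<Longrightarrow> integrable M (\<lambda>x. (z k x)\<^sup>2)"
    and u: "\<And>k l. k \<in> S \<Longrightarrow> l \<in> S \<Longrightarrow> k \<noteq> l \<Longrightarrow> (\<integral>x. z k x * z l x \<partial>M) = 0" and fin: "finite S"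
  shows "has_bochner_integral M (\<lambda>x. (\<Sum>k\<in>S. c k * z k x)\<^sup>2) (\<Sum>k\<in>S. (c k)\<^sup>2 * (\<integral>x. (z k x)\<^sup>2 \<partial>M))"
proof -
  have "has_bochner_integral M (\<lambda>x. \<Sum>k\<in>S. \<Sum>l\<in>S. (c k * c l) * (z k x * z l x)) (\<Sum>k\<in>S. \<Sum>l\<in>S. (c k * c l) * (\<integral>x. z k x * z l x \<partial>M))"
    by (intro has_bochner_integral_sum has_bochner_integral_mult_right has_bochner_integral_integrable square_integrable_mult z)
  moreover have "(\<Sum>k\<in>S. \<Sum>l\<in>S. (c k * c l) * (z k x * z l x)) = (\<Sum>k\<in>S. c k * z k x)\<^sup>2" for x
    unfolding power2_eq_square sum_product by (simp only: mult_ac)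
  moreover have "(\<Sum>l\<in>S. (c k * c l) * (\<integral>x. z k x * z l x \<partial>M)) = (c k)\<^sup>2 * (\<integral>x. (z k x)\<^sup>2 \<partial>M)" if k: "k \<in> S" for k
  proof -
    have "(\<Sum>l\<in>S. (c k * c l) * (\<integral>x. z k x * z l x \<partial>M)) = (\<Sum>l\<in>S. if l = k then (c k)\<^sup>2 * (\<integral>x. (z k x)\<^sup>2 \<partial>M) else 0)"
      using u[OF k] by (intro sum.cong) (auto simp: power2_eq_square)
    then show ?thesis using k fin by simp
  qed
  ultimately show ?thesis by (simp cong: sum.cong)
qed

text \<open>Both alternatives of the initial condition lead to the same bound: under the first the
  coefficients are independent and centred, so the second moments add; under the second
  Cauchy-Schwarz with the weights sqrt (l k) separates the constants from the random part.\<close>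

lemma initial_coeff_bound:
  assumes "prob_space M" and iv: "initial_value M \<theta>1 \<theta>2 W \<xi>" and pos: "\<And>k. k \<ge> 1 \<Longrightarrow> eigval \<theta>0 \<theta>1 \<theta>2 k > 0"
    and ic: "initial_condition M \<theta>0 \<theta>1 \<theta>2 \<xi>"
  shows "\<exists>C\<ge>0. \<forall>K c. integrable M (\<lambda>w. (\<Sum>k=1..K. c k * xi_coeff \<theta>1 \<theta>2 \<xi> k w)\<^sup>2) \<and>
     (\<integral>w. (\<Sum>k=1..K. c k * xi_coeff \<theta>1 \<theta>2 \<xi> k w)\<^sup>2 \<partial>M) \<le> C * (\<Sum>k=1..K. (c k)\<^sup>2 / eigval \<theta>0 \<theta>1 \<theta>2 k)"
proof -
  interpret prob_space M by fact
  define z where "z k w = xi_coeff \<theta>1 \<theta>2 \<xi> k w" for k w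
  define l where "l k = eigval \<theta>0 \<theta>1 \<theta>2 k" for k
  have l: "l k > 0" if "k \<ge> 1" for k using pos[OF that] by (simp add: l_def)
  have mz[measurable]: "z k \<in> borel_measurable M" for k
  proof -
    have "\<xi> \<in> measurable M (H_borel \<theta>1 \<theta>2)" using iv by (simp add: initial_value_def)
    from measurable_comp[OF this xi_coeff_functional_measurable, of k] show ?thesis by (simp add: comp_def z_def[abs_def])
  qed
  from ic consider
    (1) "\<forall>k\<ge>1. (\<integral>w. z k w \<partial>M) = 0" "(SUP k\<in>{1..}. ennreal (l k) * (\<integral>\<^sup>+w. ennreal ((z k w)\<^sup>2) \<partial>M)) < \<infinity>" "indep_vars (\<lambda>_. borel) z {1..}"
  | (2) "(\<integral>\<^sup>+w. (\<Sum>k. ennreal (l (Suc k) * (z (Suc k) w)\<^sup>2)) \<partial>M) < \<infinity>"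
    by (auto simp: initial_condition_def z_def[abs_def] l_def)
  then show ?thesis
  proof cases
    case 1
    obtain C where C: "C \<ge> 0" "\<And>k. k \<in> {1..} \<Longrightarrow> ennreal (l k) * (\<integral>\<^sup>+w. ennreal ((z k w)\<^sup>2) \<partial>M) \<le> ennreal C"
      by (rule finite_SUP_ennrealD[OF 1(2)]) blast
    have z2: "integrable M (\<lambda>w. (z k w)\<^sup>2)" "(\<integral>w. (z k w)\<^sup>2 \<partial>M) \<le> C / l k" if "k \<ge> 1" for k
      using finite_nn_integral_square[OF mz l[OF that] C(2) C(1)] that by auto
    have zi: "integrable M (z k)" if "k \<ge> 1" for k by (rule expectation_abs_le_sqrt(1)[OF mz z2(1)[OF that]])
    have u: "(\<integral>x. z k x * z k' x \<partial>M) = 0" if k: "k \<ge> 1" "k' \<ge> 1" "k \<noteq> k'" for k k'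
    proof -
      \<comment> \<open>Independence of a pair is read off from the lemma on sums with a one-element
        sum.\<close>
      have "indep_var borel (z k) borel (z k')"  using indep_vars_sum[of "{k'}" k z] indep_vars_subset[OF 1(3), of "{k, k'}"] k by simp
      then have "(\<integral>x. z k x * z k' x \<partial>M) = (\<integral>x. z k x \<partial>M) * (\<integral>x. z k' x \<partial>M)"
        by (rule indep_var_lebesgue_integral[OF _ zi[OF k(1)] zi[OF k(2)]])
      then show ?thesis using 1(1) k by simp
    qed
    show ?thesis
    proof (intro exI[of _ C] conjI allI C(1))
      fix K and c :: "nat \<Rightarrow> real"
      have hb: "has_bochner_integral M (\<lambda>x. (\<Sum>k=1..K. c k * z k x)\<^sup>2) (\<Sum>k=1..K. (c k)\<^sup>2 * (\<integral>x. (z k x)\<^sup>2 \<partial>M))"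
        by (rule uncorrelated_sum_square[OF mz z2(1) u]) auto
      then show "integrable M (\<lambda>w. (\<Sum>k=1..K. c k * xi_coeff \<theta>1 \<theta>2 \<xi> k w)\<^sup>2)" by (simp add: z_def has_bochner_integral_iff)
      have "(\<Sum>k=1..K. (c k)\<^sup>2 * (\<integral>x. (z k x)\<^sup>2 \<partial>M)) \<le> (\<Sum>k=1..K. (c k)\<^sup>2 * (C / l k))"
        by (intro sum_mono mult_left_mono z2) auto
      also have "\<dots> = C * (\<Sum>k=1..K. (c k)\<^sup>2 / l k)" by (simp add: sum_distrib_left mult_ac)
      finally show "(\<integral>w. (\<Sum>k=1..K. c k * xi_coeff \<theta>1 \<theta>2 \<xi> k w)\<^sup>2 \<partial>M) \<le> C * (\<Sum>k=1..K. (c k)\<^sup>2 / eigval \<theta>0 \<theta>1 \<theta>2 k)"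
        using hb by (simp add: z_def l_def has_bochner_integral_iff)
    qed
  next
    case 2
    then obtain C where C: "C \<ge> 0" "(\<integral>\<^sup>+w. (\<Sum>k. ennreal (l (Suc k) * (z (Suc k) w)\<^sup>2)) \<partial>M) = ennreal C"
      by (cases "(\<integral>\<^sup>+w. (\<Sum>k. ennreal (l (Suc k) * (z (Suc k) w)\<^sup>2)) \<partial>M)") auto
    have l0: "0 \<le> l k * x\<^sup>2" if "k \<in> {1..K}" for k K x using l[of k] that by (intro mult_nonneg_nonneg) auto
    have nn: "(\<integral>\<^sup>+w. ennreal (\<Sum>k=1..K. l k * (z k w)\<^sup>2) \<partial>M) \<le> ennreal C" for K
      unfolding C(2)[symmetric]
    proof (rule nn_integral_mono)
      fix w
      have "ennreal (\<Sum>k=1..K. l k * (z k w)\<^sup>2) = (\<Sum>k=1..K. ennreal (l k * (z k w)\<^sup>2))"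
        by (intro sum_ennreal[symmetric] l0)
      also have "\<dots> = (\<Sum>k<K. ennreal (l (Suc k) * (z (Suc k) w)\<^sup>2))"
        by (rule sum.reindex_bij_witness[of _ Suc "\<lambda>k. k - 1"]) auto
      also have "\<dots> \<le> (\<Sum>k. ennreal (l (Suc k) * (z (Suc k) w)\<^sup>2))" by (rule sum_le_suminf) auto
      finally show "ennreal (\<Sum>k=1..K. l k * (z k w)\<^sup>2) \<le> (\<Sum>k. ennreal (l (Suc k) * (z (Suc k) w)\<^sup>2))" .
    qed
    have D0: "0 \<le> (\<Sum>k=1..K. l k * (z k w)\<^sup>2)" for K w by (intro sum_nonneg l0)
    have iD: "integrable M (\<lambda>w. \<Sum>k=1..K. l k * (z k w)\<^sup>2)" for K
    proof (rule integrableI_bounded)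
      show "(\<integral>\<^sup>+w. ennreal (norm (\<Sum>k=1..K. l k * (z k w)\<^sup>2)) \<partial>M) < \<infinity>"
        using order_le_less_trans[OF nn[of K]] D0 by (simp add: abs_of_nonneg)
    qed simp
    have eD: "(\<integral>w. (\<Sum>k=1..K. l k * (z k w)\<^sup>2) \<partial>M) \<le> C" for K
      using nn[of K] C(1) nn_integral_eq_integral[OF iD[of K]] D0 by simp
    have cs: "(\<Sum>k=1..K. c k * z k w)\<^sup>2 \<le> (\<Sum>k=1..K. (c k)\<^sup>2 / l k) * (\<Sum>k=1..K. l k * (z k w)\<^sup>2)" for K c w
    proof -
      have "(\<Sum>k=1..K. c k * z k w) = (\<Sum>k=1..K. (c k / sqrt (l k)) * (sqrt (l k) * z k w))"
        by (intro sum.cong refl) (simp add: l less_imp_neq[OF l, symmetric])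
      then have "(\<Sum>k=1..K. c k * z k w)\<^sup>2 \<le> (\<Sum>k=1..K. (c k / sqrt (l k))\<^sup>2) * (\<Sum>k=1..K. (sqrt (l k) * z k w)\<^sup>2)"
        using Cauchy_Schwarz_ineq_sum[of "\<lambda>k. c k / sqrt (l k)" "\<lambda>k. sqrt (l k) * z k w" "{1..K}"] by simp
      also have "(\<Sum>k=1..K. (c k / sqrt (l k))\<^sup>2) = (\<Sum>k=1..K. (c k)\<^sup>2 / l k)"
        by (intro sum.cong refl) (simp add: power_divide less_imp_le[OF l])
      also have "(\<Sum>k=1..K. (sqrt (l k) * z k w)\<^sup>2) = (\<Sum>k=1..K. l k * (z k w)\<^sup>2)"
        by (intro sum.cong refl) (simp add: power_mult_distrib less_imp_le[OF l])
      finally show ?thesis .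
    qed
    show ?thesis
    proof (intro exI[of _ C] conjI allI C(1))
      fix K and c :: "nat \<Rightarrow> real"
      have i: "integrable M (\<lambda>w. (\<Sum>k=1..K. c k * z k w)\<^sup>2)"

      proof (rule Bochner_Integration.integrable_bound[OF integrable_mult_right[OF iD[of K], of "\<Sum>k=1..K. (c k)\<^sup>2 / l k"]])
        have "norm ((\<Sum>k=1..K. c k * z k w)\<^sup>2) \<le> norm ((\<Sum>k=1..K. (c k)\<^sup>2 / l k) * (\<Sum>k=1..K. l k * (z k w)\<^sup>2))" for w
          unfolding real_norm_def abs_power2 by (rule order_trans[OF cs abs_ge_self])
        then show "AE w in M. norm ((\<Sum>k=1..K. c k * z k w)\<^sup>2) \<le> norm ((\<Sum>k=1..K. (c k)\<^sup>2 / l k) * (\<Sum>k=1..K. l k * (z k w)\<^sup>2))" by (rule AE_I2)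
      qed measurable
      then show "integrable M (\<lambda>w. (\<Sum>k=1..K. c k * xi_coeff \<theta>1 \<theta>2 \<xi> k w)\<^sup>2)" by (simp add: z_def)
      have s0: "0 \<le> (\<Sum>k=1..K. (c k)\<^sup>2 / l k)" using l by (intro sum_nonneg divide_nonneg_nonneg zero_le_power2) (simp add: less_imp_le)
      have "(\<integral>w. (\<Sum>k=1..K. c k * z k w)\<^sup>2 \<partial>M) \<le> (\<integral>w. (\<Sum>k=1..K. (c k)\<^sup>2 / l k) * (\<Sum>k=1..K. l k * (z k w)\<^sup>2) \<partial>M)"
        by (intro integral_mono i integrable_mult_right iD cs)
      also have "\<dots> = (\<Sum>k=1..K. (c k)\<^sup>2 / l k) * (\<integral>w. (\<Sum>k=1..K. l k * (z k w)\<^sup>2) \<partial>M)" by simp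
      also have "\<dots> \<le> (\<Sum>k=1..K. (c k)\<^sup>2 / l k) * C" by (intro mult_left_mono eD s0)
      finally show "(\<integral>w. (\<Sum>k=1..K. c k * xi_coeff \<theta>1 \<theta>2 \<xi> k w)\<^sup>2 \<partial>M) \<le> C * (\<Sum>k=1..K. (c k)\<^sup>2 / eigval \<theta>0 \<theta>1 \<theta>2 k)"
        by (simp add: z_def l_def mult.commute)
    qed
  qed
qed

section \<open>The normalised increments of the observed field\<close>

context heat_spectrum
begin

text \<open>The covariance of increments is the mixed second difference of the kernel in
  \<open>wiener_integral_exp_cov\<close>; its stationary part depends on |i - i'| and yields
  \<open>al\<close>, the other part depends on i + i' and yields \<open>be\<close>.\<close>

lemma ou_increment_cov:
  assumes "prob_space M" and bm: "indep_brownian_motions M W" and n: "n \<ge> 1"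
    and k: "1 \<le> k" "1 \<le> k'" and a: "a < n" "a' < n"
    and I: "\<And>k i. 1 \<le> k \<Longrightarrow> i \<le> n \<Longrightarrow> has_wiener_integral M (W k) (\<lambda>s. exp (- lam k * (real i / real n - s)) * \<sigma>) 0 (real i / real n) (I k i)"
  shows "has_bochner_integral M (\<lambda>w. (I k (Suc a) w - I k a w) * (I k' (Suc a') w - I k' a' w))
    (if k = k' then \<sigma>\<^sup>2 * gam n k a a' else 0)"
proof -
  have lz: "lam k \<noteq> 0" if "k \<ge> 1" for k using lam_pos[of k] that by auto
  define c where "c i i' = (if k = k' then \<sigma>\<^sup>2 * (q n k ^ ndist i i' - q n k ^ (i + i')) / (2 * lam k) else 0)" for i i'
  have h: "has_bochner_integral M (\<lambda>w. I k i w * I k' i' w) (c i i')" if i: "i \<le> n" "i' \<le> n" for i i'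
  proof -
    have t0: "0 \<le> real i / real n" for i by simp
    have "\<bar>real i / real n - real i' / real n\<bar> = real (ndist i i') / real n"
      by (auto simp: ndist_def of_nat_diff abs_if divide_simps)
    moreover have "real i / real n + real i' / real n = real (i + i') / real n" by (simp add: add_divide_distrib)
    ultimately show ?thesis using wiener_integral_exp_cov[OF assms(1) bm k lz t0 t0 I[OF k(1) i(1)] I[OF k(2) i(2)]]
      unfolding c_def q_exp by (simp only: times_divide_eq_right)
  qed
  have "has_bochner_integral M (\<lambda>w. (I k (Suc a) w * I k' (Suc a') w - I k (Suc a) w * I k' a' w) - (I k a w * I k' (Suc a') w - I k a w * I k' a' w))
     ((c (Suc a) (Suc a') - c (Suc a) a') - (c a (Suc a') - c a a'))" by (intro has_bochner_integral_diff h) (use a in auto)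
  moreover have "(I k (Suc a) w * I k' (Suc a') w - I k (Suc a) w * I k' a' w) - (I k a w * I k' (Suc a') w - I k a w * I k' a' w)
      = (I k (Suc a) w - I k a w) * (I k' (Suc a') w - I k' a' w)" for w by (simp add: algebra_simps)
  moreover have "(c (Suc a) (Suc a') - c (Suc a) a') - (c a (Suc a') - c a a') = (if k = k' then \<sigma>\<^sup>2 * gam n k a a' else 0)"
  proof (cases "k = k'")
    case True
    define Q where "Q = q n k"
    have cT: "c i i' = \<sigma>\<^sup>2 * (Q ^ ndist i i' - Q ^ (i + i')) / (2 * lam k)" for i i' using True by (simp add: c_def Q_def)
    have lin: "(s * (x1 - y1) / L - s * (x2 - y2) / L) - (s * (x3 - y3) / L - s * (x4 - y4) / L)
        = s * ((x1 - x2 - x3 + x4) - (y1 - y2 - y3 + y4)) / L" for s L x1 x2 x3 x4 y1 y2 y3 y4 :: real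
      by (simp add: diff_divide_distrib add_divide_distrib algebra_simps)
    have be2: "2 * lam k * be n k s = (1 - Q)\<^sup>2 * Q ^ s" for s using lz[OF k(1)] by (simp add: be_def Q_def)
    \<comment> \<open>At lag r + 1 the mixed difference is - (1 - Q)^2 Q^r, on the diagonal 2 - 2 Q;
      hence the two branches in \<open>al\<close>.\<close>
    have *: "Q ^ ndist (Suc a) (Suc a') - Q ^ ndist (Suc a) a' - Q ^ ndist a (Suc a') + Q ^ ndist a a' = 2 * lam k * al n k (ndist a a')"
    proof (cases a a' rule: linorder_cases)
      case less
      then obtain r where r: "a' = Suc (a + r)" using less_imp_Suc_add by blast
      have "ndist (Suc a) (Suc a') = Suc r" "ndist (Suc a) a' = r" "ndist a (Suc a') = Suc (Suc r)" "ndist a a' = Suc r"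
        by (auto simp: ndist_def r)
      then show ?thesis using be2[of r] by (simp add: al_Suc power2_eq_square algebra_simps)
    next
      case greater
      then obtain r where r: "a = Suc (a' + r)" using less_imp_Suc_add by blast
      have "ndist (Suc a) (Suc a') = Suc r" "ndist (Suc a) a' = Suc (Suc r)" "ndist a (Suc a') = r" "ndist a a' = Suc r"
        by (auto simp: ndist_def r)
      then show ?thesis using be2[of r] by (simp add: al_Suc power2_eq_square algebra_simps)
    next
      case equal
      then have "ndist (Suc a) (Suc a') = 0" "ndist (Suc a) a' = 1" "ndist a (Suc a') = 1" "ndist a a' = 0" by (auto simp: ndist_def)
      then show ?thesis using lz[OF k(1)] by (simp add: al_def Q_def)
    qed
    have **: "Q ^ (Suc a + Suc a') - Q ^ (Suc a + a') - Q ^ (a + Suc a') + Q ^ (a + a') = 2 * lam k * be n k (a + a')"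
      using be2[of "a + a'"] by (simp add: power2_eq_square algebra_simps)
    have "(c (Suc a) (Suc a') - c (Suc a) a') - (c a (Suc a') - c a a') =
      \<sigma>\<^sup>2 * ((Q ^ ndist (Suc a) (Suc a') - Q ^ ndist (Suc a) a' - Q ^ ndist a (Suc a') + Q ^ ndist a a')
        - (Q ^ (Suc a + Suc a') - Q ^ (Suc a + a') - Q ^ (a + Suc a') + Q ^ (a + a'))) / (2 * lam k)" unfolding cT by (rule lin)
    also have "\<dots> = \<sigma>\<^sup>2 * gam n k a a'" unfolding * ** gam_def using lz[OF k(1)] by (simp add: field_simps)
    finally show ?thesis using True by simp
  qed (simp add: c_def)
  ultimately show ?thesis by simp
qed

end

lemma (in heat_spectrum) CK_sym: "CK K n a a' y y' = CK K n a' a y' y"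
proof -
  have "ndist a a' = ndist a' a" by (simp add: ndist_def)
  moreover have "wt k y y' = wt k y' y" for k by (simp add: wt_def)
  ultimately show ?thesis by (simp add: CK_def gam_def add.commute[of a])
qed

lemma sum_1_upto: "(\<Sum>k=1..K. f k) = (\<Sum>k<K. f (Suc k))" for f :: "nat \<Rightarrow> 'b::comm_monoid_add"
  by (rule sum.reindex_bij_witness[of _ Suc "\<lambda>k. k - 1"]) auto

lemma eigval_pi: "eigval \<theta>0 \<theta>1 \<theta>2 k = (\<theta>1\<^sup>2 / (4 * \<theta>2) - \<theta>0) + pi\<^sup>2 * \<theta>2 * (real k)\<^sup>2"
  by (simp add: eigval_def)

locale spde_observation =
  prob_space M + heat_spectrum "pi\<^sup>2 * \<theta>2" "\<theta>1\<^sup>2 / (4 * \<theta>2) - \<theta>0"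
  for M :: "'w measure" and \<theta>0 \<theta>1 \<theta>2 :: real +
  fixes \<sigma> :: real and W :: "nat \<Rightarrow> real \<Rightarrow> 'w \<Rightarrow> real" and \<xi> :: "'w \<Rightarrow> real \<Rightarrow> real"
    and X :: "real \<Rightarrow> real \<Rightarrow> 'w \<Rightarrow> real" and m :: "nat \<Rightarrow> nat" and y :: "nat \<Rightarrow> nat \<Rightarrow> real"
  assumes sigma_pos: "\<sigma> > 0" and bm: "indep_brownian_motions M W" and iv: "initial_value M \<theta>1 \<theta>2 W \<xi>"
    and sol: "continuous_mild_solution M \<theta>0 \<theta>1 \<theta>2 \<sigma> W \<xi> X" and scheme: "observation_scheme m y"
    and ic: "initial_condition M \<theta>0 \<theta>1 \<theta>2 \<xi>"
begin

lemma eigval_lam: "eigval \<theta>0 \<theta>1 \<theta>2 k = lam k" unfolding eigval_pi lam_def ..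

lemma theta2_pos: "\<theta>2 > 0" using b_pos by (simp add: zero_less_mult_iff)

text \<open>The grid point \<open>(a, j)\<close> stands for the increment from \<open>a / n\<close> to \<open>(a + 1) / n\<close> at \<open>y n j\<close>.\<close>

abbreviation mr :: "nat \<Rightarrow> real" where "mr n \<equiv> real (m n)"
definition grid :: "nat \<Rightarrow> (nat \<times> nat) set" where "grid n = {..<n} \<times> {1..m n}"
definition scale :: "nat \<Rightarrow> real" where "scale n = sqrt (Nn n) / \<sigma>"
text \<open>The exponential cancels the one in \<open>eigfun\<close>, which leaves products of sines
  in the covariances, and \<open>scale\<close> brings the variances close to 1.\<close>

definition V :: "nat \<Rightarrow> nat \<times> nat \<Rightarrow> 'w \<Rightarrow> real" where
  "V n p w = scale n * exp (y n (snd p) * \<theta>1 / (2 * \<theta>2)) * increment X n (Suc (fst p)) (y n (snd p)) w"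
definition cov :: "nat \<Rightarrow> nat \<times> nat \<Rightarrow> nat \<times> nat \<Rightarrow> real" where
  "cov n p r = CC n (fst p) (fst r) (y n (snd p)) (y n (snd r))"
definition diag_err :: "nat \<Rightarrow> real" where "diag_err n = (\<Sum>p\<in>grid n. \<bar>cov n p p - 1\<bar>)"
definition diag_sq_err :: "nat \<Rightarrow> real" where "diag_sq_err n = (\<Sum>p\<in>grid n. \<bar>(cov n p p)\<^sup>2 - 1\<bar>)"
definition frob :: "nat \<Rightarrow> real" where "frob n = (\<Sum>p\<in>grid n. \<Sum>q\<in>grid n. (cov n p q)\<^sup>2)"

lemma m_pos: "n \<ge> 1 \<Longrightarrow> 1 \<le> m n" using scheme by (simp add: observation_scheme_def)

lemma finite_grid [simp]: "finite (grid n)" by (simp add: grid_def)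
lemma card_grid: "card (grid n) = n * m n" by (simp add: grid_def card_cartesian_product)
lemma sum_grid: "(\<Sum>p\<in>grid n. f p) = (\<Sum>a<n. \<Sum>j=1..m n. f (a, j))" for f :: "nat \<times> nat \<Rightarrow> real"
  unfolding grid_def by (simp only: sum.cartesian_product case_prod_eta)

lemma y_range: "\<exists>\<delta>>0. \<forall>n\<ge>1. \<forall>j. 1 \<le> j \<and> j \<le> m n \<longrightarrow> \<delta> \<le> y n j \<and> y n j \<le> 1 - \<delta>"
proof -
  obtain \<delta> where \<delta>: "\<delta> > 0" "\<And>n. n \<ge> 1 \<Longrightarrow> \<delta> \<le> y n 1 \<and> strict_mono_on {1..m n} (y n) \<and> y n (m n) \<le> 1 - \<delta>"
    using scheme unfolding observation_scheme_def by blast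
  have "\<delta> \<le> y n j \<and> y n j \<le> 1 - \<delta>" if n: "n \<ge> 1" and j: "1 \<le> j" "j \<le> m n" for n j
  proof -
    have mo: "mono_on {1..m n} (y n)" using \<delta>(2)[OF n] strict_mono_on_imp_mono_on by blast
    have "y n 1 \<le> y n j" "y n j \<le> y n (m n)" using j by (auto intro!: mono_onD[OF mo])
    then show ?thesis using \<delta>(2)[OF n] by linarith
  qed
  then show ?thesis using \<delta>(1) by blast
qed

text \<open>For every truncation K of the series the increments are a Gaussian form plus a function
  of the initial value, and \<open>noise_clt_bounds\<close> applies. Row sums, entries and second
  moments of A are bounded uniformly in K, so the estimates pass to the full series.\<close>

lemma level_bounds:
  "\<exists>C\<ge>0. \<forall>n\<ge>1. clt_bounds M (grid n) (V n) (frob n) ((C * mr n)\<^sup>2 * frob n)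
     (diag_err n + C * mr n) (C * frob n)
     (diag_sq_err n / real (card (grid n))) (C * mr n)"
proof -
  have lpos: "eigval \<theta>0 \<theta>1 \<theta>2 k > 0" if "k \<ge> 1" for k unfolding eigval_lam by (rule lam_pos) (use that in simp)
  obtain C0 where C0: "C0 \<ge> 0" and iC0: "\<And>K c. integrable M (\<lambda>w. (\<Sum>k=1..K. c k * xi_coeff \<theta>1 \<theta>2 \<xi> k w)\<^sup>2)"
    and eC0: "\<And>K c. (\<integral>w. (\<Sum>k=1..K. c k * xi_coeff \<theta>1 \<theta>2 \<xi> k w)\<^sup>2 \<partial>M) \<le> C0 * (\<Sum>k=1..K. (c k)\<^sup>2 / lam k)"
    using initial_coeff_bound[OF prob_space_axioms iv lpos ic] unfolding eigval_lam by blast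
  obtain C1 where C1: "C1 \<ge> 0" "\<And>n K a y y'. n \<ge> 1 \<Longrightarrow> a < n \<Longrightarrow> (\<Sum>a'<n. \<bar>CK K n a a' y (y' a')\<bar>) \<le> C1"
    using CK_row_sum by metis
  obtain CG where CG: "CG \<ge> 0" "\<And>n. n \<ge> 1 \<Longrightarrow> Nn n * G (1 / real n) \<le> CG" using NnG_bound by blast
  define C2 where "C2 = C0 * (2 * CG / \<sigma>\<^sup>2)"
  have C2: "C2 \<ge> 0" using C0 CG by (simp add: C2_def)
  \<comment> \<open>One constant for the row sums, the cross term, the squares of A, and the quartic
    sum with 96 = 72 + 24.\<close>
  define C where "C = C1 + C2 + 2 * sqrt (C1 * C2) + 96 * C1\<^sup>2"
  have s12: "0 \<le> sqrt (C1 * C2)" using C1 C2 by simp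
  have C: "C \<ge> 0" "C1 \<le> C" "C2 \<le> C" "2 * sqrt (C1 * C2) + C2 \<le> C" "96 * C1\<^sup>2 \<le> C"
    using C1(1) C2 s12 zero_le_power2[of C1] unfolding C_def by linarith+
  obtain x :: "nat \<Rightarrow> real \<Rightarrow> 'w \<Rightarrow> real" where
    x1: "\<And>k t. k \<ge> 1 \<Longrightarrow> t \<ge> 0 \<Longrightarrow> \<exists>I.
           has_wiener_integral M (W k) (\<lambda>s. exp (- lam k * (t - s)) * \<sigma>) 0 t I \<and>
           (\<forall>w\<in>space M. x k t w = exp (- lam k * t) * xi_coeff \<theta>1 \<theta>2 \<xi> k w + I w)"
    and x2: "\<And>t y. t \<ge> 0 \<Longrightarrow> y \<in> {0..1} \<Longrightarrow> X t y \<in> borel_measurable M \<and>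
           (AE w in M. (\<lambda>k. x (Suc k) t w * eigfun \<theta>1 \<theta>2 (Suc k) y) sums X t y w)"
    using sol unfolding continuous_mild_solution_def eigval_lam by blast
  obtain \<delta> where \<delta>: "\<delta> > 0" "\<And>n j. n \<ge> 1 \<Longrightarrow> 1 \<le> j \<and> j \<le> m n \<Longrightarrow> \<delta> \<le> y n j \<and> y n j \<le> 1 - \<delta>"
    using y_range by blast
  show ?thesis
  proof (intro exI[of _ C] conjI allI impI C(1))
    fix n :: nat assume n: "n \<ge> 1"
    define P where "P = grid n"
    have finP: "finite P" by (simp add: P_def)
    have neP: "P \<noteq> {}" using n m_pos[OF n] by (auto simp: P_def grid_def lessThan_empty_iff)
    have Pp: "fst p < n" "1 \<le> snd p" "snd p \<le> m n" if "p \<in> P" for p using that by (auto simp: P_def grid_def)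
    have y01: "y n (snd p) \<in> {0..1}" if "p \<in> P" for p using \<delta>(2)[OF n, of "snd p"] Pp[OF that] \<delta>(1) by auto
    define t where "t i = real i / real n" for i
    have t0: "t i \<ge> 0" for i by (simp add: t_def)
    define Q where "Q k i I \<longleftrightarrow> has_wiener_integral M (W k) (\<lambda>s. exp (- lam k * (t i - s)) * \<sigma>) 0 (t i) I \<and>
           (\<forall>w\<in>space M. x k (t i) w = exp (- lam k * t i) * xi_coeff \<theta>1 \<theta>2 \<xi> k w + I w)" for k i I
    define I where "I k i = (SOME I. Q k i I)" for k i
    have "Q k i (I k i)" if "k \<ge> 1" for k i
      unfolding I_def by (rule someI_ex[of "Q k i"]) (use x1[OF that t0, of i] in \<open>simp add: Q_def\<close>)
    then have I1: "has_wiener_integral M (W k) (\<lambda>s. exp (- lam k * (t i - s)) * \<sigma>) 0 (t i) (I k i)"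
      and I2: "w \<in> space M \<Longrightarrow> x k (t i) w = exp (- lam k * t i) * xi_coeff \<theta>1 \<theta>2 \<xi> k w + I k i w" if "k \<ge> 1" for k i w
      using that unfolding Q_def by blast+
    define sn where "sn p k = scale n * (sqrt 2 * sin (pi * real k * y n (snd p)))" for p :: "nat \<times> nat" and k :: nat
    have sn2: "\<sigma>\<^sup>2 * (sn p k * sn r k) = Nn n * wt k (y n (snd p)) (y n (snd r))" for p r k
      using Nn_nonneg[of n] sigma_pos by (simp add: sn_def scale_def wt_def field_simps power2_eq_square)
    \<comment> \<open>The deterministic factor of the k-th initial coefficient in the increment
      p.\<close>
    define hc where "hc p k = sn p k * (exp (- lam k * t (Suc (fst p))) - exp (- lam k * t (fst p)))" for p k
    \<comment> \<open>The difference of two consecutive integrals is written as a combination over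
      all times, the form in which \<open>noise_clt_bounds\<close> takes its coefficients.\<close>
    define U where "U K p w = (\<Sum>k=1..K. \<Sum>i\<in>{..n}. (sn p k * ((if i = Suc (fst p) then 1 else 0) - (if i = fst p then 1 else 0))) * I k i w)" for K p w
    define h where "h K p f = (\<Sum>k=1..K. hc p k * H_inner \<theta>1 \<theta>2 f (eigfun \<theta>1 \<theta>2 k))" for K p f
    define A where "A K p w = h K p (\<xi> w)" for K p w
    define ck where "ck K p r = CK K n (fst p) (fst r) (y n (snd p)) (y n (snd r))" for K and p r :: "nat \<times> nat"
    define cv where "cv K p r = (\<integral>w. U K p w * U K r w \<partial>M)" for K p r
    have U: "U K p w = (\<Sum>k=1..K. sn p k * (I k (Suc (fst p)) w - I k (fst p) w))" if "p \<in> P" for K p w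
    proof -
      have "(\<Sum>i\<in>{..n}. (sn p k * ((if i = Suc (fst p) then 1 else 0) - (if i = fst p then 1 else 0))) * I k i w)
          = sn p k * ((\<Sum>i\<in>{..n}. if i = Suc (fst p) then I k i w else 0) - (\<Sum>i\<in>{..n}. if i = fst p then I k i w else 0))" for k
        unfolding sum_subtractf[symmetric] sum_distrib_left by (intro sum.cong refl) simp
      then show ?thesis unfolding U_def using Pp(1)[OF that] by (simp add: less_imp_le)
    qed
    have cvck: "cv K p r = ck K p r" if p: "p \<in> P" "r \<in> P" for K p r
    proof -
      have "has_bochner_integral M (\<lambda>w. \<Sum>k=1..K. \<Sum>k'=1..K. (sn p k * sn r k') *
            ((I k (Suc (fst p)) w - I k (fst p) w) * (I k' (Suc (fst r)) w - I k' (fst r) w)))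
         (\<Sum>k=1..K. \<Sum>k'=1..K. (sn p k * sn r k') * (if k = k' then \<sigma>\<^sup>2 * gam n k (fst p) (fst r) else 0))"
        by (intro has_bochner_integral_sum has_bochner_integral_mult_right ou_increment_cov[OF prob_space_axioms bm n _ _ Pp(1)[OF p(1)] Pp(1)[OF p(2)]])
          (use I1 in \<open>auto simp: t_def\<close>)
      moreover have "(\<Sum>k=1..K. \<Sum>k'=1..K. (sn p k * sn r k') *
            ((I k (Suc (fst p)) w - I k (fst p) w) * (I k' (Suc (fst r)) w - I k' (fst r) w))) = U K p w * U K r w" for w
        unfolding U[OF p(1)] U[OF p(2)] sum_product by (simp only: mult_ac)
      moreover have "(\<Sum>k=1..K. \<Sum>k'=1..K. (sn p k * sn r k') * (if k = k' then \<sigma>\<^sup>2 * gam n k (fst p) (fst r) else 0)) = ck K p r"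
      proof -
        have "(\<Sum>k=1..K. \<Sum>k'=1..K. (sn p k * sn r k') * (if k = k' then \<sigma>\<^sup>2 * gam n k (fst p) (fst r) else 0))
           = (\<Sum>k=1..K. \<Sum>k'=1..K. if k = k' then (\<sigma>\<^sup>2 * (sn p k * sn r k)) * gam n k (fst p) (fst r) else 0)"
          by (intro sum.cong refl) simp
        also have "\<dots> = (\<Sum>k=1..K. (\<sigma>\<^sup>2 * (sn p k * sn r k)) * gam n k (fst p) (fst r))" by (intro sum.cong refl) simp
        also have "\<dots> = (\<Sum>k<K. Nn n * (gam n (Suc k) (fst p) (fst r) * wt (Suc k) (y n (snd p)) (y n (snd r))))"
          unfolding sn2 sum_1_upto by (simp only: mult_ac)
        also have "\<dots> = ck K p r" unfolding ck_def CK_def by (simp only: sum_distrib_left)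
        finally show ?thesis .
      qed
      ultimately show ?thesis by (simp add: cv_def has_bochner_integral_iff)
    qed
    have ck_sym: "ck K p r = ck K r p" for K p r unfolding ck_def by (rule CK_sym)
    have rows: "(\<Sum>r\<in>P. \<bar>ck K p r\<bar>) \<le> C1 * mr n" if p: "p \<in> P" for K p
    proof -
      have "(\<Sum>r\<in>P. \<bar>ck K p r\<bar>) = (\<Sum>j=1..m n. \<Sum>a<n. \<bar>ck K p (a, j)\<bar>)" unfolding P_def sum_grid by (rule sum.swap)
      also have "\<dots> \<le> (\<Sum>j=1..m n. C1)" unfolding ck_def fst_conv snd_conv by (intro sum_mono C1(2)[OF n Pp(1)[OF p]])
      finally show ?thesis by (simp add: mult.commute)
    qed
    have entry: "\<bar>ck K p r\<bar> \<le> C1" if p: "p \<in> P" "r \<in> P" for K p r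
    proof -
      have "\<bar>ck K p r\<bar> \<le> (\<Sum>a<n. \<bar>ck K p (a, snd r)\<bar>)"
        using member_le_row[OF Pp(1)[OF p(2)], of "\<lambda>a. ck K p (a, snd r)"] by simp
      also have "\<dots> \<le> C1" unfolding ck_def fst_conv snd_conv by (rule C1(2)[OF n Pp(1)[OF p(1)]])
      finally show ?thesis .
    qed
    have A_eq: "A K p w = (\<Sum>k=1..K. hc p k * xi_coeff \<theta>1 \<theta>2 \<xi> k w)" for K p w by (simp add: A_def h_def)
    have hm: "h K p \<in> borel_measurable (H_borel \<theta>1 \<theta>2)" for K p
      unfolding h_def[abs_def] by (intro borel_measurable_sum borel_measurable_times borel_measurable_const xi_coeff_functional_measurable)
    have xim: "\<xi> \<in> measurable M (H_borel \<theta>1 \<theta>2)" using iv by (simp add: initial_value_def)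
    have mA: "A K p \<in> borel_measurable M" for K p unfolding A_def[abs_def] using measurable_comp[OF xim hm] by (simp add: comp_def)
    have iA: "integrable M (\<lambda>w. (A K p w)\<^sup>2)" for K p unfolding A_eq by (rule iC0)
    have iAA: "integrable M (\<lambda>w. A K p w * A K r w)" for K p r by (rule square_integrable_mult[OF mA mA iA iA])
    have a_le: "(\<Sum>p\<in>P. \<integral>w. (A K p w)\<^sup>2 \<partial>M) \<le> C2 * mr n" for K
    proof -
      \<comment> \<open>The squared increment of the exponential is (1 - q)^2 q^(2 a). Giving up one
        factor q^a compares it with \<open>be\<close>, whose sum over a is already known.\<close>
      have hc2: "(hc p (Suc k))\<^sup>2 / lam (Suc k) \<le> 4 * (Nn n / \<sigma>\<^sup>2) * be n (Suc k) (fst p)" for p k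
      proof -
        have "(sn p (Suc k))\<^sup>2 = Nn n / \<sigma>\<^sup>2 * wt (Suc k) (y n (snd p)) (y n (snd p))"
          using sn2[of p "Suc k" p] sigma_pos by (simp add: power2_eq_square field_simps)
        also have "\<dots> \<le> Nn n / \<sigma>\<^sup>2 * 2"
          using wt_le[of "Suc k" "y n (snd p)" "y n (snd p)"] Nn_nonneg[of n] by (intro mult_left_mono) auto
        finally have 1: "(sn p (Suc k))\<^sup>2 \<le> Nn n / \<sigma>\<^sup>2 * 2" .
        have e: "exp (- lam (Suc k) * t i) = q n (Suc k) ^ i" for i unfolding t_def q_exp ..
        have "(exp (- lam (Suc k) * t (Suc (fst p))) - exp (- lam (Suc k) * t (fst p)))\<^sup>2 = (1 - q n (Suc k))\<^sup>2 * q n (Suc k) ^ fst p * q n (Suc k) ^ fst p"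
          unfolding e by (simp add: power2_eq_square algebra_simps)
        also have "\<dots> \<le> (1 - q n (Suc k))\<^sup>2 * q n (Suc k) ^ fst p * 1"
          using q_bounds[OF n, of k] by (intro mult_left_mono power_le_one) auto
        finally have 2: "(exp (- lam (Suc k) * t (Suc (fst p))) - exp (- lam (Suc k) * t (fst p)))\<^sup>2 \<le> 2 * lam (Suc k) * be n (Suc k) (fst p)"
          by (simp add: be_def)
        have "(hc p (Suc k))\<^sup>2 \<le> (Nn n / \<sigma>\<^sup>2 * 2) * (2 * lam (Suc k) * be n (Suc k) (fst p))"
          unfolding hc_def power_mult_distrib using Nn_nonneg[of n] by (intro mult_mono 1 2) auto
        then have "(hc p (Suc k))\<^sup>2 / lam (Suc k) \<le> (Nn n / \<sigma>\<^sup>2 * 2) * (2 * lam (Suc k) * be n (Suc k) (fst p)) / lam (Suc k)"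
          by (intro divide_right_mono lam_ge0)
        then show ?thesis by simp
      qed
      have "(\<Sum>p\<in>P. \<integral>w. (A K p w)\<^sup>2 \<partial>M) \<le> (\<Sum>p\<in>P. C0 * (\<Sum>k=1..K. (hc p k)\<^sup>2 / lam k))"
        unfolding A_eq by (intro sum_mono eC0)
      also have "\<dots> \<le> (\<Sum>p\<in>P. C0 * (\<Sum>k<K. 4 * (Nn n / \<sigma>\<^sup>2) * be n (Suc k) (fst p)))"
        unfolding sum_1_upto by (intro sum_mono mult_left_mono hc2 C0)
      also have "\<dots> = (\<Sum>j=1..m n. \<Sum>a<n. C0 * (\<Sum>k<K. 4 * (Nn n / \<sigma>\<^sup>2) * be n (Suc k) a))"
        unfolding P_def sum_grid fst_conv by (rule sum.swap)
      also have "\<dots> = mr n * (C0 * (4 * (Nn n / \<sigma>\<^sup>2)) * (\<Sum>a<n. \<Sum>k<K. be n (Suc k) a))"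
        by (simp add: sum_distrib_left mult_ac)
      also have "\<dots> \<le> mr n * (C0 * (4 * (Nn n / \<sigma>\<^sup>2)) * (G (1 / real n) / 2))"
      proof (intro mult_left_mono mult_nonneg_nonneg C0)
        have "(\<Sum>a<n. \<Sum>k<K. be n (Suc k) a) = (\<Sum>k<K. \<Sum>a<n. be n (Suc k) a)" by (rule sum.swap)
        also have "\<dots> \<le> (\<Sum>k<K. (1 - q n (Suc k)) / (2 * lam (Suc k)))" by (intro sum_mono sum_be_le n)
        also have "\<dots> = (\<Sum>k<K. ratio n k) / 2" by (simp add: sum_divide_distrib mult.commute)
        also have "\<dots> \<le> G (1 / real n) / 2" unfolding G_q
          using q_bounds[OF n] by (intro divide_right_mono sum_le_suminf q_summable) auto
        finally show "(\<Sum>a<n. \<Sum>k<K. be n (Suc k) a) \<le> G (1 / real n) / 2" .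
      qed (use Nn_nonneg[of n] in auto)
      also have "\<dots> = mr n * (C0 * (2 * (Nn n * G (1 / real n)) / \<sigma>\<^sup>2))" by simp
      also have "\<dots> \<le> mr n * (C0 * (2 * CG / \<sigma>\<^sup>2))" by (intro mult_left_mono divide_right_mono CG(2) n C0) auto
      finally show ?thesis by (simp add: C2_def mult.commute)
    qed
    have bil: "(\<Sum>p\<in>P. \<Sum>r\<in>P. ck K p r * (\<integral>w. A K p w * A K r w \<partial>M)) \<le> (C1 * C2) * (mr n)\<^sup>2" for K
    proof -
      have "(\<Sum>p\<in>P. \<Sum>r\<in>P. ck K p r * (\<integral>w. A K p w * A K r w \<partial>M)) \<le> (C1 * mr n) * (\<Sum>p\<in>P. \<integral>w. A K p w * A K p w \<partial>M)"
      proof (rule bilinear_rows_le[OF finP rows ck_sym])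
        fix p r
        have "\<bar>\<integral>w. A K p w * A K r w \<partial>M\<bar> \<le> (\<integral>w. \<bar>A K p w * A K r w\<bar> \<partial>M)" by (rule integral_abs_bound)
        also have "\<dots> \<le> (\<integral>w. (A K p w * A K p w + A K r w * A K r w) / 2 \<partial>M)"
        proof (intro integral_mono Bochner_Integration.integrable_divide Bochner_Integration.integrable_add integrable_abs iAA)
          fix w
          show "\<bar>A K p w * A K r w\<bar> \<le> (A K p w * A K p w + A K r w * A K r w) / 2"
            using mult_le_weighted_squares[of 1 "A K p w" "A K r w"] by (simp add: power2_eq_square)
        qed
        also have "\<dots> = ((\<integral>w. A K p w * A K p w \<partial>M) + (\<integral>w. A K r w * A K r w \<partial>M)) / 2"
          using iAA by simp
        finally show "\<bar>\<integral>w. A K p w * A K r w \<partial>M\<bar> \<le> ((\<integral>w. A K p w * A K p w \<partial>M) + (\<integral>w. A K r w * A K r w \<partial>M)) / 2" .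
        show "0 \<le> (\<integral>w. A K p w * A K p w \<partial>M)" by (intro integral_nonneg_AE) auto
      qed
      also have "\<dots> \<le> (C1 * mr n) * (C2 * mr n)" using a_le[of K] C1(1) by (intro mult_left_mono) (auto simp: power2_eq_square)
      finally show ?thesis by (simp add: power2_eq_square mult_ac)
    qed
    define FK where "FK K = (\<Sum>p\<in>P. \<Sum>r\<in>P. (ck K p r)\<^sup>2)" for K
    have FK0: "0 \<le> FK K" for K unfolding FK_def by (intro sum_nonneg) auto
    have bK: "clt_bounds M P (\<lambda>p w. U K p w + A K p w) (FK K) ((C * mr n)\<^sup>2 * FK K)
       ((\<Sum>p\<in>P. \<bar>ck K p p - 1\<bar>) + C * mr n) (C * FK K)
       ((\<Sum>p\<in>P. \<bar>(ck K p p)\<^sup>2 - 1\<bar>) / real (card P)) (C * mr n)" if K: "K \<ge> 1" for K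
    proof -
      have raw: "cov_clt_bounds M P (\<lambda>p w. U K p w + A K p w) (cv K) (A K)" unfolding cv_def U_def A_def
        by (rule noise_clt_bounds[OF prob_space_axioms bm iv finP neP _ K, where t = t and f = "\<lambda>k i s. exp (- lam k * (t i - s)) * \<sigma>"])
          (use t0 I1 hm iA in \<open>auto simp: A_def\<close>)
      have eqs: "(\<Sum>p\<in>P. \<Sum>q\<in>P. (cv K p q)\<^sup>2) = FK K"
        "(\<Sum>p\<in>P. \<Sum>q\<in>P. (\<Sum>r\<in>P. cv K p r * cv K r q)\<^sup>2) = (\<Sum>p\<in>P. \<Sum>q\<in>P. (\<Sum>r\<in>P. ck K p r * ck K r q)\<^sup>2)"
        "(\<Sum>p\<in>P. \<bar>cv K p p - 1\<bar>) = (\<Sum>p\<in>P. \<bar>ck K p p - 1\<bar>)"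
        "(\<Sum>p\<in>P. \<Sum>q\<in>P. cv K p q * (\<integral>w. A K p w * A K q w \<partial>M)) = (\<Sum>p\<in>P. \<Sum>q\<in>P. ck K p q * (\<integral>w. A K p w * A K q w \<partial>M))"
        "(\<Sum>p\<in>P. \<Sum>q\<in>P. 72 * cv K p p * cv K q q * (cv K p q)\<^sup>2 + 24 * cv K p q ^ 4) = (\<Sum>p\<in>P. \<Sum>q\<in>P. 72 * ck K p p * ck K q q * (ck K p q)\<^sup>2 + 24 * ck K p q ^ 4)"
        "(\<Sum>p\<in>P. \<bar>(cv K p p)\<^sup>2 - 1\<bar>) = (\<Sum>p\<in>P. \<bar>(ck K p p)\<^sup>2 - 1\<bar>)"
        unfolding FK_def by (simp_all only: cvck cong: sum.cong)
      show ?thesis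
      proof (rule clt_bounds_mono[OF raw[unfolded eqs]])
        have "2 * sqrt (\<Sum>p\<in>P. \<Sum>q\<in>P. ck K p q * (\<integral>w. A K p w * A K q w \<partial>M)) \<le> 2 * sqrt ((C1 * C2) * (mr n)\<^sup>2)"
          using bil by (intro mult_left_mono real_sqrt_le_mono) auto
        also have "\<dots> = 2 * sqrt (C1 * C2) * mr n" by (simp add: real_sqrt_mult)
        finally have "2 * sqrt (\<Sum>p\<in>P. \<Sum>q\<in>P. ck K p q * (\<integral>w. A K p w * A K q w \<partial>M)) + (\<Sum>p\<in>P. \<integral>w. (A K p w)\<^sup>2 \<partial>M)
            \<le> (2 * sqrt (C1 * C2) + C2) * mr n" using a_le[of K] by (simp add: distrib_right)
        also have "\<dots> \<le> C * mr n" using C by (intro mult_right_mono) auto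
        finally show "(\<Sum>p\<in>P. \<bar>ck K p p - 1\<bar>) + 2 * sqrt (\<Sum>p\<in>P. \<Sum>q\<in>P. ck K p q * (\<integral>w. A K p w * A K q w \<partial>M)) + (\<Sum>p\<in>P. \<integral>w. (A K p w)\<^sup>2 \<partial>M)
            \<le> (\<Sum>p\<in>P. \<bar>ck K p p - 1\<bar>) + C * mr n" by linarith
        have "(\<Sum>p\<in>P. \<Sum>q\<in>P. (\<Sum>r\<in>P. ck K p r * ck K r q)\<^sup>2) \<le> (C1 * mr n)\<^sup>2 * FK K"
          unfolding FK_def using C1(1) by (intro frob_rows_le finP rows ck_sym) auto
        also have "\<dots> \<le> (C * mr n)\<^sup>2 * FK K" using C C1(1) FK0 by (intro mult_right_mono power_mono) auto
        finally show "(\<Sum>p\<in>P. \<Sum>q\<in>P. (\<Sum>r\<in>P. ck K p r * ck K r q)\<^sup>2) \<le> (C * mr n)\<^sup>2 * FK K" .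
        have "72 * ck K p p * ck K r r * (ck K p r)\<^sup>2 + 24 * ck K p r ^ 4 \<le> 96 * C1\<^sup>2 * (ck K p r)\<^sup>2" if p: "p \<in> P" "r \<in> P" for p r
        proof -
          have "ck K p p * ck K r r \<le> \<bar>ck K p p\<bar> * \<bar>ck K r r\<bar>" by (metis abs_ge_self abs_mult)
          also have "\<dots> \<le> C1 * C1" using entry p C1(1) by (intro mult_mono) auto
          finally have 1: "ck K p p * ck K r r \<le> C1\<^sup>2" by (simp add: power2_eq_square)
          have 2: "(ck K p r)\<^sup>2 \<le> C1\<^sup>2" using entry[OF p, of K] C1(1) by (simp add: abs_le_square_iff[symmetric])
          have "72 * ck K p p * ck K r r * (ck K p r)\<^sup>2 + 24 * ck K p r ^ 4 = (72 * (ck K p p * ck K r r) + 24 * (ck K p r)\<^sup>2) * (ck K p r)\<^sup>2"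
            by (simp add: power4_eq_xxxx power2_eq_square algebra_simps)
          also have "\<dots> \<le> (96 * C1\<^sup>2) * (ck K p r)\<^sup>2" using 1 2 by (intro mult_right_mono) auto
          finally show ?thesis .
        qed
        then have "(\<Sum>p\<in>P. \<Sum>q\<in>P. 72 * ck K p p * ck K q q * (ck K p q)\<^sup>2 + 24 * ck K p q ^ 4) \<le> (\<Sum>p\<in>P. \<Sum>q\<in>P. 96 * C1\<^sup>2 * (ck K p q)\<^sup>2)"
          by (intro sum_mono)
        also have "\<dots> = 96 * C1\<^sup>2 * FK K" by (simp only: FK_def sum_distrib_left)
        also have "\<dots> \<le> C * FK K" using C FK0 by (intro mult_right_mono)
        finally show "(\<Sum>p\<in>P. \<Sum>q\<in>P. 72 * ck K p p * ck K q q * (ck K p q)\<^sup>2 + 24 * ck K p q ^ 4) \<le> C * FK K" .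
        have "C2 * mr n \<le> C * mr n" using C by (intro mult_right_mono) auto
        with a_le[of K] show "(\<Sum>p\<in>P. \<integral>w. (A K p w)\<^sup>2 \<partial>M) \<le> C * mr n" by (rule order_trans)
      qed simp
    qed
    have inc: "increment X n (Suc (fst p)) z w = X (t (Suc (fst p))) z w - X (t (fst p)) z w" for p :: "nat \<times> nat" and z w
      by (simp add: increment_def t_def)
    have conv: "AE w in M. (\<lambda>K. U K p w + A K p w) \<longlonglongrightarrow> V n p w" if p: "p \<in> P" for p
      using x2[OF t0[of "Suc (fst p)"] y01[OF p], THEN conjunct2] x2[OF t0[of "fst p"] y01[OF p], THEN conjunct2] AE_space
    proof eventually_elim
      case (elim w)
      let ?z = "y n (snd p)"
      let ?c = "scale n * exp (?z * \<theta>1 / (2 * \<theta>2))"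
      have "(\<lambda>K. ?c * ((\<Sum>k<K. x (Suc k) (t (Suc (fst p))) w * eigfun \<theta>1 \<theta>2 (Suc k) ?z) - (\<Sum>k<K. x (Suc k) (t (fst p)) w * eigfun \<theta>1 \<theta>2 (Suc k) ?z)))
         \<longlonglongrightarrow> V n p w" using elim unfolding V_def inc sums_def by (intro tendsto_mult tendsto_diff tendsto_const)
      moreover have "?c * ((\<Sum>k<K. x (Suc k) (t (Suc (fst p))) w * eigfun \<theta>1 \<theta>2 (Suc k) ?z) - (\<Sum>k<K. x (Suc k) (t (fst p)) w * eigfun \<theta>1 \<theta>2 (Suc k) ?z))
         = U K p w + A K p w" for K
      proof -
        have e: "?c * eigfun \<theta>1 \<theta>2 k ?z = sn p k" for k
        proof -
          have "exp (?z * \<theta>1 / (2 * \<theta>2)) * exp (- (\<theta>1 / (2 * \<theta>2)) * ?z) = 1" unfolding exp_add[symmetric] by (simp add: field_simps)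
          moreover have "?c * eigfun \<theta>1 \<theta>2 k ?z = sn p k * (exp (?z * \<theta>1 / (2 * \<theta>2)) * exp (- (\<theta>1 / (2 * \<theta>2)) * ?z))"
            unfolding eigfun_def sn_def by (simp only: mult_ac)
          ultimately show ?thesis by simp
        qed
        have "?c * ((\<Sum>k<K. x (Suc k) (t (Suc (fst p))) w * eigfun \<theta>1 \<theta>2 (Suc k) ?z) - (\<Sum>k<K. x (Suc k) (t (fst p)) w * eigfun \<theta>1 \<theta>2 (Suc k) ?z))
           = (\<Sum>k<K. (?c * eigfun \<theta>1 \<theta>2 (Suc k) ?z) * (x (Suc k) (t (Suc (fst p))) w - x (Suc k) (t (fst p)) w))"
          unfolding sum_subtractf[symmetric] sum_distrib_left by (intro sum.cong refl) (simp only: right_diff_distrib mult_ac)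
        also have "\<dots> = (\<Sum>k<K. sn p (Suc k) * (I (Suc k) (Suc (fst p)) w - I (Suc k) (fst p) w) + hc p (Suc k) * xi_coeff \<theta>1 \<theta>2 \<xi> (Suc k) w)"
          unfolding e hc_def using elim(3) by (intro sum.cong refl) (simp add: I2 algebra_simps)
        also have "\<dots> = U K p w + A K p w" unfolding U[OF p] A_eq sum_1_upto sum.distrib ..
        finally show ?thesis .
      qed
      ultimately show ?case by simp
    qed
    have mV: "V n p \<in> borel_measurable M" if "p \<in> P" for p unfolding V_def[abs_def] inc using x2[OF t0 y01[OF that], THEN conjunct1]
      by (intro borel_measurable_times borel_measurable_diff borel_measurable_const)
    have mI: "I k i \<in> borel_measurable M" if "k \<ge> 1" for k i using I1[OF that] by (simp add: has_wiener_integral_def)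
    have mU: "U K p \<in> borel_measurable M" for K p
      unfolding U_def[abs_def] by (intro borel_measurable_sum borel_measurable_times borel_measurable_const mI) simp
    have ckl: "(\<lambda>K. ck (Suc K) p r) \<longlonglongrightarrow> cov n p r" for p r
      unfolding ck_def cov_def by (rule LIMSEQ_Suc[OF CK_tendsto[OF n]])
    have FKl: "(\<lambda>K. FK (Suc K)) \<longlonglongrightarrow> frob n"
      unfolding FK_def frob_def P_def by (intro tendsto_sum tendsto_power ckl)
    have "clt_bounds M P (V n) (frob n) ((C * mr n)\<^sup>2 * frob n)
       ((\<Sum>p\<in>P. \<bar>cov n p p - 1\<bar>) + C * mr n) (C * frob n)
       ((\<Sum>p\<in>P. \<bar>(cov n p p)\<^sup>2 - 1\<bar>) / real (card P)) (C * mr n)"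
    \<comment> \<open>The truncations are indexed by \<open>Suc K\<close>, since the bounds need at
      least one mode.\<close>
    proof (rule clt_bounds_tendsto[where V = "\<lambda>K p w. U (Suc K) p w + A (Suc K) p w", OF finP _ mV _ bK])
      show "(\<lambda>w. U (Suc K) p w + A (Suc K) p w) \<in> borel_measurable M" for K p by (intro borel_measurable_add mU mA)
      show "AE w in M. (\<lambda>K. U (Suc K) p w + A (Suc K) p w) \<longlonglongrightarrow> V n p w" if "p \<in> P" for p
        using conv[OF that] by eventually_elim (rule LIMSEQ_Suc)
      show "1 \<le> Suc K" for K :: nat unfolding One_nat_def by (rule Suc_leI) (rule zero_less_Suc)
    qed (unfold divide_inverse, assumption, (rule tendsto_add tendsto_sum tendsto_rabs tendsto_diff tendsto_power tendsto_mult tendsto_const FKl ckl)+)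
    then show "clt_bounds M (grid n) (V n) (frob n) ((C * mr n)\<^sup>2 * frob n)
     (diag_err n + C * mr n) (C * frob n)
     (diag_sq_err n / real (card (grid n))) (C * mr n)" unfolding P_def diag_err_def diag_sq_err_def .
  qed
qed

end

section \<open>The Frobenius norm over the whole observation grid\<close>

lemma harmonic_sum_le: "m \<ge> 1 \<Longrightarrow> (\<Sum>r<m. 1 / real (Suc r)) \<le> 1 + ln (real m)"
proof (induction m rule: nat_induct_at_least)
  case (Suc m)
  have "ln (real m / real (Suc m)) \<le> real m / real (Suc m) - 1" using Suc.hyps by (intro ln_le_minus_one) auto
  also have "real m / real (Suc m) - 1 = - (1 / real (Suc m))" by (simp add: field_simps)
  finally have "1 / real (Suc m) \<le> ln (real (Suc m)) - ln (real m)" using Suc.hyps by (simp add: ln_div)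
  then show ?case using Suc.IH by simp
qed simp

context heat_spectrum
begin

text \<open>The diagonal alone contributes (AA n 0)^2, with limit 1, to the sequence whose limit is
  pi Gamma / 2.\<close>

lemma Gamma_const_pos: "Gamma_const > 0"
proof -
  have "(\<lambda>n. (AA n 0)\<^sup>2) \<longlonglongrightarrow> 1\<^sup>2"
  proof (rule tendsto_power)
    show "(\<lambda>n. AA n 0) \<longlonglongrightarrow> 1" using NnG_tendsto[of 1] by (simp add: AA_0)
  qed
  moreover have "\<forall>\<^sub>F n in sequentially. (AA n 0)\<^sup>2 \<le> AA_frob n / real n" using eventually_ge_at_top[of 1]
  proof eventually_elim
    case (elim n)
    have "(AA n 0)\<^sup>2 \<le> (\<Sum>a'<n. (AA n (ndist a a'))\<^sup>2)" if "a < n" for a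
    proof -
      have "ndist a a = 0" by (simp add: ndist_def)
      then show ?thesis using member_le_sum[of a "{..<n}" "\<lambda>a'. (AA n (ndist a a'))\<^sup>2"] that by simp
    qed
    then have "(\<Sum>a<n. (AA n 0)\<^sup>2) \<le> AA_frob n" by (intro sum_mono) simp
    then show ?case using elim by (simp add: field_simps)
  qed
  ultimately have "1\<^sup>2 \<le> pi * Gamma_const / 2" using tendsto_le[OF _ AA_frobenius_tendsto] by force
  then have "0 < pi * Gamma_const" by simp
  then show ?thesis by (simp add: zero_less_mult_iff)
qed

end

context spde_observation
begin

text \<open>Points whose indices differ by r are at least r minimal gaps apart, as the grid is
  increasing. Spatial indices are shifted to start at 0.\<close>

lemma y_gap: "\<exists>c>0. \<forall>n\<ge>1. \<forall>i i'. i < m n \<and> i' < m n \<longrightarrow> c * real (ndist i i') \<le> mr n * \<bar>y n (Suc i) - y n (Suc i')\<bar>"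
proof -
  obtain c where c: "c > 0" "\<And>n. n \<ge> 1 \<Longrightarrow> 2 \<le> m n \<Longrightarrow> c \<le> mr n * Min ((\<lambda>j. \<bar>y n j - y n (j - 1)\<bar>) ` {2..m n})"
    using scheme unfolding observation_scheme_def by blast
  have sm: "strict_mono_on {1..m n} (y n)" if "n \<ge> 1" for n using scheme that unfolding observation_scheme_def by blast
  have step: "c \<le> mr n * (y n (Suc (Suc i)) - y n (Suc i))" if n: "n \<ge> 1" and i: "Suc i < m n" for n i
  proof -
    have "Min ((\<lambda>j. \<bar>y n j - y n (j - 1)\<bar>) ` {2..m n}) \<le> \<bar>y n (Suc (Suc i)) - y n (Suc (Suc i) - 1)\<bar>"
      using i by (intro Min_le imageI) auto
    also have "\<dots> = y n (Suc (Suc i)) - y n (Suc i)" using strict_mono_onD[OF sm[OF n], of "Suc i" "Suc (Suc i)"] i by simp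
    finally have "mr n * Min ((\<lambda>j. \<bar>y n j - y n (j - 1)\<bar>) ` {2..m n}) \<le> mr n * (y n (Suc (Suc i)) - y n (Suc i))"
      by (intro mult_left_mono) auto
    with c(2)[OF n] i show ?thesis by linarith
  qed
  have up: "i + r < m n \<Longrightarrow> c * real r \<le> mr n * (y n (Suc (i + r)) - y n (Suc i))" if n: "n \<ge> 1" for n i r
  proof (induction r)
    case (Suc r)
    have "c * real r \<le> mr n * (y n (Suc (i + r)) - y n (Suc i))" using Suc by simp
    moreover have "c \<le> mr n * (y n (Suc (Suc (i + r))) - y n (Suc (i + r)))" using step[OF n, of "i + r"] Suc by simp
    ultimately show ?case by (simp add: algebra_simps)
  qed simp
  have "c * real (ndist i i') \<le> mr n * \<bar>y n (Suc i) - y n (Suc i')\<bar>" if n: "n \<ge> 1" and i: "i < m n" "i' < m n" for n i i'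
  proof -
    have *: "c * real (b - a) \<le> mr n * \<bar>y n (Suc b) - y n (Suc a)\<bar>" if "a \<le> b" "b < m n" for a b
    proof -
      have "c * real (b - a) \<le> mr n * (y n (Suc b) - y n (Suc a))" using up[OF n, of a "b - a"] that by simp
      also have "\<dots> \<le> mr n * \<bar>y n (Suc b) - y n (Suc a)\<bar>" by (intro mult_left_mono) auto
      finally show ?thesis .
    qed
    show ?thesis using *[of i i'] *[of i' i] i by (cases "i \<le> i'") (simp_all add: ndist_def abs_minus_commute)
  qed
  then show ?thesis using c(1) by blast
qed

text \<open>The norm is split into blocks by pairs of spatial points. Diagonal blocks are compared
  with \<open>AA_frob\<close> by \<open>CC_frobenius\<close>. In the other blocks one factor of each
  square is bounded by \<open>CC_offdiag\<close> and the other one by its row sum; the reciprocal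
  distances form a harmonic sum, the source of the logarithm.\<close>

lemma frob_bound:
  "\<exists>C\<ge>0. \<forall>n\<ge>1. \<bar>frob n / (real n * mr n) - AA_frob n / real n\<bar>
     \<le> C * (mr n * (1 + ln (mr n)) / sqrt (real n))"
proof -
  obtain \<delta> where \<delta>: "\<delta> > 0" "\<And>n j. n \<ge> 1 \<Longrightarrow> 1 \<le> j \<and> j \<le> m n \<Longrightarrow> \<delta> \<le> y n j \<and> y n j \<le> 1 - \<delta>" using y_range by blast
  obtain c where c: "c > 0" "\<And>n i i'. n \<ge> 1 \<Longrightarrow> i < m n \<and> i' < m n \<Longrightarrow> c * real (ndist i i') \<le> mr n * \<bar>y n (Suc i) - y n (Suc i')\<bar>"
    using y_gap by blast
  obtain C1 where C1: "C1 \<ge> 0" "\<And>n a y y'. n \<ge> 1 \<Longrightarrow> a < n \<Longrightarrow> (\<Sum>a'<n. \<bar>CC n a a' y (y' a')\<bar>) \<le> C1" using CC_row_sum by metis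
  obtain C2 where C2: "C2 \<ge> 0" "\<And>n y. n \<ge> 1 \<Longrightarrow> \<delta> \<le> y \<and> y \<le> 1 - \<delta> \<Longrightarrow>
     \<bar>(\<Sum>a<n. \<Sum>a'<n. (CC n a a' y y)\<^sup>2) - AA_frob n\<bar> \<le> C2 * sqrt (real n)"
    using CC_frobenius[OF \<delta>(1)] by blast
  obtain C3 where C3: "C3 \<ge> 0" "\<And>n a a' y y'. n \<ge> 1 \<Longrightarrow> \<delta> \<le> y \<and> y \<le> 1 - \<delta> \<and> \<delta> \<le> y' \<and> y' \<le> 1 - \<delta> \<and> y \<noteq> y' \<Longrightarrow>
    \<bar>CC n a a' y y'\<bar> \<le> C3 / (sqrt (real n) * \<bar>y - y'\<bar>)" using CC_offdiag[OF \<delta>(1)] by blast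
  define C where "C = C2 + 2 * (C1 * C3 / c)"
  have C4: "C1 * C3 / c \<ge> 0" using C1 C3 c by simp
  have "\<bar>frob n / (real n * mr n) - AA_frob n / real n\<bar>
     \<le> C * (mr n * (1 + ln (mr n)) / sqrt (real n))" if n: "n \<ge> 1" for n
  proof -
    define S where "S = AA_frob n"
    define B where "B i i' = (\<Sum>a<n. \<Sum>a'<n. (CC n a a' (y n (Suc i)) (y n (Suc i')))\<^sup>2)" for i i'
    \<comment> \<open>The value 0 at lag 0 excludes the diagonal block from the sum of reciprocal
      distances.\<close>
    define g where "g r = (if r = 0 then 0 else 1 / real r)" for r :: nat
    have g0: "0 \<le> g r" for r by (simp add: g_def)
    have m1: "1 \<le> mr n" using m_pos[OF n] by simp
    have sn: "sqrt (real n) > 0" using n by simp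
    have L0: "0 \<le> ln (mr n)" using m1 by simp
    have frob: "frob n = (\<Sum>i<m n. \<Sum>i'<m n. B i i')"
    proof -
      have "frob n = (\<Sum>a<n. \<Sum>j=1..m n. \<Sum>a'<n. \<Sum>j'=1..m n. (CC n a a' (y n j) (y n j'))\<^sup>2)"
        by (simp only: frob_def sum_grid cov_def fst_conv snd_conv)
      also have "\<dots> = (\<Sum>a<n. \<Sum>i<m n. \<Sum>a'<n. \<Sum>i'<m n. (CC n a a' (y n (Suc i)) (y n (Suc i')))\<^sup>2)" by (simp only: sum_1_upto)
      also have "\<dots> = (\<Sum>i<m n. \<Sum>a<n. \<Sum>a'<n. \<Sum>i'<m n. (CC n a a' (y n (Suc i)) (y n (Suc i')))\<^sup>2)" by (rule sum.swap)
      also have "\<dots> = (\<Sum>i<m n. \<Sum>a<n. \<Sum>i'<m n. \<Sum>a'<n. (CC n a a' (y n (Suc i)) (y n (Suc i')))\<^sup>2)"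
        by (intro sum.cong refl sum.swap)
      also have "\<dots> = (\<Sum>i<m n. \<Sum>i'<m n. B i i')" unfolding B_def by (intro sum.cong refl sum.swap)
      finally show ?thesis .
    qed
    have Bd: "\<bar>B i i - S\<bar> \<le> C2 * sqrt (real n)" if "i < m n" for i
      unfolding B_def S_def using \<delta>(2)[OF n, of "Suc i"] that by (intro C2(2) n) auto
    have B0: "0 \<le> B i i'" for i i' unfolding B_def by (intro sum_nonneg) auto
    have Bo: "B i i' \<le> sqrt (real n) * (C1 * C3 / c) * mr n * g (ndist i i')" if i: "i < m n" "i' < m n" "i \<noteq> i'" for i i'
    proof -
      let ?d = "\<bar>y n (Suc i) - y n (Suc i')\<bar>"
      have nd: "ndist i i' > 0" using i by (auto simp: ndist_def)
      have gap: "c * real (ndist i i') \<le> mr n * ?d" by (rule c(2)[OF n]) (use i in simp)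
      have "0 < c * real (ndist i i')" using c(1) nd by simp
      with gap have "0 < mr n * ?d" by linarith
      then have d: "?d > 0" using m1 by (simp add: zero_less_mult_iff)
      have e: "\<bar>CC n a a' (y n (Suc i)) (y n (Suc i'))\<bar> \<le> C3 / (sqrt (real n) * ?d)" for a a'
        by (rule C3(2)[OF n]) (use \<delta>(2)[OF n, of "Suc i"] \<delta>(2)[OF n, of "Suc i'"] i d in auto)
      have E0: "0 \<le> C3 / (sqrt (real n) * ?d)" using C3(1) sn d by simp
      have "B i i' \<le> (\<Sum>a<n. \<Sum>a'<n. C3 / (sqrt (real n) * ?d) * \<bar>CC n a a' (y n (Suc i)) (y n (Suc i'))\<bar>)"
        unfolding B_def
      proof (intro sum_mono)
        fix a a'
        have "(CC n a a' (y n (Suc i)) (y n (Suc i')))\<^sup>2 = \<bar>CC n a a' (y n (Suc i)) (y n (Suc i'))\<bar> * \<bar>CC n a a' (y n (Suc i)) (y n (Suc i'))\<bar>"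
          by (simp add: power2_eq_square)
        also have "\<dots> \<le> C3 / (sqrt (real n) * ?d) * \<bar>CC n a a' (y n (Suc i)) (y n (Suc i'))\<bar>" by (intro mult_right_mono e) simp
        finally show "(CC n a a' (y n (Suc i)) (y n (Suc i')))\<^sup>2 \<le> C3 / (sqrt (real n) * ?d) * \<bar>CC n a a' (y n (Suc i)) (y n (Suc i'))\<bar>" .
      qed
      also have "\<dots> \<le> (\<Sum>a<n. C3 / (sqrt (real n) * ?d) * C1)" unfolding sum_distrib_left[symmetric]
        by (intro mult_left_mono[OF _ E0] sum_mono C1(2) n) auto
      also have "\<dots> = (real n / sqrt (real n)) * (C1 * C3) * (1 / ?d)" by simp
      also have "real n / sqrt (real n) = sqrt (real n)" by (simp add: real_div_sqrt)
      also have "sqrt (real n) * (C1 * C3) * (1 / ?d) \<le> sqrt (real n) * (C1 * C3) * (mr n / (c * real (ndist i i')))"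
      proof (intro mult_left_mono)
        show "1 / ?d \<le> mr n / (c * real (ndist i i'))" using gap d c(1) nd by (simp add: field_simps)
      qed (use sn C1(1) C3(1) in auto)
      also have "\<dots> = sqrt (real n) * (C1 * C3 / c) * mr n * g (ndist i i')" using nd by (simp add: g_def)
      finally show ?thesis .
    qed
    have gsum: "(\<Sum>i'<m n. g (ndist i i')) \<le> 2 * (1 + ln (mr n))" if i: "i < m n" for i
    proof -
      have "(\<Sum>i'<m n. g (ndist i i')) \<le> g 0 + 2 * (\<Sum>r<m n. g (Suc r))" by (rule sum_ndist_le[OF i]) (simp add: g_def)
      also have "\<dots> = 2 * (\<Sum>r<m n. 1 / real (Suc r))" by (simp add: g_def)
      also have "\<dots> \<le> 2 * (1 + ln (mr n))" by (intro mult_left_mono harmonic_sum_le m_pos n) simp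
      finally show ?thesis .
    qed
    have row: "\<bar>(\<Sum>i'<m n. B i i') - S\<bar> \<le> C * sqrt (real n) * (mr n * (1 + ln (mr n)))" if i: "i < m n" for i
    proof -
      have sp: "(\<Sum>i'<m n. B i i') = B i i + (\<Sum>i'\<in>{..<m n} - {i}. B i i')" using i by (intro sum.remove) auto
      have "(\<Sum>i'\<in>{..<m n} - {i}. B i i') \<le> (\<Sum>i'\<in>{..<m n} - {i}. sqrt (real n) * (C1 * C3 / c) * mr n * g (ndist i i'))"
        by (intro sum_mono Bo) (use i in auto)
      also have "\<dots> \<le> (\<Sum>i'<m n. sqrt (real n) * (C1 * C3 / c) * mr n * g (ndist i i'))"
        using sn by (intro sum_mono2 mult_nonneg_nonneg g0 C4) auto
      also have "\<dots> = sqrt (real n) * (C1 * C3 / c) * mr n * (\<Sum>i'<m n. g (ndist i i'))" by (simp only: sum_distrib_left)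
      also have "\<dots> \<le> sqrt (real n) * (C1 * C3 / c) * mr n * (2 * (1 + ln (mr n)))"
        using sn C4 by (intro mult_left_mono gsum i mult_nonneg_nonneg) auto
      finally have o: "(\<Sum>i'\<in>{..<m n} - {i}. B i i') \<le> 2 * (C1 * C3 / c) * sqrt (real n) * (mr n * (1 + ln (mr n)))"
        by (simp add: mult_ac)
      have o0: "0 \<le> (\<Sum>i'\<in>{..<m n} - {i}. B i i')" by (intro sum_nonneg B0)
      have "1 * 1 \<le> mr n * (1 + ln (mr n))" using m1 L0 by (intro mult_mono) auto
      then have "C2 * sqrt (real n) * 1 \<le> C2 * sqrt (real n) * (mr n * (1 + ln (mr n)))" using C2(1) sn by (intro mult_left_mono) auto
      with Bd[OF i] o o0 sp show ?thesis by (simp add: C_def distrib_right)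
    qed
    have "frob n - mr n * S = (\<Sum>i<m n. (\<Sum>i'<m n. B i i') - S)" by (simp add: frob sum_subtractf)
    then have "\<bar>frob n - mr n * S\<bar> \<le> (\<Sum>i<m n. \<bar>(\<Sum>i'<m n. B i i') - S\<bar>)" by (simp only: sum_abs)
    also have "\<dots> \<le> (\<Sum>i<m n. C * sqrt (real n) * (mr n * (1 + ln (mr n))))" by (intro sum_mono row) simp
    finally have A: "\<bar>frob n - mr n * S\<bar> \<le> mr n * (C * sqrt (real n) * (mr n * (1 + ln (mr n))))" by simp
    have "frob n / (real n * mr n) - S / real n = (frob n - mr n * S) / (real n * mr n)" using n m1 by (simp add: field_simps)
    then have "\<bar>frob n / (real n * mr n) - S / real n\<bar> = \<bar>frob n - mr n * S\<bar> / (real n * mr n)" by simp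
    also have "\<dots> \<le> mr n * (C * sqrt (real n) * (mr n * (1 + ln (mr n)))) / (real n * mr n)" by (intro divide_right_mono A) simp
    also have "\<dots> = (sqrt (real n) / real n) * C * (mr n * (1 + ln (mr n)))" using m1 by simp
    also have "sqrt (real n) / real n = 1 / sqrt (real n)" by (simp add: sqrt_divide_self_eq inverse_eq_divide)
    finally show ?thesis by (simp add: S_def)
  qed
  then show ?thesis using C2(1) C4 by (intro exI[of _ C]) (auto simp: C_def)
qed

text \<open>The growth condition on the number of spatial points enters here: an exponent below 1 /
  2 beats sqrt n even with the logarithm.\<close>

lemma m_growth: "(\<lambda>n. mr n * (1 + ln (mr n)) / sqrt (real n)) \<longlonglongrightarrow> 0"
proof -
  have "\<exists>K \<rho>. K \<ge> 1 \<and> 0 < \<rho> \<and> \<rho> < 1 / 2 \<and> (\<forall>\<^sub>F n in sequentially. mr n \<le> K * real n powr \<rho>)"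
  proof -
    consider m0 where "\<And>n. n \<ge> 1 \<Longrightarrow> m n = m0" | \<rho> where "0 < \<rho>" "\<rho> < 1 / 2" "(\<lambda>n. mr n) \<in> O(\<lambda>n. real n powr \<rho>)"
      using scheme unfolding observation_scheme_def by blast
    then show ?thesis
    proof cases
      case 1
      have "m0 \<ge> 1" using 1[of 1] m_pos[of 1] by simp
      \<comment> \<open>A constant number of points is subsumed under polynomial growth; 1 / 4 is an
        arbitrary exponent between 0 and 1 / 2.\<close>
      moreover have "\<forall>\<^sub>F n in sequentially. mr n \<le> real m0 * real n powr (1 / 4)" using eventually_ge_at_top[of 1]
      proof eventually_elim
        case (elim n)
        have "1 \<le> real n powr (1 / 4)" using elim by (intro ge_one_powr_ge_zero) auto
        then have "real m0 * 1 \<le> real m0 * real n powr (1 / 4)" by (intro mult_left_mono) auto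
        then show ?case using 1[OF elim] by simp
      qed
      ultimately show ?thesis by (intro exI[of _ "real m0"] exI[of _ "1 / 4"]) auto
    next
      case 2
      obtain K where K: "K > 0" "\<forall>\<^sub>F n in sequentially. norm (mr n) \<le> K * norm (real n powr \<rho>)"
        using landau_o.bigE[OF 2(3)] by blast
      from K(2) have "\<forall>\<^sub>F n in sequentially. mr n \<le> max 1 K * real n powr \<rho>"
      proof eventually_elim
        case (elim n)
        have "K * real n powr \<rho> \<le> max 1 K * real n powr \<rho>" by (intro mult_right_mono) auto
        with elim show ?case by simp
      qed
      then show ?thesis using 2 by (intro exI[of _ "max 1 K"] exI[of _ \<rho>]) auto
    qed
  qed
  then obtain K \<rho> where K: "K \<ge> 1" and \<rho>: "0 < \<rho>" "\<rho> < 1 / 2" and ev: "\<forall>\<^sub>F n in sequentially. mr n \<le> K * real n powr \<rho>" by blast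
  have lim: "(\<lambda>n. K * real n powr \<rho> * (1 + ln (K * real n powr \<rho>)) / sqrt (real n)) \<longlonglongrightarrow> 0"
    using K \<rho> by real_asymp
  show ?thesis
  proof (rule tendsto_sandwich[OF _ _ tendsto_const lim])
    show "\<forall>\<^sub>F n in sequentially. 0 \<le> mr n * (1 + ln (mr n)) / sqrt (real n)" using eventually_ge_at_top[of 1]
    proof eventually_elim
      case (elim n)
      have "0 \<le> ln (mr n)" using m_pos[OF elim] by simp
      then show ?case by (intro divide_nonneg_nonneg mult_nonneg_nonneg) auto
    qed
    show "\<forall>\<^sub>F n in sequentially. mr n * (1 + ln (mr n)) / sqrt (real n) \<le> K * real n powr \<rho> * (1 + ln (K * real n powr \<rho>)) / sqrt (real n)"
      using ev eventually_ge_at_top[of 1]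
    proof eventually_elim
      case (elim n)
      have m1: "1 \<le> mr n" using m_pos[OF elim(2)] by simp
      then have "0 \<le> ln (mr n)" by simp
      moreover have "ln (mr n) \<le> ln (K * real n powr \<rho>)" using elim(1) m1 by simp
      ultimately show ?case using elim(1) m1 by (intro divide_right_mono mult_mono) auto
    qed
  qed
qed

lemma m_over_sqrt: "(\<lambda>n. sqrt (mr n) / sqrt (real n)) \<longlonglongrightarrow> 0"
proof (rule tendsto_sandwich[OF _ _ tendsto_const m_growth])
  show "\<forall>\<^sub>F n in sequentially. 0 \<le> sqrt (mr n) / sqrt (real n)" by simp
  show "\<forall>\<^sub>F n in sequentially. sqrt (mr n) / sqrt (real n) \<le> mr n * (1 + ln (mr n)) / sqrt (real n)"
    using eventually_ge_at_top[of 1]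
  proof eventually_elim
    case (elim n)
    have m1: "1 \<le> mr n" using m_pos[OF elim] by simp
    have "sqrt (mr n) \<le> sqrt ((mr n)\<^sup>2)" using m1 by (intro real_sqrt_le_mono) (simp add: power2_eq_square)
    then have "sqrt (mr n) \<le> mr n * 1" by simp
    also have "\<dots> \<le> mr n * (1 + ln (mr n))" using m1 by (intro mult_left_mono) auto
    finally show ?case by (intro divide_right_mono) auto
  qed
qed

lemma frob_tendsto: "(\<lambda>n. frob n / (real n * mr n)) \<longlonglongrightarrow> pi * Gamma_const / 2"
proof -
  obtain C where C: "C \<ge> 0" "\<And>n. n \<ge> 1 \<Longrightarrow> \<bar>frob n / (real n * mr n) - AA_frob n / real n\<bar>
     \<le> C * (mr n * (1 + ln (mr n)) / sqrt (real n))" using frob_bound by blast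
  have "(\<lambda>n. frob n / (real n * mr n) - AA_frob n / real n) \<longlonglongrightarrow> 0"
  proof (rule Lim_null_comparison)
    show "\<forall>\<^sub>F n in sequentially. norm (frob n / (real n * mr n) - AA_frob n / real n)
       \<le> C * (mr n * (1 + ln (mr n)) / sqrt (real n))"
      using eventually_ge_at_top[of 1] by eventually_elim (simp only: real_norm_def C(2))
    show "(\<lambda>n. C * (mr n * (1 + ln (mr n)) / sqrt (real n))) \<longlonglongrightarrow> 0"
      using tendsto_mult_left[OF m_growth, of C] by (simp only: mult_zero_right)
  qed
  from tendsto_add[OF this AA_frobenius_tendsto] show ?thesis by simp
qed

text \<open>The second bound follows from the first since c^2 - 1 = (c + 1) (c - 1) and the
  variances c are bounded by the row sums.\<close>

lemma diag_bounds:
  "\<exists>C\<ge>0. \<forall>n\<ge>1. diag_err n \<le> C * mr n \<and> diag_sq_err n \<le> C * mr n"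
proof -
  obtain \<delta> where \<delta>: "\<delta> > 0" "\<And>n j. n \<ge> 1 \<Longrightarrow> 1 \<le> j \<and> j \<le> m n \<Longrightarrow> \<delta> \<le> y n j \<and> y n j \<le> 1 - \<delta>" using y_range by blast
  obtain C1 where C1: "C1 \<ge> 0" "\<And>n a y y'. n \<ge> 1 \<Longrightarrow> a < n \<Longrightarrow> (\<Sum>a'<n. \<bar>CC n a a' y (y' a')\<bar>) \<le> C1" using CC_row_sum by metis
  obtain C2 where C2: "C2 \<ge> 0" "\<And>n y. n \<ge> 1 \<Longrightarrow> \<delta> \<le> y \<and> y \<le> 1 - \<delta> \<Longrightarrow> (\<Sum>a<n. \<bar>CC n a a y y - 1\<bar>) \<le> C2"
    using CC_diag[OF \<delta>(1)] by blast
  have 1: "diag_err n \<le> C2 * mr n" if n: "n \<ge> 1" for n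
  proof -
    have "diag_err n = (\<Sum>j=1..m n. \<Sum>a<n. \<bar>CC n a a (y n j) (y n j) - 1\<bar>)"
      unfolding diag_err_def sum_grid cov_def fst_conv snd_conv by (rule sum.swap)
    also have "\<dots> \<le> (\<Sum>j=1..m n. C2)" by (intro sum_mono C2(2) n \<delta>(2)) auto
    finally show ?thesis by (simp add: mult.commute)
  qed
  have 2: "diag_sq_err n \<le> (C1 + 1) * C2 * mr n" if n: "n \<ge> 1" for n
  proof -
    have "diag_sq_err n \<le> (\<Sum>p\<in>grid n. (C1 + 1) * \<bar>cov n p p - 1\<bar>)" unfolding diag_sq_err_def
    proof (rule sum_mono)
      fix p assume "p \<in> grid n"
      then have a: "fst p < n" by (auto simp: grid_def)
      have "\<bar>cov n p p\<bar> \<le> C1" unfolding cov_def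
        using order_trans[OF member_le_row[OF a, of "\<lambda>a'. CC n (fst p) a' (y n (snd p)) (y n (snd p))"] C1(2)[OF n a]] .
      then have b: "\<bar>cov n p p + 1\<bar> \<le> C1 + 1" by linarith
      have "(cov n p p)\<^sup>2 - 1 = (cov n p p + 1) * (cov n p p - 1)" by (simp add: power2_eq_square algebra_simps)
      then show "\<bar>(cov n p p)\<^sup>2 - 1\<bar> \<le> (C1 + 1) * \<bar>cov n p p - 1\<bar>" using b by (simp add: abs_mult mult_right_mono)
    qed
    also have "\<dots> = (C1 + 1) * diag_err n" by (simp only: diag_err_def sum_distrib_left)
    also have "\<dots> \<le> (C1 + 1) * (C2 * mr n)" using C1(1) by (intro mult_left_mono 1 n) auto
    finally show ?thesis by (simp only: mult.assoc)
  qed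
  show ?thesis
  proof (intro exI[of _ "(C1 + 1) * C2"] conjI allI impI 2)
    show "0 \<le> (C1 + 1) * C2" using C1 C2 by simp
    fix n :: nat assume n: "n \<ge> 1"
    have "C2 * 1 \<le> C2 * (C1 + 1)" using C1(1) C2(1) by (intro mult_left_mono) auto
    then have "C2 * mr n \<le> (C1 + 1) * C2 * mr n" by (intro mult_right_mono) (auto simp: mult.commute)
    with 1[OF n] show "diag_err n \<le> (C1 + 1) * C2 * mr n" by linarith
  qed
qed

end

section \<open>Limits of the quarticity estimator and of the studentised volatility
  estimator\<close>

lemma (in prob_space) prob_gt_le_nn_integral:
  fixes Z :: "'a \<Rightarrow> real"
  assumes [measurable]: "Z \<in> borel_measurable M" and d: "d > 0" and B: "B \<ge> 0"
    and le: "(\<integral>\<^sup>+w. ennreal \<bar>Z w\<bar> \<partial>M) \<le> ennreal B"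
  shows "measure M {w \<in> space M. \<bar>Z w\<bar> > d} \<le> B / d"
proof -
  have "ennreal (measure M {w \<in> space M. \<bar>Z w\<bar> > d}) = emeasure M {w \<in> space M. \<bar>Z w\<bar> > d}" by (simp add: emeasure_eq_measure)
  also have "\<dots> \<le> emeasure M {w \<in> space M. 1 \<le> ennreal (1 / d) * ennreal \<bar>Z w\<bar>}"
  proof (intro emeasure_mono Collect_mono conj_mono impI)
    fix w assume "d < \<bar>Z w\<bar>"
    then have "1 \<le> 1 / d * \<bar>Z w\<bar>" using d by (simp add: field_simps)
    then have "ennreal 1 \<le> ennreal (1 / d * \<bar>Z w\<bar>)" by (rule ennreal_leI)
    also have "\<dots> = ennreal (1 / d) * ennreal \<bar>Z w\<bar>" using d by (intro ennreal_mult) auto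
    finally show "1 \<le> ennreal (1 / d) * ennreal \<bar>Z w\<bar>" by (simp only: ennreal_1)
  qed auto
  also have "\<dots> \<le> ennreal (1 / d) * (\<integral>\<^sup>+w. ennreal \<bar>Z w\<bar> * indicator (space M) w \<partial>M)"
    by (rule nn_integral_Markov_inequality) measurable
  also have "(\<integral>\<^sup>+w. ennreal \<bar>Z w\<bar> * indicator (space M) w \<partial>M) = (\<integral>\<^sup>+w. ennreal \<bar>Z w\<bar> \<partial>M)"
    by (rule nn_integral_cong) (simp only: indicator_simps mult_1_right)
  also have "ennreal (1 / d) * (\<integral>\<^sup>+w. ennreal \<bar>Z w\<bar> \<partial>M) \<le> ennreal (1 / d) * ennreal B" by (intro mult_left_mono le) simp
  also have "\<dots> = ennreal (B / d)" using d B by (simp flip: ennreal_mult)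
  finally show ?thesis using d B by (simp add: ennreal_le_iff)
qed

text \<open>Slutsky's argument for characteristic functions: where D is within eta of 1 the
  exponents differ by at most |t| eta |T|, and elsewhere the integrand is at most 2.\<close>

lemma (in prob_space) norm_char_diff_le:
  fixes T D :: "'a \<Rightarrow> real"
  assumes [measurable]: "T \<in> borel_measurable M" "D \<in> borel_measurable M" and \<eta>: "\<eta> \<ge> 0" and B: "B \<ge> 0"
    and le: "(\<integral>\<^sup>+w. ennreal \<bar>T w\<bar> \<partial>M) \<le> ennreal B"
  shows "norm ((\<integral>w. iexp (t * (D w * T w)) \<partial>M) - (\<integral>w. iexp (t * T w) \<partial>M))
    \<le> \<bar>t\<bar> * \<eta> * B + 2 * measure M {w \<in> space M. \<bar>D w - 1\<bar> > \<eta>}"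
proof -
  define S where "S = {w \<in> space M. \<bar>D w - 1\<bar> > \<eta>}"
  have S[measurable]: "S \<in> sets M" unfolding S_def by measurable
  have iT: "integrable M T" by (rule integrableI_bounded) (use le in \<open>auto intro: order_le_less_trans\<close>)
  have eT: "(\<integral>w. \<bar>T w\<bar> \<partial>M) \<le> B" using le B nn_integral_eq_integral[OF integrable_abs[OF iT]] by simp
  have ie: "integrable M (\<lambda>w. iexp (f w))" if "f \<in> borel_measurable M" for f :: "'a \<Rightarrow> real"
    using that by (intro integrable_const_bound[where B = 1]) auto
  have m1: "(\<lambda>w. t * (D w * T w)) \<in> borel_measurable M" and m2: "(\<lambda>w. t * T w) \<in> borel_measurable M" by measurable
  have "norm ((\<integral>w. iexp (t * (D w * T w)) \<partial>M) - (\<integral>w. iexp (t * T w) \<partial>M))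
      = norm (\<integral>w. iexp (t * (D w * T w)) - iexp (t * T w) \<partial>M)"
    by (simp only: Bochner_Integration.integral_diff[OF ie[OF m1] ie[OF m2]])
  also have "\<dots> \<le> (\<integral>w. norm (iexp (t * (D w * T w)) - iexp (t * T w)) \<partial>M)" by (rule integral_norm_bound)
  also have "\<dots> \<le> (\<integral>w. \<bar>t\<bar> * \<eta> * \<bar>T w\<bar> + 2 * indicator S w \<partial>M)"
  proof (intro integral_mono Bochner_Integration.integrable_add integrable_mult_right integrable_abs iT integrable_norm Bochner_Integration.integrable_diff ie m1 m2)
    show "integrable M (indicator S :: 'a \<Rightarrow> real)" by (simp add: emeasure_eq_measure integrable_real_indicator)
    fix w assume sp: "w \<in> space M"
    show "norm (iexp (t * (D w * T w)) - iexp (t * T w)) \<le> \<bar>t\<bar> * \<eta> * \<bar>T w\<bar> + 2 * indicator S w"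
    proof (cases "w \<in> S")
      case True
      have "norm (iexp (t * (D w * T w)) - iexp (t * T w)) \<le> norm (iexp (t * (D w * T w))) + norm (iexp (t * T w))" by (rule norm_triangle_ineq4)
      also have "\<dots> = 2" by (simp only: norm_exp_i_times one_add_one)
      also have "2 \<le> \<bar>t\<bar> * \<eta> * \<bar>T w\<bar> + 2 * indicator S w" using True \<eta> by simp
      finally show ?thesis .
    next
      case False
      then have D: "\<bar>D w - 1\<bar> \<le> \<eta>" using sp by (auto simp: S_def)
      have "norm (iexp (t * (D w * T w)) - iexp (t * T w)) \<le> \<bar>t * (D w * T w) - t * T w\<bar>" by (rule norm_iexp_diff_le)
      also have "t * (D w * T w) - t * T w = t * (D w - 1) * T w" by (simp add: algebra_simps)
      also have "\<bar>t * (D w - 1) * T w\<bar> \<le> \<bar>t\<bar> * \<eta> * \<bar>T w\<bar>" unfolding abs_mult using D by (intro mult_right_mono mult_left_mono) auto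
      finally show ?thesis using False by simp
    qed
  qed measurable
  also have "\<dots> = \<bar>t\<bar> * \<eta> * (\<integral>w. \<bar>T w\<bar> \<partial>M) + 2 * measure M S"
    using iT by (subst Bochner_Integration.integral_add) (auto simp: emeasure_eq_measure integrable_real_indicator)
  also have "\<dots> \<le> \<bar>t\<bar> * \<eta> * B + 2 * measure M S" using \<eta> by (intro add_right_mono mult_left_mono eT) auto
  finally show ?thesis unfolding S_def .
qed

context spde_observation
begin

definition N :: "nat \<Rightarrow> real" where "N n = real n * mr n"
definition clt_stat :: "nat \<Rightarrow> 'w \<Rightarrow> real" where "clt_stat n w = (\<Sum>p\<in>grid n. (V n p w)\<^sup>2 - 1) / sqrt (N n)"
text \<open>The quarticity estimator divided by sigma^4, see \<open>quarticity_eq\<close>; 3 is the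
  fourth moment of a standard normal.\<close>

definition rel_quarticity :: "nat \<Rightarrow> 'w \<Rightarrow> real" where "rel_quarticity n w = (\<Sum>p\<in>grid n. V n p w ^ 4) / (3 * N n)"

abbreviation char_err :: "nat \<Rightarrow> real \<Rightarrow> real" where
  "char_err n t \<equiv> norm ((\<integral>w. iexp (t * clt_stat n w) \<partial>M) - of_real (exp (- t\<^sup>2 * (frob n / N n))))"

lemma N_pos: "n \<ge> 1 \<Longrightarrow> N n > 0" using m_pos[of n] by (simp add: N_def)

lemma V_measurable:
  assumes n: "n \<ge> 1" and p: "p \<in> grid n" shows "V n p \<in> borel_measurable M"
proof -
  obtain \<delta> where \<delta>: "\<delta> > 0" "\<And>n j. n \<ge> 1 \<Longrightarrow> 1 \<le> j \<and> j \<le> m n \<Longrightarrow> \<delta> \<le> y n j \<and> y n j \<le> 1 - \<delta>" using y_range by blast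
  have y: "y n (snd p) \<in> {0..1}" using \<delta>(2)[OF n, of "snd p"] p \<delta>(1) by (auto simp: grid_def)
  have X: "X t z \<in> borel_measurable M" if "t \<ge> 0" "z \<in> {0..1}" for t z
    using sol that unfolding continuous_mild_solution_def by blast
  show ?thesis unfolding V_def[abs_def] increment_def
    by (intro borel_measurable_times borel_measurable_diff borel_measurable_const X y) auto
qed

lemma clt_stat_measurable: assumes n: "n \<ge> 1" shows "clt_stat n \<in> borel_measurable M"
proof -
  note V_measurable[OF n, measurable]
  show ?thesis unfolding clt_stat_def[abs_def] by measurable
qed

lemma rel_quarticity_measurable: assumes n: "n \<ge> 1" shows "rel_quarticity n \<in> borel_measurable M"
proof -
  note V_measurable[OF n, measurable]
  show ?thesis unfolding rel_quarticity_def[abs_def] by measurable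
qed

lemma scale_sq: "(scale n)\<^sup>2 = sqrt (pi * \<theta>2) * sqrt (real n) / \<sigma>\<^sup>2"
proof -
  have "pi / (pi\<^sup>2 * \<theta>2) = 1 / (pi * \<theta>2)" by (simp add: power2_eq_square)
  then have "Nn n = sqrt (pi * \<theta>2) * sqrt (real n)" unfolding Nn_def heat_c_def using theta2_pos by (simp add: real_sqrt_divide)
  then show ?thesis using Nn_nonneg[of n] by (simp add: scale_def power_divide)
qed

lemma V_sq: "(V n (a, j) w)\<^sup>2 = sqrt (pi * \<theta>2) * sqrt (real n) / \<sigma>\<^sup>2 * ((increment X n (Suc a) (y n j) w)\<^sup>2 * exp (y n j * \<theta>1 / \<theta>2))"
proof -
  have e: "exp (y n j * \<theta>1 / \<theta>2) = (exp (y n j * \<theta>1 / (2 * \<theta>2)))\<^sup>2"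
    unfolding exp_double[symmetric] by (simp add: field_simps)
  show ?thesis unfolding scale_sq[symmetric] e by (simp add: V_def power_mult_distrib mult_ac)
qed

lemma V_pow4: "V n (a, j) w ^ 4 = pi * \<theta>2 * real n / \<sigma> ^ 4 * ((increment X n (Suc a) (y n j) w) ^ 4 * exp (2 * y n j * \<theta>1 / \<theta>2))"
proof -
  have p4: "x ^ 4 = (x\<^sup>2)\<^sup>2" for x :: real by (simp flip: power_mult)
  have e: "(exp (y n j * \<theta>1 / \<theta>2))\<^sup>2 = exp (2 * y n j * \<theta>1 / \<theta>2)"
    unfolding exp_double[symmetric] by (simp add: field_simps)
  have s: "(sqrt (pi * \<theta>2))\<^sup>2 * (sqrt (real n))\<^sup>2 = pi * \<theta>2 * real n" using theta2_pos by simp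
  show ?thesis unfolding p4[of "V n (a, j) w"] V_sq power_mult_distrib power_divide e s unfolding p4 ..
qed

lemma sum_observations: "(\<Sum>j=1..m n. \<Sum>i=1..n. f i j) = (\<Sum>p\<in>grid n. f (Suc (fst p)) (snd p))" for f :: "nat \<Rightarrow> nat \<Rightarrow> real"
proof -
  have "(\<Sum>j=1..m n. \<Sum>i=1..n. f i j) = (\<Sum>j=1..m n. \<Sum>a<n. f (Suc a) j)" by (simp only: sum_1_upto)
  also have "\<dots> = (\<Sum>p\<in>grid n. f (Suc (fst p)) (snd p))" unfolding sum_grid fst_conv snd_conv by (rule sum.swap)
  finally show ?thesis .
qed

lemma quarticity_eq:
  assumes n: "n \<ge> 1"
  shows "quarticity_estimator \<theta>1 \<theta>2 X m y n w = \<sigma> ^ 4 * rel_quarticity n w"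
proof -
  let ?S = "\<Sum>p\<in>grid n. (increment X n (Suc (fst p)) (y n (snd p)) w) ^ 4 * exp (2 * y n (snd p) * \<theta>1 / \<theta>2)"
  have "V n p w ^ 4 = pi * \<theta>2 * real n / \<sigma> ^ 4 * ((increment X n (Suc (fst p)) (y n (snd p)) w) ^ 4 * exp (2 * y n (snd p) * \<theta>1 / \<theta>2))" for p
    using V_pow4[of n "fst p" "snd p" w] by simp
  then have "rel_quarticity n w = pi * \<theta>2 * real n / \<sigma> ^ 4 * ?S / (3 * N n)"
    unfolding rel_quarticity_def by (simp only: sum_distrib_left)
  then show ?thesis unfolding quarticity_estimator_def sum_observations N_def using n sigma_pos m_pos[OF n] by (simp add: mult_ac)
qed

lemma volatility_eq:
  assumes n: "n \<ge> 1"
  shows "sqrt (N n) * (volatility_estimator \<theta>1 \<theta>2 X m y n w - \<sigma>\<^sup>2) = \<sigma>\<^sup>2 * clt_stat n w"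
proof -
  let ?S = "\<Sum>p\<in>grid n. (increment X n (Suc (fst p)) (y n (snd p)) w)\<^sup>2 * exp (y n (snd p) * \<theta>1 / \<theta>2)"
  have "(V n p w)\<^sup>2 = sqrt (pi * \<theta>2) * sqrt (real n) / \<sigma>\<^sup>2 * ((increment X n (Suc (fst p)) (y n (snd p)) w)\<^sup>2 * exp (y n (snd p) * \<theta>1 / \<theta>2))" for p
    using V_sq[of n "fst p" "snd p" w] by simp
  then have V: "(\<Sum>p\<in>grid n. (V n p w)\<^sup>2) = sqrt (pi * \<theta>2) * sqrt (real n) / \<sigma>\<^sup>2 * ?S" by (simp only: sum_distrib_left)
  have "volatility_estimator \<theta>1 \<theta>2 X m y n w = sqrt (pi * \<theta>2) * sqrt (real n) / N n * ?S"
    unfolding volatility_estimator_def sum_observations N_def using n by (simp add: real_sqrt_divide mult_ac)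
  also have "\<dots> = \<sigma>\<^sup>2 * (\<Sum>p\<in>grid n. (V n p w)\<^sup>2) / N n" unfolding V using sigma_pos by simp
  finally have v: "volatility_estimator \<theta>1 \<theta>2 X m y n w - \<sigma>\<^sup>2 = \<sigma>\<^sup>2 * ((\<Sum>p\<in>grid n. (V n p w)\<^sup>2) - N n) / N n"
    using N_pos[OF n] by (simp add: field_simps)
  have "(\<Sum>p\<in>grid n. (V n p w)\<^sup>2 - 1) = (\<Sum>p\<in>grid n. (V n p w)\<^sup>2) - N n"
    by (simp add: sum_subtractf card_grid N_def)
  moreover have "sqrt (N n) / N n = 1 / sqrt (N n)" using N_pos[OF n] by (simp add: sqrt_divide_self_eq inverse_eq_divide)
  moreover have "sqrt (N n) * (\<sigma>\<^sup>2 * z / N n) = \<sigma>\<^sup>2 * (z * (sqrt (N n) / N n))" for z by simp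
  ultimately show ?thesis unfolding v clt_stat_def by simp
qed

text \<open>Collects all errors in one null sequence. The parameter eps stays free, because its
  factor (1 + 1 / eps)^2 explodes as eps tends to 0; it is fixed before n grows.\<close>

lemma asymptotic_bounds:
  obtains r :: "nat \<Rightarrow> real" where "r \<longlonglongrightarrow> 0"
    "\<And>n. n \<ge> 1 \<Longrightarrow> r n \<ge> 0"
    "\<And>n t. n \<ge> 1 \<Longrightarrow> char_err n t \<le> (t\<^sup>2 + \<bar>t\<bar>) * r n"
    "\<And>n. n \<ge> 1 \<Longrightarrow> (\<integral>\<^sup>+w. ennreal \<bar>clt_stat n w\<bar> \<partial>M) \<le> ennreal (sqrt (2 * (frob n / N n)) + r n)"
    "\<And>n \<epsilon>. n \<ge> 1 \<Longrightarrow> 0 < \<epsilon> \<Longrightarrow> \<epsilon> \<le> 1 \<Longrightarrow> (\<integral>\<^sup>+w. ennreal (sqrt \<bar>rel_quarticity n w - 1\<bar>) \<partial>M)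
        \<le> ennreal (sqrt (15 * \<epsilon>) + (1 + (1 + 1 / \<epsilon>)\<^sup>2) * r n)"
proof -
  obtain C where C: "C \<ge> 0" and lb: "\<And>n. n \<ge> 1 \<Longrightarrow> clt_bounds M (grid n) (V n) (frob n) ((C * mr n)\<^sup>2 * frob n)
     (diag_err n + C * mr n) (C * frob n)
     (diag_sq_err n / real (card (grid n))) (C * mr n)" using level_bounds by blast
  obtain C' where C': "C' \<ge> 0" and db: "\<And>n. n \<ge> 1 \<Longrightarrow> diag_err n \<le> C' * mr n"
      "\<And>n. n \<ge> 1 \<Longrightarrow> diag_sq_err n \<le> C' * mr n" using diag_bounds by blast
  define \<phi> where "\<phi> n = frob n / N n" for n
  define \<mu> where "\<mu> n = sqrt (mr n) / sqrt (real n)" for n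
  have \<phi>: "\<phi> \<longlonglongrightarrow> pi * Gamma_const / 2" unfolding \<phi>_def[abs_def] N_def by (rule frob_tendsto)
  have \<mu>: "\<mu> \<longlonglongrightarrow> 0" unfolding \<mu>_def[abs_def] by (rule m_over_sqrt)
  have frob0: "0 \<le> frob n" for n unfolding frob_def by (intro sum_nonneg) auto
  define s where "s n = 1 / sqrt (real n)" for n
  have s: "s \<longlonglongrightarrow> 0" unfolding s_def[abs_def] by real_asymp
  \<comment> \<open>The summands are, in this order: the trace of C^4; variance bias, cross term and
    squares of the initial value; fluctuation of the fourth powers; their bias; the initial value in
    the quarticity. Here \<open>\<mu> n\<close> is sqrt (m / n), and \<open>s n\<close> bounds 1 /
    sqrt (N n).\<close>
  define r where "r n = 2 * C * sqrt (2 * \<phi> n) * \<mu> n + (C + C') * \<mu> n + 4 * sqrt (sqrt (C * \<phi> n) * s n) + 4 * (sqrt C' * s n) + C * \<mu> n" for n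
  have rl: "r \<longlonglongrightarrow> 0"
  proof -
    have "r \<longlonglongrightarrow> 2 * C * sqrt (2 * (pi * Gamma_const / 2)) * 0 + (C + C') * 0 + 4 * sqrt (sqrt (C * (pi * Gamma_const / 2)) * 0) + 4 * (sqrt C' * 0) + C * 0"
      unfolding r_def[abs_def] by (intro tendsto_add tendsto_mult tendsto_real_sqrt tendsto_const \<phi> \<mu> s)
    then show ?thesis by simp
  qed
  have bounds: "char_err n t \<le> (t\<^sup>2 + \<bar>t\<bar>) * r n"
    "(\<integral>\<^sup>+w. ennreal \<bar>clt_stat n w\<bar> \<partial>M) \<le> ennreal (sqrt (2 * (frob n / N n)) + r n)"
    "0 < \<epsilon> \<Longrightarrow> \<epsilon> \<le> 1 \<Longrightarrow> (\<integral>\<^sup>+w. ennreal (sqrt \<bar>rel_quarticity n w - 1\<bar>) \<partial>M) \<le> ennreal (sqrt (15 * \<epsilon>) + (1 + (1 + 1 / \<epsilon>)\<^sup>2) * r n)"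
    "r n \<ge> 0"
    if n: "n \<ge> 1" for n t \<epsilon>
  proof -
    have Np: "N n > 0" using N_pos[OF n] .
    define iN where "iN = 1 / sqrt (N n)"
    have iN: "iN > 0" "iN\<^sup>2 = 1 / N n" using Np by (simp_all add: iN_def power_divide)
    have m1: "1 \<le> mr n" using m_pos[OF n] by simp
    have n0: "real n > 0" using n by simp
    have \<mu>0: "0 \<le> \<mu> n" by (simp add: \<mu>_def)
    have \<phi>0: "0 \<le> \<phi> n" using frob0[of n] Np by (simp add: \<phi>_def)
    have s0: "0 \<le> s n" by (simp add: s_def)
    have mw: "mr n * iN = \<mu> n"
    proof -
      have "mr n * iN = (mr n / sqrt (mr n)) / sqrt (real n)" by (simp add: iN_def N_def real_sqrt_mult mult.commute)
      also have "mr n / sqrt (mr n) = sqrt (mr n)" by (simp add: real_div_sqrt)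
      finally show ?thesis unfolding \<mu>_def .
    qed
    have ws: "iN \<le> s n"
    proof -
      have "real n * 1 \<le> N n" unfolding N_def using m1 n0 by (intro mult_left_mono) auto
      then show ?thesis unfolding iN_def s_def using n0 Np by (intro divide_left_mono real_sqrt_le_mono mult_pos_pos) auto
    qed
    have card: "real (card (grid n)) = N n" by (simp add: card_grid N_def)
    define L where "L = diag_err n + C * mr n"
    have Lw: "iN * L \<le> (C + C') * \<mu> n"
    proof -
      have "iN * L \<le> iN * ((C + C') * mr n)" unfolding L_def using db(1)[OF n] iN(1) by (intro mult_left_mono) (auto simp: distrib_right)
      also have "\<dots> = (C + C') * (mr n * iN)" by (simp only: mult_ac)
      finally show ?thesis unfolding mw .
    qed
    have r1: "2 * C * sqrt (2 * \<phi> n) * \<mu> n \<ge> 0" "(C + C') * \<mu> n \<ge> 0" "4 * sqrt (sqrt (C * \<phi> n) * s n) \<ge> 0" "4 * (sqrt C' * s n) \<ge> 0" "C * \<mu> n \<ge> 0"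
      using C C' \<mu>0 \<phi>0 s0 by simp_all
    show r0: "r n \<ge> 0" unfolding r_def using r1 by linarith
    have B: "\<And>t. norm ((\<integral>w. iexp (t * (\<Sum>p\<in>grid n. (V n p w)\<^sup>2 - 1)) \<partial>M) - of_real (exp (- t\<^sup>2 * frob n)))
          \<le> 2 * t\<^sup>2 * sqrt (2 * ((C * mr n)\<^sup>2 * frob n)) + \<bar>t\<bar> * L"
      "(\<integral>\<^sup>+w. ennreal \<bar>\<Sum>p\<in>grid n. (V n p w)\<^sup>2 - 1\<bar> \<partial>M) \<le> ennreal (sqrt (2 * frob n) + L)"
      "\<And>\<epsilon>. 0 < \<epsilon> \<and> \<epsilon> \<le> 1 \<Longrightarrow> (\<integral>\<^sup>+w. ennreal (sqrt \<bar>(\<Sum>p\<in>grid n. V n p w ^ 4) / (3 * N n) - 1\<bar>) \<partial>M) \<le>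
          ennreal (4 * sqrt (sqrt (C * frob n) / (3 * N n)) + 4 * sqrt (diag_sq_err n / N n) + sqrt (15 * \<epsilon>)
             + (1 + 1 / \<epsilon>)\<^sup>2 * (C * mr n / sqrt (3 * N n)))" using lb[OF n] unfolding clt_bounds_def L_def card by blast+
    have cs: "clt_stat n w = iN * (\<Sum>p\<in>grid n. (V n p w)\<^sup>2 - 1)" for w by (simp add: clt_stat_def iN_def)
    have sw: "iN * sqrt x = sqrt (x / N n)" for x by (simp add: iN_def real_sqrt_divide)
    show "char_err n t \<le> (t\<^sup>2 + \<bar>t\<bar>) * r n"
    proof -
      have e1: "t * clt_stat n w = (t * iN) * (\<Sum>p\<in>grid n. (V n p w)\<^sup>2 - 1)" for w by (simp only: cs mult.assoc)
      have e2: "- t\<^sup>2 * (frob n / N n) = - (t * iN)\<^sup>2 * frob n" by (simp add: power_mult_distrib iN(2))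
      have "char_err n t
          \<le> 2 * (t * iN)\<^sup>2 * sqrt (2 * ((C * mr n)\<^sup>2 * frob n)) + \<bar>t * iN\<bar> * L" unfolding e1 e2 by (rule B(1))
      also have "\<bar>t * iN\<bar> * L = \<bar>t\<bar> * (iN * L)" using iN(1) by (simp add: abs_mult)
      also have "2 * (t * iN)\<^sup>2 * sqrt (2 * ((C * mr n)\<^sup>2 * frob n)) = t\<^sup>2 * (2 * C * sqrt (2 * \<phi> n) * \<mu> n)"
      proof -
        have "sqrt (2 * ((C * mr n)\<^sup>2 * frob n)) = C * mr n * sqrt (2 * frob n)" using C by (simp add: real_sqrt_mult mult_ac)
        then have "2 * (t * iN)\<^sup>2 * sqrt (2 * ((C * mr n)\<^sup>2 * frob n)) = t\<^sup>2 * (2 * C * (iN * sqrt (2 * frob n)) * (mr n * iN))"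
          by (simp add: power2_eq_square mult_ac)
        then show ?thesis unfolding mw sw \<phi>_def by simp
      qed
      also have "t\<^sup>2 * (2 * C * sqrt (2 * \<phi> n) * \<mu> n) + \<bar>t\<bar> * (iN * L) \<le> t\<^sup>2 * r n + \<bar>t\<bar> * r n"
      proof (intro add_mono mult_left_mono)
        show "2 * C * sqrt (2 * \<phi> n) * \<mu> n \<le> r n" unfolding r_def using r1 by linarith
        show "iN * L \<le> r n" unfolding r_def using r1 Lw by linarith
      qed auto
      finally show ?thesis by (simp add: distrib_right)
    qed
    show "(\<integral>\<^sup>+w. ennreal \<bar>clt_stat n w\<bar> \<partial>M) \<le> ennreal (sqrt (2 * (frob n / N n)) + r n)"
    proof -
      note V_measurable[OF n, measurable]
      have "(\<integral>\<^sup>+w. ennreal \<bar>clt_stat n w\<bar> \<partial>M) = (\<integral>\<^sup>+w. ennreal iN * ennreal \<bar>\<Sum>p\<in>grid n. (V n p w)\<^sup>2 - 1\<bar> \<partial>M)"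
        unfolding cs abs_mult using iN(1) by (simp add: ennreal_mult)
      also have "\<dots> = ennreal iN * (\<integral>\<^sup>+w. ennreal \<bar>\<Sum>p\<in>grid n. (V n p w)\<^sup>2 - 1\<bar> \<partial>M)"
        by (rule nn_integral_cmult) measurable
      also have "\<dots> \<le> ennreal iN * ennreal (sqrt (2 * frob n) + L)" by (intro mult_left_mono B(2)) simp
      also have "\<dots> = ennreal (iN * (sqrt (2 * frob n) + L))" using iN(1) by (simp add: ennreal_mult')
      also have "\<dots> \<le> ennreal (sqrt (2 * (frob n / N n)) + r n)"
      proof (rule ennreal_leI)
        have "iN * L \<le> r n" unfolding r_def using r1 Lw by linarith
        then show "iN * (sqrt (2 * frob n) + L) \<le> sqrt (2 * (frob n / N n)) + r n" by (simp add: distrib_left sw)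
      qed
      finally show ?thesis .
    qed
    assume \<epsilon>: "0 < \<epsilon>" "\<epsilon> \<le> 1"
    have q1: "4 * sqrt (sqrt (C * frob n) / (3 * N n)) \<le> 4 * sqrt (sqrt (C * \<phi> n) * s n)"
    proof -
      have "sqrt (C * frob n) / (3 * N n) \<le> sqrt (C * frob n) / (1 * N n)" using Np C frob0[of n] by (intro divide_left_mono) auto
      also have "\<dots> = sqrt (C * frob n) * iN\<^sup>2" by (simp add: iN(2))
      also have "\<dots> = (iN * sqrt (C * frob n)) * iN" by (simp add: power2_eq_square)
      also have "\<dots> \<le> (iN * sqrt (C * frob n)) * s n" using ws iN(1) C frob0[of n] by (intro mult_left_mono) auto
      also have "iN * sqrt (C * frob n) = sqrt (C * \<phi> n)" by (simp add: sw \<phi>_def)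
      finally show ?thesis by (intro mult_left_mono real_sqrt_le_mono) auto
    qed
    have q2: "4 * sqrt (diag_sq_err n / N n) \<le> 4 * (sqrt C' * s n)"
    proof -
      have "diag_sq_err n / N n \<le> C' * mr n / N n" using Np by (intro divide_right_mono db(2) n) auto
      also have "\<dots> = C' / real n" using m1 by (simp add: N_def)
      finally have "sqrt (diag_sq_err n / N n) \<le> sqrt (C' / real n)" by (rule real_sqrt_le_mono)
      then show ?thesis by (simp add: s_def real_sqrt_divide)
    qed
    have q3: "C * mr n / sqrt (3 * N n) \<le> C * \<mu> n"
    proof -
      have "C * mr n / sqrt (3 * N n) \<le> C * mr n / sqrt (N n)"
        using Np C by (intro divide_left_mono real_sqrt_le_mono mult_pos_pos) auto
      also have "\<dots> = C * (mr n * iN)" by (simp add: iN_def)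
      finally show ?thesis unfolding mw .
    qed
    show "(\<integral>\<^sup>+w. ennreal (sqrt \<bar>rel_quarticity n w - 1\<bar>) \<partial>M) \<le> ennreal (sqrt (15 * \<epsilon>) + (1 + (1 + 1 / \<epsilon>)\<^sup>2) * r n)"
      unfolding rel_quarticity_def
    proof (rule order_trans[OF B(3)[OF conjI[OF \<epsilon>]] ennreal_leI])
      have "4 * sqrt (sqrt (C * frob n) / (3 * N n)) + 4 * sqrt (diag_sq_err n / N n) \<le> r n" unfolding r_def using q1 q2 r1 by linarith
      moreover have "(1 + 1 / \<epsilon>)\<^sup>2 * (C * mr n / sqrt (3 * N n)) \<le> (1 + 1 / \<epsilon>)\<^sup>2 * r n"
      proof (rule mult_left_mono)
        show "C * mr n / sqrt (3 * N n) \<le> r n" unfolding r_def using q3 r1 by linarith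
      qed simp
      ultimately show "4 * sqrt (sqrt (C * frob n) / (3 * N n)) + 4 * sqrt (diag_sq_err n / N n) + sqrt (15 * \<epsilon>)
             + (1 + 1 / \<epsilon>)\<^sup>2 * (C * mr n / sqrt (3 * N n)) \<le> sqrt (15 * \<epsilon>) + (1 + (1 + 1 / \<epsilon>)\<^sup>2) * r n"
        by (simp add: distrib_right)
    qed
  qed
  show ?thesis by (rule that[of r]) (use rl bounds in auto)
qed

text \<open>Markov's inequality for the square root of the error, the quantity for which a moment
  bound is available; eps is chosen first and n tends to infinity afterwards.\<close>

lemma rel_quarticity_converges:
  assumes d: "d > 0"
  shows "(\<lambda>n. measure M {w \<in> space M. \<bar>rel_quarticity n w - 1\<bar> > d}) \<longlonglongrightarrow> 0"
proof -
  obtain r :: "nat \<Rightarrow> real" where r: "r \<longlonglongrightarrow> 0" "\<And>n. n \<ge> 1 \<Longrightarrow> r n \<ge> 0" and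
    b: "\<And>n \<epsilon>. n \<ge> 1 \<Longrightarrow> 0 < \<epsilon> \<Longrightarrow> \<epsilon> \<le> 1 \<Longrightarrow> (\<integral>\<^sup>+w. ennreal (sqrt \<bar>rel_quarticity n w - 1\<bar>) \<partial>M)
        \<le> ennreal (sqrt (15 * \<epsilon>) + (1 + (1 + 1 / \<epsilon>)\<^sup>2) * r n)" by (rule asymptotic_bounds) blast
  have le: "measure M {w \<in> space M. \<bar>rel_quarticity n w - 1\<bar> > d} \<le> (sqrt (15 * \<epsilon>) + (1 + (1 + 1 / \<epsilon>)\<^sup>2) * r n) / sqrt d"
    if n: "n \<ge> 1" and \<epsilon>: "0 < \<epsilon>" "\<epsilon> \<le> 1" for n \<epsilon>
  proof -
    have "measure M {w \<in> space M. \<bar>sqrt \<bar>rel_quarticity n w - 1\<bar>\<bar> > sqrt d} \<le> (sqrt (15 * \<epsilon>) + (1 + (1 + 1 / \<epsilon>)\<^sup>2) * r n) / sqrt d"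
    proof (rule prob_gt_le_nn_integral)
      show "(\<lambda>w. sqrt \<bar>rel_quarticity n w - 1\<bar>) \<in> borel_measurable M" using rel_quarticity_measurable[OF n] by measurable
      show "0 \<le> sqrt (15 * \<epsilon>) + (1 + (1 + 1 / \<epsilon>)\<^sup>2) * r n" using r(2)[OF n] \<epsilon> by simp
    qed (use d b[OF n \<epsilon>] in auto)
    then show ?thesis by simp
  qed
  show ?thesis
  proof (rule order_tendstoI)
    fix a :: real assume "a < 0"
    then show "\<forall>\<^sub>F n in sequentially. a < measure M {w \<in> space M. \<bar>rel_quarticity n w - 1\<bar> > d}"
      by (intro always_eventually allI) (simp add: less_le_trans)
  next
    fix a :: real assume a: "0 < a"
    \<comment> \<open>The constant 60 = 15 * 4 makes sqrt (15 eps) at most half of a sqrt d.\<close>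
    define \<epsilon> where "\<epsilon> = min 1 ((a * sqrt d)\<^sup>2 / 60)"
    have \<epsilon>: "0 < \<epsilon>" "\<epsilon> \<le> 1" using a d by (auto simp: \<epsilon>_def)
    have "15 * \<epsilon> \<le> (a * sqrt d / 2)\<^sup>2" by (simp add: \<epsilon>_def power_divide min_def)
    then have "sqrt (15 * \<epsilon>) \<le> sqrt ((a * sqrt d / 2)\<^sup>2)" by (rule real_sqrt_le_mono)
    also have "sqrt ((a * sqrt d / 2)\<^sup>2) = a * sqrt d / 2" using a d by (intro real_sqrt_unique) auto
    finally have h: "sqrt (15 * \<epsilon>) \<le> a * sqrt d / 2" .
    have "(\<lambda>n. (sqrt (15 * \<epsilon>) + (1 + (1 + 1 / \<epsilon>)\<^sup>2) * r n) / sqrt d) \<longlonglongrightarrow> (sqrt (15 * \<epsilon>) + (1 + (1 + 1 / \<epsilon>)\<^sup>2) * 0) / sqrt d"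
      using d by (intro tendsto_divide tendsto_add tendsto_mult tendsto_const r(1)) auto
    moreover have "(sqrt (15 * \<epsilon>) + (1 + (1 + 1 / \<epsilon>)\<^sup>2) * 0) / sqrt d < a"
    proof -
      have "0 < a * sqrt d" using a d by simp
      then have "sqrt (15 * \<epsilon>) < a * sqrt d" using h by linarith
      then show ?thesis using d by (simp add: divide_less_eq)
    qed
    ultimately have "\<forall>\<^sub>F n in sequentially. (sqrt (15 * \<epsilon>) + (1 + (1 + 1 / \<epsilon>)\<^sup>2) * r n) / sqrt d < a" by (rule order_tendstoD(2))
    then show "\<forall>\<^sub>F n in sequentially. measure M {w \<in> space M. \<bar>rel_quarticity n w - 1\<bar> > d} < a"
      using eventually_ge_at_top[of 1]
    proof eventually_elim
      case (elim n)
      show ?case using le[OF elim(2) \<epsilon>] elim(1) by linarith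
    qed
  qed
qed

lemma quarticity_consistent: "converges_in_probability M (quarticity_estimator \<theta>1 \<theta>2 X m y) (\<sigma> ^ 4)"
  unfolding converges_in_probability_def
proof (intro allI impI)
  fix \<epsilon> :: real assume \<epsilon>: "\<epsilon> > 0"
  have s4: "\<sigma> ^ 4 > 0" using sigma_pos by simp
  have "\<epsilon> / \<sigma> ^ 4 > 0" using \<epsilon> s4 by simp
  from rel_quarticity_converges[OF this]
  show "(\<lambda>n. measure M {w \<in> space M. \<bar>quarticity_estimator \<theta>1 \<theta>2 X m y n w - \<sigma> ^ 4\<bar> > \<epsilon>}) \<longlonglongrightarrow> 0"
  proof (rule Lim_transform_eventually)
    show "\<forall>\<^sub>F n in sequentially. measure M {w \<in> space M. \<bar>rel_quarticity n w - 1\<bar> > \<epsilon> / \<sigma> ^ 4} =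
       measure M {w \<in> space M. \<bar>quarticity_estimator \<theta>1 \<theta>2 X m y n w - \<sigma> ^ 4\<bar> > \<epsilon>}"
      using eventually_ge_at_top[of 1]
    proof eventually_elim
      case (elim n)
      have "\<bar>quarticity_estimator \<theta>1 \<theta>2 X m y n w - \<sigma> ^ 4\<bar> = \<sigma> ^ 4 * \<bar>rel_quarticity n w - 1\<bar>" for w
      proof -
        have "quarticity_estimator \<theta>1 \<theta>2 X m y n w - \<sigma> ^ 4 = \<sigma> ^ 4 * (rel_quarticity n w - 1)"
          unfolding quarticity_eq[OF elim] by (simp add: right_diff_distrib)
        then show ?thesis using s4 by (simp add: abs_mult)
      qed
      then have "\<bar>quarticity_estimator \<theta>1 \<theta>2 X m y n w - \<sigma> ^ 4\<bar> > \<epsilon> \<longleftrightarrow> \<bar>rel_quarticity n w - 1\<bar> > \<epsilon> / \<sigma> ^ 4" for w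
        using s4 by (simp add: divide_less_eq mult.commute)
      then show ?case by simp
    qed
  qed
qed

lemma studentized_eq:
  assumes n: "n \<ge> 1"
  shows "(real (m n) * real n) powr (1 / 2) * (pi * Gamma_const * quarticity_estimator \<theta>1 \<theta>2 X m y n w) powr (- 1 / 2) *
      (volatility_estimator \<theta>1 \<theta>2 X m y n w - \<sigma>\<^sup>2)
    = rel_quarticity n w powr (- 1 / 2) * (clt_stat n w / sqrt (pi * Gamma_const))"
proof -
  \<comment> \<open>Nonnegativity allows the power to be split over the product. At a vanishing
    quarticity both sides are 0, since \<open>0 powr x = 0\<close>.\<close>
  have r0: "0 \<le> rel_quarticity n w" unfolding rel_quarticity_def using N_pos[OF n] by (intro divide_nonneg_nonneg sum_nonneg) auto
  have g: "0 < pi * Gamma_const" using Gamma_const_pos by simp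
  have "(pi * Gamma_const * (\<sigma> ^ 4 * rel_quarticity n w)) powr (- 1 / 2)
      = (pi * Gamma_const) powr (- 1 / 2) * ((\<sigma> ^ 4) powr (- 1 / 2) * rel_quarticity n w powr (- 1 / 2))"
    using g r0 sigma_pos by (simp add: powr_mult)
  also have "(pi * Gamma_const) powr (- 1 / 2) = 1 / sqrt (pi * Gamma_const)"
    using g powr_minus[of "pi * Gamma_const" "1 / 2"] by (simp add: powr_half_sqrt inverse_eq_divide)
  also have "(\<sigma> ^ 4) powr (- 1 / 2) = 1 / \<sigma>\<^sup>2"
  proof -
    have "sqrt (\<sigma> ^ 4) = \<sigma>\<^sup>2" using sigma_pos by (intro real_sqrt_unique) (simp_all flip: power_mult)
    then show ?thesis using sigma_pos powr_minus[of "\<sigma> ^ 4" "1 / 2"] by (simp add: powr_half_sqrt inverse_eq_divide)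
  qed
  finally have 1: "(pi * Gamma_const * quarticity_estimator \<theta>1 \<theta>2 X m y n w) powr (- 1 / 2)
     = 1 / sqrt (pi * Gamma_const) * (1 / \<sigma>\<^sup>2 * rel_quarticity n w powr (- 1 / 2))" unfolding quarticity_eq[OF n] .
  have 2: "(real (m n) * real n) powr (1 / 2) = sqrt (N n)" by (simp add: N_def powr_half_sqrt mult.commute)
  have "(real (m n) * real n) powr (1 / 2) * (pi * Gamma_const * quarticity_estimator \<theta>1 \<theta>2 X m y n w) powr (- 1 / 2) *
      (volatility_estimator \<theta>1 \<theta>2 X m y n w - \<sigma>\<^sup>2)
     = (1 / sqrt (pi * Gamma_const) * (1 / \<sigma>\<^sup>2 * rel_quarticity n w powr (- 1 / 2))) * (sqrt (N n) * (volatility_estimator \<theta>1 \<theta>2 X m y n w - \<sigma>\<^sup>2))"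
    unfolding 1 2 by (simp only: mult_ac)
  also have "\<dots> = rel_quarticity n w powr (- 1 / 2) * (clt_stat n w / sqrt (pi * Gamma_const))"
    unfolding volatility_eq[OF n] using sigma_pos by simp
  finally show ?thesis .
qed

text \<open>Levy's continuity theorem. The characteristic function of the statistic normalised by
  the true constant converges by \<open>asymptotic_bounds\<close> and \<open>frob_tendsto\<close>;
  replacing that constant by its estimate changes it by a null sequence through
  \<open>norm_char_diff_le\<close>.\<close>

lemma studentized_converges:
  "converges_in_distribution M
     (\<lambda>n w. (real (m n) * real n) powr (1 / 2) * (pi * Gamma_const * quarticity_estimator \<theta>1 \<theta>2 X m y n w) powr (- 1 / 2) *
      (volatility_estimator \<theta>1 \<theta>2 X m y n w - \<sigma>\<^sup>2)) std_normal_distribution"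
  (is "converges_in_distribution M ?Z _") unfolding converges_in_distribution_def
proof (rule levy_continuity)
  have g: "0 < pi * Gamma_const" using Gamma_const_pos by simp
  define v where "v = sqrt (pi * Gamma_const)"
  have v: "v > 0" "v\<^sup>2 = pi * Gamma_const" using g by (simp_all add: v_def)
  define D where "D n w = rel_quarticity n w powr (- 1 / 2)" for n w
  define T where "T n w = clt_stat n w / v" for n w
  have mD: "D n \<in> borel_measurable M" and mT: "T n \<in> borel_measurable M" if "n \<ge> 1" for n
    unfolding D_def[abs_def] T_def[abs_def] using rel_quarticity_measurable[OF that] clt_stat_measurable[OF that] by measurable
  have Z: "?Z n = (\<lambda>w. D n w * T n w)" if "n \<ge> 1" for n unfolding studentized_eq[OF that] D_def T_def v_def ..
  have mZ: "?Z n \<in> borel_measurable M" for n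
  proof (cases "n = 0")
    \<comment> \<open>For n = 0 the leading factor is \<open>0 powr (1 / 2) = 0\<close>, so the
      statistic is constant.\<close>
    case True
    then show ?thesis by simp
  next
    case False
    then have n: "n \<ge> 1" by simp
    show ?thesis unfolding Z[OF n] using mD[OF n] mT[OF n] by measurable
  qed
  show "real_distribution (distr M borel (?Z n))" for n by (rule real_distribution_distr) (rule mZ)
  show "real_distribution std_normal_distribution" by (rule real_dist_normal_dist)
  obtain r :: "nat \<Rightarrow> real" where r: "r \<longlonglongrightarrow> 0" "\<And>n. n \<ge> 1 \<Longrightarrow> r n \<ge> 0" and
    b1: "\<And>n t. n \<ge> 1 \<Longrightarrow> char_err n t \<le> (t\<^sup>2 + \<bar>t\<bar>) * r n" and
    b2: "\<And>n. n \<ge> 1 \<Longrightarrow> (\<integral>\<^sup>+w. ennreal \<bar>clt_stat n w\<bar> \<partial>M) \<le> ennreal (sqrt (2 * (frob n / N n)) + r n)"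
    by (rule asymptotic_bounds) blast
  have \<phi>: "(\<lambda>n. frob n / N n) \<longlonglongrightarrow> v\<^sup>2 / 2" unfolding N_def v(2) by (rule frob_tendsto)
  fix t :: real
  have charZ: "char (distr M borel (?Z n)) t = (\<integral>w. iexp (t * ?Z n w) \<partial>M)" for n
    unfolding char_def by (rule integral_distr[OF mZ]) measurable
  have cT: "(\<lambda>n. \<integral>w. iexp (t * T n w) \<partial>M) \<longlonglongrightarrow> of_real (exp (- (t\<^sup>2) / 2))"
  proof -
    have "(\<lambda>n. (\<integral>w. iexp (t * T n w) \<partial>M) - of_real (exp (- (t / v)\<^sup>2 * (frob n / N n)))) \<longlonglongrightarrow> 0"
    proof (rule Lim_null_comparison)
      show "\<forall>\<^sub>F n in sequentially. norm ((\<integral>w. iexp (t * T n w) \<partial>M) - of_real (exp (- (t / v)\<^sup>2 * (frob n / N n)))) \<le> ((t / v)\<^sup>2 + \<bar>t / v\<bar>) * r n"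
        using eventually_ge_at_top[of 1]
      proof eventually_elim
        case (elim n)
        have "t * T n w = t / v * clt_stat n w" for w by (simp add: T_def)
        then show ?case using b1[OF elim, of "t / v"] by (simp only:)
      qed
      show "(\<lambda>n. ((t / v)\<^sup>2 + \<bar>t / v\<bar>) * r n) \<longlonglongrightarrow> 0"
        using tendsto_mult_left[OF r(1), of "(t / v)\<^sup>2 + \<bar>t / v\<bar>"] by (simp only: mult_zero_right)
    qed
    moreover have "(\<lambda>n. complex_of_real (exp (- (t / v)\<^sup>2 * (frob n / N n)))) \<longlonglongrightarrow> of_real (exp (- (t / v)\<^sup>2 * (v\<^sup>2 / 2)))"
      by (intro tendsto_of_real tendsto_exp tendsto_mult tendsto_const \<phi>)
    moreover have "- (t / v)\<^sup>2 * (v\<^sup>2 / 2) = - (t\<^sup>2) / 2" using v(1) by (simp add: power_divide)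
    ultimately show ?thesis using tendsto_add by fastforce
  qed
  have "(\<lambda>n. (\<integral>w. iexp (t * ?Z n w) \<partial>M) - (\<integral>w. iexp (t * T n w) \<partial>M)) \<longlonglongrightarrow> 0"
  proof (rule tendstoI)
    fix e :: real assume e: "e > 0"
    define Bd where "Bd = (sqrt (2 * (v\<^sup>2 / 2)) + 1) / v"
    have Bd: "Bd > 0" using v(1) by (simp add: Bd_def add_nonneg_pos)
    have "(\<lambda>n. sqrt (2 * (frob n / N n)) + r n) \<longlonglongrightarrow> sqrt (2 * (v\<^sup>2 / 2)) + 0"
      by (intro tendsto_add tendsto_real_sqrt tendsto_mult tendsto_const \<phi> r(1))
    from order_tendstoD(2)[OF this, of "sqrt (2 * (v\<^sup>2 / 2)) + 1"]
    have ev1: "\<forall>\<^sub>F n in sequentially. sqrt (2 * (frob n / N n)) + r n < sqrt (2 * (v\<^sup>2 / 2)) + 1" by simp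
    \<comment> \<open>|t| + 1 instead of |t| keeps the denominator of eta positive at t = 0.\<close>
    define k where "k = (\<bar>t\<bar> + 1) * Bd"
    have k: "k > 0" using Bd by (simp add: k_def add_nonneg_pos)
    define \<eta> where "\<eta> = e / (2 * k)"
    have \<eta>: "\<eta> > 0" using e k by (simp add: \<eta>_def)
    have "\<bar>t\<bar> * \<eta> * Bd \<le> (\<bar>t\<bar> + 1) * \<eta> * Bd" using \<eta> Bd by (intro mult_right_mono) auto
    also have "\<dots> = \<eta> * k" unfolding k_def by (simp only: mult_ac)
    also have "\<dots> = e / 2" using k by (simp add: \<eta>_def)
    finally have \<eta>2: "\<bar>t\<bar> * \<eta> * Bd \<le> e / 2" .
    have "isCont (\<lambda>x :: real. x powr (- 1 / 2)) 1" by (intro continuous_intros) auto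
    then have "(\<lambda>x :: real. x powr (- 1 / 2)) \<midarrow>1\<rightarrow> 1" by (simp add: isCont_def)
    then obtain d where d: "d > 0" "\<And>x :: real. x \<noteq> 1 \<Longrightarrow> dist x 1 < d \<Longrightarrow> dist (x powr (- 1 / 2)) 1 < \<eta>"
      using \<eta> unfolding LIM_def by blast
    \<comment> \<open>The limit excludes the point 1 itself, and halving the radius turns its strict
      condition into the non-strict one that complements the event of a large deviation.\<close>
    have dd: "\<bar>x powr (- 1 / 2) - 1\<bar> \<le> \<eta>" if "\<bar>x - 1\<bar> \<le> d / 2" for x :: real
    proof (cases "x = 1")
      case False
      then show ?thesis using d(2)[of x] d(1) that by (simp add: dist_real_def)
    qed (use \<eta> in simp)
    have "0 < d / 2" using d(1) by simp
    from order_tendstoD(2)[OF rel_quarticity_converges[OF this], of "e / 4"]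
    have ev2: "\<forall>\<^sub>F n in sequentially. measure M {w \<in> space M. \<bar>rel_quarticity n w - 1\<bar> > d / 2} < e / 4" using e by simp
    show "\<forall>\<^sub>F n in sequentially. dist ((\<integral>w. iexp (t * ?Z n w) \<partial>M) - (\<integral>w. iexp (t * T n w) \<partial>M)) 0 < e"
      using ev1 ev2 eventually_ge_at_top[of 1]
    proof eventually_elim
      case (elim n)
      note n = elim(3)
      have "(\<integral>\<^sup>+w. ennreal \<bar>T n w\<bar> \<partial>M) = (\<integral>\<^sup>+w. ennreal (1 / v) * ennreal \<bar>clt_stat n w\<bar> \<partial>M)"
        unfolding T_def using v(1) by (intro nn_integral_cong) (simp flip: ennreal_mult)
      also have "\<dots> = ennreal (1 / v) * (\<integral>\<^sup>+w. ennreal \<bar>clt_stat n w\<bar> \<partial>M)"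
        by (rule nn_integral_cmult) (use clt_stat_measurable[OF n] in measurable)
      also have "\<dots> \<le> ennreal (1 / v) * ennreal (sqrt (2 * (v\<^sup>2 / 2)) + 1)"
        by (intro mult_left_mono order_trans[OF b2[OF n] ennreal_leI]) (use elim(1) in auto)
      also have "\<dots> = ennreal (1 / v * (sqrt (2 * (v\<^sup>2 / 2)) + 1))" using v(1) by (intro ennreal_mult[symmetric]) auto
      also have "1 / v * (sqrt (2 * (v\<^sup>2 / 2)) + 1) = Bd" by (simp add: Bd_def)
      finally have T1: "(\<integral>\<^sup>+w. ennreal \<bar>T n w\<bar> \<partial>M) \<le> ennreal Bd" .
      have "measure M {w \<in> space M. \<bar>D n w - 1\<bar> > \<eta>} \<le> measure M {w \<in> space M. \<bar>rel_quarticity n w - 1\<bar> > d / 2}"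
      proof (rule finite_measure_mono)
        show "{w \<in> space M. \<bar>D n w - 1\<bar> > \<eta>} \<subseteq> {w \<in> space M. \<bar>rel_quarticity n w - 1\<bar> > d / 2}"
          using dd unfolding D_def by (auto simp: not_le[symmetric])
        show "{w \<in> space M. \<bar>rel_quarticity n w - 1\<bar> > d / 2} \<in> sets M" using rel_quarticity_measurable[OF n] by measurable
      qed
      then have "\<bar>t\<bar> * \<eta> * Bd + 2 * measure M {w \<in> space M. \<bar>D n w - 1\<bar> > \<eta>} < e" using \<eta>2 elim(2) by linarith
      then show ?case unfolding studentized_eq[OF n] D_def[symmetric] v_def[symmetric] T_def[symmetric] dist_norm diff_0_right
        using norm_char_diff_le[OF mT[OF n] mD[OF n] less_imp_le[OF \<eta>] less_imp_le[OF Bd] T1, of t] by (rule le_less_trans[rotated])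
    qed
  qed
  from tendsto_add[OF this cT]
  have "(\<lambda>n. \<integral>w. iexp (t * ?Z n w) \<partial>M) \<longlonglongrightarrow> of_real (exp (- (t\<^sup>2) / 2))" by simp
  then show "(\<lambda>n. char (distr M borel (?Z n)) t) \<longlonglongrightarrow> char std_normal_distribution t"
    unfolding charZ char_std_normal_distribution .
qed

end

theorem proposition3p5:
  fixes M :: "'w measure"
    and \<theta>0 \<theta>1 \<theta>2 \<sigma> :: real
    and W :: "nat \<Rightarrow> real \<Rightarrow> 'w \<Rightarrow> real"
    and \<xi> :: "'w \<Rightarrow> real \<Rightarrow> real"
    and X :: "real \<Rightarrow> real \<Rightarrow> 'w \<Rightarrow> real"
    and m :: "nat \<Rightarrow> nat"
    and y :: "nat \<Rightarrow> nat \<Rightarrow> real"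
  assumes "prob_space M"
    and "\<theta>2 > 0" and "\<sigma> > 0"
    and "\<forall>k\<ge>1. eigval \<theta>0 \<theta>1 \<theta>2 k > 0"
    and "indep_brownian_motions M W"
    and "initial_value M \<theta>1 \<theta>2 W \<xi>"
    and "continuous_mild_solution M \<theta>0 \<theta>1 \<theta>2 \<sigma> W \<xi> X"
    and "observation_scheme m y"
    and "initial_condition M \<theta>0 \<theta>1 \<theta>2 \<xi>"
    and "\<forall>l\<in>{4, 8}. (SUP k\<in>{1..}. ennreal (eigval \<theta>0 \<theta>1 \<theta>2 k) *
           (\<integral>\<^sup>+\<omega>. ennreal ((xi_coeff \<theta>1 \<theta>2 \<xi> k \<omega>) ^ l) \<partial>M)) < \<infinity>"
  shows "converges_in_probability M (quarticity_estimator \<theta>1 \<theta>2 X m y) (\<sigma> ^ 4) \<and>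
         converges_in_distribution M
           (\<lambda>n \<omega>. (real (m n) * real n) powr (1 / 2) *
              (pi * Gamma_const * quarticity_estimator \<theta>1 \<theta>2 X m y n \<omega>) powr (- 1 / 2) *
              (volatility_estimator \<theta>1 \<theta>2 X m y n \<omega> - \<sigma>\<^sup>2))
           std_normal_distribution"
proof -
  interpret spde_observation M \<theta>0 \<theta>1 \<theta>2 \<sigma> W \<xi> X m y
  proof (intro spde_observation.intro spde_observation_axioms.intro heat_spectrum.intro)
    show "0 < pi\<^sup>2 * \<theta>2" using assms(2) by simp
    show "0 < pi\<^sup>2 * \<theta>2 + (\<theta>1\<^sup>2 / (4 * \<theta>2) - \<theta>0)"
      using assms(4)[rule_format, of 1] unfolding eigval_pi by simp
  qed (use assms in auto)
  show ?thesis using quarticity_consistent studentized_converges by blast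
qed

end
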